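(* Let $\Omega$ be an associative $\mathbb{C}$-algebra of finite or countable dimension (possibly not unital) and let $d\ge1$ be an integer. The graded algebra associated with the shifted filtration in $Y_d(\Omega)$ is isomorphic to the algebra $\mathcal{U}(\mathfrak{gl}(d,\mathrm{R}(\Omega)))$.
   Context: The algebra $\mathrm{R}(\Omega)$. As a vector space, $\mathrm{R}(\Omega)=\bigoplus_{n\ge0}\mathrm{R}_n(\Omega)$ with $\mathrm{R}_n(\Omega):=\Omega^{\otimes(n+1)}$ (tensor products over $\mathbb{C}$). The associative multiplication $\odot$ is given, for $\mathbf{x}=x_1\otimes\cdots\otimes x_{m+1}\in\mathrm{R}_m(\Omega)$ and $\mathbf{y}=y_1\otimes\cdots\otimes y_{n+1}\in\mathrm{R}_n(\Omega)$, by $\mathbf{x}\odot\mathbf{y}:=x_1\otimes\cdots\otimes x_m\otimes(x_{m+1}y_1)\otimes y_2\otimes\cdots\otimes y_{n+1}\in\mathrm{R}_{m+n}(\Omega)$, with $x_{m+1}y_1$ the product in $\Omega$; $\mathrm{R}(\Omega)$ is a graded algebra. $\mathfrak{gl}(d,\mathrm{R}(\Omega))$ is the associative algebra $\mathrm{Mat}(d,\mathbb{C})\otimes\mathrm{R}(\Omega)$ with the commutator bracket; it inherits a grading from $\mathrm{R}(\Omega)$, and so does its universal enveloping algebra $\mathcal{U}(\mathfrak{gl}(d,\mathrm{R}(\Omega)))$. The algebra $A_d(\Omega)$. The Lie algebra $\mathfrak{gl}(N,\Omega)=\mathrm{Mat}(N,\mathbb{C})\otimes\Omega$ carries the commutator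 bracket; with $E_{ij}$ the matrix units and $E_{ij}(x):=E_{ij}\otimes x$, one has $[E_{ij}(x),E_{kl}(y)]=\delta_{kj}E_{il}(xy)-\delta_{il}E_{kj}(yx)$. The Lie algebra $\mathfrak{gl}(N,\mathbb{C})$ acts on $\mathfrak{gl}(N,\Omega)$ by $\mathrm{ad}\otimes\mathrm{Id}$, i.e. $[E_{ij},E_{kl}(y)]=\delta_{kj}E_{il}(y)-\delta_{il}E_{kj}(y)$, and this extends to $\mathcal{U}(\mathfrak{gl}(N,\Omega))$ by derivations. For $d\le N$ let $\mathfrak{gl}_d(N,\mathbb{C})$ be the span of the $E_{ij}$ with $d+1\le i,j\le N$, and $A_d(\Omega;N):=\mathcal{U}(\mathfrak{gl}(N,\Omega))^{\mathfrak{gl}_d(N,\mathbb{C})}$ (invariants). Let $I^+(N)$ be the left ideal of $\mathcal{U}(\mathfrak{gl}(N,\Omega))$ generated by all $E_{iN}(x)$ and $I^-(N)$ the right ideal generated by all $E_{Nj}(x)$ ($1\le i,j\le N$, $x\in\Omega$). Let $\mathcal{U}(\mathfrak{gl}(N,\Omega))^{E_{NN}}$ be the subalgebra of elements annihilated by $[E_{NN},-]$. Its intersections with $I^+(N)$ and $I^-(N)$ coincide; the common intersection $L(N)$ is a two-sided ideal in it, and $\mathcal{U}(\mathfrak{gl}(N,\Omega))^{E_{NN}}=\mathcal{U}(\mathfrak{gl}(N-1,\Omega))\oplus L(N)$. Let $\pi_{N,N-1}$ be the projection onto $\mathcal{U}(\mathfrak{gl}(N-1,\Omega))$ along $L(N)$,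 a homomorphism of filtered algebras mapping $A_d(\Omega;N)$ into $A_d(\Omega;N-1)$ for $N>d$. $A_d(\Omega)$ is the projective limit of $(A_d(\Omega;N),\pi_{N,N-1})$ in the category of filtered algebras: its elements are sequences $\mathbf{a}=\{\mathbf{a}(N)\colon N\ge d\}$ with $\mathbf{a}(N)\in A_d(\Omega;N)$, $\pi_{N,N-1}(\mathbf{a}(N))=\mathbf{a}(N-1)$ for $N>d$, and $\deg\mathbf{a}(N)$ (canonical filtration of the enveloping algebra) bounded uniformly in $N$. The algebra $Y_d(\Omega)$. Let $W(\Omega):=\bigsqcup_{m\ge1}\Omega^m$, $\ell(\mathbf{x}):=m$ for $\mathbf{x}\in\Omega^m$. For $\mathbf{x}=(x_1,\dots,x_m)$ put $e_{ij}(\mathbf{x};N):=\sum_{a_1,\dots,a_{m-1}=1}^N E_{ia_1}(x_1)E_{a_1a_2}(x_2)\cdots E_{a_{m-1}j}(x_m)$ ($=E_{ij}(x_1)$ if $m=1$). For a composition $\nu=(\nu_1,\dots,\nu_n)\in\mathrm{Comp}(m)$ of $m$, $\mathbf{x}\rhd\nu:=(y_1,\dots,y_n)$, where $y_1=x_1\cdots x_{\nu_1}$, $y_2=x_{\nu_1+1}\cdots x_{\nu_1+\nu_2}$, ..., $y_n=x_{\nu_1+\dots+\nu_{n-1}+1}\cdots x_m$. For $s\in\mathbb{C}$, $t_{ij}(\mathbf{x};N;s):=\sum_{\nu\in\mathrm{Comp}(m)}(-N-s)^{\ell(\mathbf{x})-\ell(\mathbf{x}\rhd\nu)}e_{ij}(\mathbf{x}\rhd\nu;N)$,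 with $0^0:=1$. For $i,j\in\{1,\dots,d\}$, $t_{ij}(\mathbf{x};s)\in A_d(\Omega)$ is the unique element whose $N$th term is $t_{ij}(\mathbf{x};N;s)$ for all $N\ge d$. $Y_d(\Omega)$ is the unital subalgebra of $A_d(\Omega)$ generated by all $t_{ij}(\mathbf{x};s)$, $i,j\in\{1,\dots,d\}$, $\mathbf{x}\in W(\Omega)$, for an arbitrary fixed $s\in\mathbb{C}$ (it does not depend on $s$). The shifted filtration on $Y_d(\Omega)$ is the one specified by declaring $t_{ij}(\mathbf{x};s)$ to have degree $\ell(\mathbf{x})-1$: its $k$th term is spanned by $1$ and the products $t_{i_1j_1}(\mathbf{x}^1;s)\cdots t_{i_rj_r}(\mathbf{x}^r;s)$ with $\sum_{q=1}^r(\ell(\mathbf{x}^q)-1)\le k$. *)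

theory Defs
  imports Complex_Main "HOL-Algebra.Module" "HOL-Algebra.QuotRing" "HOL-Library.Poly_Mapping" "HOL-Library.Countable_Set"
begin

section \<open>Complex algebras\<close>

text \<open>
  All algebras are records of type \<open>(complex, 'a) module\<close>. For an algebra that need not be unital
  the field \<^const>\<open>one\<close> is never used. A Lie algebra is such a record whose \<^const>\<open>mult\<close> is the
  Lie bracket.
\<close>

definition cplx :: "(complex, complex) module" where
  "cplx = \<lparr>carrier = UNIV, mult = (*), one = 1, zero = 0, add = (+), smult = (*)\<rparr>"

locale complex_algebra = module cplx A for A :: "(complex, 'a) module" (structure) +
  assumes alg_m_closed: "\<lbrakk>x \<in> carrier A; y \<in> carrier A\<rbrakk> \<Longrightarrow> x \<otimes> y \<in> carrier A"
    and alg_m_assoc: "\<lbrakk>x \<in> carrier A; y \<in> carrier A; z \<in> carrier A\<rbrakk> \<Longrightarrow>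
      (x \<otimes> y) \<otimes> z = x \<otimes> (y \<otimes> z)"
    and alg_l_distr: "\<lbrakk>x \<in> carrier A; y \<in> carrier A; z \<in> carrier A\<rbrakk> \<Longrightarrow>
      (x \<oplus> y) \<otimes> z = x \<otimes> z \<oplus> y \<otimes> z"
    and alg_r_distr: "\<lbrakk>x \<in> carrier A; y \<in> carrier A; z \<in> carrier A\<rbrakk> \<Longrightarrow>
      z \<otimes> (x \<oplus> y) = z \<otimes> x \<oplus> z \<otimes> y"
    and alg_smult_l: "\<lbrakk>x \<in> carrier A; y \<in> carrier A\<rbrakk> \<Longrightarrow> (c \<odot> x) \<otimes> y = c \<odot> (x \<otimes> y)"
    and alg_smult_r: "\<lbrakk>x \<in> carrier A; y \<in> carrier A\<rbrakk> \<Longrightarrow> x \<otimes> (c \<odot> y) = c \<odot> (x \<otimes> y)"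

inductive_set lin_span :: "(complex, 'a) module \<Rightarrow> 'a set \<Rightarrow> 'a set"
  for A :: "(complex, 'a) module" and S :: "'a set" where
  base: "x \<in> S \<Longrightarrow> x \<in> lin_span A S"
| zero: "\<zero>\<^bsub>A\<^esub> \<in> lin_span A S"
| add: "\<lbrakk>x \<in> lin_span A S; y \<in> lin_span A S\<rbrakk> \<Longrightarrow> x \<oplus>\<^bsub>A\<^esub> y \<in> lin_span A S"
| smult: "x \<in> lin_span A S \<Longrightarrow> c \<odot>\<^bsub>A\<^esub> x \<in> lin_span A S"

definition is_basis :: "(complex, 'a) module \<Rightarrow> 'a set \<Rightarrow> bool" where
  "is_basis A B \<longleftrightarrow>
    B \<subseteq> carrier A \<and> (\<forall>b\<in>B. b \<notin> lin_span A (B - {b})) \<and> lin_span A B = carrier A"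

definition countable_dim :: "(complex, 'a) module \<Rightarrow> bool" where
  "countable_dim A \<longleftrightarrow> (\<exists>B. is_basis A B \<and> countable B)"

definition mprod :: "(complex, 'a) module \<Rightarrow> 'a list \<Rightarrow> 'a" where
  "mprod A xs = foldr (\<otimes>\<^bsub>A\<^esub>) xs \<one>\<^bsub>A\<^esub>"

text \<open>Product of a nonempty list in a possibly non-unital algebra.\<close>
definition mprod1 :: "(complex, 'a) module \<Rightarrow> 'a list \<Rightarrow> 'a" where
  "mprod1 A xs = foldl (\<otimes>\<^bsub>A\<^esub>) (hd xs) (tl xs)"

inductive_set subalg_gen :: "(complex, 'a) module \<Rightarrow> 'a set \<Rightarrow> 'a set"
  for A :: "(complex, 'a) module" and S :: "'a set" where
  base: "x \<in> S \<Longrightarrow> x \<in> subalg_gen A S"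
| one: "\<one>\<^bsub>A\<^esub> \<in> subalg_gen A S"
| zero: "\<zero>\<^bsub>A\<^esub> \<in> subalg_gen A S"
| add: "\<lbrakk>x \<in> subalg_gen A S; y \<in> subalg_gen A S\<rbrakk> \<Longrightarrow> x \<oplus>\<^bsub>A\<^esub> y \<in> subalg_gen A S"
| smult: "x \<in> subalg_gen A S \<Longrightarrow> c \<odot>\<^bsub>A\<^esub> x \<in> subalg_gen A S"
| mult: "\<lbrakk>x \<in> subalg_gen A S; y \<in> subalg_gen A S\<rbrakk> \<Longrightarrow> x \<otimes>\<^bsub>A\<^esub> y \<in> subalg_gen A S"

text \<open>The quotient, whose elements are the cosets of \<open>I\<close>: \<open>A Quot I\<close> with scalar multiplication.\<close>
definition alg_quot :: "(complex, 'a) module \<Rightarrow> 'a set \<Rightarrow> (complex, 'a set) module" where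
  "alg_quot A I =
    \<lparr>carrier = carrier (A Quot I), mult = mult (A Quot I), one = one (A Quot I),
     zero = zero (A Quot I), add = add (A Quot I),
     smult = (\<lambda>c X. \<Union>x\<in>X. I +>\<^bsub>A\<^esub> (c \<odot>\<^bsub>A\<^esub> x))\<rparr>"

definition alg_iso :: "(complex, 'a) module \<Rightarrow> (complex, 'b) module \<Rightarrow> ('a \<Rightarrow> 'b) set" where
  "alg_iso A B =
    {h \<in> ring_iso A B. \<forall>c. \<forall>x\<in>carrier A. h (c \<odot>\<^bsub>A\<^esub> x) = c \<odot>\<^bsub>B\<^esub> h x}"


section \<open>The associated graded algebra of a filtered algebra\<close>

text \<open>For a filtration \<open>F\<close> indexed by the natural numbers, \<open>F\<^sub>-\<^sub>1 = 0\<close>.\<close>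
definition filt_prev :: "(complex, 'a) module \<Rightarrow> (nat \<Rightarrow> 'a set) \<Rightarrow> nat \<Rightarrow> 'a set" where
  "filt_prev A F k = (case k of 0 \<Rightarrow> {\<zero>\<^bsub>A\<^esub>} | Suc m \<Rightarrow> F m)"

text \<open>The vector space \<open>F\<^sub>k / F\<^sub>k\<^sub>-\<^sub>1\<close>; the field \<^const>\<open>mult\<close> of this record is meaningless.\<close>
definition gr_comp :: "(complex, 'a) module \<Rightarrow> (nat \<Rightarrow> 'a set) \<Rightarrow> nat \<Rightarrow> (complex, 'a set) module" where
  "gr_comp A F k = alg_quot (A\<lparr>carrier := F k\<rparr>) (filt_prev A F k)"

text \<open>The direct sum of the \<open>F\<^sub>k / F\<^sub>k\<^sub>-\<^sub>1\<close>: an element is a finitely supported family of cosets.\<close>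
definition gr_alg :: "(complex, 'a) module \<Rightarrow> (nat \<Rightarrow> 'a set) \<Rightarrow> (complex, nat \<Rightarrow> 'a set) module" where
  "gr_alg A F =
    \<lparr>carrier = {f. (\<forall>k. f k \<in> carrier (gr_comp A F k)) \<and> finite {k. f k \<noteq> \<zero>\<^bsub>gr_comp A F k\<^esub>}},
     mult = (\<lambda>f g k. \<Oplus>\<^bsub>gr_comp A F k\<^esub>p\<in>{..k}. rcoset_mult A (filt_prev A F k) (f p) (g (k - p))),
     one = (\<lambda>k. if k = 0 then filt_prev A F 0 +>\<^bsub>A\<^esub> \<one>\<^bsub>A\<^esub> else \<zero>\<^bsub>gr_comp A F k\<^esub>),
     zero = (\<lambda>k. \<zero>\<^bsub>gr_comp A F k\<^esub>),
     add = (\<lambda>f g k. f k \<oplus>\<^bsub>gr_comp A F k\<^esub> g k),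
     smult = (\<lambda>c f k. c \<odot>\<^bsub>gr_comp A F k\<^esub> f k)\<rparr>"

definition gr_hom :: "(complex, 'a) module \<Rightarrow> (nat \<Rightarrow> 'a set) \<Rightarrow> nat \<Rightarrow> (nat \<Rightarrow> 'a set) set" where
  "gr_hom A F k = {f \<in> carrier (gr_alg A F). \<forall>m. m \<noteq> k \<longrightarrow> f m = \<zero>\<^bsub>gr_comp A F m\<^esub>}"


section \<open>Universal enveloping algebras\<close>

text \<open>
  Lists form the free monoid, so \<open>'g list \<Rightarrow>\<^sub>0 complex\<close> with the convolution product of
  \<^theory>\<open>HOL-Library.Poly_Mapping\<close> is the free unital associative algebra on the set \<open>'g\<close>.
\<close>
instantiation list :: (type) monoid_add
begin

definition zero_list :: "'a list" where "zero_list = []"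

definition plus_list :: "'a list \<Rightarrow> 'a list \<Rightarrow> 'a list" where "plus_list = (@)"

instance by standard (simp_all add: zero_list_def plus_list_def)

end

definition free_alg :: "'g set \<Rightarrow> (complex, 'g list \<Rightarrow>\<^sub>0 complex) module" where
  "free_alg G =
    \<lparr>carrier = {p. Poly_Mapping.keys p \<subseteq> lists G}, mult = (*), one = 1, zero = 0, add = (+),
     smult = (\<lambda>c. Poly_Mapping.map ((*) c))\<rparr>"

definition wd :: "'g list \<Rightarrow> ('g list \<Rightarrow>\<^sub>0 complex)" where
  "wd w = Poly_Mapping.single w 1"

text \<open>
  The defining ideal of the enveloping algebra of \<open>L\<close>. The first two families of relations turn the
  free algebra on the set \<open>carrier L\<close> into the tensor algebra of the vector space \<open>L\<close>.
\<close>
definition uea_ideal :: "(complex, 'g) module \<Rightarrow> ('g list \<Rightarrow>\<^sub>0 complex) set" where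
  "uea_ideal L = Idl\<^bsub>free_alg (carrier L)\<^esub>
    ({wd [x \<oplus>\<^bsub>L\<^esub> y] - wd [x] - wd [y] | x y. x \<in> carrier L \<and> y \<in> carrier L} \<union>
     {wd [c \<odot>\<^bsub>L\<^esub> x] - Poly_Mapping.single [x] c | c x. x \<in> carrier L} \<union>
     {wd [x] * wd [y] - wd [y] * wd [x] - wd [x \<otimes>\<^bsub>L\<^esub> y] | x y. x \<in> carrier L \<and> y \<in> carrier L})"

definition uea :: "(complex, 'g) module \<Rightarrow> (complex, ('g list \<Rightarrow>\<^sub>0 complex) set) module" where
  "uea L = alg_quot (free_alg (carrier L)) (uea_ideal L)"

definition uea_of :: "(complex, 'g) module \<Rightarrow> 'g \<Rightarrow> ('g list \<Rightarrow>\<^sub>0 complex) set" where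
  "uea_of L x = uea_ideal L +>\<^bsub>free_alg (carrier L)\<^esub> wd [x]"

definition uea_filt :: "(complex, 'g) module \<Rightarrow> nat \<Rightarrow> ('g list \<Rightarrow>\<^sub>0 complex) set set" where
  "uea_filt L k = lin_span (uea L)
    {mprod (uea L) (map (uea_of L) xs) | xs. set xs \<subseteq> carrier L \<and> length xs \<le> k}"

text \<open>The grading of the enveloping algebra induced by a grading \<open>G\<close> of the Lie algebra.\<close>
definition uea_grade ::
    "(complex, 'g) module \<Rightarrow> (nat \<Rightarrow> 'g set) \<Rightarrow> nat \<Rightarrow> ('g list \<Rightarrow>\<^sub>0 complex) set set" where
  "uea_grade L G k = lin_span (uea L)
    {mprod (uea L) (map (uea_of L) xs) | xs ns. list_all2 (\<lambda>x n. x \<in> G n) xs ns \<and> sum_list ns = k}"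

text \<open>
  The derivation of the free algebra extending a map \<open>D\<close> of its generators, and the map it induces
  on the enveloping algebra (well defined when \<open>D\<close> is a derivation of the Lie algebra \<open>L\<close>).
\<close>
definition free_deriv :: "('g \<Rightarrow> 'g) \<Rightarrow> ('g list \<Rightarrow>\<^sub>0 complex) \<Rightarrow> ('g list \<Rightarrow>\<^sub>0 complex)" where
  "free_deriv D p = (\<Sum>w\<in>Poly_Mapping.keys p. \<Sum>q<length w.
      Poly_Mapping.single (w[q := D (w ! q)]) (Poly_Mapping.lookup p w))"

definition uea_deriv ::
    "(complex, 'g) module \<Rightarrow> ('g \<Rightarrow> 'g) \<Rightarrow> ('g list \<Rightarrow>\<^sub>0 complex) set \<Rightarrow> ('g list \<Rightarrow>\<^sub>0 complex) set" where
  "uea_deriv L D X = (\<Union>p\<in>X. uea_ideal L +>\<^bsub>free_alg (carrier L)\<^esub> free_deriv D p)"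

text \<open>The homomorphism of enveloping algebras induced by the inclusion of a Lie subalgebra of \<open>L\<close>.\<close>
definition uea_incl ::
    "(complex, 'g) module \<Rightarrow> ('g list \<Rightarrow>\<^sub>0 complex) set \<Rightarrow> ('g list \<Rightarrow>\<^sub>0 complex) set" where
  "uea_incl L X = (\<Union>p\<in>X. uea_ideal L +>\<^bsub>free_alg (carrier L)\<^esub> p)"


section \<open>The Lie algebras of matrices\<close>

text \<open>
  Matrices over \<open>A\<close> with rows and columns indexed by \<open>{1..n}\<close> are extended by zero, so that
  \<open>gl n A\<close> literally sits inside \<open>gl (Suc n) A\<close> as the upper left corner.
\<close>
definition mat_mult ::
    "nat \<Rightarrow> (complex, 'a) module \<Rightarrow> (nat \<Rightarrow> nat \<Rightarrow> 'a) \<Rightarrow> (nat \<Rightarrow> nat \<Rightarrow> 'a) \<Rightarrow> (nat \<Rightarrow> nat \<Rightarrow> 'a)" where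
  "mat_mult n A X Y = (\<lambda>i j. \<Oplus>\<^bsub>A\<^esub>k\<in>{1..n}. X i k \<otimes>\<^bsub>A\<^esub> Y k j)"

definition gl :: "nat \<Rightarrow> (complex, 'a) module \<Rightarrow> (complex, nat \<Rightarrow> nat \<Rightarrow> 'a) module" where
  "gl n A =
    \<lparr>carrier = {X. \<forall>i j. X i j \<in> carrier A \<and> (i \<notin> {1..n} \<or> j \<notin> {1..n} \<longrightarrow> X i j = \<zero>\<^bsub>A\<^esub>)},
     mult = (\<lambda>X Y i j. mat_mult n A X Y i j \<ominus>\<^bsub>A\<^esub> mat_mult n A Y X i j),
     one = undefined,
     zero = (\<lambda>i j. \<zero>\<^bsub>A\<^esub>),
     add = (\<lambda>X Y i j. X i j \<oplus>\<^bsub>A\<^esub> Y i j),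
     smult = (\<lambda>c X i j. c \<odot>\<^bsub>A\<^esub> X i j)\<rparr>"

text \<open>\<open>E\<^sub>i\<^sub>j(x)\<close>\<close>
definition mat_unit :: "(complex, 'a) module \<Rightarrow> nat \<Rightarrow> nat \<Rightarrow> 'a \<Rightarrow> (nat \<Rightarrow> nat \<Rightarrow> 'a)" where
  "mat_unit A i j x = (\<lambda>k l. if k = i \<and> l = j then x else \<zero>\<^bsub>A\<^esub>)"

text \<open>
  The action \<open>ad \<otimes> Id\<close> of a complex matrix \<open>Z\<close> on \<open>Mat(N) \<otimes> A\<close>. It is not an inner
  action in general, since \<open>A\<close> may lack a unit.
\<close>
definition ad_id ::
    "nat \<Rightarrow> (complex, 'a) module \<Rightarrow> (nat \<Rightarrow> nat \<Rightarrow> complex) \<Rightarrow> (nat \<Rightarrow> nat \<Rightarrow> 'a) \<Rightarrow> (nat \<Rightarrow> nat \<Rightarrow> 'a)" where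
  "ad_id N A Z X = (\<lambda>i j.
    (\<Oplus>\<^bsub>A\<^esub>k\<in>{1..N}. Z i k \<odot>\<^bsub>A\<^esub> X k j) \<ominus>\<^bsub>A\<^esub> (\<Oplus>\<^bsub>A\<^esub>k\<in>{1..N}. Z k j \<odot>\<^bsub>A\<^esub> X i k))"


section \<open>The algebra \<open>R(\<Omega>)\<close>\<close>

text \<open>
  The free vector space on nonempty words over \<open>\<Omega>\<close>; its quotient by the multilinearity relations
  is the direct sum of the tensor powers \<open>\<Omega>\<^bsup>\<otimes>(n+1)\<^esup>\<close>, a word \<open>[x\<^sub>1, \<dots>, x\<^sub>m]\<close> representing the
  tensor of its letters.
\<close>
definition word_join :: "(complex, 'w) module \<Rightarrow> 'w list \<Rightarrow> 'w list \<Rightarrow> 'w list" where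
  "word_join \<Omega> u v = butlast u @ [last u \<otimes>\<^bsub>\<Omega>\<^esub> hd v] @ tl v"

definition word_alg :: "(complex, 'w) module \<Rightarrow> (complex, 'w list \<Rightarrow>\<^sub>0 complex) module" where
  "word_alg \<Omega> =
    \<lparr>carrier = {p. Poly_Mapping.keys p \<subseteq> lists (carrier \<Omega>) - {[]}},
     mult = (\<lambda>p q. \<Sum>u\<in>Poly_Mapping.keys p. \<Sum>v\<in>Poly_Mapping.keys q.
       Poly_Mapping.single (word_join \<Omega> u v) (Poly_Mapping.lookup p u * Poly_Mapping.lookup q v)),
     one = undefined, zero = 0, add = (+), smult = (\<lambda>c. Poly_Mapping.map ((*) c))\<rparr>"

definition multilin :: "(complex, 'w) module \<Rightarrow> ('w list \<Rightarrow>\<^sub>0 complex) set" where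
  "multilin \<Omega> = lin_span (word_alg \<Omega>)
    ({wd (us @ [x \<oplus>\<^bsub>\<Omega>\<^esub> y] @ vs) - wd (us @ [x] @ vs) - wd (us @ [y] @ vs) | us vs x y.
        us \<in> lists (carrier \<Omega>) \<and> vs \<in> lists (carrier \<Omega>) \<and> x \<in> carrier \<Omega> \<and> y \<in> carrier \<Omega>} \<union>
     {wd (us @ [c \<odot>\<^bsub>\<Omega>\<^esub> x] @ vs) - Poly_Mapping.single (us @ [x] @ vs) c | us vs c x.
        us \<in> lists (carrier \<Omega>) \<and> vs \<in> lists (carrier \<Omega>) \<and> x \<in> carrier \<Omega>})"

definition R_alg :: "(complex, 'w) module \<Rightarrow> (complex, ('w list \<Rightarrow>\<^sub>0 complex) set) module" where
  "R_alg \<Omega> = alg_quot (word_alg \<Omega>) (multilin \<Omega>)"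

definition R_grade :: "(complex, 'w) module \<Rightarrow> nat \<Rightarrow> ('w list \<Rightarrow>\<^sub>0 complex) set set" where
  "R_grade \<Omega> n = {multilin \<Omega> +>\<^bsub>word_alg \<Omega>\<^esub> p | p.
    p \<in> carrier (word_alg \<Omega>) \<and> (\<forall>w\<in>Poly_Mapping.keys p. length w = n + 1)}"

definition gl_R_grade ::
    "nat \<Rightarrow> (complex, 'w) module \<Rightarrow> nat \<Rightarrow> (nat \<Rightarrow> nat \<Rightarrow> ('w list \<Rightarrow>\<^sub>0 complex) set) set" where
  "gl_R_grade d \<Omega> n = {X \<in> carrier (gl d (R_alg \<Omega>)). \<forall>i j. X i j \<in> R_grade \<Omega> n}"


section \<open>The algebra \<open>A\<^sub>d(\<Omega>)\<close>\<close>

type_synonym 'w ugl = "((nat \<Rightarrow> nat \<Rightarrow> 'w) list \<Rightarrow>\<^sub>0 complex) set"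

abbreviation Ugl :: "(complex, 'w) module \<Rightarrow> nat \<Rightarrow> (complex, 'w ugl) module" where
  "Ugl \<Omega> N \<equiv> uea (gl N \<Omega>)"

abbreviation EU :: "(complex, 'w) module \<Rightarrow> nat \<Rightarrow> nat \<Rightarrow> nat \<Rightarrow> 'w \<Rightarrow> 'w ugl" where
  "EU \<Omega> N i j x \<equiv> uea_of (gl N \<Omega>) (mat_unit \<Omega> i j x)"

text \<open>The elements of \<open>U(gl(N, \<Omega>))\<close> annihilated by all \<open>Z\<close> in \<open>S\<close>.\<close>
definition Ugl_inv :: "(complex, 'w) module \<Rightarrow> nat \<Rightarrow> (nat \<Rightarrow> nat \<Rightarrow> complex) set \<Rightarrow> 'w ugl set" where
  "Ugl_inv \<Omega> N S = {a \<in> carrier (Ugl \<Omega> N).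
    \<forall>Z\<in>S. uea_deriv (gl N \<Omega>) (ad_id N \<Omega> Z) a = \<zero>\<^bsub>Ugl \<Omega> N\<^esub>}"

definition gl_sub :: "nat \<Rightarrow> nat \<Rightarrow> (nat \<Rightarrow> nat \<Rightarrow> complex) set" where
  "gl_sub d N = lin_span (gl N cplx) {mat_unit cplx i j 1 | i j. i \<in> {d+1..N} \<and> j \<in> {d+1..N}}"

definition A_inv :: "nat \<Rightarrow> (complex, 'w) module \<Rightarrow> nat \<Rightarrow> 'w ugl set" where
  "A_inv d \<Omega> N = Ugl_inv \<Omega> N (gl_sub d N)"

definition I_plus :: "(complex, 'w) module \<Rightarrow> nat \<Rightarrow> 'w ugl set" where
  "I_plus \<Omega> N = lin_span (Ugl \<Omega> N)
    {u \<otimes>\<^bsub>Ugl \<Omega> N\<^esub> EU \<Omega> N i N x | u i x. u \<in> carrier (Ugl \<Omega> N) \<and> i \<in> {1..N} \<and> x \<in> carrier \<Omega>}"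

definition I_minus :: "(complex, 'w) module \<Rightarrow> nat \<Rightarrow> 'w ugl set" where
  "I_minus \<Omega> N = lin_span (Ugl \<Omega> N)
    {EU \<Omega> N N j x \<otimes>\<^bsub>Ugl \<Omega> N\<^esub> u | u j x. u \<in> carrier (Ugl \<Omega> N) \<and> j \<in> {1..N} \<and> x \<in> carrier \<Omega>}"

definition L_ideal :: "(complex, 'w) module \<Rightarrow> nat \<Rightarrow> 'w ugl set" where
  "L_ideal \<Omega> N = Ugl_inv \<Omega> N {mat_unit cplx N N 1} \<inter> I_plus \<Omega> N \<inter> I_minus \<Omega> N"

text \<open>
  The projection onto \<open>U(gl(N-1, \<Omega>))\<close> along \<open>L(N)\<close>, where \<open>U(gl(N-1, \<Omega>))\<close> is viewed inside
  \<open>U(gl(N, \<Omega>))\<close> through \<^const>\<open>uea_incl\<close>.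
\<close>
definition proj :: "(complex, 'w) module \<Rightarrow> nat \<Rightarrow> 'w ugl \<Rightarrow> 'w ugl" where
  "proj \<Omega> N a = (THE b. b \<in> carrier (Ugl \<Omega> (N - 1)) \<and>
    a \<ominus>\<^bsub>Ugl \<Omega> N\<^esub> uea_incl (gl N \<Omega>) b \<in> L_ideal \<Omega> N)"

text \<open>
  An element of the projective limit is a function on \<open>{d..}\<close> (taking the value \<^const>\<open>undefined\<close>
  below \<open>d\<close>).
\<close>
definition A_alg :: "nat \<Rightarrow> (complex, 'w) module \<Rightarrow> (complex, nat \<Rightarrow> 'w ugl) module" where
  "A_alg d \<Omega> =
    \<lparr>carrier = {a \<in> (\<Pi>\<^sub>E N\<in>{d..}. A_inv d \<Omega> N).
       (\<forall>N>d. proj \<Omega> N (a N) = a (N - 1)) \<and>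
       (\<exists>k. \<forall>N\<ge>d. a N \<in> uea_filt (gl N \<Omega>) k)},
     mult = (\<lambda>a b. \<lambda>N\<in>{d..}. a N \<otimes>\<^bsub>Ugl \<Omega> N\<^esub> b N),
     one = (\<lambda>N\<in>{d..}. \<one>\<^bsub>Ugl \<Omega> N\<^esub>),
     zero = (\<lambda>N\<in>{d..}. \<zero>\<^bsub>Ugl \<Omega> N\<^esub>),
     add = (\<lambda>a b. \<lambda>N\<in>{d..}. a N \<oplus>\<^bsub>Ugl \<Omega> N\<^esub> b N),
     smult = (\<lambda>c a. \<lambda>N\<in>{d..}. c \<odot>\<^bsub>Ugl \<Omega> N\<^esub> a N)\<rparr>"


section \<open>The algebra \<open>Y\<^sub>d(\<Omega>)\<close>\<close>

text \<open>
  \<open>e\<^sub>i\<^sub>j(x; N)\<close>; the summation index is the tuple \<open>(a\<^sub>1, \<dots>, a\<^sub>m\<^sub>-\<^sub>1)\<close>, completed to the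
  index path \<open>i, a\<^sub>1, \<dots>, a\<^sub>m\<^sub>-\<^sub>1, j\<close>.
\<close>
definition e_elt :: "(complex, 'w) module \<Rightarrow> nat \<Rightarrow> nat \<Rightarrow> nat \<Rightarrow> 'w list \<Rightarrow> 'w ugl" where
  "e_elt \<Omega> N i j x =
    (\<Oplus>\<^bsub>Ugl \<Omega> N\<^esub>a\<in>{a. set a \<subseteq> {1..N} \<and> length a = length x - 1}.
      (let p = i # a @ [j] in
       mprod (Ugl \<Omega> N) (map (\<lambda>q. EU \<Omega> N (p ! q) (p ! Suc q) (x ! q)) [0..<length x])))"

definition comps :: "nat \<Rightarrow> nat list set" where
  "comps m = {\<nu>. 0 \<notin> set \<nu> \<and> sum_list \<nu> = m}"

fun merge_word :: "(complex, 'w) module \<Rightarrow> 'w list \<Rightarrow> nat list \<Rightarrow> 'w list" where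
  "merge_word \<Omega> x [] = []"
| "merge_word \<Omega> x (n # \<nu>) = mprod1 \<Omega> (take n x) # merge_word \<Omega> (drop n x) \<nu>"

definition t_term :: "(complex, 'w) module \<Rightarrow> complex \<Rightarrow> nat \<Rightarrow> nat \<Rightarrow> nat \<Rightarrow> 'w list \<Rightarrow> 'w ugl" where
  "t_term \<Omega> s N i j x =
    (\<Oplus>\<^bsub>Ugl \<Omega> N\<^esub>\<nu>\<in>comps (length x).
      ((- of_nat N - s) ^ (length x - length (merge_word \<Omega> x \<nu>)))
        \<odot>\<^bsub>Ugl \<Omega> N\<^esub> e_elt \<Omega> N i j (merge_word \<Omega> x \<nu>))"

definition t_elt :: "nat \<Rightarrow> (complex, 'w) module \<Rightarrow> complex \<Rightarrow> nat \<times> nat \<times> 'w list \<Rightarrow> (nat \<Rightarrow> 'w ugl)" where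
  "t_elt d \<Omega> s = (\<lambda>(i, j, x). \<lambda>N\<in>{d..}. t_term \<Omega> s N i j x)"

text \<open>The labels \<open>(i, j, x)\<close> of the generators, with \<open>x\<close> in \<open>W(\<Omega>)\<close>.\<close>
definition t_index :: "nat \<Rightarrow> (complex, 'w) module \<Rightarrow> (nat \<times> nat \<times> 'w list) set" where
  "t_index d \<Omega> = {1..d} \<times> {1..d} \<times> (lists (carrier \<Omega>) - {[]})"

definition Y_alg :: "nat \<Rightarrow> (complex, 'w) module \<Rightarrow> complex \<Rightarrow> (complex, nat \<Rightarrow> 'w ugl) module" where
  "Y_alg d \<Omega> s = (A_alg d \<Omega>)\<lparr>carrier := subalg_gen (A_alg d \<Omega>) (t_elt d \<Omega> s ` t_index d \<Omega>)\<rparr>"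

definition Y_shifted_filt ::
    "nat \<Rightarrow> (complex, 'w) module \<Rightarrow> complex \<Rightarrow> nat \<Rightarrow> (nat \<Rightarrow> 'w ugl) set" where
  "Y_shifted_filt d \<Omega> s k = lin_span (Y_alg d \<Omega> s)
    {mprod (Y_alg d \<Omega> s) (map (t_elt d \<Omega> s) ts) | ts.
      set ts \<subseteq> t_index d \<Omega> \<and> (\<Sum>(i, j, x)\<leftarrow>ts. length x - 1) \<le> k}"

end

theory Submission
  imports Defs "HOL-Computational_Algebra.Polynomial"
begin

text \<open>
  Let \<open>T\<close> be the free algebra on the labels \<open>(i, j, x)\<close> of the generators, graded by the shifted
  degree. Sending labels to the generators \<open>t\<^sub>i\<^sub>j(x; s)\<close> and to \<open>E\<^sub>i\<^sub>j(x)\<close> maps \<open>T\<close> onto \<open>gr Y\<close> and onto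
  \<open>U(gl(d, R))\<close>, so it is enough that the two kernels agree. An element of \<open>T\<close> vanishes in \<open>Y\<close> if and
  only if its evaluations at all \<open>N \<ge> d\<close> vanish, so the projections \<open>\<pi>\<^sub>N\<close> never enter.

  Both kernels contain the commutator and multilinearity relations. At \<open>c = 0\<close> in place of
  \<open>c = - N - s\<close> the generators become the \<open>e\<^sub>i\<^sub>j(x; N)\<close>, and \<open>[e\<^sub>i\<^sub>j(x), e\<^sub>k\<^sub>l(y)]\<close> has the expected leading
  term up to products of lower shifted degree, with coefficients not depending on \<open>N\<close>. To pass to
  other \<open>c\<close>, let \<open>U(gl(N))\<close> act on multilinear forms: on forms killed by the last column, replacing \<open>N\<close>
  by \<open>N - 1\<close> amounts to replacing \<open>c\<close> by \<open>c + 1\<close>, so a relation valid for \<open>c = 0\<close> and all \<open>N\<close> holds for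
  \<open>c = 0, 1, 2, \<dots>\<close>, hence for all \<open>c\<close> by polynomiality.

  Modulo these relations \<open>T\<close> is spanned by ordered monomials, and the latter are linearly independent
  in both targets. For \<open>Y\<close>, the same forms give the top symbol of an element of \<open>U(gl(N))\<close> (as in the
  Poincare-Birkhoff-Witt theorem), and for \<open>N\<close> large one can choose linear maps
  \<open>Z : \<Omega> \<rightarrow> Mat(N)\<close> such that the upper left corners of the products \<open>Z(x\<^sub>1) \<cdots> Z(x\<^sub>m)\<close> of basis
  elements take arbitrary prescribed values.
\<close>

section \<open>Linear extension\<close>

text \<open>On forms killed by the last column only \<open>N + c\<close> matters: the additional
  summand \<open>a = N + 1\<close> of a path sum merges two neighbouring letters, exactly as the
  term with coefficient \<open>c\<close> does. The parameter \<open>- N - s\<close> is the choice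
  for which this sum is constant. A relation in Y needs one element of \<open>T\<close> as a witness
  for all \<open>N\<close> at once. At \<open>c = 0\<close> the commutator recursion provides it,
  built with sums and signs only, and the relation is then transported to other parameters.
  Transport requires a test for the whole defining ideal of U(gl(N)), not only for top symbols.
  Straightening provides it: an element annihilating all product forms is congruent to a combination
  of ordered words, and the words of maximal length in it are forced to vanish. The two independence
  proofs measure words differently: a label \<open>(i, j, x)\<close> has a symbol of degree
  \<open>length x\<close> in U(gl(N)), but of degree one in U(gl(d, R)). Both rest on the same
  prescribed matrix entries, which serve once as values of symbols and once as values of linear
  functionals on tensor powers.\<close>

definition lin_ext :: "('k \<Rightarrow> complex \<Rightarrow> 'b) \<Rightarrow> ('k \<Rightarrow>\<^sub>0 complex) \<Rightarrow> 'b::comm_monoid_add" where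
  "lin_ext g p = (\<Sum>w\<in>Poly_Mapping.keys p. g w (Poly_Mapping.lookup p w))"

text \<open>The coefficient is an argument of \<open>g\<close> because the target is only an abelian
  group, without scalar multiplication. Additivity in the coefficient is what makes
  \<open>lin_ext g\<close> additive.\<close>

definition coeff_additive :: "('k \<Rightarrow> complex \<Rightarrow> 'b::ab_group_add) \<Rightarrow> bool" where
  "coeff_additive g \<longleftrightarrow> (\<forall>w a b. g w (a + b) = g w a + g w b)"

lemma coeff_additiveI: "(\<And>w a b. g w (a + b) = g w a + g w b) \<Longrightarrow> coeff_additive g"
  by (simp add: coeff_additive_def)

lemma coeff_additive_zero: "coeff_additive g \<Longrightarrow> g w 0 = 0"
  unfolding coeff_additive_def by (metis add_cancel_right_right)

lemma lin_ext_superset: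
  assumes "coeff_additive g" "finite S" "Poly_Mapping.keys p \<subseteq> S"
  shows "lin_ext g p = (\<Sum>w\<in>S. g w (Poly_Mapping.lookup p w))"
  unfolding lin_ext_def
  by (rule sum.mono_neutral_left) (use assms coeff_additive_zero in \<open>auto simp: in_keys_iff\<close>)

lemma lin_ext_add: "coeff_additive g \<Longrightarrow> lin_ext g (p + q) = lin_ext g p + lin_ext g q"
proof -
  assume g: "coeff_additive g"
  let ?S = "Poly_Mapping.keys p \<union> Poly_Mapping.keys q"
  have "lin_ext g (p + q) = (\<Sum>w\<in>?S. g w (Poly_Mapping.lookup (p + q) w))"
    by (rule lin_ext_superset[OF g]) (auto simp: Poly_Mapping.keys_add)
  also have "\<dots> = (\<Sum>w\<in>?S. g w (Poly_Mapping.lookup p w)) + (\<Sum>w\<in>?S. g w (Poly_Mapping.lookup q w))"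
    using g by (simp add: coeff_additive_def lookup_add sum.distrib)
  also have "\<dots> = lin_ext g p + lin_ext g q"
    using g by (simp add: lin_ext_superset[of g ?S])
  finally show ?thesis .
qed

lemma lin_ext_0 [simp]: "lin_ext g 0 = 0"
  by (simp add: lin_ext_def)

lemma lin_ext_single: "coeff_additive g \<Longrightarrow> lin_ext g (Poly_Mapping.single w a) = g w a"
  by (cases "a = 0") (simp_all add: lin_ext_def coeff_additive_zero)

lemma lin_ext_uminus: "coeff_additive g \<Longrightarrow> lin_ext g (- p) = - lin_ext g p"
  by (metis lin_ext_add lin_ext_0 add.right_inverse add_eq_0_iff)

lemma lin_ext_diff: "coeff_additive g \<Longrightarrow> lin_ext g (p - q) = lin_ext g p - lin_ext g q"
  by (metis lin_ext_add lin_ext_uminus diff_conv_add_uminus)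

lemma lin_ext_sum: "coeff_additive g \<Longrightarrow> lin_ext g (sum f S) = (\<Sum>x\<in>S. lin_ext g (f x))"
  by (induction S rule: infinite_finite_induct) (auto simp: lin_ext_add)

lemma pm_eq_sum: "p = (\<Sum>w\<in>Poly_Mapping.keys p. Poly_Mapping.single w (Poly_Mapping.lookup p w))"
proof (rule poly_mapping_eqI)
  fix k
  have "(\<Sum>w\<in>Poly_Mapping.keys p. Poly_Mapping.lookup (Poly_Mapping.single w (Poly_Mapping.lookup p w)) k)
      = (\<Sum>w\<in>Poly_Mapping.keys p. if w = k then Poly_Mapping.lookup p w else 0)"
    by (rule sum.cong) (auto simp: lookup_single when_def)
  then show "Poly_Mapping.lookup p k = Poly_Mapping.lookup
      (\<Sum>w\<in>Poly_Mapping.keys p. Poly_Mapping.single w (Poly_Mapping.lookup p w)) k"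
    by (simp add: lookup_sum in_keys_iff)
qed

text \<open>Every element is a finite sum of single terms, so an additive property has to be checked
  on those only. The set \<open>S\<close> keeps track of the admissible keys.\<close>

lemma pm_induct [consumes 1, case_names zero single add]:
  fixes p :: "'k \<Rightarrow>\<^sub>0 complex"
  assumes "Poly_Mapping.keys p \<subseteq> S"
    and "P 0" and "\<And>w a. w \<in> S \<Longrightarrow> P (Poly_Mapping.single w a)"
    and add: "\<And>p q. \<lbrakk>Poly_Mapping.keys p \<subseteq> S; Poly_Mapping.keys q \<subseteq> S; P p; P q\<rbrakk> \<Longrightarrow> P (p + q)"
  shows "P p"
proof -
  have "\<And>R. \<lbrakk>finite R; R \<subseteq> S\<rbrakk> \<Longrightarrow>
      Poly_Mapping.keys (\<Sum>w\<in>R. Poly_Mapping.single w (f w)) \<subseteq> S \<and>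
      P (\<Sum>w\<in>R. Poly_Mapping.single w (f w))" for f :: "'k \<Rightarrow> complex"
  proof -
    fix R assume "finite R" "R \<subseteq> S"
    then show "Poly_Mapping.keys (\<Sum>w\<in>R. Poly_Mapping.single w (f w)) \<subseteq> S \<and>
      P (\<Sum>w\<in>R. Poly_Mapping.single w (f w))"
    proof (induction R rule: finite_induct)
      case empty then show ?case using assms(2) by simp
    next
      case (insert x F)
      have "Poly_Mapping.keys (Poly_Mapping.single x (f x)) \<subseteq> S" using insert by auto
      moreover have "Poly_Mapping.keys (Poly_Mapping.single x (f x) + (\<Sum>w\<in>F. Poly_Mapping.single w (f w))) \<subseteq> S"
        using insert Poly_Mapping.keys_add[of "Poly_Mapping.single x (f x)" "(\<Sum>w\<in>F. Poly_Mapping.single w (f w))"]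
        by (auto split: if_splits)
      ultimately show ?case using insert add assms(3) by simp
    qed
  qed
  from this[of "Poly_Mapping.keys p" "Poly_Mapping.lookup p"] assms(1) pm_eq_sum[of p]
  show ?thesis by simp
qed

section \<open>Free algebras\<close>

type_synonym 'g fa = "'g list \<Rightarrow>\<^sub>0 complex"

text \<open>Scalars are multiples of the empty word; scalar multiplication becomes multiplication by
  the central elements \<open>cst c\<close>.\<close>

definition cst :: "complex \<Rightarrow> 'g fa" where "cst c = Poly_Mapping.single [] c"

definition FA :: "'g set \<Rightarrow> 'g fa set" where "FA G = {p. Poly_Mapping.keys p \<subseteq> lists G}"

lemma single_mult_list: "Poly_Mapping.single u a * Poly_Mapping.single v b = Poly_Mapping.single (u @ v) (a * b)"
  for a b :: complex
  by (simp add: mult_single plus_list_def)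

lemma wd_mult: "wd u * wd v = wd (u @ v)"
  by (simp add: wd_def single_mult_list)

lemma wd_Nil: "wd [] = 1"
  by (simp add: wd_def zero_list_def flip: single_one)

lemma cst_0 [simp]: "cst 0 = 0" and cst_1 [simp]: "cst 1 = 1"
  by (simp_all add: cst_def zero_list_def flip: single_one)

lemma cst_add: "cst (a + b) = cst a + cst b"
  by (simp add: cst_def Poly_Mapping.single_add)

lemma cst_mult: "cst (a * b) = cst a * cst b"
  by (simp add: cst_def single_mult_list)

lemma cst_minus: "cst (- a) = - cst a"
  by (simp add: cst_def Poly_Mapping.single_uminus)

lemma single_conv: "Poly_Mapping.single w c = cst c * wd w"
  by (simp add: cst_def wd_def single_mult_list)

lemma cst_central: "cst c * p = p * cst c"
proof -
  have "Poly_Mapping.keys p \<subseteq> UNIV" by simp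
  then show ?thesis
    by (induction p rule: pm_induct) (auto simp: cst_def single_mult_list algebra_simps)
qed

lemma cst_left_comm: "p * (cst c * q) = cst c * (p * q)"
  by (metis cst_central mult.assoc)

lemma map_smult: "Poly_Mapping.map ((*) c) p = cst c * p"
  by (simp add: mult_map_scale_conv_mult cst_def zero_list_def)

lemma prod_list_wd: "prod_list (map (\<lambda>x. wd [x]) w) = wd w"
  by (induction w) (auto simp: wd_Nil wd_mult)

lemma FA_0 [simp, intro]: "0 \<in> FA G"
  and FA_1 [simp, intro]: "1 \<in> FA G"
  by (auto simp: FA_def zero_list_def)

lemma FA_single: "w \<in> lists G \<Longrightarrow> Poly_Mapping.single w a \<in> FA G"
  by (auto simp: FA_def)

lemma FA_wd: "set w \<subseteq> G \<Longrightarrow> wd w \<in> FA G"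
  unfolding wd_def by (auto intro!: FA_single)

lemma FA_wd1 [simp, intro]: "x \<in> G \<Longrightarrow> wd [x] \<in> FA G"
  by (rule FA_wd) simp

lemma FA_cst [simp, intro]: "cst c \<in> FA G"
  unfolding cst_def by (auto intro!: FA_single)

lemma FA_add [intro]: "p \<in> FA G \<Longrightarrow> q \<in> FA G \<Longrightarrow> p + q \<in> FA G"
  using Poly_Mapping.keys_add[of p q] by (auto simp: FA_def)

lemma FA_mult [intro]: "p \<in> FA G \<Longrightarrow> q \<in> FA G \<Longrightarrow> p * q \<in> FA G"
proof -
  assume pq: "p \<in> FA G" "q \<in> FA G"
  show ?thesis unfolding FA_def
  proof safe
    fix w x assume "w \<in> Poly_Mapping.keys (p * q)" and x: "x \<in> set w"
    then obtain u v where "u \<in> Poly_Mapping.keys p" "v \<in> Poly_Mapping.keys q" "w = u @ v"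
      using Poly_Mapping.keys_mult[of p q] by (auto simp: plus_list_def)
    then show "x \<in> G" using pq x by (auto simp: FA_def)
  qed
qed

lemma FA_uminus [intro]: "p \<in> FA G \<Longrightarrow> - p \<in> FA G"
  by (auto simp: FA_def in_keys_iff)

lemma FA_diff [intro]: "p \<in> FA G \<Longrightarrow> q \<in> FA G \<Longrightarrow> p - q \<in> FA G"
  by (metis FA_add FA_uminus diff_conv_add_uminus)

lemma FA_sum [intro]: "(\<And>x. x \<in> S \<Longrightarrow> f x \<in> FA G) \<Longrightarrow> sum f S \<in> FA G"
  by (induction S rule: infinite_finite_induct) auto

lemma FA_prod_list [intro]: "(\<And>x. x \<in> set xs \<Longrightarrow> x \<in> FA G) \<Longrightarrow> prod_list xs \<in> FA G"
  by (induction xs) auto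

lemma FA_mono: "G \<subseteq> G' \<Longrightarrow> FA G \<subseteq> FA G'"
  by (auto simp: FA_def)

lemma FA_induct [consumes 1, case_names zero single add]:
  assumes "p \<in> FA G" and "P 0" and "\<And>w a. w \<in> lists G \<Longrightarrow> P (Poly_Mapping.single w a)"
    and "\<And>p q. \<lbrakk>p \<in> FA G; q \<in> FA G; P p; P q\<rbrakk> \<Longrightarrow> P (p + q)"
  shows "P p"
proof -
  have "Poly_Mapping.keys p \<subseteq> lists G" using assms(1) by (simp add: FA_def)
  then show ?thesis
    by (induction p rule: pm_induct) (use assms in \<open>auto simp: FA_def\<close>)
qed

lemma carrier_free_alg: "carrier (free_alg G) = FA G"
  by (simp add: free_alg_def FA_def)

lemma ring_free_alg: "ring (free_alg G)"
proof (rule ringI)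
  show "abelian_group (free_alg G)"
    by (rule abelian_groupI)
      (auto simp: free_alg_def FA_def[symmetric] algebra_simps intro: bexI[of _ "- _"])
  show "monoid (free_alg G)"
    by (rule monoidI) (auto simp: free_alg_def FA_def[symmetric] algebra_simps)
qed (auto simp: free_alg_def FA_def[symmetric] algebra_simps)

text \<open>The universal property of the free algebra: the homomorphism that sends the letter
  \<open>x\<close> to \<open>h x\<close>. Both \<open>ev\<close> and \<open>U_map\<close> are
  instances.\<close>

definition subst :: "('b \<Rightarrow> 'g fa) \<Rightarrow> 'b fa \<Rightarrow> 'g fa" where
  "subst h = lin_ext (\<lambda>w a. cst a * prod_list (map h w))"

lemma coeff_additive_subst: "coeff_additive (\<lambda>w a. cst a * prod_list (map h w))"
  by (rule coeff_additiveI) (simp add: cst_add algebra_simps)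

lemma subst_0 [simp]: "subst h 0 = 0"
  by (simp add: subst_def)

lemma subst_add: "subst h (p + q) = subst h p + subst h q"
  by (simp add: subst_def lin_ext_add coeff_additive_subst)

lemma subst_diff: "subst h (p - q) = subst h p - subst h q"
  by (simp add: subst_def lin_ext_diff coeff_additive_subst)

lemma subst_uminus: "subst h (- q) = - subst h q"
  by (simp add: subst_def lin_ext_uminus coeff_additive_subst)

lemma subst_sum: "subst h (sum f S) = (\<Sum>x\<in>S. subst h (f x))"
  by (simp add: subst_def lin_ext_sum coeff_additive_subst)

lemma subst_single: "subst h (Poly_Mapping.single w a) = cst a * prod_list (map h w)"
  by (simp add: subst_def lin_ext_single coeff_additive_subst)

lemma subst_wd: "subst h (wd w) = prod_list (map h w)"
  by (simp add: wd_def subst_single)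

lemma subst_cst: "subst h (cst c) = cst c"
  by (simp add: cst_def subst_single)

lemma subst_1 [simp]: "subst h 1 = 1"
  using subst_cst[of h 1] by simp

lemma subst_mult: "subst h (p * q) = subst h p * subst h q"
proof -
  have 1: "subst h (Poly_Mapping.single w a * q) = subst h (Poly_Mapping.single w a) * subst h q" for w a
  proof -
    have "Poly_Mapping.keys q \<subseteq> UNIV" by simp
    then show ?thesis
    proof (induction q rule: pm_induct)
      case (single v b)
      have "prod_list (map h w) * (cst b * prod_list (map h v)) = cst b * (prod_list (map h w) * prod_list (map h v))"
        by (rule cst_left_comm)
      then show ?case by (simp add: subst_single single_mult_list cst_mult mult.assoc)
    qed (simp_all add: subst_add distrib_left)
  qed
  have "Poly_Mapping.keys p \<subseteq> UNIV" by simp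
  then show ?thesis
    by (induction p rule: pm_induct) (simp_all add: subst_add 1 distrib_right)
qed

lemma subst_FA: "p \<in> FA G \<Longrightarrow> (\<And>x. x \<in> G \<Longrightarrow> h x \<in> FA G') \<Longrightarrow> subst h p \<in> FA G'"
  by (induction p rule: FA_induct) (auto simp: subst_add subst_single intro!: FA_mult FA_prod_list)

section \<open>Quotients\<close>

text \<open>The quotients are records of cosets, with operations given by unions of cosets. A fixed
  additive map \<open>rp\<close> from an abelian group onto the carrier, injective or not, allows
  all computations to be done on representatives.\<close>

locale rep =
  fixes A :: "(complex, 'a) module" and rp :: "'r::ab_group_add \<Rightarrow> 'a" and T :: "'r set"
  assumes T0: "0 \<in> T" and Tadd: "\<lbrakk>p \<in> T; q \<in> T\<rbrakk> \<Longrightarrow> p + q \<in> T"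
    and Tuminus: "p \<in> T \<Longrightarrow> - p \<in> T"
    and rp_carrier: "carrier A = rp ` T"
    and rp_zero: "\<zero>\<^bsub>A\<^esub> = rp 0"
    and rp_add: "\<lbrakk>p \<in> T; q \<in> T\<rbrakk> \<Longrightarrow> rp p \<oplus>\<^bsub>A\<^esub> rp q = rp (p + q)"
begin

lemma abelian: "abelian_group A"
proof (rule abelian_groupI)
  fix x assume "x \<in> carrier A"
  then obtain p where p: "p \<in> T" "x = rp p" by (auto simp: rp_carrier)
  then show "\<exists>y\<in>carrier A. y \<oplus>\<^bsub>A\<^esub> x = \<zero>\<^bsub>A\<^esub>"
    by (intro bexI[of _ "rp (- p)"]) (auto simp: rp_add Tuminus rp_zero rp_carrier)
qed (auto simp: rp_carrier rp_zero rp_add T0 Tadd algebra_simps)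

lemma rp_finsum: "\<lbrakk>finite S; \<And>x. x \<in> S \<Longrightarrow> g x \<in> T\<rbrakk> \<Longrightarrow> finsum A (\<lambda>x. rp (g x)) S = rp (sum g S) \<and> sum g S \<in> T"
proof (induction S rule: finite_induct)
  interpret abelian_group A by (rule abelian)
  case empty then show ?case by (simp add: rp_zero T0)
next
  interpret abelian_group A by (rule abelian)
  case (insert x F)
  then have "finsum A (\<lambda>x. rp (g x)) (insert x F) = rp (g x) \<oplus>\<^bsub>A\<^esub> finsum A (\<lambda>x. rp (g x)) F"
    by (intro finsum_insert) (auto simp: rp_carrier)
  then show ?case using insert by (auto simp: rp_add Tadd)
qed

end

text \<open>By \<open>Ksat\<close> the subgroup \<open>K\<close> contains the kernel of
  \<open>rp\<close>, so cosets in \<open>A\<close> correspond to cosets of \<open>K\<close> in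
  \<open>T\<close>. For enveloping algebras and for R the map \<open>rp\<close> is the identity; for
  a graded piece of Y it is the evaluation \<open>Y_map\<close>.\<close>

locale rep_sub = rep A rp T
  for A :: "(complex, 'a) module" and rp :: "'r::ab_group_add \<Rightarrow> 'a" and T :: "'r set" +
  fixes K :: "'r set"
  assumes KT: "K \<subseteq> T" and K0: "0 \<in> K" and Kadd: "\<lbrakk>p \<in> K; q \<in> K\<rbrakk> \<Longrightarrow> p + q \<in> K"
    and Kuminus: "p \<in> K \<Longrightarrow> - p \<in> K"
    and Ksat: "\<lbrakk>p \<in> T; q \<in> T; rp p = rp q\<rbrakk> \<Longrightarrow> p - q \<in> K"
begin

definition cs :: "'r \<Rightarrow> 'a set" where "cs p = rp ` {k + p | k. k \<in> K}"

lemma KT': "k \<in> K \<Longrightarrow> k \<in> T" using KT by auto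

lemma coset: "p \<in> T \<Longrightarrow> rp ` K +>\<^bsub>A\<^esub> rp p = cs p"
  by (auto simp: a_r_coset_def' cs_def rp_add KT')

lemma cs_0: "cs 0 = rp ` K" by (simp add: cs_def)

lemma cs_self: "rp p \<in> cs p" unfolding cs_def using K0 by force

lemma cs_mem: "p \<in> T \<Longrightarrow> q \<in> T \<Longrightarrow> rp q \<in> cs p \<longleftrightarrow> q - p \<in> K"
proof
  assume pq: "p \<in> T" "q \<in> T" and "rp q \<in> cs p"
  then obtain k where k: "k \<in> K" "rp q = rp (k + p)" by (auto simp: cs_def)
  then have "q - (k + p) \<in> K" using pq by (intro Ksat) (auto simp: Tadd KT')
  then have "(q - (k + p)) + k \<in> K" using k Kadd by blast
  then show "q - p \<in> K" by (simp add: algebra_simps)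
next
  assume "q - p \<in> K" then show "rp q \<in> cs p" unfolding cs_def by (intro imageI) force
qed

lemma cs_eq: "p \<in> T \<Longrightarrow> q \<in> T \<Longrightarrow> cs p = cs q \<longleftrightarrow> p - q \<in> K"
proof
  assume pq: "p \<in> T" "q \<in> T" and "cs p = cs q"
  then show "p - q \<in> K" using cs_mem[of q p] cs_self[of p] by simp
next
  have *: "cs p \<subseteq> cs q" if "p \<in> T" "q \<in> T" "p - q \<in> K" for p q
  proof
    fix x assume "x \<in> cs p"
    then obtain k where k: "k \<in> K" "x = rp (k + p)" by (auto simp: cs_def)
    then have "k + (p - q) \<in> K" using that Kadd by blast
    then show "x \<in> cs q" unfolding cs_def using k by (intro image_eqI[of _ _ "k + p"]) (auto intro!: exI[of _ "k + (p - q)"])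
  qed
  assume pq: "p \<in> T" "q \<in> T" "p - q \<in> K"
  then have "q - p \<in> K" using Kuminus[of "p - q"] by simp
  then show "cs p = cs q" using *[of p q] *[of q p] pq by blast
qed

lemma cs_add: "p \<in> T \<Longrightarrow> q \<in> T \<Longrightarrow> cs p <+>\<^bsub>A\<^esub> cs q = cs (p + q)"
proof (intro equalityI subsetI)
  fix x assume pq: "p \<in> T" "q \<in> T" and "x \<in> cs p <+>\<^bsub>A\<^esub> cs q"
  then obtain k l where "k \<in> K" "l \<in> K" "x = rp (k + p) \<oplus>\<^bsub>A\<^esub> rp (l + q)"
    by (auto simp: set_add_def' cs_def)
  then show "x \<in> cs (p + q)" using pq unfolding cs_def
    by (intro image_eqI[of _ _ "(k + l) + (p + q)"]) (auto simp: rp_add Tadd KT' Kadd algebra_simps intro!: exI[of _ "k + l"])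
next
  fix x assume pq: "p \<in> T" "q \<in> T" and "x \<in> cs (p + q)"
  then obtain k where "k \<in> K" "x = rp (k + (p + q))" by (auto simp: cs_def)
  then have "x = rp (k + p) \<oplus>\<^bsub>A\<^esub> rp (0 + q)" using pq by (simp add: rp_add Tadd KT' algebra_simps)
  then show "x \<in> cs p <+>\<^bsub>A\<^esub> cs q" using \<open>k \<in> K\<close> K0 by (force simp: set_add_def' cs_def)
qed

lemma rcosets: "a_rcosets\<^bsub>A\<^esub> (rp ` K) = cs ` T"
  by (auto simp: A_RCOSETS_def' rp_carrier coset)

lemma cs_smult_union:
  assumes "p \<in> T" and "\<And>q. q \<in> T \<Longrightarrow> c \<odot>\<^bsub>A\<^esub> rp q = rp (m q)"
    and "\<And>q. q \<in> T \<Longrightarrow> m q \<in> T" "\<And>q r. q \<in> T \<Longrightarrow> r \<in> T \<Longrightarrow> m (q + r) = m q + m r" "\<And>q. q \<in> K \<Longrightarrow> m q \<in> K"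
  shows "(\<Union>x\<in>cs p. rp ` K +>\<^bsub>A\<^esub> (c \<odot>\<^bsub>A\<^esub> x)) = cs (m p)"
proof -
  have "rp ` K +>\<^bsub>A\<^esub> (c \<odot>\<^bsub>A\<^esub> x) = cs (m p)" if x: "x \<in> cs p" for x
  proof -
    obtain k where k: "k \<in> K" "x = rp (k + p)" using x by (auto simp: cs_def)
    have "rp ` K +>\<^bsub>A\<^esub> (c \<odot>\<^bsub>A\<^esub> x) = cs (m (k + p))"
      using k assms by (simp add: Tadd KT' coset)
    also have "\<dots> = cs (m p)"
      using k assms by (subst cs_eq) (auto simp: Tadd KT')
    finally show ?thesis .
  qed
  moreover have "cs p \<noteq> {}" using cs_self by blast
  ultimately show ?thesis by blast
qed

text \<open>Three subgroups occur because the product of the graded pieces of degrees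
  \<open>i\<close> and \<open>j\<close> lies in the piece of degree \<open>i + j\<close>. For a
  quotient by an ideal they coincide.\<close>

lemma cs_mult_union:
  assumes "X = rp ` {k + p | k. k \<in> K1}" "Y = rp ` {k + q | k. k \<in> K2}"
    and "0 \<in> K1" "0 \<in> K2"
    and "\<And>k l. \<lbrakk>k \<in> K1; l \<in> K2\<rbrakk> \<Longrightarrow> \<exists>r\<in>T. rp (k + p) \<otimes>\<^bsub>A\<^esub> rp (l + q) = rp r \<and> r - m \<in> K"
    and "m \<in> T"
  shows "rcoset_mult A (rp ` K) X Y = cs m"
proof -
  have "rp ` K +>\<^bsub>A\<^esub> (x \<otimes>\<^bsub>A\<^esub> y) = cs m" if xy: "x \<in> X" "y \<in> Y" for x y
  proof -
    obtain k where k: "k \<in> K1" "x = rp (k + p)" using xy(1) unfolding assms(1) by blast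
    obtain l where "l \<in> K2" "y = rp (l + q)" using xy(2) unfolding assms(2) by blast
    with k assms(5)[of k l] obtain r where "r \<in> T" "x \<otimes>\<^bsub>A\<^esub> y = rp r" "r - m \<in> K" by auto
    then show ?thesis using assms(6) by (simp add: coset cs_eq)
  qed
  moreover have "X \<noteq> {}" "Y \<noteq> {}" using assms by auto
  ultimately show ?thesis unfolding rcoset_mult_def by blast
qed

end

section \<open>Enveloping algebras\<close>

lemma free_alg_simps [simp]:
  "monoid.mult (free_alg G) = (*)" "monoid.one (free_alg G) = 1" "ring.zero (free_alg G) = 0" "ring.add (free_alg G) = (+)"
  "module.smult (free_alg G) = (\<lambda>c p. cst c * p)"
  by (simp_all add: free_alg_def map_smult fun_eq_iff)

lemma free_alg_a_inv: "p \<in> FA G \<Longrightarrow> \<ominus>\<^bsub>free_alg G\<^esub> p = - p"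
proof -
  interpret ring "free_alg G" by (rule ring_free_alg)
  assume "p \<in> FA G"
  then show ?thesis by (intro minus_equality) (auto simp: carrier_free_alg)
qed

definition uea_rels :: "(complex, 'g) module \<Rightarrow> 'g fa set" where
  "uea_rels L =
    ({wd [x \<oplus>\<^bsub>L\<^esub> y] - wd [x] - wd [y] | x y. x \<in> carrier L \<and> y \<in> carrier L} \<union>
     {wd [c \<odot>\<^bsub>L\<^esub> x] - Poly_Mapping.single [x] c | c x. x \<in> carrier L} \<union>
     {wd [x] * wd [y] - wd [y] * wd [x] - wd [x \<otimes>\<^bsub>L\<^esub> y] | x y. x \<in> carrier L \<and> y \<in> carrier L})"

lemma uea_ideal_eq: "uea_ideal L = Idl\<^bsub>free_alg (carrier L)\<^esub> (uea_rels L)"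
  by (simp add: uea_ideal_def uea_rels_def)

text \<open>The multiplication of the record is the bracket. Here it only has to be closed; that it
  is a commutator enters with \<open>lie_action\<close>.\<close>

locale lie_rec =
  fixes L :: "(complex, 'g) module"
  assumes L_add: "\<lbrakk>x \<in> carrier L; y \<in> carrier L\<rbrakk> \<Longrightarrow> x \<oplus>\<^bsub>L\<^esub> y \<in> carrier L"
    and L_smult: "x \<in> carrier L \<Longrightarrow> c \<odot>\<^bsub>L\<^esub> x \<in> carrier L"
    and L_mult: "\<lbrakk>x \<in> carrier L; y \<in> carrier L\<rbrakk> \<Longrightarrow> x \<otimes>\<^bsub>L\<^esub> y \<in> carrier L"
begin

abbreviation "I \<equiv> uea_ideal L"
abbreviation "F \<equiv> FA (carrier L)"

lemma rels_FA: "uea_rels L \<subseteq> F"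
  by (auto simp: uea_rels_def single_conv intro!: FA_diff FA_mult L_add L_smult L_mult)

lemma I_ideal: "ideal I (free_alg (carrier L))"
  unfolding uea_ideal_eq
  by (rule ring.genideal_ideal[OF ring_free_alg]) (use rels_FA in \<open>simp add: carrier_free_alg\<close>)

lemma I_rels: "r \<in> uea_rels L \<Longrightarrow> r \<in> I"
  using ring.genideal_self[OF ring_free_alg, of "uea_rels L" "carrier L"] rels_FA
  by (auto simp: carrier_free_alg uea_ideal_eq)

lemma I_FA: "p \<in> I \<Longrightarrow> p \<in> F"
  using ideal.Icarr[OF I_ideal] by (simp add: carrier_free_alg)

lemma I_0 [simp]: "0 \<in> I"
  using additive_subgroup.zero_closed[OF ideal.axioms(1)[OF I_ideal]] by simp

lemma I_add: "p \<in> I \<Longrightarrow> q \<in> I \<Longrightarrow> p + q \<in> I"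
  using additive_subgroup.a_closed[OF ideal.axioms(1)[OF I_ideal]] by simp

lemma I_lmult: "p \<in> I \<Longrightarrow> q \<in> F \<Longrightarrow> q * p \<in> I"
  using ideal.I_l_closed[OF I_ideal] by (simp add: carrier_free_alg)

lemma I_rmult: "p \<in> I \<Longrightarrow> q \<in> F \<Longrightarrow> p * q \<in> I"
  using ideal.I_r_closed[OF I_ideal] by (simp add: carrier_free_alg)

lemma I_cst: "p \<in> I \<Longrightarrow> cst c * p \<in> I"
  by (rule I_lmult) auto

lemma I_uminus: "p \<in> I \<Longrightarrow> - p \<in> I"
  using I_cst[of p "-1"] by (simp add: cst_minus)

lemma I_diff: "p \<in> I \<Longrightarrow> q \<in> I \<Longrightarrow> p - q \<in> I"
  by (metis I_add I_uminus diff_conv_add_uminus)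

lemma I_sum: "(\<And>x. x \<in> S \<Longrightarrow> f x \<in> I) \<Longrightarrow> sum f S \<in> I"
  by (induction S rule: infinite_finite_induct) (auto intro: I_add)

definition eqv :: "'g fa \<Rightarrow> 'g fa \<Rightarrow> bool" (infix "\<approx>" 50) where "p \<approx> q \<longleftrightarrow> p - q \<in> I"

lemma eqv_refl [simp]: "p \<approx> p" by (simp add: eqv_def)
lemma eqv_sym: "p \<approx> q \<Longrightarrow> q \<approx> p" using I_uminus[of "p - q"] by (simp add: eqv_def)
lemma eqv_trans [trans]: "p \<approx> q \<Longrightarrow> q \<approx> r \<Longrightarrow> p \<approx> r"
  using I_add[of "p - q" "q - r"] by (simp add: eqv_def)
lemma eqv_eq_trans [trans]: "p \<approx> q \<Longrightarrow> q = r \<Longrightarrow> p \<approx> r" by simp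
lemma eq_eqv_trans [trans]: "p = q \<Longrightarrow> q \<approx> r \<Longrightarrow> p \<approx> r" by simp
lemma eqv_add: "p \<approx> q \<Longrightarrow> p' \<approx> q' \<Longrightarrow> p + p' \<approx> q + q'"
  using I_add[of "p - q" "p' - q'"] by (simp add: eqv_def algebra_simps)
lemma eqv_diff: "p \<approx> q \<Longrightarrow> p' \<approx> q' \<Longrightarrow> p - p' \<approx> q - q'"
  using I_diff[of "p - q" "p' - q'"] by (simp add: eqv_def algebra_simps)
lemma eqv_uminus: "p \<approx> q \<Longrightarrow> - p \<approx> - q"
  using I_uminus[of "p - q"] by (simp add: eqv_def algebra_simps)
lemma eqv_sum: "(\<And>x. x \<in> S \<Longrightarrow> f x \<approx> g x) \<Longrightarrow> sum f S \<approx> sum g S"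
  unfolding eqv_def by (simp add: sum_subtractf[symmetric] I_sum)
lemma eqv_lmult: "p \<approx> q \<Longrightarrow> r \<in> F \<Longrightarrow> r * p \<approx> r * q"
  using I_lmult[of "p - q" r] by (simp add: eqv_def algebra_simps)
lemma eqv_rmult: "p \<approx> q \<Longrightarrow> r \<in> F \<Longrightarrow> p * r \<approx> q * r"
  using I_rmult[of "p - q" r] by (simp add: eqv_def algebra_simps)
lemma eqv_cst: "p \<approx> q \<Longrightarrow> cst c * p \<approx> cst c * q"
  by (rule eqv_lmult) auto
lemma eqv_mult: "p \<approx> q \<Longrightarrow> p' \<approx> q' \<Longrightarrow> p \<in> F \<Longrightarrow> q' \<in> F \<Longrightarrow> p * p' \<approx> q * q'"
  by (rule eqv_trans[OF eqv_lmult[of p' q' p] eqv_rmult])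

lemma wd_add: "x \<in> carrier L \<Longrightarrow> y \<in> carrier L \<Longrightarrow> wd [x \<oplus>\<^bsub>L\<^esub> y] \<approx> wd [x] + wd [y]"
  unfolding eqv_def diff_diff_eq[symmetric] by (rule I_rels) (auto simp: uea_rels_def)

lemma wd_smult: "x \<in> carrier L \<Longrightarrow> wd [c \<odot>\<^bsub>L\<^esub> x] \<approx> cst c * wd [x]"
  unfolding eqv_def single_conv[symmetric] by (rule I_rels) (auto simp: uea_rels_def)

lemma wd_comm: "x \<in> carrier L \<Longrightarrow> y \<in> carrier L \<Longrightarrow> wd [x] * wd [y] - wd [y] * wd [x] \<approx> wd [x \<otimes>\<^bsub>L\<^esub> y]"
  unfolding eqv_def by (rule I_rels) (unfold uea_rels_def, blast)

definition cls :: "'g fa \<Rightarrow> 'g fa set" where "cls p = I +>\<^bsub>free_alg (carrier L)\<^esub> p"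

sublocale fr: rep_sub "free_alg (carrier L)" "\<lambda>p. p" F I
  by unfold_locales
    (auto simp: carrier_free_alg I_FA intro: I_add I_uminus I_diff)

lemma cls_cs: "p \<in> F \<Longrightarrow> cls p = fr.cs p"
  using fr.coset[of p] by (simp add: cls_def)

lemma cls_eq: "p \<in> F \<Longrightarrow> q \<in> F \<Longrightarrow> cls p = cls q \<longleftrightarrow> p \<approx> q"
  by (simp add: cls_cs fr.cs_eq eqv_def)

lemma uea_add: "p \<in> F \<Longrightarrow> q \<in> F \<Longrightarrow> cls p \<oplus>\<^bsub>uea L\<^esub> cls q = cls (p + q)"
  by (simp add: uea_def alg_quot_def FactRing_def cls_cs fr.cs_add FA_add)

lemma uea_carrier: "carrier (uea L) = cls ` F"
  using fr.rcosets by (simp add: uea_def alg_quot_def FactRing_def cls_cs)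

lemma uea_zero: "\<zero>\<^bsub>uea L\<^esub> = cls 0"
  using fr.cs_0 by (simp add: uea_def alg_quot_def FactRing_def cls_cs)

lemma uea_one: "\<one>\<^bsub>uea L\<^esub> = cls 1"
  by (simp add: uea_def alg_quot_def FactRing_def cls_def)

lemma uea_mult: "p \<in> F \<Longrightarrow> q \<in> F \<Longrightarrow> cls p \<otimes>\<^bsub>uea L\<^esub> cls q = cls (p * q)"
proof -
  assume pq: "p \<in> F" "q \<in> F"
  have "rcoset_mult (free_alg (carrier L)) ((\<lambda>p. p) ` I) (cls p) (cls q) = fr.cs (p * q)"
  proof (rule fr.cs_mult_union[where ?K1.0 = I and ?K2.0 = I])
    fix k l assume kl: "k \<in> I" "l \<in> I"
    have "(k + p) * (l + q) - p * q = k * (l + q) + p * l" by (simp add: algebra_simps)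
    moreover have "k * (l + q) + p * l \<in> I" using kl pq I_FA[of l] by (intro I_add[OF I_rmult[of k "l + q"] I_lmult[of l p]]) auto
    ultimately show "\<exists>r\<in>F. (k + p) \<otimes>\<^bsub>free_alg (carrier L)\<^esub> (l + q) = r \<and> r - p * q \<in> I"
      using kl pq I_FA[of k] I_FA[of l] by (intro bexI[of _ "(k + p) * (l + q)"] conjI) (auto intro!: FA_mult FA_add)
  qed (use pq in \<open>auto simp: cls_cs fr.cs_def\<close>)
  then show ?thesis using pq by (simp add: uea_def alg_quot_def FactRing_def cls_cs FA_mult)
qed

lemma uea_smult: "p \<in> F \<Longrightarrow> c \<odot>\<^bsub>uea L\<^esub> cls p = cls (cst c * p)"
  using fr.cs_smult_union[of p c "\<lambda>q. cst c * q"]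
  by (simp add: uea_def alg_quot_def cls_cs FA_mult distrib_left I_cst)

sublocale ue: rep "uea L" cls F
  by unfold_locales (auto simp: uea_carrier uea_zero uea_add)

lemma uea_mprod: "set ps \<subseteq> F \<Longrightarrow> mprod (uea L) (map cls ps) = cls (prod_list ps)"
  by (induction ps) (auto simp: mprod_def uea_one uea_mult FA_prod_list subset_iff)

lemma uea_of_cls: "uea_of L x = cls (wd [x])"
  by (simp add: uea_of_def cls_def)

end

section \<open>The action on multilinear forms\<close>

text \<open>
  Commutators in an associative algebra with product \<open>P\<close> act on forms on the \<open>K\<close>th tensor power of its
  unitization; a slot holding \<^const>\<open>None\<close> stands for the adjoined unit. Evaluating at the
  slots \<^const>\<open>None\<close> detects top symbols.
\<close>

type_synonym 'g form = "(nat \<Rightarrow> 'g option) \<Rightarrow> complex"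

fun omul :: "('g \<Rightarrow> 'g \<Rightarrow> 'g) \<Rightarrow> 'g option \<Rightarrow> 'g \<Rightarrow> 'g" where
  "omul P None x = x" | "omul P (Some a) x = P a x"

text \<open>The sum over the slots is the coproduct action on a tensor power. Forms are acted on by
  precomposition, so multiplication from the right inside the slots gives a left action: a word acts
  as the composite of its letters in their order.\<close>

definition act :: "('g \<Rightarrow> 'g \<Rightarrow> 'g) \<Rightarrow> nat \<Rightarrow> 'g \<Rightarrow> 'g form \<Rightarrow> 'g form" where
  "act P K x H as = (\<Sum>r<K. H (as(r := Some (omul P (as r) x))))"

definition actw :: "('g \<Rightarrow> 'g \<Rightarrow> 'g) \<Rightarrow> nat \<Rightarrow> 'g list \<Rightarrow> 'g form \<Rightarrow> 'g form" where
  "actw P K w H = foldr (act P K) w H"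

definition acts :: "('g \<Rightarrow> 'g \<Rightarrow> 'g) \<Rightarrow> nat \<Rightarrow> 'g fa \<Rightarrow> 'g form \<Rightarrow> 'g form" where
  "acts P K p H as = lin_ext (\<lambda>w a. a * actw P K w H as) p"

definition slots :: "'g set \<Rightarrow> (nat \<Rightarrow> 'g option) set" where
  "slots G = {as. \<forall>r x. as r = Some x \<longrightarrow> x \<in> G}"

text \<open>Linearity is asked of a slot only when it is filled; the dependence on
  \<open>None\<close> is unrestricted.\<close>

definition multilinear :: "(complex, 'g) module \<Rightarrow> nat \<Rightarrow> 'g form \<Rightarrow> bool" where
  "multilinear A K H \<longleftrightarrow> (\<forall>as\<in>slots (carrier A). \<forall>r<K. \<forall>x\<in>carrier A.
     (\<forall>y\<in>carrier A. H (as(r := Some (x \<oplus>\<^bsub>A\<^esub> y))) = H (as(r := Some x)) + H (as(r := Some y))) \<and>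
     (\<forall>c. H (as(r := Some (c \<odot>\<^bsub>A\<^esub> x))) = c * H (as(r := Some x))))"

lemma slots_upd: "as \<in> slots G \<Longrightarrow> x \<in> G \<Longrightarrow> as(r := Some x) \<in> slots G"
  by (auto simp: slots_def)

lemma coeff_additive_acts: "coeff_additive (\<lambda>w a. a * actw P K w H as)"
  by (rule coeff_additiveI) (simp add: algebra_simps)

lemma acts_add: "acts P K (p + q) H as = acts P K p H as + acts P K q H as"
  and acts_diff: "acts P K (p - q) H as = acts P K p H as - acts P K q H as"
  and acts_0 [simp]: "acts P K 0 H as = 0"
  and acts_single: "acts P K (Poly_Mapping.single w a) H as = a * actw P K w H as"
  and acts_sum: "acts P K (sum f S) H as = (\<Sum>x\<in>S. acts P K (f x) H as)"
  by (simp_all add: acts_def lin_ext_add lin_ext_diff lin_ext_single lin_ext_sum coeff_additive_acts)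

lemma acts_wd1: "acts P K (wd [x]) H = act P K x H"
  by (simp add: fun_eq_iff wd_def acts_single actw_def)

lemma acts_1 [simp]: "acts P K 1 H = H"
  by (simp add: fun_eq_iff wd_Nil[symmetric] wd_def acts_single actw_def)

lemma actw_linear:
  "actw P K w (\<lambda>as. \<Sum>x\<in>S. c x * H x as) as = (\<Sum>x\<in>S. c x * actw P K w (H x) as)"
proof (induction w arbitrary: as)
  case (Cons x w)
  have "actw P K (x # w) (\<lambda>as. \<Sum>x\<in>S. c x * H x as) as
      = (\<Sum>r<K. \<Sum>y\<in>S. c y * actw P K w (H y) (as(r := Some (omul P (as r) x))))"
    using Cons by (simp add: actw_def act_def fun_upd_def)
  also have "\<dots> = (\<Sum>y\<in>S. c y * actw P K (x # w) (H y) as)"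
    by (subst sum.swap) (simp add: actw_def act_def sum_distrib_left)
  finally show ?case .
qed (simp add: actw_def)

lemma acts_mult: "acts P K (p * q) H = acts P K p (acts P K q H)"
proof
  fix as
  have 1: "acts P K (Poly_Mapping.single u a * q) H as = a * actw P K u (acts P K q H) as" for u a
  proof -
    have "Poly_Mapping.single u a * q = (\<Sum>v\<in>Poly_Mapping.keys q. Poly_Mapping.single (u @ v) (a * Poly_Mapping.lookup q v))"
      by (subst (1) pm_eq_sum[of q]) (simp add: sum_distrib_left single_mult_list)
    then have "acts P K (Poly_Mapping.single u a * q) H as
      = (\<Sum>v\<in>Poly_Mapping.keys q. a * Poly_Mapping.lookup q v * actw P K u (actw P K v H) as)"
      by (simp add: acts_sum acts_single actw_def)
    also have "\<dots> = a * actw P K u (\<lambda>as. \<Sum>v\<in>Poly_Mapping.keys q. Poly_Mapping.lookup q v * actw P K v H as) as"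
      by (subst actw_linear) (simp add: sum_distrib_left mult.assoc)
    finally show ?thesis by (simp add: acts_def[abs_def] lin_ext_def)
  qed
  have "Poly_Mapping.keys p \<subseteq> UNIV" by simp
  then show "acts P K (p * q) H as = acts P K p (acts P K q H) as"
    by (induction p rule: pm_induct) (simp_all add: distrib_right acts_add 1 acts_single)
qed

lemma acts_cst1: "acts P K (cst c) H as = c * H as"
  by (simp add: cst_def acts_single actw_def)

lemma acts_cst: "acts P K (cst c * p) H as = c * acts P K p H as"
  unfolding acts_mult by (simp add: cst_def acts_single actw_def)

text \<open>The bracket of \<open>L\<close> is the commutator of the product \<open>P\<close> of a
  possibly larger algebra \<open>A\<close>; \<open>P_bracket\<close> states this without
  subtraction. Different carriers are allowed so that the algebras gl(n) with
  \<open>n \<le> m\<close> can all act on the same forms over gl(m).\<close>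

locale lie_action = lie_rec L for L :: "(complex, 'g) module" +
  fixes A :: "(complex, 'g) module" and P :: "'g \<Rightarrow> 'g \<Rightarrow> 'g"
  assumes LA: "carrier L \<subseteq> carrier A"
    and L_ops: "ring.add L = ring.add A" "module.smult L = module.smult A"
    and A_add: "\<lbrakk>x \<in> carrier A; y \<in> carrier A\<rbrakk> \<Longrightarrow> x \<oplus>\<^bsub>A\<^esub> y \<in> carrier A"
    and A_smult: "x \<in> carrier A \<Longrightarrow> c \<odot>\<^bsub>A\<^esub> x \<in> carrier A"
    and P_closed: "\<lbrakk>x \<in> carrier A; y \<in> carrier A\<rbrakk> \<Longrightarrow> P x y \<in> carrier A"
    and P_assoc: "\<lbrakk>x \<in> carrier A; y \<in> carrier A; z \<in> carrier A\<rbrakk> \<Longrightarrow> P (P x y) z = P x (P y z)"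
    and P_addl: "\<lbrakk>x \<in> carrier A; y \<in> carrier A; z \<in> carrier A\<rbrakk> \<Longrightarrow> P (x \<oplus>\<^bsub>A\<^esub> y) z = P x z \<oplus>\<^bsub>A\<^esub> P y z"
    and P_addr: "\<lbrakk>x \<in> carrier A; y \<in> carrier A; z \<in> carrier A\<rbrakk> \<Longrightarrow> P z (x \<oplus>\<^bsub>A\<^esub> y) = P z x \<oplus>\<^bsub>A\<^esub> P z y"
    and P_sml: "\<lbrakk>x \<in> carrier A; z \<in> carrier A\<rbrakk> \<Longrightarrow> P (c \<odot>\<^bsub>A\<^esub> x) z = c \<odot>\<^bsub>A\<^esub> P x z"
    and P_smr: "\<lbrakk>x \<in> carrier A; z \<in> carrier A\<rbrakk> \<Longrightarrow> P z (c \<odot>\<^bsub>A\<^esub> x) = c \<odot>\<^bsub>A\<^esub> P z x"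
    and P_bracket: "\<lbrakk>x \<in> carrier L; y \<in> carrier L\<rbrakk> \<Longrightarrow> P x y = (x \<otimes>\<^bsub>L\<^esub> y) \<oplus>\<^bsub>A\<^esub> P y x"
begin

abbreviation "S \<equiv> slots (carrier A)"

lemma omul_closed: "as \<in> S \<Longrightarrow> x \<in> carrier A \<Longrightarrow> omul P (as r) x \<in> carrier A"
  by (cases "as r") (auto simp: slots_def P_closed)

lemma omul_add: "as \<in> S \<Longrightarrow> x \<in> carrier A \<Longrightarrow> y \<in> carrier A \<Longrightarrow>
    omul P (as r) (x \<oplus>\<^bsub>A\<^esub> y) = omul P (as r) x \<oplus>\<^bsub>A\<^esub> omul P (as r) y"
  by (cases "as r") (auto simp: slots_def P_addr)

lemma omul_smult: "as \<in> S \<Longrightarrow> x \<in> carrier A \<Longrightarrow> omul P (as r) (c \<odot>\<^bsub>A\<^esub> x) = c \<odot>\<^bsub>A\<^esub> omul P (as r) x"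
  by (cases "as r") (auto simp: slots_def P_smr)

lemma multilinear_add: "multilinear A K H \<Longrightarrow> as \<in> S \<Longrightarrow> r < K \<Longrightarrow> x \<in> carrier A \<Longrightarrow> y \<in> carrier A \<Longrightarrow>
    H (as(r := Some (x \<oplus>\<^bsub>A\<^esub> y))) = H (as(r := Some x)) + H (as(r := Some y))"
  unfolding multilinear_def by blast

lemma multilinear_smult: "multilinear A K H \<Longrightarrow> as \<in> S \<Longrightarrow> r < K \<Longrightarrow> x \<in> carrier A \<Longrightarrow>
    H (as(r := Some (c \<odot>\<^bsub>A\<^esub> x))) = c * H (as(r := Some x))"
  unfolding multilinear_def by blast

lemma multilinear_act:
  assumes H: "multilinear A K H" and x: "x \<in> carrier A"
  shows "multilinear A K (act P K x H)"
  unfolding multilinear_def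
proof (intro ballI allI impI conjI)
  fix as r y z assume as: "as \<in> S" "r < K" and y: "y \<in> carrier A" and z: "z \<in> carrier A"
  have 1: "H ((as(r := Some (y \<oplus>\<^bsub>A\<^esub> z)))(q := Some (omul P ((as(r := Some (y \<oplus>\<^bsub>A\<^esub> z))) q) x)))
      = H ((as(r := Some y))(q := Some (omul P ((as(r := Some y)) q) x)))
      + H ((as(r := Some z))(q := Some (omul P ((as(r := Some z)) q) x)))" if q: "q < K" for q
  proof (cases "q = r")
    case True
    then show ?thesis using multilinear_add[OF H as, of "P y x" "P z x"] by (simp add: P_addl P_closed x y z)
  next
    case False
    have "as(q := Some (omul P (as q) x)) \<in> S" using as x by (simp add: slots_upd omul_closed)
    from multilinear_add[OF H this as(2) y z] False show ?thesis
      by (simp add: fun_upd_twist)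
  qed
  show "act P K x H (as(r := Some (y \<oplus>\<^bsub>A\<^esub> z))) = act P K x H (as(r := Some y)) + act P K x H (as(r := Some z))"
    unfolding act_def sum.distrib[symmetric] by (rule sum.cong[OF refl], rule 1) auto
next
  fix as r y c assume as: "as \<in> S" "r < K" and y: "y \<in> carrier A"
  have 1: "H ((as(r := Some (c \<odot>\<^bsub>A\<^esub> y)))(q := Some (omul P ((as(r := Some (c \<odot>\<^bsub>A\<^esub> y))) q) x)))
      = c * H ((as(r := Some y))(q := Some (omul P ((as(r := Some y)) q) x)))" if q: "q < K" for q
  proof (cases "q = r")
    case True
    then show ?thesis using multilinear_smult[OF H as, of "P y x" c] by (simp add: P_sml P_closed x y)
  next
    case False
    have "as(q := Some (omul P (as q) x)) \<in> S" using as x by (simp add: slots_upd omul_closed)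
    from multilinear_smult[OF H this as(2) y] False show ?thesis
      by (simp add: fun_upd_twist)
  qed
  show "act P K x H (as(r := Some (c \<odot>\<^bsub>A\<^esub> y))) = c * act P K x H (as(r := Some y))"
    unfolding act_def sum_distrib_left by (rule sum.cong[OF refl], rule 1) auto
qed

lemma act_add:
  assumes "multilinear A K H" "as \<in> S" "x \<in> carrier A" "y \<in> carrier A"
  shows "act P K (x \<oplus>\<^bsub>A\<^esub> y) H as = act P K x H as + act P K y H as"
  unfolding act_def sum.distrib[symmetric]
  by (rule sum.cong[OF refl]) (use assms in \<open>simp add: omul_add multilinear_add omul_closed\<close>)

lemma act_smult:
  assumes "multilinear A K H" "as \<in> S" "x \<in> carrier A"
  shows "act P K (c \<odot>\<^bsub>A\<^esub> x) H as = c * act P K x H as"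
  unfolding act_def sum_distrib_left
  by (rule sum.cong[OF refl]) (use assms in \<open>simp add: omul_smult multilinear_smult omul_closed\<close>)

text \<open>If both letters hit the same slot, associativity turns them into the action of their
  product. The remaining sum over two different slots is symmetric in the two letters and cancels in
  a commutator.\<close>

lemma act_act:
  assumes "as \<in> S" "x \<in> carrier A" "y \<in> carrier A"
  shows "act P K x (act P K y H) as = act P K (P x y) H as +
    (\<Sum>r<K. \<Sum>q\<in>{..<K} - {r}. H (as(r := Some (omul P (as r) x), q := Some (omul P (as q) y))))"
proof -
  have "(\<Sum>q<K. H (as(r := Some (omul P (as r) x), q := Some (omul P ((as(r := Some (omul P (as r) x))) q) y))))
    = H (as(r := Some (omul P (as r) (P x y)))) +
      (\<Sum>q\<in>{..<K} - {r}. H (as(r := Some (omul P (as r) x), q := Some (omul P (as q) y))))" if "r < K" for r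
  proof -
    have "P (omul P (as r) x) y = omul P (as r) (P x y)"
      using assms by (cases "as r") (auto simp: P_assoc slots_def)
    then show ?thesis using that
      by (subst sum.remove[of _ r]) (auto intro!: sum.cong)
  qed
  then show ?thesis by (simp add: act_def sum.distrib)
qed

lemma act_comm:
  assumes H: "multilinear A K H" and as: "as \<in> S" and x: "x \<in> carrier L" and y: "y \<in> carrier L"
  shows "act P K x (act P K y H) as - act P K y (act P K x H) as = act P K (x \<otimes>\<^bsub>L\<^esub> y) H as"
proof -
  have xy: "x \<in> carrier A" "y \<in> carrier A" "x \<otimes>\<^bsub>L\<^esub> y \<in> carrier A" using x y LA L_mult by auto
  have "(\<Sum>r<K. \<Sum>q\<in>{..<K} - {r}. H (as(r := Some (omul P (as r) x), q := Some (omul P (as q) y))))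
    = (\<Sum>q<K. \<Sum>r\<in>{..<K} - {q}. H (as(r := Some (omul P (as r) x), q := Some (omul P (as q) y))))"
    by (rule sum.swap_restrict[of "{..<K}" "{..<K}" _ "\<lambda>r q. q \<noteq> r", simplified, THEN trans[rotated], THEN trans])
      (auto intro!: sum.cong)
  also have "\<dots> = (\<Sum>r<K. \<Sum>q\<in>{..<K} - {r}. H (as(r := Some (omul P (as r) y), q := Some (omul P (as q) x))))"
    by (auto intro!: sum.cong simp: fun_upd_twist)
  finally have sw: "(\<Sum>r<K. \<Sum>q\<in>{..<K} - {r}. H (as(r := Some (omul P (as r) x), q := Some (omul P (as q) y))))
    = (\<Sum>r<K. \<Sum>q\<in>{..<K} - {r}. H (as(r := Some (omul P (as r) y), q := Some (omul P (as q) x))))" .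
  have "act P K (P x y) H as = act P K (x \<otimes>\<^bsub>L\<^esub> y) H as + act P K (P y x) H as"
    using act_add[OF H as xy(3), of "P y x"] P_bracket[OF x y] xy P_closed by simp
  then show ?thesis using sw xy as by (simp add: act_act)
qed

lemma multilinear_actw: "multilinear A K H \<Longrightarrow> w \<in> lists (carrier A) \<Longrightarrow> multilinear A K (actw P K w H)"
  by (induction w) (auto simp: actw_def multilinear_act)

lemma multilinear_acts: 
  assumes H: "multilinear A K H" and p: "p \<in> FA (carrier A)"
  shows "multilinear A K (acts P K p H)"
  using p
proof (induction p rule: FA_induct)
  case zero then show ?case by (simp add: multilinear_def)
next
  case (single w a)
  then have "multilinear A K (actw P K w H)" by (rule multilinear_actw[OF H])
  then show ?case by (simp add: multilinear_def acts_single algebra_simps)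
next
  case (add p q) then show ?case by (simp add: multilinear_def acts_add algebra_simps)
qed

lemma acts_cong_slots:
  assumes "\<And>as. as \<in> S \<Longrightarrow> H as = H' as" "w \<in> lists (carrier A)" "as \<in> S"
  shows "actw P K w H as = actw P K w H' as"
  using assms(2,3)
proof (induction w arbitrary: as)
  case (Cons x w)
  then have "actw P K w H (as(r := Some (omul P (as r) x))) = actw P K w H' (as(r := Some (omul P (as r) x)))" for r
    using Cons.prems Cons.hyps by (intro Cons.IH slots_upd omul_closed) auto
  then show ?case by (simp add: actw_def act_def)
qed (simp add: actw_def assms)

lemma acts_zero: 
  assumes "\<And>as. as \<in> S \<Longrightarrow> H as = 0" "p \<in> FA (carrier A)" "as \<in> S"
  shows "acts P K p H as = 0"
proof -
  have 0: "actw P K w (\<lambda>_. 0) as = 0" for w as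
    by (induction w arbitrary: as) (auto simp: actw_def act_def)
  have "actw P K w H as = 0" if "w \<in> lists (carrier A)" for w
    using acts_cong_slots[of H "\<lambda>_. 0" w as K] assms that 0 by simp
  with assms(2) show ?thesis by (induction p rule: FA_induct) (simp_all add: acts_add acts_single)
qed

lemma FLA: "p \<in> F \<Longrightarrow> p \<in> FA (carrier A)"
  using FA_mono[OF LA] by auto

text \<open>The elements annihilating every multilinear form constitute a two-sided ideal that
  contains the defining relations. In a product \<open>a * x\<close> the annihilator
  \<open>a\<close> meets the form moved by \<open>x\<close>, so it matters that the action preserves
  multilinearity.\<close>

theorem ideal_acts_zero:
  assumes p: "p \<in> I" and H: "multilinear A K H" and as: "as \<in> S"
  shows "acts P K p H as = 0"
proof -
  define J where "J = {p \<in> F. \<forall>K H. multilinear A K H \<longrightarrow> (\<forall>as\<in>S. acts P K p H as = 0)}"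
  have "ideal J (free_alg (carrier L))"
  proof (rule idealI[OF ring_free_alg])
    show "subgroup J (add_monoid (free_alg (carrier L)))"
    proof (rule group.subgroupI)
      show "group (add_monoid (free_alg (carrier L)))"
        using ring_free_alg ring.is_abelian_group abelian_group.a_group by blast
      show "J \<noteq> {}" using FA_0 unfolding J_def by fastforce
      fix p assume p: "p \<in> J"
      then have "inv\<^bsub>add_monoid (free_alg (carrier L))\<^esub> p = - p"
        using free_alg_a_inv[of p "carrier L"] by (simp add: a_inv_def J_def)
      then show "inv\<^bsub>add_monoid (free_alg (carrier L))\<^esub> p \<in> J"
        using p acts_diff[of P _ 0 p] by (auto simp: J_def)
    qed (auto simp: J_def carrier_free_alg acts_add)
  next
    fix a x assume a: "a \<in> J" and x: "x \<in> carrier (free_alg (carrier L))"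
    have "acts P K x (acts P K a H) as = 0" if "multilinear A K H" "as \<in> S" for K H as
      by (rule acts_zero) (use a x that in \<open>auto simp: J_def carrier_free_alg FLA\<close>)
    then show "x \<otimes>\<^bsub>free_alg (carrier L)\<^esub> a \<in> J"
      using a x by (auto simp: J_def carrier_free_alg acts_mult)
    show "a \<otimes>\<^bsub>free_alg (carrier L)\<^esub> x \<in> J"
      using a x by (auto simp: J_def carrier_free_alg acts_mult intro!: multilinear_acts FLA)
  qed
  moreover have "uea_rels L \<subseteq> J"
  proof
    fix r assume r: "r \<in> uea_rels L"
    then have "r \<in> F" using rels_FA by blast
    moreover have "acts P K r H as = 0" if "multilinear A K H" "as \<in> S" for K H as
      using r that LA
      by (auto simp: uea_rels_def acts_diff acts_mult acts_wd1 single_conv acts_cst acts_cst1 L_ops act_comm)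
        (auto simp: act_add act_smult subset_iff)
    ultimately show "r \<in> J" by (simp add: J_def)
  qed
  ultimately have "I \<subseteq> J"
    unfolding uea_ideal_eq by (rule ring.genideal_minimal[OF ring_free_alg])
  then show ?thesis using p H as by (auto simp: J_def)
qed

end

section \<open>Product forms and top symbols\<close>

definition prod_form :: "nat \<Rightarrow> ('g \<Rightarrow> complex) \<Rightarrow> 'g form" where
  "prod_form K f as = (\<Prod>r<K. case as r of None \<Rightarrow> 0 | Some x \<Rightarrow> f x)"

definition linfun :: "(complex, 'g) module \<Rightarrow> ('g \<Rightarrow> complex) \<Rightarrow> bool" where
  "linfun A f \<longleftrightarrow> (\<forall>x\<in>carrier A. \<forall>y\<in>carrier A. f (x \<oplus>\<^bsub>A\<^esub> y) = f x + f y) \<and>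
     (\<forall>x\<in>carrier A. \<forall>c. f (c \<odot>\<^bsub>A\<^esub> x) = c * f x)"

lemma prod_form_upd: "r < K \<Longrightarrow> prod_form K f (as(r := Some x)) =
    f x * (\<Prod>q\<in>{..<K} - {r}. case as q of None \<Rightarrow> 0 | Some x \<Rightarrow> f x)"
  unfolding prod_form_def by (subst prod.remove[of _ r]) (auto intro!: prod.cong)

lemma multilinear_prod_form: "linfun A f \<Longrightarrow> multilinear A K (prod_form K f)"
  by (auto simp: multilinear_def linfun_def prod_form_upd algebra_simps)

definition someprod :: "nat \<Rightarrow> ('g \<Rightarrow> complex) \<Rightarrow> 'g form" where
  "someprod K f as = (\<Prod>r<K. case as r of None \<Rightarrow> 1 | Some x \<Rightarrow> f x)"

text \<open>A product form is zero as long as some slot is empty. A word shorter than the number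
  \<open>n\<close> of empty slots cannot fill them. A word of length \<open>n\<close> must put its
  letters into different empty slots, in \<open>fact n\<close> ways, each letter contributing its
  value under \<open>f\<close>. The induction needs arbitrary slots; the filled ones contribute
  \<open>someprod\<close>.\<close>

lemma actw_prod_form:
  "let n = card {r. r < K \<and> as r = None} in
    (length w < n \<longrightarrow> actw P K w (prod_form K f) as = 0) \<and>
    (length w = n \<longrightarrow> actw P K w (prod_form K f) as = fact n * prod_list (map f w) * someprod K f as)"
proof (induction w arbitrary: as)
  case Nil
  let ?N = "{r. r < K \<and> as r = None}"
  have "prod_form K f as = 0" if N: "?N \<noteq> {}"
  proof -
    obtain r where "r < K" "as r = None" using N by blast
    then show ?thesis unfolding prod_form_def by (intro prod_zero) (auto intro!: bexI[of _ r])
  qed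
  moreover have "prod_form K f as = someprod K f as" if "?N = {}"
    using that unfolding prod_form_def someprod_def by (auto intro!: prod.cong split: option.splits)
  ultimately show ?case by (auto simp: actw_def Let_def card_gt_0_iff)
next
  case (Cons x w)
  let ?N = "\<lambda>as. {r. r < K \<and> as r = None}"
  let ?n = "card (?N as)"
  let ?as = "\<lambda>r. as(r := Some (omul P (as r) x))"
  have IH: "length w < card (?N b) \<Longrightarrow> actw P K w (prod_form K f) b = 0"
    "length w = card (?N b) \<Longrightarrow> actw P K w (prod_form K f) b = fact (card (?N b)) * prod_list (map f w) * someprod K f b" for b
    using Cons.IH[of b] by (simp_all add: Let_def)
  have nS: "?N (?as r) = ?N as - {r}" for r by auto
  have cS: "card (?N (?as r)) = (if as r = None then ?n - 1 else ?n)" if "r < K" for r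
    using that unfolding nS by (auto simp: card_Diff_singleton_if)
  have split: "actw P K (x # w) (prod_form K f) as = (\<Sum>r<K. actw P K w (prod_form K f) (?as r))"
    by (simp add: actw_def act_def)
  have pos: "?n > 0" if "r < K" "as r = None" for r
    using that by (auto simp: card_gt_0_iff)
  have "actw P K (x # w) (prod_form K f) as = 0" if "length (x # w) < ?n"
  proof -
    have "actw P K w (prod_form K f) (?as r) = 0" if r: "r < K" for r
      by (rule IH(1)) (use cS[OF r] \<open>length (x # w) < ?n\<close> in \<open>simp split: if_splits\<close>)
    then show ?thesis unfolding split by simp
  qed
  moreover have "actw P K (x # w) (prod_form K f) as = fact ?n * prod_list (map f (x # w)) * someprod K f as"
    if len: "length (x # w) = ?n"
  proof -
    have 1: "actw P K w (prod_form K f) (?as r) =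
       (if as r = None then fact (?n - 1) * prod_list (map f (x # w)) * someprod K f as else 0)" if r: "r < K" for r
    proof (cases "as r")
      case None
      have "someprod K f (?as r) = f x * someprod K f as"
        unfolding someprod_def using r None
        by (subst (1 2) prod.remove[of _ r]) (auto intro!: prod.cong)
      then show ?thesis using IH(2)[of "?as r"] cS[OF r] len None by simp
    next
      \<comment> \<open>A letter spent on a filled slot leaves more empty slots than letters, so
        only empty slots contribute.\<close>
      case (Some a)
      then show ?thesis using IH(1)[of "?as r"] cS[OF r] len by simp
    qed
    have "actw P K (x # w) (prod_form K f) as =
      (\<Sum>r<K. if as r = None then fact (?n - 1) * prod_list (map f (x # w)) * someprod K f as else 0)"
      unfolding split using 1 by simp
    also have "\<dots> = of_nat ?n * (fact (?n - 1) * prod_list (map f (x # w)) * someprod K f as)"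
    proof -
      have "{..<K} \<inter> {r. as r = None} = ?N as" by auto
      then show ?thesis by (simp add: sum.If_cases)
    qed
    also have "\<dots> = fact ?n * prod_list (map f (x # w)) * someprod K f as"
      using len by (cases ?n) (auto simp: algebra_simps)
    finally show ?thesis .
  qed
  ultimately show ?case by (simp add: Let_def)
qed

text \<open>The part of degree \<open>k\<close>, read as a polynomial function on the dual of the
  Lie algebra and evaluated at \<open>f\<close>.\<close>

definition top_symbol :: "('g \<Rightarrow> complex) \<Rightarrow> nat \<Rightarrow> 'g fa \<Rightarrow> complex" where
  "top_symbol f k = lin_ext (\<lambda>w a. a * (if length w = k then prod_list (map f w) else 0))"

definition len_le :: "nat \<Rightarrow> 'g fa \<Rightarrow> bool" where
  "len_le k p \<longleftrightarrow> (\<forall>w\<in>Poly_Mapping.keys p. length w \<le> k)"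

lemma acts_prod_form:
  assumes "len_le K p"
  shows "acts P K p (prod_form K f) (\<lambda>_. None) = fact K * top_symbol f K p"
proof -
  have 1: "actw P K w (prod_form K f) (\<lambda>_. None) = fact K * (if length w = K then prod_list (map f w) else 0)"
    if "length w \<le> K" for w
    using actw_prod_form[of K "\<lambda>_. None" w P f] that by (auto simp: Let_def someprod_def)
  show ?thesis
    unfolding acts_def top_symbol_def lin_ext_def sum_distrib_left
    by (rule sum.cong) (use assms 1 in \<open>auto simp: len_le_def algebra_simps\<close>)
qed

text \<open>This is the substantial half of the Poincare-Birkhoff-Witt theorem: relations have no
  symbol. It follows by letting the relation act on a product form with \<open>k\<close> slots, all
  of them empty.\<close>

lemma (in lie_action) pbw_top:
  assumes "linfun A f" "p \<in> I" "len_le k p"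
  shows "top_symbol f k p = 0"
proof -
  have "acts P k p (prod_form k f) (\<lambda>_. None) = 0"
    by (rule ideal_acts_zero) (use assms in \<open>auto simp: multilinear_prod_form slots_def\<close>)
  then show ?thesis using acts_prod_form[OF assms(3)] by simp
qed

lemma coeff_additive_top_symbol: "coeff_additive (\<lambda>w a. a * (if length w = k then prod_list (map f w) else 0))"
  by (rule coeff_additiveI) (simp add: algebra_simps)

lemma top_symbol_add: "top_symbol f k (p + q) = top_symbol f k p + top_symbol f k q"
  and top_symbol_diff: "top_symbol f k (p - q) = top_symbol f k p - top_symbol f k q"
  and top_symbol_sum: "top_symbol f k (sum g S) = (\<Sum>x\<in>S. top_symbol f k (g x))"
  and top_symbol_single: "top_symbol f k (Poly_Mapping.single w a) = a * (if length w = k then prod_list (map f w) else 0)"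
  and top_symbol_0 [simp]: "top_symbol f k 0 = 0"
  by (simp_all add: top_symbol_def lin_ext_add lin_ext_diff lin_ext_single lin_ext_sum coeff_additive_top_symbol)

lemma top_symbol_cst: "top_symbol f k (cst c * p) = c * top_symbol f k p"
proof -
  have "Poly_Mapping.keys p \<subseteq> UNIV" by simp
  then show ?thesis
    by (induction p rule: pm_induct) (simp_all add: top_symbol_add top_symbol_single cst_def single_mult_list distrib_left)
qed

lemma len_le_0 [simp]: "len_le k 0" by (simp add: len_le_def)
lemma len_le_add: "len_le k p \<Longrightarrow> len_le k q \<Longrightarrow> len_le k (p + q)"
  using Poly_Mapping.keys_add[of p q] by (auto simp: len_le_def)
lemma len_le_sum: "(\<And>x. x \<in> S \<Longrightarrow> len_le k (f x)) \<Longrightarrow> len_le k (sum f S)"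
  by (induction S rule: infinite_finite_induct) (auto intro: len_le_add)
lemma len_le_mult: "len_le k p \<Longrightarrow> len_le l q \<Longrightarrow> len_le (k + l) (p * q)"
  using Poly_Mapping.keys_mult[of p q] unfolding len_le_def plus_list_def
  by (fastforce intro: add_mono)
lemma len_le_mono: "len_le k p \<Longrightarrow> k \<le> l \<Longrightarrow> len_le l p"
  by (force simp: len_le_def)
lemma len_le_wd: "length w \<le> k \<Longrightarrow> len_le k (wd w)"
  by (simp add: len_le_def wd_def)
lemma len_le_cst: "len_le k (cst c)"
  by (simp add: len_le_def cst_def)
lemma len_le_cst_mult: "len_le k p \<Longrightarrow> len_le k (cst c * p)"
  using len_le_mult[OF len_le_cst[of 0 c]] by simp

lemma top_symbol_low: "len_le k p \<Longrightarrow> k < l \<Longrightarrow> top_symbol f l p = 0"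
  unfolding top_symbol_def lin_ext_def by (rule sum.neutral) (auto simp: len_le_def)

lemma top_symbol_mult:
  assumes "len_le k p" "len_le l q"
  shows "top_symbol f (k + l) (p * q) = top_symbol f k p * top_symbol f l q"
proof -
  have pq: "p * q = (\<Sum>u\<in>Poly_Mapping.keys p. \<Sum>v\<in>Poly_Mapping.keys q.
      Poly_Mapping.single (u @ v) (Poly_Mapping.lookup p u * Poly_Mapping.lookup q v))"
    by (subst (1) pm_eq_sum[of p], subst (1) pm_eq_sum[of q])
      (simp add: sum_distrib_left sum_distrib_right single_mult_list sum.swap[of _ "Poly_Mapping.keys p"])
  show ?thesis
    unfolding pq top_symbol_sum top_symbol_single
    unfolding top_symbol_def lin_ext_def sum_product
    by (intro sum.cong) (use assms in \<open>force simp: len_le_def\<close>)+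
qed

section \<open>Straightening\<close>

text \<open>Any choice of an ordering of the factors works, so no order on the letters is needed.\<close>

definition arrange :: "'a multiset \<Rightarrow> 'a list" where "arrange M = (SOME w. mset w = M)"

lemma mset_arrange [simp]: "mset (arrange M) = M"
  unfolding arrange_def by (rule someI_ex) (rule ex_mset)

definition arranged :: "'a set \<Rightarrow> 'a list set" where
  "arranged S = {w \<in> lists S. w = arrange (mset w)}"

lemma arrange_arranged: "set_mset M \<subseteq> S \<Longrightarrow> arrange M \<in> arranged S"
  unfolding arranged_def by (auto simp flip: set_mset_mset)

definition len_lt :: "nat \<Rightarrow> 'g fa \<Rightarrow> bool" where
  "len_lt k p \<longleftrightarrow> (\<forall>w\<in>Poly_Mapping.keys p. length w < k)"

lemma len_lt_Suc: "len_lt (Suc k) p = len_le k p"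
  by (auto simp: len_lt_def len_le_def)

lemma len_lt_0: "len_lt 0 p \<longleftrightarrow> p = 0"
  by (auto simp: len_lt_def)

definition letter_combs :: "'g set \<Rightarrow> 'g fa set" where
  "letter_combs S = {p. Poly_Mapping.keys p \<subseteq> (\<lambda>s. [s]) ` S}"

lemma letter_combs_FA: "p \<in> letter_combs S \<Longrightarrow> p \<in> FA S"
  by (auto simp: letter_combs_def FA_def)

lemma letter_combs_len_le: "p \<in> letter_combs S \<Longrightarrow> len_le 1 p"
  by (auto simp: letter_combs_def len_le_def)

lemma letter_combs_0 [simp]: "0 \<in> letter_combs S" by (simp add: letter_combs_def)

lemma letter_combs_add: "p \<in> letter_combs S \<Longrightarrow> q \<in> letter_combs S \<Longrightarrow> p + q \<in> letter_combs S"
  using Poly_Mapping.keys_add[of p q] by (auto simp: letter_combs_def)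

lemma letter_combs_uminus: "p \<in> letter_combs S \<Longrightarrow> - p \<in> letter_combs S"
  by (auto simp: letter_combs_def in_keys_iff)

lemma letter_combs_diff: "p \<in> letter_combs S \<Longrightarrow> q \<in> letter_combs S \<Longrightarrow> p - q \<in> letter_combs S"
  by (metis letter_combs_add letter_combs_uminus diff_conv_add_uminus)

lemma letter_combs_wd: "s \<in> S \<Longrightarrow> wd [s] \<in> letter_combs S"
  by (simp add: letter_combs_def wd_def)

lemma keys_cst_mult: "Poly_Mapping.keys (cst c * p) \<subseteq> Poly_Mapping.keys p"
  by (auto simp: map_smult[symmetric] map.rep_eq in_keys_iff when_def)

lemma letter_combs_cst: "p \<in> letter_combs S \<Longrightarrow> cst c * p \<in> letter_combs S"
  using keys_cst_mult[of c p] by (auto simp: letter_combs_def)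

lemma letter_combs_sum: "(\<And>x. x \<in> X \<Longrightarrow> f x \<in> letter_combs S) \<Longrightarrow> sum f X \<in> letter_combs S"
  by (induction X rule: infinite_finite_induct) (auto intro: letter_combs_add)

text \<open>Here \<open>C\<close> stands for an ideal of relations and \<open>S\<close> for letters
  that span all letters modulo \<open>C\<close>. The locale is used for the ideal of an enveloping
  algebra and for the common kernel of the two maps out of \<open>T\<close>.\<close>

locale straight =
  fixes C :: "'j fa set" and J S :: "'j set"
  assumes C0: "0 \<in> C" and Cadd: "\<lbrakk>p \<in> C; q \<in> C\<rbrakk> \<Longrightarrow> p + q \<in> C"
    and Cl: "\<lbrakk>p \<in> C; q \<in> FA J\<rbrakk> \<Longrightarrow> q * p \<in> C" and Cr: "\<lbrakk>p \<in> C; q \<in> FA J\<rbrakk> \<Longrightarrow> p * q \<in> C"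
    and SJ: "S \<subseteq> J"
    and red: "a \<in> J \<Longrightarrow> \<exists>q\<in>letter_combs S. wd [a] - q \<in> C"
    and comm: "\<lbrakk>a \<in> S; b \<in> S\<rbrakk> \<Longrightarrow> \<exists>q\<in>letter_combs S. wd [a, b] - wd [b, a] - q \<in> C"
begin

lemma SFA: "p \<in> FA S \<Longrightarrow> p \<in> FA J"
  using FA_mono[OF SJ] by auto

lemma reduce_word: "w \<in> lists J \<Longrightarrow> \<exists>q\<in>FA S. wd w - q \<in> C"
proof (induction w)
  case Nil
  show ?case by (rule bexI[of _ 1]) (auto simp: wd_Nil C0)
next
  case (Cons a w)
  then obtain q where q: "q \<in> FA S" "wd w - q \<in> C" by auto
  obtain r where r: "r \<in> FA S" "wd [a] - r \<in> C" using red[of a] Cons letter_combs_FA by auto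
  have "wd (a # w) - r * q = (wd [a] - r) * wd w + r * (wd w - q)"
    using wd_mult[of "[a]" w] by (simp add: algebra_simps)
  also have "\<dots> \<in> C"
    by (rule Cadd[OF Cr Cl]) (use q r Cons in \<open>auto simp: SFA intro: FA_wd\<close>)
  finally show ?case using q r by (intro bexI[of _ "r * q"] FA_mult) auto
qed

lemma reduce: "p \<in> FA J \<Longrightarrow> \<exists>q\<in>FA S. p - q \<in> C"
proof (induction p rule: FA_induct)
  case zero show ?case by (rule bexI[of _ 0]) (auto simp: C0)
next
  case (single w a)
  then obtain q where q: "q \<in> FA S" "wd w - q \<in> C" using reduce_word by auto
  have "Poly_Mapping.single w a - cst a * q = cst a * (wd w - q)"
    by (simp add: single_conv algebra_simps)
  also have "\<dots> \<in> C" using q by (intro Cl) auto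
  finally show ?case using q by (intro bexI[of _ "cst a * q"] FA_mult) auto
next
  case (add p q)
  then obtain p' q' where "p' \<in> FA S" "p - p' \<in> C" "q' \<in> FA S" "q - q' \<in> C" by auto
  then show ?case using Cadd[of "p - p'" "q - q'"]
    by (intro bexI[of _ "p' + q'"] FA_add) (auto simp: algebra_simps)
qed

text \<open>Each exchange of neighbours costs a linear combination of letters in place of two
  letters, so the error consists of words shorter than \<open>u @ a # v\<close>.\<close>

lemma move_front:
  "set u \<subseteq> S \<Longrightarrow> set v \<subseteq> S \<Longrightarrow> a \<in> S \<Longrightarrow>
   \<exists>q\<in>FA S. len_lt (length u + length v + 1) q \<and> wd (u @ a # v) - wd (a # u @ v) - q \<in> C"
proof (induction u)
  case Nil
  show ?case by (rule bexI[of _ 0]) (auto simp: C0 len_lt_def)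
next
  case (Cons b u)
  then obtain q where q: "q \<in> FA S" "len_lt (length u + length v + 1) q"
      "wd (u @ a # v) - wd (a # u @ v) - q \<in> C" by auto
  obtain r where r: "r \<in> letter_combs S" "wd [b, a] - wd [a, b] - r \<in> C" using comm[of b a] Cons by auto
  let ?q = "wd [b] * q + r * wd (u @ v)"
  have 1: "wd [b] * wd w = wd (b # w)" for w by (simp add: wd_mult)
  have 2: "wd [x, y] * wd w = wd (x # y # w)" for x y w by (simp add: wd_mult)
  have "wd ((b # u) @ a # v) - wd (a # (b # u) @ v) - ?q =
      wd [b] * (wd (u @ a # v) - wd (a # u @ v) - q) + (wd [b, a] - wd [a, b] - r) * wd (u @ v)"
    unfolding right_diff_distrib left_diff_distrib 1 2 by (simp add: algebra_simps)
  also have "\<dots> \<in> C"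
  proof (rule Cadd[OF Cl Cr])
    show "wd (u @ v) \<in> FA J" using Cons.prems SJ by (intro FA_wd) auto
  qed (use q r Cons.prems SJ in auto)
  finally have "wd ((b # u) @ a # v) - wd (a # (b # u) @ v) - ?q \<in> C" .
  moreover have "len_lt (length (b # u) + length v + 1) ?q"
    using len_le_mult[OF len_le_wd[of "[b]" 1], of "length u + length v" q]
      len_le_mult[OF letter_combs_len_le[OF r(1)] len_le_wd[of "u @ v" "length u + length v"]] q(2)
    by (simp add: len_lt_Suc len_le_add)
  moreover have "?q \<in> FA S" using q r Cons by (auto intro!: FA_add FA_mult FA_wd simp: letter_combs_FA)
  ultimately show ?case by blast
qed

text \<open>Move the first letter of \<open>w\<close> to the front of \<open>u\<close>; the tails
  then have the same letters, and the induction hypothesis compares them.\<close>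

lemma permute:
  "mset w = mset u \<Longrightarrow> set w \<subseteq> S \<Longrightarrow>
   \<exists>q\<in>FA S. len_lt (length w) q \<and> wd w - wd u - q \<in> C"
proof (induction w arbitrary: u)
  case Nil
  then show ?case by (intro bexI[of _ 0]) (auto simp: C0 len_lt_def)
next
  case (Cons a w)
  have "a \<in> set u" using Cons(2) by (metis list.set_intros(1) set_mset_mset)
  then obtain u1 u2 where u: "u = u1 @ a # u2" by (meson split_list)
  have ms: "mset w = mset (u1 @ u2)" using Cons(2) u by simp
  then have su: "set u1 \<subseteq> S" "set u2 \<subseteq> S" using Cons(3) mset_eq_setD[OF ms] by auto
  have ln: "length w = length u1 + length u2" using ms by (metis length_append size_mset)
  obtain q where q: "q \<in> FA S" "len_lt (length w) q" "wd w - wd (u1 @ u2) - q \<in> C"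
    using Cons.IH[OF ms] Cons(3) by auto
  obtain r where r: "r \<in> FA S" "len_lt (length w + 1) r" "wd u - wd (a # u1 @ u2) - r \<in> C"
    using move_front[OF su, of a] Cons(3) u ln by auto
  have 1: "wd [a] * wd w = wd (a # w)" for w by (simp add: wd_mult)
  have "wd (a # w) - wd u - (wd [a] * q - r) =
     wd [a] * (wd w - wd (u1 @ u2) - q) + cst (-1) * (wd u - wd (a # u1 @ u2) - r)"
    unfolding right_diff_distrib 1 by (simp add: cst_minus algebra_simps)
  also have "\<dots> \<in> C" using q r Cons(3) SJ by (intro Cadd Cl) auto
  finally have "wd (a # w) - wd u - (wd [a] * q - r) \<in> C" .
  moreover have "len_lt (length (a # w)) (wd [a] * q - r)"
  \<comment> \<open>The strict bound on \<open>q\<close> turns into a weak one only if the tail is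
    nonempty; for an empty tail \<open>q\<close> is zero.\<close>
  proof (cases "length w")
    case 0
    then show ?thesis using q(2) r(2) by (simp add: len_lt_0 len_lt_Suc) (auto simp: len_le_def in_keys_iff)
  next
    case (Suc n)
    have "len_le (length w) (wd [a] * q)"
      using len_le_mult[OF len_le_wd[of "[a]" 1], of n q] q(2) Suc by (simp add: len_lt_Suc)
    moreover have "len_le (length w) (cst (-1) * r)" using r(2) by (intro len_le_cst_mult) (simp add: len_lt_Suc)
    ultimately show ?thesis using len_le_add by (fastforce simp: len_lt_Suc cst_minus)
  qed
  moreover have "wd [a] * q - r \<in> FA S" using q r Cons(3) by auto
  ultimately show ?case by blast
qed

definition straightenable :: "'j fa set" where
  "straightenable = {p. \<exists>u. Poly_Mapping.keys u \<subseteq> arranged S \<and> p - u \<in> C}"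

lemma straightenable_add: "p \<in> straightenable \<Longrightarrow> q \<in> straightenable \<Longrightarrow> p + q \<in> straightenable"
proof -
  assume "p \<in> straightenable" "q \<in> straightenable"
  then obtain o1 o2 where "Poly_Mapping.keys o1 \<subseteq> arranged S" "p - o1 \<in> C" "Poly_Mapping.keys o2 \<subseteq> arranged S" "q - o2 \<in> C"
    by (auto simp: straightenable_def)
  then show ?thesis unfolding straightenable_def using Cadd[of "p - o1" "q - o2"] Poly_Mapping.keys_add[of o1 o2]
    by (intro CollectI exI[of _ "o1 + o2"]) (auto simp: algebra_simps)
qed

lemma straightenable_C: "p - q \<in> C \<Longrightarrow> q \<in> straightenable \<Longrightarrow> p \<in> straightenable"
  using Cadd[of "p - q"] by (fastforce simp: straightenable_def)

lemma straightenable_cst: "p \<in> straightenable \<Longrightarrow> cst c * p \<in> straightenable"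
proof -
  assume "p \<in> straightenable"
  then obtain o1 where o1: "Poly_Mapping.keys o1 \<subseteq> arranged S" "p - o1 \<in> C" by (auto simp: straightenable_def)
  have "cst c * (p - o1) \<in> C" using o1 by (intro Cl) auto
  then show ?thesis unfolding straightenable_def using o1 keys_cst_mult[of c o1]
    by (intro CollectI exI[of _ "cst c * o1"]) (auto simp: algebra_simps)
qed

text \<open>Replacing a longest word by its arranged permutation leaves shorter words, which are
  covered by the induction on the strict length bound.\<close>

lemma straightenable_len_lt: "p \<in> FA S \<Longrightarrow> len_lt n p \<Longrightarrow> p \<in> straightenable"
proof (induction n arbitrary: p)
  case 0
  then show ?case by (auto simp: len_lt_0 straightenable_def C0 intro!: exI[of _ 0])
next
  case (Suc n)
  have word: "wd w \<in> straightenable" if w: "w \<in> lists S" "length w \<le> n" for w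
  proof (cases "length w = n")
    case True
    obtain q where q: "q \<in> FA S" "len_lt (length w) q" "wd w - wd (arrange (mset w)) - q \<in> C"
      using permute[of w "arrange (mset w)"] w by auto
    have "wd (arrange (mset w)) \<in> straightenable" unfolding straightenable_def using arrange_arranged[of "mset w" S] w
      by (intro CollectI exI[of _ "wd (arrange (mset w))"]) (auto simp: wd_def C0)
    then have "wd (arrange (mset w)) + q \<in> straightenable" using q Suc.IH[of q] True straightenable_add by blast
    then show ?thesis using q(3) by (intro straightenable_C[of "wd w" "wd (arrange (mset w)) + q"]) (auto simp: algebra_simps)
  next
    case False
    then show ?thesis using w by (intro Suc.IH) (auto simp: len_lt_def wd_def intro!: FA_single)
  qed
  have "Poly_Mapping.keys p \<subseteq> {w \<in> lists S. length w \<le> n}"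
    using Suc.prems by (auto simp: FA_def len_lt_def less_Suc_eq_le)
  then show ?case
    by (induction p rule: pm_induct) (auto simp: straightenable_add single_conv straightenable_cst word intro: exI[of _ 0] simp: straightenable_def[THEN eqset_imp_iff, of 0] C0)
qed

theorem straighten: "p \<in> FA J \<Longrightarrow> \<exists>u. Poly_Mapping.keys u \<subseteq> arranged S \<and> p - u \<in> C"
proof -
  assume "p \<in> FA J"
  then obtain q where q: "q \<in> FA S" "p - q \<in> C" using reduce by blast
  have "len_lt (Suc (Max (length ` Poly_Mapping.keys q))) q"
    by (auto simp: len_lt_def less_Suc_eq_le)
  then have "q \<in> straightenable" using q straightenable_len_lt by blast
  then have "p \<in> straightenable" using q straightenable_C by blast
  then show ?thesis by (simp add: straightenable_def)
qed

end

section \<open>Vanishing polynomials\<close>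

text \<open>Monomials are indexed by multisets of variables. With the other variables fixed, a sum
  that vanishes everywhere is the zero polynomial in the variable \<open>a\<close>; so the
  coefficient of each power of \<open>a\<close> vanishes for all values of the others, and the
  induction continues with one variable less.\<close>

lemma mpoly_zero:
  fixes c :: "'a multiset \<Rightarrow> complex"
  assumes "finite V" "finite Ms" "\<And>M. M \<in> Ms \<Longrightarrow> set_mset M \<subseteq> V"
    and "\<And>v. (\<Sum>M\<in>Ms. c M * prod_mset (image_mset v M)) = 0"
  shows "M \<in> Ms \<Longrightarrow> c M = 0"
  using assms
proof (induction V arbitrary: Ms c M rule: finite_induct)
  case empty
  then have "Ms \<subseteq> {{#}}" by auto
  then have "Ms = {{#}}" using empty(1) by auto
  then show ?case using empty(4)[of "\<lambda>_. 1"] empty(1) by auto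
next
  case (insert a V)
  let ?f = "\<lambda>M. filter_mset (\<lambda>b. b \<noteq> a) M"
  let ?g = "\<lambda>v M. prod_mset (image_mset v (?f M))"
  have dec: "M = ?f M + replicate_mset (count M a) a" for M
    by (metis add.commute filter_eq_replicate_mset multiset_partition)
  have fa: "prod_mset (image_mset (v(a := z)) M) = z ^ count M a * ?g v M" for v z M
  proof -
    have "prod_mset (image_mset (v(a := z)) M) = prod_mset (image_mset (v(a := z)) (?f M)) * z ^ count M a"
      by (subst dec[of M]) simp
    also have "image_mset (v(a := z)) (?f M) = image_mset v (?f M)"
      by (rule image_mset_cong) auto
    finally show ?thesis by (simp only: mult.commute)
  qed
  have k0: "(\<Sum>M\<in>{M\<in>Ms. count M a = k}. c M * ?g v M) = 0" for k v
  proof -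
    define q where "q = (\<Sum>M\<in>Ms. monom (c M * ?g v M) (count M a))"
    have "poly q z = 0" for z
      using insert.prems(4)[of "v(a := z)"] unfolding fa by (simp add: q_def poly_sum poly_monom mult_ac)
    then have "q = 0" by (simp add: poly_all_0_iff_0[symmetric])
    then have "coeff q k = 0" by simp
    then have "(\<Sum>M\<in>Ms. if count M a = k then c M * ?g v M else 0) = 0" by (simp add: q_def coeff_sum)
    then show ?thesis using insert.prems(2) by (simp add: sum.inter_filter)
  qed
  define k where "k = count M a"
  let ?Mk = "{M\<in>Ms. count M a = k}"
  \<comment> \<open>Deleting \<open>a\<close> loses no information once its multiplicity is fixed to
    \<open>k\<close>.\<close>
  have inj: "inj_on ?f ?Mk"
    by (rule inj_onI) (metis (mono_tags, lifting) dec mem_Collect_eq)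
  have "c (?f M + replicate_mset k a) = 0"
  proof (rule insert.IH[of "?f M" "?f ` ?Mk" "\<lambda>M. c (M + replicate_mset k a)"])
    show "?f M \<in> ?f ` ?Mk" using insert.prems(1) k_def by auto
    show "finite (?f ` ?Mk)" using insert.prems(2) by simp
    show "set_mset N \<subseteq> V" if "N \<in> ?f ` ?Mk" for N using that insert.prems(3) by fastforce
    show "(\<Sum>N\<in>?f ` ?Mk. c (N + replicate_mset k a) * prod_mset (image_mset v N)) = 0" for v
    proof -
      have "c (?f N + replicate_mset k a) = c N" if "N \<in> ?Mk" for N
        using that dec[of N] by simp
      then show ?thesis using k0[of v k] by (simp add: sum.reindex[OF inj])
    qed
  qed
  then show ?case using dec[of M] k_def by simp
qed

text \<open>An arranged word is determined by its multiset of letters, so different arranged words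
  give different monomials in the values \<open>v\<close>.\<close>

lemma arranged_indep:
  fixes c :: "'a list \<Rightarrow> complex"
  assumes W: "finite W" "W \<subseteq> arranged S" and z: "\<And>v. (\<Sum>w\<in>W. c w * prod_list (map v w)) = 0" and w: "w \<in> W"
  shows "c w = 0"
proof -
  have cw: "w = arrange (mset w)" if "w \<in> W" for w using that W(2) by (auto simp: arranged_def)
  have inj: "inj_on mset W"
  proof (rule inj_onI)
    fix x y assume "x \<in> W" "y \<in> W" "mset x = mset y"
    then show "x = y" using cw[of x] cw[of y] by simp
  qed
  have "(\<lambda>M. c (arrange M)) (mset w) = 0"
  proof (rule mpoly_zero[of "\<Union>w\<in>W. set w" "mset ` W" "\<lambda>M. c (arrange M)"])
    fix v
    have "c (arrange (mset w)) = c w" if "w \<in> W" for w using cw[OF that] by simp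
    then show "(\<Sum>M\<in>mset ` W. c (arrange M) * prod_mset (image_mset v M)) = 0"
      using z[of v] by (simp add: sum.reindex[OF inj] prod_mset_prod_list flip: mset_map)
  qed (use W w in auto)
  then show ?thesis using cw[OF w] by simp
qed

text \<open>The converse of \<open>ideal_acts_zero\<close>. Modulo the ideal, \<open>p\<close> is a
  combination \<open>u\<close> of arranged words; forms with as many slots as the longest word of
  \<open>u\<close> see the longest words as monomials in freely chosen values. The family
  \<open>Fn\<close> limits the functionals that have to be tested; it will consist of those read off
  from matrix entries.\<close>

lemma (in lie_action) separation:
  assumes p: "p \<in> F" and SL: "S0 \<subseteq> carrier L"
    and red: "\<And>a. a \<in> carrier L \<Longrightarrow> \<exists>q\<in>letter_combs S0. wd [a] \<approx> q"
    and ext: "\<And>v. \<exists>f\<in>Fn. linfun A f \<and> (\<forall>s\<in>S0. f s = v s)"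
    and zero: "\<And>K f. f \<in> Fn \<Longrightarrow> linfun A f \<Longrightarrow> acts P K p (prod_form K f) (\<lambda>_. None) = 0"
  shows "p \<in> I"
proof -
  interpret straight I "carrier L" S0
  proof
    fix a b assume ab: "a \<in> S0" "b \<in> S0"
    then obtain q where q: "q \<in> letter_combs S0" "wd [a \<otimes>\<^bsub>L\<^esub> b] \<approx> q" using red[of "a \<otimes>\<^bsub>L\<^esub> b"] SL L_mult by blast
    have "wd [a] * wd [b] - wd [b] * wd [a] \<approx> q" using wd_comm[of a b] ab SL q(2) eqv_trans by blast
    then show "\<exists>q\<in>letter_combs S0. wd [a, b] - wd [b, a] - q \<in> I" using q(1) by (auto simp: eqv_def wd_mult)
  qed (use SL red in \<open>auto simp: eqv_def intro: I_add I_lmult I_rmult\<close>)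
  obtain u where u: "Poly_Mapping.keys u \<subseteq> arranged S0" "p - u \<in> I" using straighten[OF p] by blast
  have "u = 0"
  proof (rule ccontr)
    assume nz: "u \<noteq> 0"
    define K where "K = Max (length ` Poly_Mapping.keys u)"
    have ne: "Poly_Mapping.keys u \<noteq> {}" using nz by simp
    have dg: "len_le K u" unfolding len_le_def K_def by auto
    obtain w where w: "w \<in> Poly_Mapping.keys u" "length w = K"
    proof -
      have "K \<in> length ` Poly_Mapping.keys u" unfolding K_def by (rule Max_in) (use ne in auto)
      then show thesis using that by auto
    qed
    let ?W = "{w \<in> Poly_Mapping.keys u. length w = K}"
    have "Poly_Mapping.lookup u w = 0"
    proof (rule arranged_indep[of ?W S0])
      fix v
      obtain f where f: "linfun A f" "\<forall>s\<in>S0. f s = v s" "f \<in> Fn" using ext by blast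
      have "acts P K (p - u) (prod_form K f) (\<lambda>_. None) = 0"
        by (rule ideal_acts_zero) (use u f in \<open>auto simp: multilinear_prod_form slots_def\<close>)
      then have "top_symbol f K u = 0" using zero[OF f(3,1), of K] acts_prod_form[OF dg, of P f] by (simp add: acts_diff)
      then have "(\<Sum>w\<in>Poly_Mapping.keys u. if length w = K then Poly_Mapping.lookup u w * prod_list (map f w) else 0) = 0"
        by (simp add: top_symbol_def lin_ext_def if_distrib cong: if_cong)
      then have "(\<Sum>w\<in>?W. Poly_Mapping.lookup u w * prod_list (map f w)) = 0"
        by (simp add: sum.inter_filter)
      moreover have mfv: "map f w = map v w" if "w \<in> ?W" for w
        using that u(1) f(2) by (auto simp: arranged_def)
      have "(\<Sum>w\<in>?W. Poly_Mapping.lookup u w * prod_list (map v w)) = (\<Sum>w\<in>?W. Poly_Mapping.lookup u w * prod_list (map f w))"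
        by (intro sum.cong refl) (simp only: mfv)
      ultimately show "(\<Sum>w\<in>?W. Poly_Mapping.lookup u w * prod_list (map v w)) = 0"
        by (simp only:)
    qed (use u w in auto)
    then show False using w by (simp add: in_keys_iff)
  qed
  then show ?thesis using u by simp
qed

section \<open>Linear functionals\<close>

lemma linfunD: "linfun A f \<Longrightarrow> x \<in> carrier A \<Longrightarrow> y \<in> carrier A \<Longrightarrow> f (x \<oplus>\<^bsub>A\<^esub> y) = f x + f y"
  "linfun A f \<Longrightarrow> x \<in> carrier A \<Longrightarrow> f (c \<odot>\<^bsub>A\<^esub> x) = c * f x"
  by (auto simp: linfun_def)

lemma cplx_simps [simp]: "carrier cplx = UNIV" "\<one>\<^bsub>cplx\<^esub> = 1" "\<zero>\<^bsub>cplx\<^esub> = 0"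
  "x \<oplus>\<^bsub>cplx\<^esub> y = x + y" "x \<otimes>\<^bsub>cplx\<^esub> y = x * y"
  by (simp_all add: cplx_def)

context complex_algebra
begin

lemma sm_closed [simp]: "x \<in> carrier A \<Longrightarrow> c \<odot> x \<in> carrier A"
  using smult_closed[of c x] by simp

lemma sm_add: "x \<in> carrier A \<Longrightarrow> (a + b) \<odot> x = a \<odot> x \<oplus> b \<odot> x"
  using smult_l_distr[of a b x] by simp

lemma sm_mult: "x \<in> carrier A \<Longrightarrow> (a * b) \<odot> x = a \<odot> (b \<odot> x)"
  using smult_assoc1[of a b x] by simp

lemma sm_radd: "x \<in> carrier A \<Longrightarrow> y \<in> carrier A \<Longrightarrow> c \<odot> (x \<oplus> y) = c \<odot> x \<oplus> c \<odot> y"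
  using smult_r_distr[of c x y] by simp

lemma sm_one: "x \<in> carrier A \<Longrightarrow> 1 \<odot> x = x"
  using smult_one[of x] by simp

lemma sm_0: "x \<in> carrier A \<Longrightarrow> 0 \<odot> x = \<zero>"
  using sm_add[of x 0 0] M.add.l_cancel_one' by (metis add_0 sm_closed)

lemma sm_zero: "c \<odot> \<zero> = \<zero>"
  by (metis M.zero_closed sm_0 sm_mult mult_zero_right)

lemma sm_m1: "x \<in> carrier A \<Longrightarrow> (-1) \<odot> x = \<ominus> x"
  by (rule M.minus_equality[symmetric]) (use sm_add[of x "-1" 1] in \<open>simp_all add: sm_one sm_0\<close>)

lemma linfun_0: "linfun A f \<Longrightarrow> f \<zero> = 0"
  using linfunD(2)[of A f \<zero> 0] sm_0 by simp

definition lval :: "('a \<Rightarrow>\<^sub>0 complex) \<Rightarrow> 'a" where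
  "lval q = (\<Oplus>b\<in>Poly_Mapping.keys q. Poly_Mapping.lookup q b \<odot> b)"

lemma lval_superset:
  assumes "finite X" "Poly_Mapping.keys q \<subseteq> X" "X \<subseteq> carrier A"
  shows "lval q = (\<Oplus>b\<in>X. Poly_Mapping.lookup q b \<odot> b)"
  unfolding lval_def
  by (rule M.add.finprod_mono_neutral_cong_left) (use assms in \<open>auto simp: in_keys_iff sm_0 subset_iff\<close>)

lemma lval_add:
  assumes "Poly_Mapping.keys p \<subseteq> carrier A" "Poly_Mapping.keys q \<subseteq> carrier A"
  shows "lval (p + q) = lval p \<oplus> lval q"
proof -
  let ?X = "Poly_Mapping.keys p \<union> Poly_Mapping.keys q"
  have X: "finite ?X" "?X \<subseteq> carrier A" using assms by auto
  have P: "lval p = (\<Oplus>b\<in>?X. Poly_Mapping.lookup p b \<odot> b)" "lval q = (\<Oplus>b\<in>?X. Poly_Mapping.lookup q b \<odot> b)"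
    "lval (p + q) = (\<Oplus>b\<in>?X. Poly_Mapping.lookup (p + q) b \<odot> b)"
    using lval_superset[OF X(1) _ X(2)] Poly_Mapping.keys_add[of p q] by auto
  have "(\<Oplus>b\<in>?X. Poly_Mapping.lookup (p + q) b \<odot> b) = (\<Oplus>b\<in>?X. Poly_Mapping.lookup p b \<odot> b \<oplus> Poly_Mapping.lookup q b \<odot> b)"
    by (rule M.add.finprod_cong') (use X in \<open>auto simp: lookup_add sm_add subset_iff\<close>)
  also have "\<dots> = (\<Oplus>b\<in>?X. Poly_Mapping.lookup p b \<odot> b) \<oplus> (\<Oplus>b\<in>?X. Poly_Mapping.lookup q b \<odot> b)"
    by (rule M.finsum_addf) (use X in \<open>auto simp: subset_iff\<close>)
  finally show ?thesis unfolding P .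
qed

lemma keys_map_mult: "Poly_Mapping.keys (Poly_Mapping.map ((*) c) q) \<subseteq> Poly_Mapping.keys q" for c :: complex
  by (auto simp: map.rep_eq in_keys_iff when_def split: if_splits)

lemma lval_smult:
  assumes "Poly_Mapping.keys q \<subseteq> carrier A"
  shows "lval (Poly_Mapping.map ((*) c) q) = c \<odot> lval q"
proof -
  have lin: "c \<odot> finsum A g X = finsum A (\<lambda>x. c \<odot> g x) X" if "finite X" "g \<in> X \<rightarrow> carrier A" for g X
    using that by (induction X rule: finite_induct) (auto simp: sm_zero sm_radd M.finsum_closed Pi_def)
  have "lval (Poly_Mapping.map ((*) c) q) = (\<Oplus>b\<in>Poly_Mapping.keys q. Poly_Mapping.lookup (Poly_Mapping.map ((*) c) q) b \<odot> b)"
    by (rule lval_superset) (use assms in \<open>auto simp: map.rep_eq in_keys_iff when_def\<close>)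
  also have "\<dots> = (\<Oplus>b\<in>Poly_Mapping.keys q. c \<odot> (Poly_Mapping.lookup q b \<odot> b))"
    by (rule M.add.finprod_cong') (use assms in \<open>auto simp: map.rep_eq when_def sm_mult[symmetric] in_keys_iff\<close>)
  also have "\<dots> = c \<odot> lval q"
    unfolding lval_def by (rule lin[symmetric]) (use assms in auto)
  finally show ?thesis .
qed

lemma lval_single: "b \<in> carrier A \<Longrightarrow> lval (Poly_Mapping.single b c) = c \<odot> b"
  using lval_superset[of "{b}" "Poly_Mapping.single b c"] by simp

lemma lin_span_lval:
  assumes "S \<subseteq> carrier A"
  shows "x \<in> lin_span A S \<longleftrightarrow> (\<exists>q. Poly_Mapping.keys q \<subseteq> S \<and> x = lval q)"
proof
  assume "x \<in> lin_span A S"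
  then show "\<exists>q. Poly_Mapping.keys q \<subseteq> S \<and> x = lval q"
  proof induction
    case (base x)
    then show ?case using lval_single[of x 1] assms by (intro exI[of _ "Poly_Mapping.single x 1"]) (auto simp: sm_one)
  next
    case zero
    show ?case by (rule exI[of _ 0]) (simp add: lval_def)
  next
    case (add x y)
    then obtain p q where "Poly_Mapping.keys p \<subseteq> S" "x = lval p" "Poly_Mapping.keys q \<subseteq> S" "y = lval q" by auto
    then show ?case using assms Poly_Mapping.keys_add[of p q]
      by (intro exI[of _ "p + q"]) (auto simp: lval_add)
  next
    case (smult x c)
    then obtain p where "Poly_Mapping.keys p \<subseteq> S" "x = lval p" by auto
    then show ?case using assms keys_map_mult[of c p] by (intro exI[of _ "Poly_Mapping.map ((*) c) p"]) (auto simp: lval_smult)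
  qed
next
  assume "\<exists>q. Poly_Mapping.keys q \<subseteq> S \<and> x = lval q"
  then obtain q where q: "Poly_Mapping.keys q \<subseteq> S" "x = lval q" by blast
  have "lval q \<in> lin_span A S" using q(1)
  proof (induction q rule: pm_induct)
    case zero then show ?case by (simp add: lval_def lin_span.zero)
  next
    case (single w a) then show ?case using assms by (simp add: lval_single subset_iff lin_span.base lin_span.smult)
  next
    case (add p q) then show ?case using assms by (subst lval_add) (auto intro: lin_span.intros)
  qed
  then show "x \<in> lin_span A S" using q by simp
qed

lemma basis_unique:
  assumes B: "is_basis A B" and q: "Poly_Mapping.keys q \<subseteq> B" "lval q = \<zero>"
  shows "q = 0"
proof (rule ccontr)
  assume "q \<noteq> 0"
  then obtain b where b: "b \<in> Poly_Mapping.keys q" by (auto simp: keys_eq_empty[symmetric] simp del: keys_eq_empty)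
  have BA: "B \<subseteq> carrier A" using B by (simp add: is_basis_def)
  define l where "l = Poly_Mapping.lookup q b"
  have l: "l \<noteq> 0" using b by (simp add: l_def in_keys_iff)
  define r where "r = Poly_Mapping.single b l - q"
  have kr: "Poly_Mapping.keys r \<subseteq> B - {b}"
    using q(1) by (auto simp: r_def in_keys_iff lookup_minus l_def lookup_single when_def split: if_splits)
  have rA: "Poly_Mapping.keys r \<subseteq> carrier A" "Poly_Mapping.keys q \<subseteq> carrier A" using kr q(1) BA by auto
  have "Poly_Mapping.single b l = r + q" by (simp add: r_def)
  then have "l \<odot> b = lval r \<oplus> lval q" using lval_add[OF rA] lval_single[of b l] b q(1) BA by auto
  moreover have "lval r \<in> carrier A"
    unfolding lval_def by (rule M.finsum_closed) (use rA in auto)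
  ultimately have "l \<odot> b = lval r" using q(2) by simp
  then have "l \<odot> b \<in> lin_span A (B - {b})" using lin_span_lval[of "B - {b}" "l \<odot> b"] kr BA by auto
  then have "(1 / l) \<odot> (l \<odot> b) \<in> lin_span A (B - {b})" by (rule lin_span.smult)
  then have "b \<in> lin_span A (B - {b})"
    using b q(1) BA l by (simp add: sm_mult[symmetric] sm_one subset_iff)
  then show False using B b q(1) by (auto simp: is_basis_def)
qed

text \<open>Coordinates with respect to \<open>B\<close> are chosen vector by vector; their
  uniqueness makes the choice additive and homogeneous.\<close>

lemma linfun_extend:
  assumes B: "is_basis A B"
  shows "\<exists>f. linfun A f \<and> (\<forall>b\<in>B. f b = g b)"
proof -
  have BA: "B \<subseteq> carrier A" using B by (simp add: is_basis_def)
  define co where "co x = (SOME q. Poly_Mapping.keys q \<subseteq> B \<and> x = lval q)" for x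
  have co: "Poly_Mapping.keys (co x) \<subseteq> B \<and> x = lval (co x)" if "x \<in> carrier A" for x
    unfolding co_def by (rule someI_ex) (use that B lin_span_lval[OF BA, of x] in \<open>auto simp: is_basis_def\<close>)
  have uniq: "p = q" if pq: "Poly_Mapping.keys p \<subseteq> B" "Poly_Mapping.keys q \<subseteq> B" "lval p = lval q" for p q
  proof -
    have k: "Poly_Mapping.keys (p - q) \<subseteq> B"
      using pq by (auto simp: in_keys_iff lookup_minus) (metis in_keys_iff right_minus_eq subsetD)
    have cA: "lval x \<in> carrier A" if "Poly_Mapping.keys x \<subseteq> B" for x
      unfolding lval_def by (rule M.finsum_closed) (use that BA in auto)
    have "lval ((p - q) + q) = lval (p - q) \<oplus> lval q"
      by (rule lval_add) (use k pq BA in auto)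
    then have "lval (p - q) = \<zero>" using pq cA[OF k] cA[OF pq(2)] by (simp add: M.add.r_cancel_one')
    then show ?thesis using basis_unique[OF B k] by simp
  qed
  let ?f = "\<lambda>x. lin_ext (\<lambda>b a. a * g b) (co x)"
  have ag: "coeff_additive (\<lambda>b a. a * g b)" by (rule coeff_additiveI) (simp add: algebra_simps)
  have coadd: "co (x \<oplus> y) = co x + co y" if "x \<in> carrier A" "y \<in> carrier A" for x y
  proof (rule uniq)
    show "lval (co (x \<oplus> y)) = lval (co x + co y)"
      using that co[of "x \<oplus> y"] co[of x] co[of y] BA by (subst lval_add) auto
    show "Poly_Mapping.keys (co x + co y) \<subseteq> B" by (rule order_trans[OF Poly_Mapping.keys_add]) (use co[OF that(1)] co[OF that(2)] in simp)
  qed (use that co in auto)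
  have cosm: "co (c \<odot> x) = Poly_Mapping.map ((*) c) (co x)" if "x \<in> carrier A" for x c
  proof (rule uniq)
    show "lval (co (c \<odot> x)) = lval (Poly_Mapping.map ((*) c) (co x))"
      using that co[of "c \<odot> x"] co[of x] BA by (subst lval_smult) auto
    show "Poly_Mapping.keys (Poly_Mapping.map ((*) c) (co x)) \<subseteq> B"
      by (rule order_trans[OF keys_map_mult]) (use co[OF that] in simp)
  qed (use that co in auto)
  have mp: "lin_ext (\<lambda>b a. a * g b) (Poly_Mapping.map ((*) c) q) = c * lin_ext (\<lambda>b a. a * g b) q" for c q
  proof -
    have "lin_ext (\<lambda>b a. a * g b) (Poly_Mapping.map ((*) c) q) = (\<Sum>w\<in>Poly_Mapping.keys q. Poly_Mapping.lookup (Poly_Mapping.map ((*) c) q) w * g w)"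
      by (intro lin_ext_superset[OF ag]) (auto intro: subsetD[OF keys_map_mult])
    then show ?thesis by (auto simp: lin_ext_def sum_distrib_left map.rep_eq when_def mult.assoc in_keys_iff intro!: sum.cong)
  qed
  have cob: "co b = Poly_Mapping.single b 1" if "b \<in> B" for b
    by (rule uniq) (use that BA co[of b] lval_single[of b 1] in \<open>auto simp: sm_one subset_iff\<close>)
  have "linfun A ?f" unfolding linfun_def by (auto simp: coadd cosm mp lin_ext_add[OF ag])
  moreover have "\<forall>b\<in>B. ?f b = g b" by (simp add: cob lin_ext_single[OF ag])
  ultimately show ?thesis by (intro exI[of _ ?f] conjI)
qed

end

section \<open>Matrices over an algebra\<close>

context complex_algebra
begin

lemma fs_cl: "(\<And>x. x \<in> X \<Longrightarrow> f x \<in> carrier A) \<Longrightarrow> finsum A f X \<in> carrier A"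
  by (rule M.finsum_closed) auto

lemma fs_cong: "X = Y \<Longrightarrow> (\<And>x. x \<in> Y \<Longrightarrow> f x = g x) \<Longrightarrow> (\<And>x. x \<in> Y \<Longrightarrow> g x \<in> carrier A) \<Longrightarrow> finsum A f X = finsum A g Y"
  by (rule M.add.finprod_cong') auto

lemma m0l [simp]: "y \<in> carrier A \<Longrightarrow> \<zero> \<otimes> y = \<zero>"
  using alg_l_distr[of \<zero> \<zero> y] M.add.l_cancel_one'[of "\<zero> \<otimes> y" "\<zero> \<otimes> y"] by (simp add: alg_m_closed)

lemma m0r [simp]: "y \<in> carrier A \<Longrightarrow> y \<otimes> \<zero> = \<zero>"
  using alg_r_distr[of \<zero> \<zero> y] M.add.l_cancel_one'[of "y \<otimes> \<zero>" "y \<otimes> \<zero>"] by (simp add: alg_m_closed)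

lemma fs_rmult: "finite X \<Longrightarrow> (\<And>x. x \<in> X \<Longrightarrow> f x \<in> carrier A) \<Longrightarrow> y \<in> carrier A \<Longrightarrow>
    finsum A f X \<otimes> y = finsum A (\<lambda>x. f x \<otimes> y) X"
proof (induction X rule: finite_induct)
  case (insert x X)
  then have "f \<in> X \<rightarrow> carrier A" "(\<lambda>x. f x \<otimes> y) \<in> X \<rightarrow> carrier A" by (auto simp: alg_m_closed)
  then show ?case using insert by (simp add: alg_l_distr alg_m_closed M.finsum_closed)
qed simp

lemma fs_lmult: "finite X \<Longrightarrow> (\<And>x. x \<in> X \<Longrightarrow> f x \<in> carrier A) \<Longrightarrow> y \<in> carrier A \<Longrightarrow>
    y \<otimes> finsum A f X = finsum A (\<lambda>x. y \<otimes> f x) X"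
proof (induction X rule: finite_induct)
  case (insert x X)
  then have "f \<in> X \<rightarrow> carrier A" "(\<lambda>x. y \<otimes> f x) \<in> X \<rightarrow> carrier A" by (auto simp: alg_m_closed)
  then show ?case using insert by (simp add: alg_r_distr alg_m_closed M.finsum_closed)
qed simp

lemma fs_smult: "finite X \<Longrightarrow> (\<And>x. x \<in> X \<Longrightarrow> f x \<in> carrier A) \<Longrightarrow>
    c \<odot> finsum A f X = finsum A (\<lambda>x. c \<odot> f x) X"
proof (induction X rule: finite_induct)
  case (insert x X)
  then have "f \<in> X \<rightarrow> carrier A" "(\<lambda>x. c \<odot> f x) \<in> X \<rightarrow> carrier A" by auto
  then show ?case using insert by (simp add: sm_radd M.finsum_closed)
qed (simp add: sm_zero)

lemma fs_add: "(\<And>x. x \<in> X \<Longrightarrow> f x \<in> carrier A) \<Longrightarrow> (\<And>x. x \<in> X \<Longrightarrow> g x \<in> carrier A) \<Longrightarrow>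
    finsum A (\<lambda>x. f x \<oplus> g x) X = finsum A f X \<oplus> finsum A g X"
  by (rule M.finsum_addf) auto

lemma fs_zero: "(\<And>x. x \<in> X \<Longrightarrow> f x = \<zero>) \<Longrightarrow> finsum A f X = \<zero>"
  using fs_cong[of X X f "\<lambda>_. \<zero>"] by simp

lemma fs_swap: "finite X \<Longrightarrow> finite Y \<Longrightarrow> (\<And>x y. x \<in> X \<Longrightarrow> y \<in> Y \<Longrightarrow> f x y \<in> carrier A) \<Longrightarrow>
    finsum A (\<lambda>x. finsum A (f x) Y) X = finsum A (\<lambda>y. finsum A (\<lambda>x. f x y) X) Y"
proof (induction X rule: finite_induct)
  case empty then show ?case by (simp add: fs_zero)
next
  case (insert x X)
  have "finsum A (\<lambda>x. finsum A (f x) Y) (insert x X) = finsum A (f x) Y \<oplus> finsum A (\<lambda>x. finsum A (f x) Y) X"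
    using insert by (intro M.finsum_insert) (auto intro!: fs_cl)
  also have "\<dots> = finsum A (f x) Y \<oplus> finsum A (\<lambda>y. finsum A (\<lambda>x. f x y) X) Y"
    using insert by simp
  also have "\<dots> = finsum A (\<lambda>y. f x y \<oplus> finsum A (\<lambda>x. f x y) X) Y"
    using insert by (intro fs_add[symmetric]) (auto intro!: fs_cl)
  also have "\<dots> = finsum A (\<lambda>y. finsum A (\<lambda>x. f x y) (insert x X)) Y"
    using insert by (intro fs_cong[symmetric]) (auto intro!: fs_cl M.finsum_insert[symmetric] M.a_closed simp: M.finsum_insert)
  finally show ?case .
qed

lemma fs_single: "finite X \<Longrightarrow> a \<in> X \<Longrightarrow> y \<in> carrier A \<Longrightarrow> finsum A (\<lambda>x. if x = a then y else \<zero>) X = y"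
  using M.add.finprod_singleton[of a X "\<lambda>_. y"] by (simp add: eq_commute[of a])

lemma gl_carrier: "X \<in> carrier (gl n A) \<longleftrightarrow> (\<forall>i j. X i j \<in> carrier A \<and> (i \<notin> {1..n} \<or> j \<notin> {1..n} \<longrightarrow> X i j = \<zero>))"
  by (simp add: gl_def)

lemma gl_cl: "X \<in> carrier (gl n A) \<Longrightarrow> X i j \<in> carrier A"
  by (simp add: gl_carrier)

lemma gl_out: "X \<in> carrier (gl n A) \<Longrightarrow> i \<notin> {1..n} \<or> j \<notin> {1..n} \<Longrightarrow> X i j = \<zero>"
  unfolding gl_carrier by blast

lemma gl_simps: "X \<oplus>\<^bsub>gl n A\<^esub> Y = (\<lambda>i j. X i j \<oplus> Y i j)" "c \<odot>\<^bsub>gl n A\<^esub> X = (\<lambda>i j. c \<odot> X i j)"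
  "X \<otimes>\<^bsub>gl n A\<^esub> Y = (\<lambda>i j. mat_mult n A X Y i j \<ominus> mat_mult n A Y X i j)" "\<zero>\<^bsub>gl n A\<^esub> = (\<lambda>i j. \<zero>)"
  by (simp_all add: gl_def)

lemma gl_mono: "n \<le> m \<Longrightarrow> carrier (gl n A) \<subseteq> carrier (gl m A)"
  by (auto simp: gl_carrier)

lemma mm_cl: "X \<in> carrier (gl m A) \<Longrightarrow> Y \<in> carrier (gl m' A) \<Longrightarrow> mat_mult n A X Y i j \<in> carrier A"
  unfolding mat_mult_def by (rule fs_cl) (auto simp: gl_cl alg_m_closed)

lemma mm_closed: "X \<in> carrier (gl n A) \<Longrightarrow> Y \<in> carrier (gl n A) \<Longrightarrow> mat_mult n A X Y \<in> carrier (gl n A)"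
  unfolding gl_carrier[of "mat_mult n A X Y"]
proof (intro allI conjI impI)
  fix i j assume XY: "X \<in> carrier (gl n A)" "Y \<in> carrier (gl n A)"
  then show "mat_mult n A X Y i j \<in> carrier A" by (rule mm_cl)
  assume "i \<notin> {1..n} \<or> j \<notin> {1..n}"
  then show "mat_mult n A X Y i j = \<zero>" unfolding mat_mult_def
    using gl_out[OF XY(1), of i] gl_out[OF XY(2), of _ j] gl_cl[OF XY(1)] gl_cl[OF XY(2)]
    by (intro fs_zero) (elim disjE, simp_all)
qed

text \<open>Matrices are extended by zero, so the additional summands vanish.\<close>

lemma mm_mono:
  assumes "n \<le> m" "X \<in> carrier (gl n A)" "Y \<in> carrier (gl n A)"
  shows "mat_mult m A X Y = mat_mult n A X Y"
proof (intro ext)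
  fix i j
  show "mat_mult m A X Y i j = mat_mult n A X Y i j"
    unfolding mat_mult_def
    by (rule M.add.finprod_mono_neutral_cong_right) (use assms in \<open>auto simp: gl_cl gl_out alg_m_closed\<close>)
qed

lemma mm_assoc:
  assumes X: "X \<in> carrier (gl n A)" and Y: "Y \<in> carrier (gl n A)" and Z: "Z \<in> carrier (gl n A)"
  shows "mat_mult n A (mat_mult n A X Y) Z = mat_mult n A X (mat_mult n A Y Z)"
proof (intro ext)
  fix i j
  note cl = gl_cl[OF X] gl_cl[OF Y] gl_cl[OF Z]
  have "mat_mult n A (mat_mult n A X Y) Z i j = (\<Oplus>k\<in>{1..n}. \<Oplus>l\<in>{1..n}. (X i l \<otimes> Y l k) \<otimes> Z k j)"
    unfolding mat_mult_def by (rule fs_cong) (auto simp: cl alg_m_closed fs_rmult intro!: fs_cl)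
  also have "\<dots> = (\<Oplus>l\<in>{1..n}. \<Oplus>k\<in>{1..n}. X i l \<otimes> (Y l k \<otimes> Z k j))"
    by (subst fs_swap) (auto simp: cl alg_m_closed alg_m_assoc)
  also have "\<dots> = mat_mult n A X (mat_mult n A Y Z) i j"
    unfolding mat_mult_def by (rule fs_cong) (auto simp: cl alg_m_closed fs_lmult intro!: fs_cl)
  finally show "mat_mult n A (mat_mult n A X Y) Z i j = mat_mult n A X (mat_mult n A Y Z) i j" .
qed

lemma lie_rec_gl: "lie_rec (gl n A)"
proof
  fix X Y c assume X: "X \<in> carrier (gl n A)" and Y: "Y \<in> carrier (gl n A)"
  show "X \<oplus>\<^bsub>gl n A\<^esub> Y \<in> carrier (gl n A)" using X Y by (auto simp: gl_carrier gl_simps)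
  show "X \<otimes>\<^bsub>gl n A\<^esub> Y \<in> carrier (gl n A)"
    using mm_closed[OF X Y] mm_closed[OF Y X] by (auto simp: gl_carrier gl_simps M.minus_eq)
next
  fix X c assume X: "X \<in> carrier (gl n A)"
  then show "c \<odot>\<^bsub>gl n A\<^esub> X \<in> carrier (gl n A)" by (auto simp: gl_carrier gl_simps sm_zero)
qed

text \<open>The bracket of gl(n) is formed with products of size \<open>n\<close>;
  \<open>mm_mono\<close> identifies it with a commutator of matrices of size
  \<open>m\<close>.\<close>

lemma lie_action_gl: "n \<le> m \<Longrightarrow> lie_action (gl n A) (gl m A) (mat_mult m A)"
proof (intro lie_action.intro lie_action_axioms.intro)
  assume nm: "n \<le> m"
  show "lie_rec (gl n A)" by (rule lie_rec_gl)
  interpret m: lie_rec "gl m A" by (rule lie_rec_gl)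
  show "carrier (gl n A) \<subseteq> carrier (gl m A)" using nm by (rule gl_mono)
  show "ring.add (gl n A) = ring.add (gl m A)" "module.smult (gl n A) = module.smult (gl m A)" by (simp_all add: gl_def)
  fix X Y Z c assume X: "X \<in> carrier (gl m A)" and Y: "Y \<in> carrier (gl m A)" and Z: "Z \<in> carrier (gl m A)"
  note cl = gl_cl[OF X] gl_cl[OF Y] gl_cl[OF Z]
  show "X \<oplus>\<^bsub>gl m A\<^esub> Y \<in> carrier (gl m A)" using X Y by (rule m.L_add)
  show "mat_mult m A X Y \<in> carrier (gl m A)" using X Y by (rule mm_closed)
  show "mat_mult m A (mat_mult m A X Y) Z = mat_mult m A X (mat_mult m A Y Z)" by (rule mm_assoc[OF X Y Z])
  show "mat_mult m A (X \<oplus>\<^bsub>gl m A\<^esub> Y) Z = mat_mult m A X Z \<oplus>\<^bsub>gl m A\<^esub> mat_mult m A Y Z"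
    unfolding gl_simps mat_mult_def
    by (intro ext, subst fs_add[symmetric]) (auto simp: cl alg_m_closed alg_l_distr)
  show "mat_mult m A Z (X \<oplus>\<^bsub>gl m A\<^esub> Y) = mat_mult m A Z X \<oplus>\<^bsub>gl m A\<^esub> mat_mult m A Z Y"
    unfolding gl_simps mat_mult_def
    by (intro ext, subst fs_add[symmetric]) (auto simp: cl alg_m_closed alg_r_distr)
next
  fix X Z c assume X: "X \<in> carrier (gl m A)" and Z: "Z \<in> carrier (gl m A)"
  interpret m: lie_rec "gl m A" by (rule lie_rec_gl)
  note cl = gl_cl[OF X] gl_cl[OF Z]
  show "mat_mult m A (c \<odot>\<^bsub>gl m A\<^esub> X) Z = c \<odot>\<^bsub>gl m A\<^esub> mat_mult m A X Z"
    "mat_mult m A Z (c \<odot>\<^bsub>gl m A\<^esub> X) = c \<odot>\<^bsub>gl m A\<^esub> mat_mult m A Z X"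
    unfolding gl_simps mat_mult_def
    by (intro ext, subst fs_smult, auto simp: cl alg_m_closed alg_smult_l alg_smult_r)+
  show "c \<odot>\<^bsub>gl m A\<^esub> X \<in> carrier (gl m A)" using X by (rule m.L_smult)
next
  fix X Y assume nm: "n \<le> m" and X: "X \<in> carrier (gl n A)" and Y: "Y \<in> carrier (gl n A)"
  show "mat_mult m A X Y = X \<otimes>\<^bsub>gl n A\<^esub> Y \<oplus>\<^bsub>gl m A\<^esub> mat_mult m A Y X"
    unfolding mm_mono[OF nm X Y] mm_mono[OF nm Y X] gl_simps
    using mm_cl[OF X Y] mm_cl[OF Y X] by (auto simp: M.minus_eq M.a_assoc M.l_neg)
qed

abbreviation EE :: "nat \<Rightarrow> nat \<Rightarrow> 'a \<Rightarrow> nat \<Rightarrow> nat \<Rightarrow> 'a" where "EE \<equiv> mat_unit A"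

lemma EE_cl [simp]: "x \<in> carrier A \<Longrightarrow> i \<in> {1..n} \<Longrightarrow> j \<in> {1..n} \<Longrightarrow> EE i j x \<in> carrier (gl n A)"
  by (auto simp: gl_carrier mat_unit_def)

lemma EE_zero: "EE i j \<zero> = (\<lambda>i j. \<zero>)"
  by (simp add: mat_unit_def fun_eq_iff)

lemma mm_EE:
  assumes "x \<in> carrier A" "y \<in> carrier A" "j \<in> {1..n}"
  shows "mat_mult n A (EE i j x) (EE k l y) = (if j = k then EE i l (x \<otimes> y) else (\<lambda>i j. \<zero>))"
proof (intro ext)
  fix a b
  have "mat_mult n A (EE i j x) (EE k l y) a b =
      (\<Oplus>c\<in>{1..n}. if c = j then (if a = i \<and> j = k \<and> b = l then x \<otimes> y else \<zero>) else \<zero>)"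
    unfolding mat_mult_def mat_unit_def using assms by (intro fs_cong) (auto simp: alg_m_closed)
  also have "\<dots> = (if a = i \<and> j = k \<and> b = l then x \<otimes> y else \<zero>)"
    using assms by (intro fs_single) (auto simp: alg_m_closed)
  finally show "mat_mult n A (EE i j x) (EE k l y) a b = (if j = k then EE i l (x \<otimes> y) else (\<lambda>i j. \<zero>)) a b"
    by (auto simp: mat_unit_def)
qed

lemma bracket_EE:
  assumes "x \<in> carrier A" "y \<in> carrier A" "i \<in> {1..n}" "j \<in> {1..n}" "k \<in> {1..n}" "l \<in> {1..n}"
  shows "EE i j x \<otimes>\<^bsub>gl n A\<^esub> EE k l y =
    (if j = k then EE i l (x \<otimes> y) else (\<lambda>i j. \<zero>)) \<oplus>\<^bsub>gl n A\<^esub> ((-1) \<odot>\<^bsub>gl n A\<^esub> (if i = l then EE k j (y \<otimes> x) else (\<lambda>i j. \<zero>)))"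
proof (intro ext)
  fix a b
  have "(if i = l then EE k j (y \<otimes> x) else (\<lambda>i j. \<zero>)) a b \<in> carrier A"
    using assms by (auto simp: mat_unit_def alg_m_closed)
  then show "(EE i j x \<otimes>\<^bsub>gl n A\<^esub> EE k l y) a b = ((if j = k then EE i l (x \<otimes> y) else (\<lambda>i j. \<zero>)) \<oplus>\<^bsub>gl n A\<^esub> ((-1) \<odot>\<^bsub>gl n A\<^esub> (if i = l then EE k j (y \<otimes> x) else (\<lambda>i j. \<zero>)))) a b"
    using mm_EE[of x y j n i k l] mm_EE[of y x l n k i j] assms
    by (simp add: gl_simps M.minus_eq sm_m1 eq_commute[of l i])
qed

end

locale gl_alg = complex_algebra A for A :: "(complex, 'a) module" (structure) + fixes n :: nat
begin

sublocale U: lie_rec "gl n A" by (rule lie_rec_gl)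

notation U.eqv (infix "\<approx>" 50)

abbreviation "w1 i j x \<equiv> wd [EE i j x]"

lemma zero_gl: "(\<lambda>i j. \<zero>) \<in> carrier (gl n A)" by (auto simp: gl_carrier)

lemma wd_zero: "wd [(\<lambda>i j. \<zero>)] \<approx> 0"
  using U.wd_smult[OF zero_gl, of 0] by (simp add: gl_simps sm_zero)

lemma w1_F [intro, simp]: "x \<in> carrier A \<Longrightarrow> i \<in> {1..n} \<Longrightarrow> j \<in> {1..n} \<Longrightarrow> w1 i j x \<in> FA (carrier (gl n A))"
  by (rule FA_wd1) simp

lemma w1_add:
  assumes "x \<in> carrier A" "y \<in> carrier A" "i \<in> {1..n}" "j \<in> {1..n}"
  shows "w1 i j (x \<oplus> y) \<approx> w1 i j x + w1 i j y"
proof -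
  have "EE i j (x \<oplus> y) = EE i j x \<oplus>\<^bsub>gl n A\<^esub> EE i j y" using assms by (auto simp: gl_simps mat_unit_def fun_eq_iff)
  then show ?thesis using U.wd_add[of "EE i j x" "EE i j y"] assms by simp
qed

lemma w1_smult:
  assumes "x \<in> carrier A" "i \<in> {1..n}" "j \<in> {1..n}"
  shows "w1 i j (c \<odot> x) \<approx> cst c * w1 i j x"
proof -
  have "EE i j (c \<odot> x) = c \<odot>\<^bsub>gl n A\<^esub> EE i j x" using assms by (auto simp: gl_simps mat_unit_def fun_eq_iff sm_zero)
  then show ?thesis using U.wd_smult[of "EE i j x" c] assms by simp
qed

lemma w1_comm:
  assumes "x \<in> carrier A" "y \<in> carrier A" "i \<in> {1..n}" "j \<in> {1..n}" "k \<in> {1..n}" "l \<in> {1..n}"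
  shows "w1 i j x * w1 k l y - w1 k l y * w1 i j x \<approx>
    (if k = j then w1 i l (x \<otimes> y) else 0) - (if i = l then w1 k j (y \<otimes> x) else 0)"
proof -
  let ?X = "if j = k then EE i l (x \<otimes> y) else (\<lambda>i j. \<zero>)" and ?Y = "if i = l then EE k j (y \<otimes> x) else (\<lambda>i j. \<zero>)"
  have XY: "?X \<in> carrier (gl n A)" "?Y \<in> carrier (gl n A)" using assms zero_gl by (auto simp: alg_m_closed)
  have "w1 i j x * w1 k l y - w1 k l y * w1 i j x \<approx> wd [EE i j x \<otimes>\<^bsub>gl n A\<^esub> EE k l y]"
    using assms by (intro U.wd_comm) auto
  also have "EE i j x \<otimes>\<^bsub>gl n A\<^esub> EE k l y = ?X \<oplus>\<^bsub>gl n A\<^esub> ((-1) \<odot>\<^bsub>gl n A\<^esub> ?Y)"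
    using assms by (rule bracket_EE)
  also have "wd [?X \<oplus>\<^bsub>gl n A\<^esub> ((-1) \<odot>\<^bsub>gl n A\<^esub> ?Y)] \<approx> wd [?X] + wd [(-1) \<odot>\<^bsub>gl n A\<^esub> ?Y]"
    by (rule U.wd_add[OF XY(1) U.L_smult[OF XY(2)]])
  also have "\<dots> \<approx> wd [?X] + cst (-1) * wd [?Y]"
    by (rule U.eqv_add[OF U.eqv_refl U.wd_smult[OF XY(2)]])
  also have "wd [?X] + cst (-1) * wd [?Y] = wd [?X] - wd [?Y]" by (simp add: cst_minus)
  also have "\<dots> \<approx> (if k = j then w1 i l (x \<otimes> y) else 0) - (if i = l then w1 k j (y \<otimes> x) else 0)"
    using wd_zero by (intro U.eqv_diff) auto
  finally show ?thesis .
qed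

lemma wd_decomp:
  assumes X: "X \<in> carrier (gl n A)"
  shows "wd [X] \<approx> (\<Sum>i=1..n. \<Sum>j=1..n. w1 i j (X i j))"
proof -
  let ?R = "\<lambda>D. (\<lambda>i j. if (i, j) \<in> D then X i j else \<zero>)"
  \<comment> \<open>Induction over the set \<open>D\<close> of positions already filled in;
    \<open>?R D\<close> is \<open>X\<close> with all other entries erased.\<close>
  have *: "D \<subseteq> {1..n} \<times> {1..n} \<Longrightarrow> wd [?R D] \<approx> (\<Sum>(i,j)\<in>D. w1 i j (X i j))" if "finite D" for D
    using that
  proof (induction D rule: finite_induct)
    case empty then show ?case using wd_zero by simp
  next
    case (insert p D)
    obtain i j where p: "p = (i, j)" by (cases p)
    have R: "?R D \<in> carrier (gl n A)" using X insert by (auto simp: gl_carrier)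
    have E: "EE i j (X i j) \<in> carrier (gl n A)" using X insert p by (auto simp: gl_cl)
    have "?R (insert p D) = EE i j (X i j) \<oplus>\<^bsub>gl n A\<^esub> ?R D"
      using insert(2) p gl_cl[OF X] by (auto simp: gl_simps mat_unit_def fun_eq_iff)
    then have "wd [?R (insert p D)] \<approx> w1 i j (X i j) + wd [?R D]" using U.wd_add[OF E R] by simp
    also have "\<dots> \<approx> w1 i j (X i j) + (\<Sum>(i,j)\<in>D. w1 i j (X i j))"
      using insert by (intro U.eqv_add) auto
    finally show ?case using insert p by simp
  qed
  have "?R ({1..n} \<times> {1..n}) = X"
    using gl_out[OF X] by (fastforce simp: fun_eq_iff)
  then show ?thesis using *[of "{1..n} \<times> {1..n}"] by (simp add: sum.cartesian_product)
qed

end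

text \<open>The functional on matrices with components \<open>\<zeta> i j\<close>. Applied to a
  larger matrix it still reads only the upper left corner of size \<open>n\<close>, which makes the
  further columns invisible in \<open>last_col_kills\<close>.\<close>

definition lf :: "nat \<Rightarrow> (nat \<Rightarrow> nat \<Rightarrow> 'a \<Rightarrow> complex) \<Rightarrow> (nat \<Rightarrow> nat \<Rightarrow> 'a) \<Rightarrow> complex" where
  "lf n \<zeta> X = (\<Sum>i=1..n. \<Sum>j=1..n. \<zeta> i j (X i j))"

context complex_algebra
begin

lemma linfun_lf: "(\<And>i j. linfun A (\<zeta> i j)) \<Longrightarrow> linfun (gl m A) (lf n \<zeta>)"
  by (auto simp: linfun_def gl_simps lf_def sum.distrib sum_distrib_left gl_cl)

lemma lf_EE:
  assumes "\<And>i j. linfun A (\<zeta> i j)" "x \<in> carrier A" 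
  shows "lf n \<zeta> (EE i j x) = (if i \<in> {1..n} \<and> j \<in> {1..n} then \<zeta> i j x else 0)"
proof -
  have e: "\<zeta> k l (EE i j x k l) = (if k = i then (if l = j then \<zeta> i j x else 0) else 0)" for k l
    using linfun_0[OF assms(1)] by (simp add: mat_unit_def)
  have "lf n \<zeta> (EE i j x) = (\<Sum>k=1..n. if k = i then (\<Sum>l=1..n. if l = j then \<zeta> i j x else 0) else 0)"
    unfolding lf_def e by (intro sum.cong refl) auto
  then show ?thesis by simp
qed

lemma gl_reduce:
  assumes B: "is_basis A B" and X: "X \<in> carrier (gl n A)"
  shows "\<exists>q\<in>letter_combs {EE i j b | i j b. i \<in> {1..n} \<and> j \<in> {1..n} \<and> b \<in> B}. lie_rec.eqv (gl n A) (wd [X]) q"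
proof -
  interpret gl_alg A n ..
  let ?S = "{EE i j b | i j b. i \<in> {1..n} \<and> j \<in> {1..n} \<and> b \<in> B}"
  have BA: "B \<subseteq> carrier A" "lin_span A B = carrier A" using B by (auto simp: is_basis_def)
  have 1: "\<exists>q\<in>letter_combs ?S. w1 i j x \<approx> q" if ij: "i \<in> {1..n}" "j \<in> {1..n}" and x: "x \<in> lin_span A B" for i j x
    using x
  proof induction
    case (base x)
    then show ?case using ij by (intro bexI[of _ "w1 i j x"] U.eqv_refl letter_combs_wd) auto
  next
    case zero
    show ?case by (rule bexI[of _ 0]) (use wd_zero in \<open>auto simp: EE_zero\<close>)
  next
    case (add x y)
    then obtain p q where pq: "p \<in> letter_combs ?S" "w1 i j x \<approx> p" "q \<in> letter_combs ?S" "w1 i j y \<approx> q" by auto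
    have "w1 i j (x \<oplus> y) \<approx> w1 i j x + w1 i j y" using add ij BA by (intro w1_add) auto
    also have "\<dots> \<approx> p + q" using pq by (intro U.eqv_add)
    finally show ?case using pq letter_combs_add by blast
  next
    case (smult x c)
    then obtain p where p: "p \<in> letter_combs ?S" "w1 i j x \<approx> p" by auto
    have "w1 i j (c \<odot> x) \<approx> cst c * w1 i j x" using smult ij BA by (intro w1_smult) auto
    also have "\<dots> \<approx> cst c * p" using p by (intro U.eqv_cst)
    finally show ?case using p letter_combs_cst by blast
  qed
  define q where "q i j = (SOME q. q \<in> letter_combs ?S \<and> w1 i j (X i j) \<approx> q)" for i j
  have q: "q i j \<in> letter_combs ?S \<and> w1 i j (X i j) \<approx> q i j" if "i \<in> {1..n}" "j \<in> {1..n}" for i j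
    unfolding q_def by (rule someI_ex) (use 1[OF that, of "X i j"] gl_cl[OF X] BA(2) in auto)
  have "wd [X] \<approx> (\<Sum>i=1..n. \<Sum>j=1..n. w1 i j (X i j))" by (rule wd_decomp[OF X])
  also have "\<dots> \<approx> (\<Sum>i=1..n. \<Sum>j=1..n. q i j)" using q by (intro U.eqv_sum) auto
  finally have "wd [X] \<approx> (\<Sum>i=1..n. \<Sum>j=1..n. q i j)" .
  moreover have "(\<Sum>i=1..n. \<Sum>j=1..n. q i j) \<in> letter_combs ?S" using q by (intro letter_combs_sum) auto
  ultimately show ?thesis by blast
qed

text \<open>Matrix units with basis elements as entries span the letters, and functionals
  \<open>lf n \<zeta>\<close> take arbitrary values on them. So the forms that permit a change of
  \<open>N\<close> already detect the whole ideal.\<close>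

theorem gl_separation:
  assumes B: "is_basis A B" and p: "p \<in> FA (carrier (gl n A))"
    and zero: "\<And>K \<zeta>. (\<And>i j. linfun A (\<zeta> i j)) \<Longrightarrow> acts (mat_mult n A) K p (prod_form K (lf n \<zeta>)) (\<lambda>_. None) = 0"
  shows "p \<in> uea_ideal (gl n A)"
proof -
  interpret lie_action "gl n A" "gl n A" "mat_mult n A" by (rule lie_action_gl) simp
  let ?S = "{EE i j b | i j b. i \<in> {1..n} \<and> j \<in> {1..n} \<and> b \<in> B}"
  have BA: "B \<subseteq> carrier A" using B by (auto simp: is_basis_def)
  show ?thesis
  proof (rule separation[OF p, of ?S "{lf n \<zeta> | \<zeta>. \<forall>i j. linfun A (\<zeta> i j)}"])
    show "?S \<subseteq> carrier (gl n A)" using BA by auto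
    show "\<exists>q\<in>letter_combs ?S. eqv (wd [X]) q" if "X \<in> carrier (gl n A)" for X by (rule gl_reduce[OF B that])
    fix v :: "(nat \<Rightarrow> nat \<Rightarrow> 'a) \<Rightarrow> complex"
    define \<zeta> where "\<zeta> i j = (SOME f. linfun A f \<and> (\<forall>b\<in>B. f b = v (EE i j b)))" for i j
    have "linfun A (\<zeta> i j) \<and> (\<forall>b\<in>B. \<zeta> i j b = v (EE i j b))" for i j
      unfolding \<zeta>_def using someI_ex[OF linfun_extend[OF B, of "\<lambda>b. v (EE i j b)"]] .
    then have \<zeta>: "\<And>i j. linfun A (\<zeta> i j)" "\<And>i j b. b \<in> B \<Longrightarrow> \<zeta> i j b = v (EE i j b)" by auto
    have "\<forall>s\<in>?S. lf n \<zeta> s = v s" using \<zeta> BA by (auto simp: lf_EE subset_iff)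
    then show "\<exists>f\<in>{lf n \<zeta> | \<zeta>. \<forall>i j. linfun A (\<zeta> i j)}. linfun (gl n A) f \<and> (\<forall>s\<in>?S. f s = v s)"
      using \<zeta>(1) linfun_lf[of \<zeta> n n] by blast
  qed (use zero in auto)
qed

text \<open>Slots filled with matrices of size \<open>n\<close> keep this size under gl(n), so on
  such slots the surrounding size does not matter.\<close>

lemma act_ambient:
  assumes "n \<le> m" "p \<in> FA (carrier (gl n A))" "as \<in> slots (carrier (gl n A))"
  shows "acts (mat_mult m A) K p H as = acts (mat_mult n A) K p H as"
proof -
  have om: "omul (mat_mult m A) (as r) x = omul (mat_mult n A) (as r) x" "omul (mat_mult n A) (as r) x \<in> carrier (gl n A)"
    if "as \<in> slots (carrier (gl n A))" "x \<in> carrier (gl n A)" for as r x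
    using that assms(1) by (cases "as r"; auto simp: slots_def mm_mono mm_closed)+
  have w: "actw (mat_mult m A) K w H as = actw (mat_mult n A) K w H as" if "w \<in> lists (carrier (gl n A))" "as \<in> slots (carrier (gl n A))" for w as
    using that
  proof (induction w arbitrary: as)
    case (Cons x w)
    then have "actw (mat_mult m A) K w H (as(r := Some (omul (mat_mult n A) (as r) x))) = actw (mat_mult n A) K w H (as(r := Some (omul (mat_mult n A) (as r) x)))" for r
      by (intro Cons.IH slots_upd om) auto
    moreover have "x \<in> carrier (gl n A)" "as \<in> slots (carrier (gl n A))" using Cons by auto
    ultimately show ?case using om(1)[of as x] by (simp add: actw_def act_def)
  qed (simp add: actw_def)
  show ?thesis using assms(2) by (induction p rule: FA_induct) (simp_all add: acts_add acts_single w assms(3))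
qed

text \<open>Right multiplication by \<open>EE i a x\<close> moves everything into column
  \<open>a\<close>, which \<open>lf n \<zeta>\<close> does not read. Such forms do the work of a
  quotient by the left ideal generated by the last columns.\<close>

lemma last_col_kills:
  assumes "n \<le> m" "\<And>i j. linfun A (\<zeta> i j)" "a \<in> {n<..m}" "i \<in> {1..m}" "x \<in> carrier A" "as \<in> slots (carrier (gl m A))"
  shows "act (mat_mult m A) K (EE i a x) (prod_form K (lf n \<zeta>)) as = 0"
proof -
  have 0: "lf n \<zeta> (omul (mat_mult m A) (as r) (EE i a x)) = 0" for r
  proof -
    have "omul (mat_mult m A) (as r) (EE i a x) k l = \<zero>" if "l \<in> {1..n}" for k l
    proof (cases "as r")
      case None
      then show ?thesis using that assms(3) by (auto simp: mat_unit_def)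
    next
      case (Some y)
      then have "y k c \<in> carrier A" for c using assms(6) gl_cl[of y m k c] by (auto simp: slots_def)
      then show ?thesis using that assms(3) Some by (auto simp: mat_unit_def mat_mult_def intro!: fs_zero)
    qed
    then show ?thesis unfolding lf_def using linfun_0[OF assms(2)] by simp
  qed
  show ?thesis unfolding act_def by (rule sum.neutral) (simp add: prod_form_upd 0)
qed

end

section \<open>Commutators of the elements \<open>e\<^sub>i\<^sub>j(x)\<close>\<close>

type_synonym 'a mfa = "(nat \<Rightarrow> nat \<Rightarrow> 'a) fa"

text \<open>
  Relations are stated for families indexed by \<open>N\<close> and by \<open>i\<close>, \<open>j\<close>, \<open>k\<close>, \<open>l\<close>, so that membership in a
  closure yields one expression valid for all \<open>N\<close>.
\<close>
type_synonym 'a fam = "nat \<Rightarrow> nat \<Rightarrow> nat \<Rightarrow> nat \<Rightarrow> nat \<Rightarrow> 'a mfa"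

text \<open>The shifted degree of a word. By truncated subtraction the empty word has degree 0; it
  stands for a Kronecker delta, so that the products of two factors used below include single
  generators.\<close>

definition dg :: "'a list \<Rightarrow> nat" where "dg x = length x - 1"

lemma dg_append: "dg (u @ v) \<le> dg u + dg v + 1" by (auto simp: dg_def)

lemma sum_delta_l: "finite S \<Longrightarrow> (\<Sum>a\<in>S. (if k = a then g a else 0) * f a) = (if k \<in> S then g k * f k else 0)"
  for f g :: "_ \<Rightarrow> _::ring_1"
proof -
  assume "finite S"
  then have "(\<Sum>a\<in>S. if k = a then g a * f a else 0) = (if k \<in> S then g k * f k else 0)" by simp
  then show ?thesis by (simp add: if_distrib[of "\<lambda>x. x * _"] cong: if_cong)
qed

lemma sum_delta_r: "finite S \<Longrightarrow> (\<Sum>a\<in>S. f a * (if k = a then g a else 0)) = (if k \<in> S then f k * g k else 0)"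
  for f g :: "_ \<Rightarrow> _::ring_1"
proof -
  assume "finite S"
  then have "(\<Sum>a\<in>S. if k = a then f a * g a else 0) = (if k \<in> S then f k * g k else 0)" by simp
  then show ?thesis by (simp add: if_distrib[of "\<lambda>x. _ * x"] cong: if_cong)
qed

context complex_algebra
begin

abbreviation eqN :: "nat \<Rightarrow> 'a mfa \<Rightarrow> 'a mfa \<Rightarrow> bool" where "eqN N \<equiv> lie_rec.eqv (gl N A)"

abbreviation "W \<equiv> lists (carrier A)"

text \<open>With the identity matrix for the empty word, concatenation of words is multiplication of
  matrices without exception.\<close>

primrec e_word :: "nat \<Rightarrow> nat \<Rightarrow> nat \<Rightarrow> 'a list \<Rightarrow> 'a mfa" where
  "e_word N i j [] = (if i = j then 1 else 0)"
| "e_word N i j (x # xs) = (\<Sum>a=1..N. wd [EE i a x] * e_word N a j xs)"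

lemma e_word_FA: "x \<in> W \<Longrightarrow> i \<in> {1..N} \<Longrightarrow> j \<in> {1..N} \<Longrightarrow> e_word N i j x \<in> FA (carrier (gl N A))"
proof (induction x arbitrary: i)
  case (Cons x xs)
  then show ?case by (auto intro!: FA_sum FA_mult FA_wd1)
qed auto

lemma e_word_single: "j \<in> {1..N} \<Longrightarrow> e_word N i j [x] = wd [EE i j x]"
  using sum_delta_r[of "{1..N}" "\<lambda>a. wd [EE i a x]" j "\<lambda>_. 1"] by (simp add: eq_commute[of _ j])

lemma e_word_append: "i \<in> {1..N} \<Longrightarrow> e_word N i j (u @ v) = (\<Sum>a=1..N. e_word N i a u * e_word N a j v)"
proof (induction u arbitrary: i)
  case Nil
  then show ?case using sum_delta_l[of "{1..N}" i "\<lambda>_. 1" "\<lambda>a. e_word N a j v"] by simp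
next
  case (Cons x u)
  have "e_word N i j ((x # u) @ v) = (\<Sum>b=1..N. wd [EE i b x] * (\<Sum>a=1..N. e_word N b a u * e_word N a j v))"
    using Cons by simp
  also have "\<dots> = (\<Sum>a=1..N. \<Sum>b=1..N. wd [EE i b x] * (e_word N b a u * e_word N a j v))"
    unfolding sum_distrib_left by (rule sum.swap)
  finally show ?case by (simp add: sum_distrib_right mult.assoc)
qed

text \<open>Only sums and signs are allowed, and no summation whose range depends on
  \<open>N\<close>. A derivation of membership therefore is an expression that
  \<open>Good_translate\<close> can turn into an element of \<open>T\<close>. Congruence is demanded
  only for indices in \<open>{1..N}\<close>.\<close>

inductive fam_closure :: "'a fam set \<Rightarrow> 'a fam \<Rightarrow> bool" for Bs where
  base: "G \<in> Bs \<Longrightarrow> fam_closure Bs G"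
| zero: "fam_closure Bs (\<lambda>N i j k l. 0)"
| add: "fam_closure Bs G \<Longrightarrow> fam_closure Bs G' \<Longrightarrow> fam_closure Bs (\<lambda>N i j k l. G N i j k l + G' N i j k l)"
| neg: "fam_closure Bs G \<Longrightarrow> fam_closure Bs (\<lambda>N i j k l. - G N i j k l)"
| eqv: "fam_closure Bs G \<Longrightarrow> (\<And>N i j k l. \<lbrakk>i \<in> {1..N}; j \<in> {1..N}; k \<in> {1..N}; l \<in> {1..N}\<rbrakk> \<Longrightarrow> eqN N (G N i j k l) (G' N i j k l))
   \<Longrightarrow> fam_closure Bs G'"

lemma eqN_refl [simp]: "eqN N p p"
  by (rule lie_rec.eqv_refl[OF lie_rec_gl])

lemma fam_closure_eq: "fam_closure Bs G \<Longrightarrow> (\<And>N i j k l. \<lbrakk>i \<in> {1..N}; j \<in> {1..N}; k \<in> {1..N}; l \<in> {1..N}\<rbrakk> \<Longrightarrow> G' N i j k l = G N i j k l)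
   \<Longrightarrow> fam_closure Bs G'"
  by (rule fam_closure.eqv[of Bs G]) auto

lemma fam_closure_diff: "fam_closure Bs G \<Longrightarrow> fam_closure Bs G' \<Longrightarrow> fam_closure Bs (\<lambda>N i j k l. G N i j k l - G' N i j k l)"
  using fam_closure.add[OF _ fam_closure.neg] by fastforce

text \<open>It is applied to permutations of the indices and to summation against a path. Condition
  \<open>c\<close> makes sure that the operator reads a family, up to congruence, only at indices in
  range, the only place where congruences are known.\<close>

lemma fam_closure_map:
  assumes G: "fam_closure Bs G"
    and 0: "\<And>N i j k l. \<Phi> (\<lambda>N i j k l. 0) N i j k l = 0"
    and a: "\<And>G G' N i j k l. \<Phi> (\<lambda>N i j k l. G N i j k l + G' N i j k l) N i j k l = \<Phi> G N i j k l + \<Phi> G' N i j k l"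
    and c: "\<And>G G' N i j k l. \<lbrakk>\<And>i j k l. \<lbrakk>i \<in> {1..N}; j \<in> {1..N}; k \<in> {1..N}; l \<in> {1..N}\<rbrakk> \<Longrightarrow> eqN N (G N i j k l) (G' N i j k l);
        i \<in> {1..N}; j \<in> {1..N}; k \<in> {1..N}; l \<in> {1..N}\<rbrakk> \<Longrightarrow> eqN N (\<Phi> G N i j k l) (\<Phi> G' N i j k l)"
    and b: "\<And>G. G \<in> Bs \<Longrightarrow> fam_closure Bs' (\<Phi> G)"
  shows "fam_closure Bs' (\<Phi> G)"
  using G
proof induction
  case (base G) then show ?case by (rule b)
next
  case zero
  show ?case by (rule fam_closure_eq[OF fam_closure.zero]) (simp add: 0)
next
  case (add G G')
  show ?case by (rule fam_closure_eq[OF fam_closure.add[OF add.IH]]) (simp add: a)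
next
  case (neg G)
  show ?case
  proof (rule fam_closure_eq[OF fam_closure.neg[OF neg.IH]])
    fix N i j k l :: nat
    show "\<Phi> (\<lambda>N i j k l. - G N i j k l) N i j k l = - \<Phi> G N i j k l"
      using a[of "\<lambda>N i j k l. - G N i j k l" G N i j k l] by (simp add: 0 eq_neg_iff_add_eq_0)
  qed
next
  case (eqv G G')
  show ?case by (rule fam_closure.eqv[OF eqv.IH]) (rule c, use eqv.hyps in auto)
qed

text \<open>A commutator of generators with indices \<open>(i, j)\<close> and \<open>(k, l)\<close>
  produces the index pairs \<open>(k, j)\<close> and \<open>(i, l)\<close>, and a further commutator
  leads back. The four shapes are stable under these exchanges.\<close>

definition prod_kj_il :: "'a list \<Rightarrow> 'a list \<Rightarrow> 'a fam" where "prod_kj_il u v = (\<lambda>N i j k l. e_word N k j u * e_word N i l v)"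
definition prod_il_kj :: "'a list \<Rightarrow> 'a list \<Rightarrow> 'a fam" where "prod_il_kj u v = (\<lambda>N i j k l. e_word N i l v * e_word N k j u)"
definition prod_ij_kl :: "'a list \<Rightarrow> 'a list \<Rightarrow> 'a fam" where "prod_ij_kl u v = (\<lambda>N i j k l. e_word N i j u * e_word N k l v)"
definition prod_kl_ij :: "'a list \<Rightarrow> 'a list \<Rightarrow> 'a fam" where "prod_kl_ij u v = (\<lambda>N i j k l. e_word N k l v * e_word N i j u)"

definition "prods_kj_il D = {prod_kj_il u v | u v. u \<in> W \<and> v \<in> W \<and> dg u + dg v < D}"
definition "all_prods D = prods_kj_il D \<union> {prod_il_kj u v | u v. u \<in> W \<and> v \<in> W \<and> dg u + dg v < D} \<union>
  {prod_ij_kl u v | u v. u \<in> W \<and> v \<in> W \<and> dg u + dg v < D} \<union> {prod_kl_ij u v | u v. u \<in> W \<and> v \<in> W \<and> dg u + dg v < D}"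

lemma prods_kj_ilI: "u \<in> W \<Longrightarrow> v \<in> W \<Longrightarrow> dg u + dg v < D \<Longrightarrow> prod_kj_il u v \<in> prods_kj_il D"
  unfolding prods_kj_il_def by blast

abbreviation "Good D \<equiv> fam_closure (all_prods D)"

lemma fam_closure_mono: "fam_closure Bs G \<Longrightarrow> Bs \<subseteq> Bs' \<Longrightarrow> fam_closure Bs' G"
  by (rule fam_closure_map[where \<Phi> = "\<lambda>G. G"]) (auto intro: fam_closure.base)

lemma Good_mono: "Good D G \<Longrightarrow> D \<le> D' \<Longrightarrow> Good D' G"
proof (rule fam_closure_mono)
  assume D: "D \<le> D'"
  show "all_prods D \<subseteq> all_prods D'"
  proof
    fix G assume "G \<in> all_prods D"
    then show "G \<in> all_prods D'" unfolding all_prods_def prods_kj_il_def using D by (blast intro: less_le_trans)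
  qed
qed

lemma Good_base:
  assumes "u \<in> W" "v \<in> W" "dg u + dg v < D"
  shows "Good D (prod_kj_il u v)" "Good D (prod_il_kj u v)" "Good D (prod_ij_kl u v)" "Good D (prod_kl_ij u v)"
  by (rule fam_closure.base, use assms in \<open>auto simp: all_prods_def prods_kj_il_def\<close>)+

lemma all_prods_cases:
  assumes "G \<in> all_prods D"
  obtains u v where "u \<in> W" "v \<in> W" "dg u + dg v < D" "G = prod_kj_il u v \<or> G = prod_il_kj u v \<or> G = prod_ij_kl u v \<or> G = prod_kl_ij u v"
  using assms by (auto simp: all_prods_def prods_kj_il_def)

lemma Good_swap_ik: "Good D G \<Longrightarrow> Good D (\<lambda>N i j k l. G N k j i l)"
proof (erule fam_closure_map[where \<Phi> = "\<lambda>G N i j k l. G N k j i l"])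
  fix G assume "G \<in> all_prods D"
  then obtain u v where uv: "u \<in> W" "v \<in> W" "dg u + dg v < D" "dg v + dg u < D" and G: "G = prod_kj_il u v \<or> G = prod_il_kj u v \<or> G = prod_ij_kl u v \<or> G = prod_kl_ij u v"
    by (elim all_prods_cases) auto
  show "Good D (\<lambda>N i j k l. G N k j i l)"
    using G Good_base[OF uv(1,2,3)] Good_base[OF uv(2,1,4)]
    by (elim disjE) (simp_all add: prod_kj_il_def prod_il_kj_def prod_ij_kl_def prod_kl_ij_def)
qed auto

lemma Good_swap: "Good D G \<Longrightarrow> Good D (\<lambda>N i j k l. G N k l i j)"
proof (erule fam_closure_map[where \<Phi> = "\<lambda>G N i j k l. G N k l i j"])
  fix G assume "G \<in> all_prods D"
  then obtain u v where uv: "u \<in> W" "v \<in> W" "dg u + dg v < D" "dg v + dg u < D" and G: "G = prod_kj_il u v \<or> G = prod_il_kj u v \<or> G = prod_ij_kl u v \<or> G = prod_kl_ij u v"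
    by (elim all_prods_cases) auto
  show "Good D (\<lambda>N i j k l. G N k l i j)"
    using G Good_base[OF uv(1,2,3)] Good_base[OF uv(2,1,4)]
    by (elim disjE) (simp_all add: prod_kj_il_def prod_il_kj_def prod_ij_kl_def prod_kl_ij_def)
qed auto

abbreviation "wj \<equiv> word_join A"

lemma wj_W: "u \<in> W \<Longrightarrow> v \<in> W \<Longrightarrow> u \<noteq> [] \<Longrightarrow> v \<noteq> [] \<Longrightarrow> wj u v \<in> W"
  by (cases v; cases u rule: rev_cases) (auto simp: word_join_def alg_m_closed)

lemma wj_dg: "u \<noteq> [] \<Longrightarrow> v \<noteq> [] \<Longrightarrow> dg (wj u v) = dg u + dg v"
  by (cases v; cases u rule: rev_cases) (auto simp: word_join_def dg_def)

lemma wj_simps: "wj [x] (y # ys) = (x \<otimes> y) # ys" "u \<noteq> [] \<Longrightarrow> wj (x # u) v = x # wj u v"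
  "v \<noteq> [] \<Longrightarrow> wj u (x # v) = wj u [x] @ v"
  by (auto simp: word_join_def)

lemma wj_ne: "wj u v \<noteq> []"
  by (simp add: word_join_def)

text \<open>The commutator minus what the bracket of gl(d, R) predicts, where the product of two
  words joins the last letter of one to the first letter of the other. It has to be shown that the
  defect has lower shifted degree.\<close>

definition bracket_defect :: "'a list \<Rightarrow> 'a list \<Rightarrow> 'a fam" where
  "bracket_defect x y = (\<lambda>N i j k l. e_word N i j x * e_word N k l y - e_word N k l y * e_word N i j x -
     ((if k = j then e_word N i l (wj x y) else 0) - (if i = l then e_word N k j (wj y x) else 0)))"

text \<open>Leibniz rule along the second word. Besides the leading terms there are two others: the
  bracket with its first letter \<open>y\<close> leaves \<open>E_kj(yx) e_il(ys)\<close>, and a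
  leading term for \<open>ys\<close> contracts with \<open>E_ka(y)\<close> to \<open>E_kj(y)\<close>
  times \<open>e_il\<close> of \<open>x\<close> joined to \<open>ys\<close>. Both have the shape
  \<open>prod_kj_il\<close>.\<close>

lemma bracket_defect_single: "x \<in> carrier A \<Longrightarrow> y \<in> W \<Longrightarrow> y \<noteq> [] \<Longrightarrow> fam_closure (prods_kj_il (dg y)) (bracket_defect [x] y)"
proof (induction y)
  case (Cons y ys)
  show ?case
  proof (cases "ys = []")
    case True
    show ?thesis
    proof (rule fam_closure.eqv[OF fam_closure.zero])
      fix N i j k l :: nat assume r: "i \<in> {1..N}" "j \<in> {1..N}" "k \<in> {1..N}" "l \<in> {1..N}"
      interpret gl_alg A N ..
      have "(if k = j then w1 i l (x \<otimes> y) else 0) - (if i = l then w1 k j (y \<otimes> x) else 0) -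
         ((if k = j then w1 i l (x \<otimes> y) else 0) - (if i = l then w1 k j (y \<otimes> x) else 0)) \<approx>
        w1 i j x * w1 k l y - w1 k l y * w1 i j x - ((if k = j then w1 i l (x \<otimes> y) else 0) - (if i = l then w1 k j (y \<otimes> x) else 0))"
        by (rule U.eqv_diff[OF U.eqv_sym[OF w1_comm] U.eqv_refl]) (use Cons.prems r in auto)
      moreover have "bracket_defect [x] (y # ys) N i j k l =
          w1 i j x * w1 k l y - w1 k l y * w1 i j x - ((if k = j then w1 i l (x \<otimes> y) else 0) - (if i = l then w1 k j (y \<otimes> x) else 0))"
        using True r by (simp add: bracket_defect_def e_word_single word_join_def del: e_word.simps)
      ultimately show "0 \<approx> bracket_defect [x] (y # ys) N i j k l"
        by (simp only: diff_self)
    qed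
  next
    case False
    have IH: "fam_closure (prods_kj_il (dg ys)) (bracket_defect [x] ys)" using Cons False by auto
    have dg: "dg (y # ys) = dg ys + 1" using False by (cases ys) (auto simp: dg_def)
    let ?\<Phi> = "\<lambda>G N i j k l. \<Sum>a=1..N. wd [EE k a y] * G N i j a l"
    have 1: "fam_closure (prods_kj_il (dg (y # ys))) (?\<Phi> (bracket_defect [x] ys))"
    proof (rule fam_closure_map[OF IH, where \<Phi> = ?\<Phi>])
      fix G assume "G \<in> prods_kj_il (dg ys)"
      then obtain u v where uv: "u \<in> W" "v \<in> W" "dg u + dg v < dg ys" "G = prod_kj_il u v" by (auto simp: prods_kj_il_def)
      have "fam_closure (prods_kj_il (dg (y # ys))) (prod_kj_il (y # u) v)"
        by (rule fam_closure.base[OF prods_kj_ilI]) (use uv Cons.prems dg in \<open>auto simp: dg_def\<close>)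
      then show "fam_closure (prods_kj_il (dg (y # ys))) (?\<Phi> G)"
        by (rule fam_closure_eq) (simp add: uv(4) prod_kj_il_def sum_distrib_right mult.assoc)
    next
      fix G G' :: "'a fam" and N i j k l :: nat
      assume r: "i \<in> {1..N}" "j \<in> {1..N}" "k \<in> {1..N}" "l \<in> {1..N}"
        and eq: "\<And>i j k l. \<lbrakk>i \<in> {1..N}; j \<in> {1..N}; k \<in> {1..N}; l \<in> {1..N}\<rbrakk> \<Longrightarrow> eqN N (G N i j k l) (G' N i j k l)"
      interpret gl_alg A N ..
      show "?\<Phi> G N i j k l \<approx> ?\<Phi> G' N i j k l"
        using Cons.prems r by (intro U.eqv_sum U.eqv_lmult eq w1_F) auto
    qed (simp_all add: distrib_left sum.distrib)
    have 2: "fam_closure (prods_kj_il (dg (y # ys))) (prod_kj_il [y] (wj [x] ys))" "fam_closure (prods_kj_il (dg (y # ys))) (prod_kj_il [y \<otimes> x] ys)"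
      using Cons.prems False dg wj_dg[of "[x]" ys] wj_W[of "[x]" ys]
      by (auto intro!: fam_closure.base prods_kj_ilI simp: dg_def alg_m_closed)
    show ?thesis
    proof (rule fam_closure.eqv[OF fam_closure.add[OF fam_closure_diff[OF 2] 1]])
      fix N i j k l :: nat assume r: "i \<in> {1..N}" "j \<in> {1..N}" "k \<in> {1..N}" "l \<in> {1..N}"
      interpret gl_alg A N ..
      \<comment> \<open>The relation between two matrix units; the difference of the two sides is
        the sum of these elements of the ideal, multiplied by paths.\<close>
      let ?Z = "\<lambda>a. w1 i j x * w1 k a y - w1 k a y * w1 i j x -
         ((if k = j then w1 i a (x \<otimes> y) else 0) - (if i = a then w1 k j (y \<otimes> x) else 0))"
      have s1: "(\<Sum>a=1..N. (if k = j then w1 i a (x \<otimes> y) else 0) * e_word N a l ys) = (if k = j then e_word N i l (wj [x] (y # ys)) else 0)"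
        by (simp add: wj_simps)
      have s2: "(\<Sum>a=1..N. (if i = a then w1 k j (y \<otimes> x) else 0) * e_word N a l ys) = w1 k j (y \<otimes> x) * e_word N i l ys"
        using sum_delta_l[of "{1..N}" i "\<lambda>_. w1 k j (y \<otimes> x)" "\<lambda>a. e_word N a l ys"] r by simp
      have s3: "(\<Sum>a=1..N. w1 k a y * (if a = j then e_word N i l (wj [x] ys) else 0)) = w1 k j y * e_word N i l (wj [x] ys)"
        using sum_delta_r[of "{1..N}" "\<lambda>a. w1 k a y" j "\<lambda>_. e_word N i l (wj [x] ys)"] r by (simp add: eq_commute[of _ j])
      have s4: "(\<Sum>a=1..N. w1 k a y * (if i = l then e_word N a j (wj ys [x]) else 0)) = (if i = l then e_word N k j (wj (y # ys) [x]) else 0)"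
        using False by (simp add: wj_simps)
      have "bracket_defect [x] (y # ys) N i j k l - (w1 k j y * e_word N i l (wj [x] ys) - w1 k j (y \<otimes> x) * e_word N i l ys + ?\<Phi> (bracket_defect [x] ys) N i j k l)
        = (\<Sum>a=1..N. ?Z a * e_word N a l ys)"
        unfolding bracket_defect_def s1[symmetric] s2[symmetric] s3[symmetric] s4[symmetric] e_word_single[OF r(2)]
        by (simp add: sum_distrib_left sum_distrib_right sum.distrib[symmetric] sum_subtractf[symmetric] algebra_simps)
      also have "\<dots> \<in> U.I"
        using w1_comm[of x y i j k] Cons.prems r by (intro U.I_sum U.I_rmult e_word_FA) (auto simp: U.eqv_def)
      finally have "bracket_defect [x] (y # ys) N i j k l \<approx> w1 k j y * e_word N i l (wj [x] ys) - w1 k j (y \<otimes> x) * e_word N i l ys + ?\<Phi> (bracket_defect [x] ys) N i j k l"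
        by (simp add: U.eqv_def)
      then show "prod_kj_il [y] (wj [x] ys) N i j k l - prod_kj_il [y \<otimes> x] ys N i j k l + ?\<Phi> (bracket_defect [x] ys) N i j k l \<approx> bracket_defect [x] (y # ys) N i j k l"
        unfolding prod_kj_il_def e_word_single[OF r(2)] by (rule U.eqv_sym)
    qed
  qed
qed simp

text \<open>A path from \<open>k\<close> to \<open>l\<close> interrupted by a factor
  \<open>e_ij(q)\<close>. Such sums arise when a product of two generators is multiplied by a
  further path. They must be reduced to products of two generators, because a summation over
  \<open>a\<close> up to \<open>N\<close> has no counterpart in \<open>T\<close>.\<close>

definition triple_sum :: "'a list \<Rightarrow> 'a list \<Rightarrow> 'a list \<Rightarrow> 'a fam" where
  "triple_sum p q b = (\<lambda>N i j k l. \<Sum>a=1..N. e_word N k a p * e_word N i j q * e_word N a l b)"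

definition \<Phi>R :: "'a list \<Rightarrow> 'a fam \<Rightarrow> 'a fam" where
  "\<Phi>R b G = (\<lambda>N i j k l. \<Sum>a=1..N. G N k a i j * e_word N a l b)"

definition \<Phi>L :: "'a \<Rightarrow> 'a fam \<Rightarrow> 'a fam" where
  "\<Phi>L x G = (\<lambda>N i j k l. \<Sum>a=1..N. wd [EE i a x] * G N a j k l)"

text \<open>Multiplication by a path on the right lengthens a word for two of the four shapes, by
  \<open>e_word_append\<close>, and gives triple sums for the other two. Concatenation can raise the
  degree by one more than \<open>dg b\<close>, which is the summand 1.\<close>

lemma \<Phi>R_Good:
  assumes triple_sum: "\<And>p q. \<lbrakk>p \<in> W; q \<in> W; dg p + dg q < E\<rbrakk> \<Longrightarrow> Good (dg p + dg q + dg b + 2) (triple_sum p q b)"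
    and b: "b \<in> W" and G: "Good E G"
  shows "Good (E + dg b + 1) (\<Phi>R b G)"
proof (rule fam_closure_map[OF G, where \<Phi> = "\<Phi>R b"])
  fix G assume "G \<in> all_prods E"
  then obtain u v where uv: "u \<in> W" "v \<in> W" "dg u + dg v < E" and G: "G = prod_kj_il u v \<or> G = prod_il_kj u v \<or> G = prod_ij_kl u v \<or> G = prod_kl_ij u v"
    by (elim all_prods_cases) auto
  have t: "Good (E + dg b + 1) (triple_sum u v b)" by (rule Good_mono[OF triple_sum[OF uv]]) (use uv in auto)
  have ub: "u @ b \<in> W" "dg v + dg (u @ b) < E + dg b + 1" using uv b dg_append[of u b] by auto
  show "Good (E + dg b + 1) (\<Phi>R b G)" using G
  proof (elim disjE)
    assume "G = prod_kj_il u v"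
    then show ?thesis by (intro fam_closure_eq[OF Good_swap_ik[OF t]]) (simp add: \<Phi>R_def prod_kj_il_def triple_sum_def)
  next
    assume "G = prod_ij_kl u v"
    then show ?thesis by (intro fam_closure_eq[OF t]) (simp add: \<Phi>R_def prod_ij_kl_def triple_sum_def)
  next
    assume "G = prod_il_kj u v"
    then show ?thesis
      by (intro fam_closure_eq[OF Good_base(1)[OF uv(2) ub]]) (simp add: \<Phi>R_def prod_kj_il_def prod_il_kj_def e_word_append sum_distrib_left mult.assoc)
  next
    assume "G = prod_kl_ij u v"
    then show ?thesis
      by (intro fam_closure_eq[OF Good_base(3)[OF uv(2) ub]]) (simp add: \<Phi>R_def prod_ij_kl_def prod_kl_ij_def e_word_append sum_distrib_left mult.assoc)
  qed
next
  fix G G' :: "'a fam" and N i j k l :: nat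
  assume r: "i \<in> {1..N}" "j \<in> {1..N}" "k \<in> {1..N}" "l \<in> {1..N}"
    and eq: "\<And>i j k l. \<lbrakk>i \<in> {1..N}; j \<in> {1..N}; k \<in> {1..N}; l \<in> {1..N}\<rbrakk> \<Longrightarrow> eqN N (G N i j k l) (G' N i j k l)"
  interpret gl_alg A N ..
  show "\<Phi>R b G N i j k l \<approx> \<Phi>R b G' N i j k l"
    unfolding \<Phi>R_def using r b by (intro U.eqv_sum U.eqv_rmult eq e_word_FA) auto
qed (simp_all add: \<Phi>R_def distrib_right sum.distrib)

lemma \<Phi>L_Good:
  assumes triple_sum: "\<And>p q b. \<lbrakk>p \<in> W; q \<in> W; b \<in> W; dg p + dg q < E\<rbrakk> \<Longrightarrow> Good (dg p + dg q + dg b + 2) (triple_sum p q b)"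
    and x: "x \<in> carrier A" and G: "Good E G"
  shows "Good (E + 1) (\<Phi>L x G)"
proof (rule fam_closure_map[OF G, where \<Phi> = "\<Phi>L x"])
  fix G assume "G \<in> all_prods E"
  then obtain u v where uv: "u \<in> W" "v \<in> W" "dg u + dg v < E" and G: "G = prod_kj_il u v \<or> G = prod_il_kj u v \<or> G = prod_ij_kl u v \<or> G = prod_kl_ij u v"
    by (elim all_prods_cases) auto
  have xW: "[x] \<in> W" "dg [x] = 0" using x by (auto simp: dg_def)
  have t: "Good (E + 1) (triple_sum [x] u v)" "Good (E + 1) (triple_sum [x] v u)"
    using triple_sum[OF xW(1) uv(1,2)] triple_sum[OF xW(1) uv(2,1)] uv(3) xW(2) by (auto elim!: Good_mono)
  have dx: "dg (x # u) \<le> dg u + 1" "dg (x # v) \<le> dg v + 1" by (auto simp: dg_def)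
  show "Good (E + 1) (\<Phi>L x G)" using G
  proof (elim disjE)
    assume "G = prod_kj_il u v"
    then show ?thesis by (intro fam_closure_eq[OF Good_swap_ik[OF t(1)]]) (simp add: \<Phi>L_def prod_kj_il_def triple_sum_def e_word_single mult.assoc del: e_word.simps)
  next
    assume "G = prod_kl_ij u v"
    then show ?thesis by (intro fam_closure_eq[OF Good_swap[OF t(2)]]) (simp add: \<Phi>L_def prod_kl_ij_def triple_sum_def e_word_single mult.assoc del: e_word.simps)
  next
    assume "G = prod_il_kj u v"
    moreover have b: "Good (E + 1) (prod_il_kj u (x # v))" using uv x dx by (intro Good_base) auto
    ultimately show ?thesis by (intro fam_closure_eq[OF b]) (simp add: \<Phi>L_def prod_il_kj_def sum_distrib_right mult.assoc)
  next
    assume "G = prod_ij_kl u v"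
    moreover have b: "Good (E + 1) (prod_ij_kl (x # u) v)" using uv x dx by (intro Good_base) auto
    ultimately show ?thesis by (intro fam_closure_eq[OF b]) (simp add: \<Phi>L_def prod_ij_kl_def sum_distrib_right mult.assoc)
  qed
next
  fix G G' :: "'a fam" and N i j k l :: nat
  assume r: "i \<in> {1..N}" "j \<in> {1..N}" "k \<in> {1..N}" "l \<in> {1..N}"
    and eq: "\<And>i j k l. \<lbrakk>i \<in> {1..N}; j \<in> {1..N}; k \<in> {1..N}; l \<in> {1..N}\<rbrakk> \<Longrightarrow> eqN N (G N i j k l) (G' N i j k l)"
  interpret gl_alg A N ..
  show "\<Phi>L x G N i j k l \<approx> \<Phi>L x G' N i j k l"
    unfolding \<Phi>L_def using r x by (intro U.eqv_sum U.eqv_lmult eq w1_F) auto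
qed (simp_all add: \<Phi>L_def distrib_left sum.distrib)

text \<open>Move \<open>e_ij(q)\<close> to the front. The leading terms of the commutator of
  \<open>p\<close> and \<open>q\<close> contract with \<open>b\<close> to products of two factors,
  and its defect leads to triple sums with smaller \<open>dg p + dg q\<close>. The commutator
  statement is assumed below the bound \<open>Dm\<close> only, so that it can be supplied by the
  induction in \<open>bracket_defect_Good\<close>. The summand 2 accounts for the concatenation and
  for the strict bound in \<open>Good\<close>.\<close>

lemma triple_sum_Good:
  assumes HC: "\<And>u v. \<lbrakk>u \<in> W; v \<in> W; u \<noteq> []; v \<noteq> []; dg u + dg v < Dm\<rbrakk> \<Longrightarrow> Good (dg u + dg v) (bracket_defect u v)"
  shows "\<lbrakk>p \<in> W; q \<in> W; b \<in> W; dg p + dg q < Dm\<rbrakk> \<Longrightarrow> Good (dg p + dg q + dg b + 2) (triple_sum p q b)"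
proof (induction "dg p + dg q" arbitrary: p q b rule: less_induct)
  case less
  let ?D = "dg p + dg q + dg b + 2"
  have pb: "p @ b \<in> W" "dg q + dg (p @ b) < ?D" using less.prems dg_append[of p b] by auto
  have b1: "Good ?D (prod_ij_kl q (p @ b))" using Good_base(3)[OF less.prems(2) pb] .
  consider "p = []" | "q = []" | "p \<noteq> []" "q \<noteq> []" by blast
  then show ?case
  proof cases
    case 1
    show ?thesis
    proof (rule fam_closure_eq[OF b1])
      fix N i j k l :: nat assume r: "k \<in> {1..N}"
      show "triple_sum p q b N i j k l = prod_ij_kl q (p @ b) N i j k l"
        using sum_delta_l[of "{1..N}" k "\<lambda>_. 1" "\<lambda>a. e_word N i j q * e_word N a l b"] r 1
        by (simp add: triple_sum_def prod_ij_kl_def mult.assoc)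
    qed
  next
    case 2
    show ?thesis
    proof (rule fam_closure_eq[OF b1])
      fix N i j k l :: nat assume r: "k \<in> {1..N}"
      show "triple_sum p q b N i j k l = prod_ij_kl q (p @ b) N i j k l"
        using r 2 by (simp add: triple_sum_def prod_ij_kl_def e_word_append)
    qed
  next
    case 3
    have B: "Good (dg p + dg q) (bracket_defect p q)" using HC less.prems 3 by blast
    have R: "Good ?D (\<Phi>R b (bracket_defect p q))"
      using \<Phi>R_Good[OF less.hyps less.prems(3) B] less.prems by (auto elim!: Good_mono)
    have b2: "Good ?D (prod_kj_il (wj p q) b)" using wj_W[of p q] wj_dg[of p q] less.prems 3 by (intro Good_base) auto
    \<comment> \<open>The empty word supplies the factor that is 1 for \<open>k = j\<close> and 0
      otherwise.\<close>
    have b3: "Good ?D (prod_kj_il [] (wj q p @ b))"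
      using wj_W[of q p] wj_dg[of q p] dg_append[of "wj q p" b] less.prems 3 by (intro Good_base) (auto simp: dg_def)
    show ?thesis
    proof (rule fam_closure_eq[OF fam_closure.add[OF fam_closure.add[OF b1 fam_closure_diff[OF b2 b3]] R]])
      fix N i j k l :: nat assume r: "i \<in> {1..N}" "j \<in> {1..N}" "k \<in> {1..N}" "l \<in> {1..N}"
      have s1: "(\<Sum>a=1..N. (if i = a then e_word N k j (wj p q) else 0) * e_word N a l b) = prod_kj_il (wj p q) b N i j k l"
        using sum_delta_l[of "{1..N}" i "\<lambda>_. e_word N k j (wj p q)" "\<lambda>a. e_word N a l b"] r by (simp add: prod_kj_il_def)
      have s2: "(\<Sum>a=1..N. (if k = j then e_word N i a (wj q p) else 0) * e_word N a l b) = prod_kj_il [] (wj q p @ b) N i j k l"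
        using r by (simp add: prod_kj_il_def e_word_append)
      have s3: "(\<Sum>a=1..N. e_word N i j q * e_word N k a p * e_word N a l b) = prod_ij_kl q (p @ b) N i j k l"
        using r by (simp add: prod_ij_kl_def e_word_append sum_distrib_left mult.assoc)
      show "triple_sum p q b N i j k l = prod_ij_kl q (p @ b) N i j k l + (prod_kj_il (wj p q) b N i j k l - prod_kj_il [] (wj q p @ b) N i j k l) + \<Phi>R b (bracket_defect p q) N i j k l"
        unfolding s1[symmetric] s2[symmetric] s3[symmetric] triple_sum_def \<Phi>R_def bracket_defect_def sum.distrib[symmetric] sum_subtractf[symmetric]
        by (rule sum.cong[OF refl]) (simp add: algebra_simps)
    qed
  qed
qed

text \<open>Leibniz rule along \<open>x\<close>, with its first letter \<open>z\<close> split off.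
  The brackets of \<open>x'\<close> and of \<open>[z]\<close> with \<open>y\<close> are known, and
  \<open>\<Phi>L\<close> and \<open>\<Phi>R\<close> multiply them by the missing path. That this
  stays within products of two factors is \<open>triple_sum_Good\<close>, whose assumption is the
  present induction hypothesis.\<close>

theorem bracket_defect_Good: "\<lbrakk>x \<in> W; y \<in> W; x \<noteq> []; y \<noteq> []\<rbrakk> \<Longrightarrow> Good (dg x + dg y) (bracket_defect x y)"
proof (induction "dg x + dg y" arbitrary: x y rule: less_induct)
  case less
  obtain z x' where x: "x = z # x'" using less.prems(3) by (cases x) auto
  show ?case
  proof (cases "x' = []")
    case True
    then show ?thesis using bracket_defect_single[of z y] less.prems x
      by (auto simp: dg_def all_prods_def intro: fam_closure_mono)
  next
    case False
    have zx: "z \<in> carrier A" "x' \<in> W" using less.prems x by auto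
    have dx: "dg x = dg x' + 1" using x False by (cases x') (auto simp: dg_def)
    have triple_sum: "Good (dg p + dg q + dg b + 2) (triple_sum p q b)" if "p \<in> W" "q \<in> W" "b \<in> W" "dg p + dg q < dg x + dg y" for p q b
      by (rule triple_sum_Good[OF less.hyps]) (use that in auto)
    have B1: "Good (dg x' + dg y) (bracket_defect x' y)" using less.hyps[of x' y] less.prems zx False dx by simp
    have L: "Good (dg x + dg y) (\<Phi>L z (bracket_defect x' y))"
      using \<Phi>L_Good[OF triple_sum zx(1) B1] dx by simp
    have B2: "Good (dg y) (bracket_defect [z] y)"
      using bracket_defect_single[of z y] less.prems zx by (auto simp: all_prods_def intro: fam_closure_mono)
    have R: "Good (dg x + dg y) (\<lambda>N i j k l. \<Phi>R x' (bracket_defect [z] y) N k l i j)"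
      using Good_swap[OF \<Phi>R_Good[OF triple_sum zx(2) B2]] dx zx by (simp add: add.commute)
    \<comment> \<open>\<open>b1\<close> and \<open>b2\<close> are the leading terms in which the
      summation index is contracted: \<open>a = l\<close> in the first bracket and
      \<open>a = k\<close> in the second. They are products of lower degree.\<close>
    have b1: "Good (dg x + dg y) (prod_il_kj (wj y x') [z])"
      using wj_W[of y x'] wj_dg[of y x'] less.prems zx False dx by (intro Good_base) (auto simp: dg_def)
    have b2: "Good (dg x + dg y) (prod_il_kj x' (wj [z] y))"
      using wj_W[of "[z]" y] wj_dg[of "[z]" y] less.prems zx False dx by (intro Good_base) (auto simp: dg_def)
    show ?thesis
    proof (rule fam_closure_eq[OF fam_closure.add[OF fam_closure_diff[OF L b1] fam_closure.add[OF R b2]]])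
      fix N i j k l :: nat assume r: "i \<in> {1..N}" "j \<in> {1..N}" "k \<in> {1..N}" "l \<in> {1..N}"
      have s1: "(\<Sum>a=1..N. wd [EE i a z] * (if k = j then e_word N a l (wj x' y) else 0)) = (if k = j then e_word N i l (wj x y) else 0)"
        using x False by (simp add: wj_simps)
      have s2: "(\<Sum>a=1..N. wd [EE i a z] * (if a = l then e_word N k j (wj y x') else 0)) = prod_il_kj (wj y x') [z] N i j k l"
        using sum_delta_r[of "{1..N}" "\<lambda>a. wd [EE i a z]" l "\<lambda>_. e_word N k j (wj y x')"] r
        by (simp add: prod_il_kj_def e_word_single eq_commute[of _ l] del: e_word.simps)
      have s3: "(\<Sum>a=1..N. (if k = a then e_word N i l (wj [z] y) else 0) * e_word N a j x') = prod_il_kj x' (wj [z] y) N i j k l"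
        using sum_delta_l[of "{1..N}" k "\<lambda>_. e_word N i l (wj [z] y)" "\<lambda>a. e_word N a j x'"] r by (simp add: prod_il_kj_def)
      have s4: "(\<Sum>a=1..N. (if i = l then e_word N k a (wj y [z]) else 0) * e_word N a j x') = (if i = l then e_word N k j (wj y x) else 0)"
        using x False r by (simp add: wj_simps(3) e_word_append)
      have s5: "e_word N i j x = (\<Sum>a=1..N. wd [EE i a z] * e_word N a j x')" by (simp add: x)
      have s6: "\<Phi>R x' (bracket_defect [z] y) N k l i j = (\<Sum>a=1..N. (wd [EE i a z] * e_word N k l y - e_word N k l y * wd [EE i a z] -
          ((if k = a then e_word N i l (wj [z] y) else 0) - (if i = l then e_word N k a (wj y [z]) else 0))) * e_word N a j x')"
        unfolding \<Phi>R_def bracket_defect_def by (rule sum.cong[OF refl]) (simp add: e_word_single del: e_word.simps)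
      show "bracket_defect x y N i j k l = \<Phi>L z (bracket_defect x' y) N i j k l - prod_il_kj (wj y x') [z] N i j k l +
          (\<Phi>R x' (bracket_defect [z] y) N k l i j + prod_il_kj x' (wj [z] y) N i j k l)"
        unfolding s2[symmetric] s3[symmetric] s6
        unfolding \<Phi>L_def bracket_defect_def s5 s1[symmetric] s4[symmetric] sum_distrib_left sum_distrib_right
        unfolding sum.distrib[symmetric] sum_subtractf[symmetric]
        by (rule sum.cong[OF refl]) (simp add: algebra_simps)
    qed
  qed
qed

end

section \<open>Dependence on the parameter\<close>

definition polynomial_fun :: "(complex \<Rightarrow> complex) \<Rightarrow> bool" where "polynomial_fun g \<longleftrightarrow> (\<exists>q. \<forall>c. g c = poly q c)"

lemma polynomial_fun_const [simp]: "polynomial_fun (\<lambda>c. a)"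
  unfolding polynomial_fun_def by (rule exI[of _ "[:a:]"]) simp

lemma polynomial_fun_id [simp]: "polynomial_fun (\<lambda>c. c)"
  unfolding polynomial_fun_def by (rule exI[of _ "[:0, 1:]"]) simp

lemma polynomial_fun_add: "polynomial_fun f \<Longrightarrow> polynomial_fun g \<Longrightarrow> polynomial_fun (\<lambda>c. f c + g c)"
  unfolding polynomial_fun_def by (metis poly_add)

lemma polynomial_fun_mult: "polynomial_fun f \<Longrightarrow> polynomial_fun g \<Longrightarrow> polynomial_fun (\<lambda>c. f c * g c)"
  unfolding polynomial_fun_def by (metis poly_mult)

lemma polynomial_fun_sum: "(\<And>x. x \<in> S \<Longrightarrow> polynomial_fun (f x)) \<Longrightarrow> polynomial_fun (\<lambda>c. \<Sum>x\<in>S. f x c)"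
  by (induction S rule: infinite_finite_induct) (auto intro: polynomial_fun_add)

lemma polynomial_fun_zero:
  assumes "polynomial_fun g" and 0: "\<And>n::nat. g (of_nat n) = 0"
  shows "g c = 0"
proof -
  obtain q where q: "\<And>c. g c = poly q c" using assms(1) by (auto simp: polynomial_fun_def)
  have "q = 0"
  proof (rule ccontr)
    assume "q \<noteq> 0"
    then have "finite {x. poly q x = 0}" by (rule poly_roots_finite)
    moreover have "range (of_nat :: nat \<Rightarrow> complex) \<subseteq> {x. poly q x = 0}" using 0 q by auto
    ultimately have "finite (range (of_nat :: nat \<Rightarrow> complex))" by (rule finite_subset[rotated])
    then show False using range_inj_infinite[OF inj_of_nat[where 'a = complex]] by simp
  qed
  then show ?thesis using q by simp
qed

context complex_algebra
begin

text \<open>The recursion looks at the first part of a composition: it is 1, or the first two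
  letters are merged at the price of a factor \<open>c\<close>. The agreement with the sum over
  compositions is \<open>comp_sum\<close>; the recursive form displays how \<open>N\<close> can be
  traded for \<open>c\<close>.\<close>

fun t_word :: "nat \<Rightarrow> complex \<Rightarrow> nat \<Rightarrow> nat \<Rightarrow> 'a list \<Rightarrow> 'a mfa" where
  "t_word N c i j [] = (if i = j then 1 else 0)"
| "t_word N c i j [x] = wd [EE i j x]"
| "t_word N c i j (x # y # zs) = (\<Sum>a=1..N. wd [EE i a x] * t_word N c a j (y # zs)) + cst c * t_word N c i j ((x \<otimes> y) # zs)"

lemma t_word_FA: "x \<in> W \<Longrightarrow> i \<in> {1..N} \<Longrightarrow> j \<in> {1..N} \<Longrightarrow> t_word N c i j x \<in> FA (carrier (gl N A))"
proof (induction N c i j x rule: t_word.induct)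
  case (3 N c i j x y zs)
  then show ?case by (auto intro!: FA_add FA_sum FA_mult FA_wd1 simp: alg_m_closed)
qed auto

lemma t_word_0: "j \<in> {1..N} \<Longrightarrow> t_word N 0 i j x = e_word N i j x"
proof (induction N "0::complex" i j x rule: t_word.induct)
  case (2 N i j x)
  then show ?case by (simp add: e_word_single del: e_word.simps)
qed simp_all

definition ev :: "nat \<Rightarrow> complex \<Rightarrow> (nat \<times> nat \<times> 'a list) fa \<Rightarrow> 'a mfa" where
  "ev N c = subst (\<lambda>(i, j, x). t_word N c i j x)"

abbreviation "lab d \<equiv> t_index d A"

lemma ev_simps: "ev N c (p + q) = ev N c p + ev N c q" "ev N c (p * q) = ev N c p * ev N c q"
  "ev N c (p - q) = ev N c p - ev N c q" "ev N c 0 = 0" "ev N c 1 = 1" "ev N c (cst a) = cst a" "ev N c (- p) = - ev N c p"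
  "ev N c (sum f S) = (\<Sum>x\<in>S. ev N c (f x))"
  by (simp_all add: ev_def subst_add subst_mult subst_diff subst_cst subst_uminus subst_sum)

lemma ev_wd1: "ev N c (wd [(i, j, x)]) = t_word N c i j x"
  by (simp add: ev_def subst_wd)

lemma ev_FA: "p \<in> FA (lab d) \<Longrightarrow> d \<le> N \<Longrightarrow> ev N c p \<in> FA (carrier (gl N A))"
  unfolding ev_def by (erule subst_FA) (auto simp: t_index_def intro!: t_word_FA)

end

section \<open>Trading the size N for the parameter c\<close>

locale ambient = complex_algebra A for A :: "(complex, 'a) module" (structure) +
  fixes m K :: nat
begin

sublocale ma: lie_action "gl m A" "gl m A" "mat_mult m A" by (rule lie_action_gl) simp

abbreviation "Sm \<equiv> slots (carrier (gl m A))"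
abbreviation "X \<equiv> acts (mat_mult m A) K"

text \<open>Forms are compared only on slots filled from gl(m), where the laws of the algebra
  hold.\<close>

definition eqS :: "(nat \<Rightarrow> nat \<Rightarrow> 'a) form \<Rightarrow> (nat \<Rightarrow> nat \<Rightarrow> 'a) form \<Rightarrow> bool" (infix "\<doteq>" 50)
  where "H \<doteq> H' \<longleftrightarrow> (\<forall>as\<in>Sm. H as = H' as)"

abbreviation "Z \<equiv> (\<lambda>as. 0) :: (nat \<Rightarrow> nat \<Rightarrow> 'a) form"

lemma eqS_refl [simp]: "H \<doteq> H" by (simp add: eqS_def)
lemma eqS_trans [trans]: "H \<doteq> H' \<Longrightarrow> H' \<doteq> H'' \<Longrightarrow> H \<doteq> H''" by (simp add: eqS_def)

lemma X_cong: "H \<doteq> H' \<Longrightarrow> p \<in> FA (carrier (gl m A)) \<Longrightarrow> X p H \<doteq> X p H'"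
proof -
  assume H: "H \<doteq> H'" and p: "p \<in> FA (carrier (gl m A))"
  show ?thesis unfolding eqS_def
  proof
    fix as assume as: "as \<in> Sm"
    show "X p H as = X p H' as" using p
      by (induction p rule: FA_induct)
        (use H as in \<open>auto simp: acts_add acts_single eqS_def intro!: ma.acts_cong_slots\<close>)
  qed
qed

lemma X_lin: "X p (\<lambda>as. H as + H' as) as = X p H as + X p H' as" 
  "X p (\<lambda>as. c * H as) as = c * X p H as" "X p Z as = 0"
proof -
  have 1: "actw P K w (\<lambda>as. H as + H' as) as = actw P K w H as + actw P K w H' as" for P w and as :: "nat \<Rightarrow> (nat \<Rightarrow> nat \<Rightarrow> 'a) option"
    using actw_linear[of P K w "\<lambda>x. 1" "\<lambda>x. if x then H' else H" "UNIV" as] by (simp add: UNIV_bool)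
  show "X p (\<lambda>as. H as + H' as) as = X p H as + X p H' as"
    by (simp add: acts_def lin_ext_def 1 distrib_left sum.distrib)
  have 2: "actw P K w (\<lambda>as. c * H as) as = c * actw P K w H as" for P w c and as :: "nat \<Rightarrow> (nat \<Rightarrow> nat \<Rightarrow> 'a) option"
    using actw_linear[of P K w "\<lambda>x. c" "\<lambda>x. H" "{()}" as] by simp
  have 3: "X p (\<lambda>as. c * H as) as = c * X p H as" for c
    by (simp add: 2 acts_def lin_ext_def sum_distrib_left mult.left_commute)
  show "X p (\<lambda>as. c * H as) as = c * X p H as" by (rule 3)
  have "X p (\<lambda>as. 0 * H as) as = 0 * X p H as" by (rule 3)
  then show "X p Z as = 0" by simp
qed

lemma X_Z: "H \<doteq> Z \<Longrightarrow> p \<in> FA (carrier (gl m A)) \<Longrightarrow> X p H \<doteq> Z"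
  using X_cong[of H Z p] X_lin(3)[of p] by (simp add: eqS_def)

lemma X_ideal: "p \<in> uea_ideal (gl n A) \<Longrightarrow> n \<le> m \<Longrightarrow> multilinear (gl m A) K H \<Longrightarrow> X p H \<doteq> Z"
proof -
  assume "n \<le> m"
  then interpret lie_action "gl n A" "gl m A" "mat_mult m A" by (rule lie_action_gl)
  show "p \<in> uea_ideal (gl n A) \<Longrightarrow> multilinear (gl m A) K H \<Longrightarrow> X p H \<doteq> Z"
    unfolding eqS_def using ideal_acts_zero by blast
qed

text \<open>For such \<open>H\<close> the result of applying an element of U(gl(n)) depends only on
  its class modulo the left ideal generated by the last column.\<close>

definition col_kills :: "nat \<Rightarrow> (nat \<Rightarrow> nat \<Rightarrow> 'a) form \<Rightarrow> bool" where
  "col_kills n H \<longleftrightarrow> multilinear (gl m A) K H \<and> (\<forall>i\<in>{1..n}. \<forall>x\<in>carrier A. X (wd [EE i n x]) H \<doteq> Z)"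

lemma w1m: "x \<in> carrier A \<Longrightarrow> i \<in> {1..n} \<Longrightarrow> j \<in> {1..n} \<Longrightarrow> n \<le> m \<Longrightarrow> wd [EE i j x] \<in> FA (carrier (gl m A))"
  by (rule FA_wd1) (auto intro!: EE_cl)

lemma comm_act:
  assumes n: "n \<le> m" and H: "multilinear (gl m A) K H"
    and r: "x \<in> carrier A" "y \<in> carrier A" "i \<in> {1..n}" "j \<in> {1..n}" "k \<in> {1..n}" "l \<in> {1..n}" and as: "as \<in> Sm"
  shows "X (wd [EE i j x]) (X (wd [EE k l y]) H) as = X (wd [EE k l y]) (X (wd [EE i j x]) H) as +
    (if k = j then X (wd [EE i l (x \<otimes> y)]) H as else 0) - (if i = l then X (wd [EE k j (y \<otimes> x)]) H as else 0)"
proof -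
  interpret gl_alg A n ..
  have "X (w1 i j x * w1 k l y - w1 k l y * w1 i j x - ((if k = j then w1 i l (x \<otimes> y) else 0) - (if i = l then w1 k j (y \<otimes> x) else 0))) H \<doteq> Z"
    using w1_comm[OF r] by (intro X_ideal[OF _ n H]) (simp add: U.eqv_def)
  then have "X (w1 i j x * w1 k l y - w1 k l y * w1 i j x - ((if k = j then w1 i l (x \<otimes> y) else 0) - (if i = l then w1 k j (y \<otimes> x) else 0))) H as = 0"
    using as by (simp add: eqS_def)
  then show ?thesis unfolding acts_diff acts_mult by (auto simp: algebra_simps split: if_splits)
qed

lemma col_kills_multilinear: "col_kills n H \<Longrightarrow> multilinear (gl m A) K H" by (simp add: col_kills_def)

lemma col_kills_0: "col_kills n H \<Longrightarrow> i \<in> {1..n} \<Longrightarrow> x \<in> carrier A \<Longrightarrow> as \<in> Sm \<Longrightarrow> X (wd [EE i n x]) H as = 0"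
  by (simp add: col_kills_def eqS_def)

lemma col_kills_add: "col_kills n H \<Longrightarrow> col_kills n H' \<Longrightarrow> col_kills n (\<lambda>as. H as + H' as)"
  unfolding col_kills_def eqS_def by (auto simp: X_lin multilinear_def algebra_simps)

lemma col_kills_smult: "col_kills n H \<Longrightarrow> col_kills n (\<lambda>as. c * H as)"
  unfolding col_kills_def eqS_def by (auto simp: X_lin multilinear_def algebra_simps)

lemma col_kills_zero: "col_kills n Z"
  unfolding col_kills_def eqS_def by (auto simp: X_lin multilinear_def)

lemma col_kills_sum: "(\<And>a. a \<in> S \<Longrightarrow> col_kills n (H a)) \<Longrightarrow> col_kills n (\<lambda>as. \<Sum>a\<in>S. H a as)"
  by (induction S rule: infinite_finite_induct) (auto intro: col_kills_add col_kills_zero)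

text \<open>Moving an element of column \<open>N + 1\<close> past \<open>E_kl(y)\<close> with
  \<open>k, l \<le> N\<close> produces again only elements of column \<open>N + 1\<close>.\<close>

lemma col_kills_E:
  assumes n: "Suc N \<le> m" and H: "col_kills (Suc N) H" and r: "y \<in> carrier A" "k \<in> {1..N}" "l \<in> {1..N}"
  shows "col_kills (Suc N) (X (wd [EE k l y]) H)"
  unfolding col_kills_def
proof (intro conjI ballI)
  have kl: "k \<in> {1..Suc N}" "l \<in> {1..Suc N}" using r by auto
  show "multilinear (gl m A) K (X (wd [EE k l y]) H)"
    by (rule ma.multilinear_acts[OF col_kills_multilinear[OF H] w1m[OF r(1) kl n]])
  fix i x assume i: "i \<in> {1..Suc N}" and x: "x \<in> carrier A"
  have 0: "X (wd [EE i (Suc N) x]) H \<doteq> Z" using H i x by (simp add: col_kills_def)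
  show "X (wd [EE i (Suc N) x]) (X (wd [EE k l y]) H) \<doteq> Z"
    unfolding eqS_def
  proof
    fix as assume as: "as \<in> Sm"
    have "X (wd [EE k l y]) (X (wd [EE i (Suc N) x]) H) as = 0"
      using X_Z[OF 0 w1m[OF r(1) kl n]] as by (simp add: eqS_def)
    moreover have "X (wd [EE k (Suc N) (y \<otimes> x)]) H as = 0"
      by (rule col_kills_0[OF H kl(1) _ as]) (use r x in \<open>simp add: alg_m_closed\<close>)
    ultimately show "X (wd [EE i (Suc N) x]) (X (wd [EE k l y]) H) as = 0"
      using comm_act[OF n col_kills_multilinear[OF H] x r(1) i _ kl as, of "Suc N"] r by auto
  qed
qed

lemma X_t_word_Cons: "X (t_word N c i j (x # y # zs)) H as =
    (\<Sum>a=1..N. X (wd [EE i a x]) (X (t_word N c a j (y # zs)) H) as) + c * X (t_word N c i j ((x \<otimes> y) # zs)) H as"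
  by (simp add: acts_add acts_sum acts_mult acts_cst1)

lemma col_kills_t_word:
  "Suc N \<le> m \<Longrightarrow> col_kills (Suc N) H \<Longrightarrow> w \<in> W \<Longrightarrow> i \<in> {1..N} \<Longrightarrow> j \<in> {1..N} \<Longrightarrow> col_kills (Suc N) (X (t_word N c i j w) H)"
proof (induction N c i j w rule: t_word.induct)
  case (1 N c i j)
  have "X 0 H = Z" by (simp add: fun_eq_iff)
  then show ?case using 1 col_kills_zero by simp
next
  case (2 N c i j x)
  then show ?case by (simp add: col_kills_E)
next
  case (3 N c i j x y zs)
  have "X (t_word N c i j (x # y # zs)) H = (\<lambda>as. (\<Sum>a=1..N. X (wd [EE i a x]) (X (t_word N c a j (y # zs)) H) as) + c * X (t_word N c i j ((x \<otimes> y) # zs)) H as)"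
    by (rule ext) (rule X_t_word_Cons)
  moreover have "col_kills (Suc N) (\<lambda>as. (\<Sum>a=1..N. X (wd [EE i a x]) (X (t_word N c a j (y # zs)) H) as) + c * X (t_word N c i j ((x \<otimes> y) # zs)) H as)"
    using 3 by (intro col_kills_add col_kills_sum col_kills_smult col_kills_E) (auto simp: alg_m_closed)
  ultimately show ?case by simp
qed

text \<open>The two claims support each other. At size \<open>N + 1\<close> the additional summand
  applies \<open>E_i,N+1(x)\<close> to the generator with first index \<open>N + 1\<close>; by the
  second claim this merges \<open>x\<close> with the next letter, which is the term with coefficient
  \<open>c\<close> once more, so \<open>c\<close> becomes \<open>c + 1\<close>. For the second claim
  \<open>E_i,N+1(z)\<close> is moved to the right until it meets \<open>H\<close>; the first claim
  ensures that the forms met on the way are killed too.\<close>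

lemma t_word_step:
  assumes n: "Suc N \<le> m" and H: "col_kills (Suc N) H"
  shows "\<lbrakk>w \<in> W; length w = Suc len\<rbrakk> \<Longrightarrow>
    (\<forall>i\<in>{1..N}. \<forall>j\<in>{1..N}. X (t_word (Suc N) c i j w) H \<doteq> X (t_word N (c + 1) i j w) H) \<and>
    (\<forall>z\<in>carrier A. \<forall>i\<in>{1..N}. \<forall>j\<in>{1..N}. \<forall>k\<in>{1..Suc N}.
      X (wd [EE i (Suc N) z]) (X (t_word (Suc N) c k j w) H) \<doteq> (if k = Suc N then X (t_word (Suc N) c i j ((z \<otimes> hd w) # tl w)) H else Z))"
proof (induction len arbitrary: w)
  case 0
  then obtain x where w: "w = [x]" "x \<in> carrier A" by (auto simp: length_Suc_conv)
  have "X (wd [EE i (Suc N) z]) (X (wd [EE k j x]) H) as = (if k = Suc N then X (wd [EE i j (z \<otimes> x)]) H as else 0)"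
    if r: "z \<in> carrier A" "i \<in> {1..N}" "j \<in> {1..N}" "k \<in> {1..Suc N}" and as: "as \<in> Sm" for z i j k as
  proof -
    have r': "i \<in> {1..Suc N}" "j \<in> {1..Suc N}" "Suc N \<in> {1..Suc N}" using r by auto
    have "X (wd [EE i (Suc N) z]) H \<doteq> Z" using H r' r by (simp add: col_kills_def)
    then have "X (wd [EE k j x]) (X (wd [EE i (Suc N) z]) H) as = 0"
      using X_Z[OF _ w1m[OF w(2) r(4) r'(2) n]] as by (simp add: eqS_def)
    moreover have "X (wd [EE k (Suc N) (x \<otimes> z)]) H as = 0"
      by (rule col_kills_0[OF H r(4) _ as]) (use r w in \<open>simp add: alg_m_closed\<close>)
    ultimately show ?thesis
      using comm_act[OF n col_kills_multilinear[OF H] r(1) w(2) r'(1,3) r(4) r'(2) as] by auto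
  qed
  then show ?case using w by (auto simp: eqS_def)
next
  case (Suc len)
  obtain x y zs where w: "w = x # y # zs" using Suc.prems(2) by (auto simp: length_Suc_conv)
  have cl: "x \<in> carrier A" "y \<in> carrier A" "zs \<in> W" using Suc.prems w by auto
  have ln: "length (u # zs) = Suc len" for u :: 'a using Suc.prems(2) w by simp
  let ?n = "Suc N"
  let ?T = "\<lambda>a j. X (t_word ?n c a j (y # zs)) H"
  have b: "X (t_word ?n c i j (u # zs)) H \<doteq> X (t_word N (c + 1) i j (u # zs)) H" if "u \<in> carrier A" "i \<in> {1..N}" "j \<in> {1..N}" for u i j
    using Suc.IH[of "u # zs"] that cl ln by simp
  have d: "X (wd [EE i ?n z]) (X (t_word ?n c k j (u # zs)) H) \<doteq> (if k = ?n then X (t_word ?n c i j ((z \<otimes> u) # zs)) H else Z)"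
    if "u \<in> carrier A" "z \<in> carrier A" "i \<in> {1..N}" "j \<in> {1..N}" "k \<in> {1..?n}" for u z i j k
  proof -
    have "\<forall>z\<in>carrier A. \<forall>i\<in>{1..N}. \<forall>j\<in>{1..N}. \<forall>k\<in>{1..Suc N}.
      X (wd [EE i (Suc N) z]) (X (t_word (Suc N) c k j (u # zs)) H) \<doteq> (if k = Suc N then X (t_word (Suc N) c i j ((z \<otimes> hd (u # zs)) # tl (u # zs))) H else Z)"
      by (rule conjunct2[OF Suc.IH]) (use that cl ln in auto)
    from this[THEN bspec, OF that(2), THEN bspec, OF that(3), THEN bspec, OF that(4), THEN bspec, OF that(5)]
    show ?thesis by (simp only: list.sel)
  qed
  have kl: "col_kills ?n (X (t_word N (c + 1) i j (u # zs)) H)" if "u \<in> carrier A" "i \<in> {1..N}" "j \<in> {1..N}" for u i j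
    by (rule col_kills_t_word[OF n H]) (use that cl in auto)
  have sn: "i \<in> {1..?n}" if "i \<in> {1..N}" for i using that by auto
  have nn: "?n \<in> {1..?n}" by simp
  have ml: "multilinear (gl m A) K (?T a j)" if "a \<in> {1..?n}" "j \<in> {1..N}" for a j
  proof (rule ma.multilinear_acts[OF col_kills_multilinear[OF H]])
    have "t_word ?n c a j (y # zs) \<in> FA (carrier (gl ?n A))" using that cl sn by (intro t_word_FA) auto
    then show "t_word ?n c a j (y # zs) \<in> FA (carrier (gl m A))" using FA_mono[OF gl_mono[OF n]] by blast
  qed
  \<comment> \<open>For a first index \<open>i \<le> N\<close> the first claim replaces the
    generator by one of size \<open>N\<close>, which preserves the property of being killed by the
    last column.\<close>
  have colz: "X (wd [EE k ?n z]) (X (t_word ?n c i j (u # zs)) H) as = 0"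
    if r: "u \<in> carrier A" "z \<in> carrier A" "i \<in> {1..N}" "j \<in> {1..N}" "k \<in> {1..?n}" and as: "as \<in> Sm" for u z i j k as
  proof -
    have "X (wd [EE k ?n z]) (X (t_word ?n c i j (u # zs)) H) as = X (wd [EE k ?n z]) (X (t_word N (c + 1) i j (u # zs)) H) as"
      using X_cong[OF b[OF r(1,3,4)] w1m[OF r(2) r(5) nn n]] as by (simp add: eqS_def)
    then show ?thesis using col_kills_0[OF kl[OF r(1,3,4)] r(5,2) as] by simp
  qed
  have D: "X (wd [EE i ?n z]) (X (t_word ?n c k j w) H) as = (if k = ?n then X (t_word ?n c i j ((z \<otimes> x) # y # zs)) H as else 0)"
    if r: "z \<in> carrier A" "i \<in> {1..N}" "j \<in> {1..N}" "k \<in> {1..?n}" and as: "as \<in> Sm" for z i j k as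
  proof -
    have e1: "X (wd [EE i ?n z]) (X (t_word ?n c k j w) H) as =
       (\<Sum>a=1..?n. X (wd [EE i ?n z]) (X (wd [EE k a x]) (?T a j)) as) + c * X (wd [EE i ?n z]) (X (t_word ?n c k j ((x \<otimes> y) # zs)) H) as"
    proof -
      have "X (wd [EE i ?n z]) (X (t_word ?n c k j w) H) as = X (wd [EE i ?n z] * t_word ?n c k j w) H as" by (simp add: acts_mult)
      also have "wd [EE i ?n z] * t_word ?n c k j w = (\<Sum>a=1..?n. wd [EE i ?n z] * (wd [EE k a x] * t_word ?n c a j (y # zs))) +
         cst c * (wd [EE i ?n z] * t_word ?n c k j ((x \<otimes> y) # zs))"
        by (simp only: w t_word.simps distrib_left sum_distrib_left cst_left_comm)
      finally show ?thesis by (simp only: acts_add acts_sum acts_mult acts_cst1)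
    qed
    \<comment> \<open>Of the three terms of the commutation only the one with the merged letter
      \<open>z \<otimes> x\<close> survives; the other two end with an element of column
      \<open>N + 1\<close> acting on a form that it kills.\<close>
    have e2: "X (wd [EE i ?n z]) (X (wd [EE k a x]) (?T a j)) as = (if k = ?n then X (wd [EE i a (z \<otimes> x)]) (?T a j) as else 0)"
      if a: "a \<in> {1..?n}" for a
    proof -
      have "X (wd [EE k a x]) (X (wd [EE i ?n z]) (?T a j)) as = X (wd [EE k a x]) (if a = ?n then X (t_word ?n c i j ((z \<otimes> y) # zs)) H else Z) as"
        using X_cong[OF d[OF cl(2) r(1,2,3) a] w1m[OF cl(1) r(4) a n]] as by (simp add: eqS_def)
      also have "\<dots> = 0" using colz[of "z \<otimes> y" x i j k as] r cl as by (auto simp: X_lin alg_m_closed)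
      finally have z1: "X (wd [EE k a x]) (X (wd [EE i ?n z]) (?T a j)) as = 0" .
      have z2: "i = a \<longrightarrow> X (wd [EE k ?n (x \<otimes> z)]) (?T a j) as = 0"
        using colz[of y "x \<otimes> z" i j k as] r cl as by (auto simp: alg_m_closed)
      show ?thesis
        using comm_act[OF n ml[OF a r(3)] r(1) cl(1) sn[OF r(2)] nn r(4) a as] z1 z2 by auto
    qed
    have e3: "X (wd [EE i ?n z]) (X (t_word ?n c k j ((x \<otimes> y) # zs)) H) as = (if k = ?n then X (t_word ?n c i j ((z \<otimes> (x \<otimes> y)) # zs)) H as else 0)"
      using d[of "x \<otimes> y" z i j k] r cl as by (auto simp: eqS_def alg_m_closed)
    show ?thesis
      unfolding e1 e3 using e2 by (auto simp: X_t_word_Cons[of ?n c i j "z \<otimes> x"] alg_m_assoc r cl simp del: t_word.simps)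
  qed
  have Bb: "X (t_word ?n c i j w) H as = X (t_word N (c + 1) i j w) H as"
    if r: "i \<in> {1..N}" "j \<in> {1..N}" and as: "as \<in> Sm" for i j as
  proof -
    have e1: "X (wd [EE i a x]) (?T a j) as = X (wd [EE i a x]) (X (t_word N (c + 1) a j (y # zs)) H) as" if a: "a \<in> {1..N}" for a
      using X_cong[OF b[OF cl(2) a r(2)] w1m[OF cl(1) sn[OF r(1)] sn[OF a] n]] as by (simp add: eqS_def)
    have e2: "X (wd [EE i ?n x]) (?T ?n j) as = X (t_word ?n c i j ((x \<otimes> y) # zs)) H as"
      using d[OF cl(2,1) r nn] as by (simp add: eqS_def)
    have e3: "X (t_word ?n c i j ((x \<otimes> y) # zs)) H as = X (t_word N (c + 1) i j ((x \<otimes> y) # zs)) H as"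
      using b[of "x \<otimes> y" i j] r cl as by (simp add: eqS_def alg_m_closed)
    have "{1..?n} = insert ?n {1..N}" by auto
    then have "(\<Sum>a=1..?n. X (wd [EE i a x]) (?T a j) as) = X (wd [EE i ?n x]) (?T ?n j) as + (\<Sum>a=1..N. X (wd [EE i a x]) (?T a j) as)"
      by simp
    then show ?thesis unfolding w X_t_word_Cons e2 e3 using e1 by (simp add: algebra_simps)
  qed
  show ?case using D Bb by (auto simp: eqS_def w)
qed

lemma ev_step_word:
  assumes n: "Suc N \<le> m" and d: "d \<le> N" and H: "col_kills (Suc N) H" and w: "w \<in> lists (lab d)"
  shows "X (ev (Suc N) c (wd w)) H \<doteq> X (ev N (c + 1) (wd w)) H \<and> col_kills (Suc N) (X (ev N (c + 1) (wd w)) H)"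
  using w
proof (induction w)
  case Nil
  then show ?case using H by (simp add: wd_Nil ev_simps)
next
  case (Cons l w)
  obtain i j x where l: "l = (i, j, x)" by (cases l)
  have r: "i \<in> {1..N}" "j \<in> {1..N}" "x \<in> W" "x \<noteq> []" using Cons.hyps d l by (auto simp: t_index_def)
  obtain len where len: "length x = Suc len" using r(4) by (cases x) auto
  have e: "ev M c' (wd (l # w)) = t_word M c' i j x * ev M c' (wd w)" for M c'
    using wd_mult[of "[l]" w] ev_simps(2)[of M c' "wd [l]" "wd w"] by (simp add: l ev_wd1)
  let ?H = "X (ev N (c + 1) (wd w)) H"
  have tF: "t_word (Suc N) c i j x \<in> FA (carrier (gl m A))"
    using t_word_FA[of x i "Suc N" j c] r FA_mono[OF gl_mono[OF n]] by auto
  have "X (ev (Suc N) c (wd (l # w))) H \<doteq> X (t_word (Suc N) c i j x) ?H"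
    unfolding e acts_mult using X_cong Cons.IH tF by blast
  also have "\<dots> \<doteq> X (t_word N (c + 1) i j x) ?H"
    using t_word_step[OF n, of ?H x len c] Cons.IH r len by blast
  also have "\<dots> \<doteq> X (ev N (c + 1) (wd (l # w))) H"
    unfolding e acts_mult by simp
  finally show ?case using col_kills_t_word[OF n, of ?H x i j "c + 1"] Cons.IH r unfolding e acts_mult by blast
qed

lemma ev_step:
  assumes n: "Suc N \<le> m" and d: "d \<le> N" and H: "col_kills (Suc N) H" and p: "p \<in> FA (lab d)"
  shows "X (ev (Suc N) c p) H \<doteq> X (ev N (c + 1) p) H"
  using p
proof (induction p rule: FA_induct)
  case (single w a)
  then show ?case using ev_step_word[OF n d H single, of c]
    by (simp add: single_conv ev_simps eqS_def acts_cst)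
qed (auto simp: ev_simps eqS_def acts_add)

text \<open>Each step lowers the size by one and raises the parameter by one. The form must be
  killed by every column that is removed on the way.\<close>

lemma ev_iterate:
  assumes d: "d \<le> N" and H: "\<And>n. n \<in> {N<..m} \<Longrightarrow> col_kills n H" and p: "p \<in> FA (lab d)"
  shows "N + k \<le> m \<Longrightarrow> X (ev (N + k) c p) H \<doteq> X (ev N (c + of_nat k) p) H"
proof (induction k arbitrary: c)
  case (Suc k)
  have "X (ev (N + Suc k) c p) H \<doteq> X (ev (N + k) (c + 1) p) H"
    using ev_step[of "N + k" d H p c] Suc.prems d H p by simp
  also have "\<dots> \<doteq> X (ev N (c + 1 + of_nat k) p) H" using Suc by simp
  finally show ?case by (simp add: add.assoc)
qed simp

end

section \<open>Polynomial dependence on the parameter\<close>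

context complex_algebra
begin

text \<open>The form may itself depend on \<open>c\<close>, because the generators in a word act one
  after another.\<close>

lemma polynomial_fun_t_word:
  "(\<And>as. polynomial_fun (\<lambda>c. Hc c as)) \<Longrightarrow> polynomial_fun (\<lambda>c. acts P K (t_word N c i j x) (Hc c) as)"
proof (induction "length x" arbitrary: x i as rule: less_induct)
  case less
  consider "x = []" | y where "x = [y]" | y z zs where "x = y # z # zs"
    by (metis neq_Nil_conv)
  then show ?case
  proof cases
    case 1
    then show ?thesis using less.prems by simp
  next
    case (2 y)
    then show ?thesis using less.prems by (auto simp: acts_wd1 act_def intro!: polynomial_fun_sum)
  next
    case (3 y z zs)
    show ?thesis unfolding 3 t_word.simps acts_add acts_sum acts_mult acts_cst1 acts_wd1 act_def
      by (intro polynomial_fun_add polynomial_fun_mult polynomial_fun_sum polynomial_fun_id less.hyps less.prems) (simp_all add: 3)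
  qed
qed

lemma polynomial_fun_ev:
  assumes "\<And>as. polynomial_fun (\<lambda>c. Hc c as)"
  shows "polynomial_fun (\<lambda>c. acts P K (ev N c p) (Hc c) as)"
proof -
  have 1: "polynomial_fun (\<lambda>c. acts P K (ev N c (wd w)) (Hc c) as)" for w as
  proof (induction w arbitrary: as)
    case Nil then show ?case using assms by (simp add: wd_Nil ev_simps)
  next
    case (Cons l w)
    obtain i j x where l: "l = (i, j, x)" by (cases l)
    have e: "ev N c (wd (l # w)) = t_word N c i j x * ev N c (wd w)" for c
      using wd_mult[of "[l]" w] ev_simps(2)[of N c "wd [l]" "wd w"] by (simp add: l ev_wd1)
    show ?case unfolding e acts_mult by (rule polynomial_fun_t_word) (rule Cons.IH)
  qed
  have "Poly_Mapping.keys p \<subseteq> UNIV" by simp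
  then show ?thesis
    by (induction p rule: pm_induct)
      (auto simp: ev_simps acts_add acts_cst single_conv 1 intro!: polynomial_fun_add polynomial_fun_mult)
qed

text \<open>By \<open>gl_separation\<close> it suffices to apply \<open>ev N c p\<close> to product
  forms of \<open>lf N \<zeta>\<close>. All columns beyond \<open>N\<close> kill them, so inside
  matrices of size \<open>N + k\<close> the hypothesis for size \<open>N + k\<close> and parameter 0
  becomes the claim for size \<open>N\<close> and parameter \<open>k\<close>. The result is
  polynomial in \<open>c\<close> and vanishes at all natural numbers.\<close>

theorem stability:
  assumes B: "is_basis A B" and p: "p \<in> FA (lab d)"
    and 0: "\<And>N. N \<ge> d \<Longrightarrow> ev N 0 p \<in> uea_ideal (gl N A)"
    and N: "d \<le> N"
  shows "ev N c p \<in> uea_ideal (gl N A)"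
proof (rule gl_separation[OF B])
  show "ev N c p \<in> FA (carrier (gl N A))" using p N by (rule ev_FA)
  fix K and \<zeta> :: "nat \<Rightarrow> nat \<Rightarrow> 'a \<Rightarrow> complex" assume \<zeta>: "\<And>i j. linfun A (\<zeta> i j)"
  let ?H = "prod_form K (lf N \<zeta>)"
  have pf: "polynomial_fun (\<lambda>c. acts (mat_mult N A) K (ev N c p) ?H (\<lambda>_. None))"
    by (rule polynomial_fun_ev) simp
  have "acts (mat_mult N A) K (ev N (of_nat k) p) ?H (\<lambda>_. None) = 0" for k
  proof -
    interpret ambient A "N + k" K ..
    have ml: "multilinear (gl (N + k) A) K ?H" by (rule multilinear_prod_form[OF linfun_lf[OF \<zeta>]])
    have kil: "col_kills n ?H" if "n \<in> {N<..N + k}" for n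
      unfolding col_kills_def eqS_def using ml that
      by (auto simp: acts_wd1 intro!: last_col_kills[OF _ \<zeta>])
    let ?X = "acts (mat_mult (N + k) A) K"
    have "eqS (?X (ev (N + k) 0 p) ?H) (\<lambda>as. 0)"
      by (rule X_ideal[OF 0 _ ml]) (use N in auto)
    moreover have "eqS (?X (ev (N + k) 0 p) ?H) (?X (ev N (0 + of_nat k) p) ?H)"
      by (rule ev_iterate[OF N kil p]) auto
    ultimately have "?X (ev N (of_nat k) p) ?H (\<lambda>_. None) = 0"
      by (simp add: eqS_def slots_def)
    then show ?thesis
      using act_ambient[of N "N + k" "ev N (of_nat k) p" "\<lambda>_. None" K ?H] ev_FA[OF p N] by (simp add: slots_def)
  qed
  then show "acts (mat_mult N A) K (ev N c p) ?H (\<lambda>_. None) = 0"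
    by (rule polynomial_fun_zero[OF pf])
qed

end

section \<open>The algebra \<open>R(\<Omega>)\<close>\<close>

text \<open>The multiplication of \<open>word_alg\<close> as a double linear extension, from which
  bilinearity follows by the general lemmas.\<close>

definition wmul :: "(complex, 'w) module \<Rightarrow> ('w list \<Rightarrow>\<^sub>0 complex) \<Rightarrow> ('w list \<Rightarrow>\<^sub>0 complex) \<Rightarrow> ('w list \<Rightarrow>\<^sub>0 complex)" where
  "wmul \<Omega> p q = lin_ext (\<lambda>u a. lin_ext (\<lambda>v b. Poly_Mapping.single (word_join \<Omega> u v) (a * b)) q) p"

definition WA :: "(complex, 'w) module \<Rightarrow> ('w list \<Rightarrow>\<^sub>0 complex) set" where
  "WA \<Omega> = {p. Poly_Mapping.keys p \<subseteq> lists (carrier \<Omega>) - {[]}}"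

lemma word_alg_simps [simp]:
  "carrier (word_alg \<Omega>) = WA \<Omega>" "monoid.mult (word_alg \<Omega>) = wmul \<Omega>" "ring.zero (word_alg \<Omega>) = 0"
  "ring.add (word_alg \<Omega>) = (+)" "module.smult (word_alg \<Omega>) = (\<lambda>c p. cst c * p)"
  by (simp_all add: word_alg_def WA_def wmul_def lin_ext_def map_smult fun_eq_iff)

lemma coeff_additive_in: "coeff_additive (\<lambda>v b. Poly_Mapping.single (f v) (a * b :: complex))"
  by (rule coeff_additiveI) (simp add: algebra_simps Poly_Mapping.single_add)

lemma coeff_additive_out: "coeff_additive (\<lambda>u a. lin_ext (\<lambda>v b. Poly_Mapping.single (word_join \<Omega> u v) (a * b)) q)"
  by (rule coeff_additiveI) (simp add: lin_ext_def algebra_simps Poly_Mapping.single_add sum.distrib)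

lemma wmul_add: "wmul \<Omega> (p + p') q = wmul \<Omega> p q + wmul \<Omega> p' q" "wmul \<Omega> p (q + q') = wmul \<Omega> p q + wmul \<Omega> p q'"
  and wmul_diff: "wmul \<Omega> (p - p') q = wmul \<Omega> p q - wmul \<Omega> p' q" "wmul \<Omega> p (q - q') = wmul \<Omega> p q - wmul \<Omega> p q'"
  and wmul_0: "wmul \<Omega> 0 q = 0" "wmul \<Omega> p 0 = 0"
  by (simp_all add: wmul_def lin_ext_add[OF coeff_additive_out] lin_ext_diff[OF coeff_additive_out] lin_ext_add[OF coeff_additive_in] lin_ext_diff[OF coeff_additive_in])
    (simp_all add: lin_ext_def sum.distrib sum_subtractf)

lemma wmul_single: "wmul \<Omega> (Poly_Mapping.single u a) (Poly_Mapping.single v b) = Poly_Mapping.single (word_join \<Omega> u v) (a * b)"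
  unfolding wmul_def by (subst lin_ext_single[OF coeff_additive_out]) (rule lin_ext_single[OF coeff_additive_in])

lemma cst_single: "cst c * Poly_Mapping.single w a = Poly_Mapping.single w (c * a)"
  by (simp add: cst_def single_mult_list)

lemma wmul_cst: "wmul \<Omega> (cst c * p) q = cst c * wmul \<Omega> p q" "wmul \<Omega> p (cst c * q) = cst c * wmul \<Omega> p q"
proof -
  have p: "Poly_Mapping.keys p \<subseteq> UNIV" and q: "Poly_Mapping.keys q \<subseteq> UNIV" by auto
  have 1: "wmul \<Omega> (cst c * Poly_Mapping.single w a) q = cst c * wmul \<Omega> (Poly_Mapping.single w a) q"
    "wmul \<Omega> (Poly_Mapping.single w a) (cst c * q) = cst c * wmul \<Omega> (Poly_Mapping.single w a) q" for w a
    using q by (induction q rule: pm_induct)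
      (simp_all add: wmul_0 wmul_add distrib_left cst_single wmul_single mult.assoc mult.left_commute)
  show "wmul \<Omega> (cst c * p) q = cst c * wmul \<Omega> p q" "wmul \<Omega> p (cst c * q) = cst c * wmul \<Omega> p q"
    using p by (induction p rule: pm_induct) (simp_all add: wmul_0 wmul_add distrib_left 1)
qed

lemma WA_0 [simp]: "0 \<in> WA \<Omega>" by (simp add: WA_def)
lemma WA_add: "p \<in> WA \<Omega> \<Longrightarrow> q \<in> WA \<Omega> \<Longrightarrow> p + q \<in> WA \<Omega>"
  using Poly_Mapping.keys_add[of p q] by (auto simp: WA_def)
lemma WA_cst: "p \<in> WA \<Omega> \<Longrightarrow> cst c * p \<in> WA \<Omega>"
  using keys_cst_mult[of c p] by (auto simp: WA_def)
lemma WA_uminus: "p \<in> WA \<Omega> \<Longrightarrow> - p \<in> WA \<Omega>"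
  using WA_cst[of p \<Omega> "-1"] by (simp add: cst_minus)
lemma WA_diff: "p \<in> WA \<Omega> \<Longrightarrow> q \<in> WA \<Omega> \<Longrightarrow> p - q \<in> WA \<Omega>"
  by (metis WA_add WA_uminus diff_conv_add_uminus)
lemma WA_single: "w \<in> lists (carrier \<Omega>) \<Longrightarrow> w \<noteq> [] \<Longrightarrow> Poly_Mapping.single w a \<in> WA \<Omega>"
  by (auto simp: WA_def)

lemma WA_induct [consumes 1, case_names zero single add]:
  assumes "p \<in> WA \<Omega>" "P 0" "\<And>w a. w \<in> lists (carrier \<Omega>) \<Longrightarrow> w \<noteq> [] \<Longrightarrow> P (Poly_Mapping.single w a)"
    "\<And>p q. \<lbrakk>p \<in> WA \<Omega>; q \<in> WA \<Omega>; P p; P q\<rbrakk> \<Longrightarrow> P (p + q)"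
  shows "P p"
proof -
  have "Poly_Mapping.keys p \<subseteq> lists (carrier \<Omega>) - {[]}" using assms(1) by (simp add: WA_def)
  then show ?thesis by (induction p rule: pm_induct) (use assms in \<open>auto simp: WA_def\<close>)
qed

context complex_algebra
begin

definition mrel :: "('a list \<Rightarrow>\<^sub>0 complex) set" where
  "mrel = {wd (us @ [x \<oplus> y] @ vs) - wd (us @ [x] @ vs) - wd (us @ [y] @ vs) | us vs x y.
        us \<in> W \<and> vs \<in> W \<and> x \<in> carrier A \<and> y \<in> carrier A} \<union>
     {wd (us @ [c \<odot> x] @ vs) - Poly_Mapping.single (us @ [x] @ vs) c | us vs c x.
        us \<in> W \<and> vs \<in> W \<and> x \<in> carrier A}"

lemma multilin_eq: "multilin A = lin_span (word_alg A) mrel"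
  by (simp add: multilin_def mrel_def)

lemma mrelI1: "us \<in> W \<Longrightarrow> vs \<in> W \<Longrightarrow> x \<in> carrier A \<Longrightarrow> y \<in> carrier A \<Longrightarrow>
    wd (us @ [x \<oplus> y] @ vs) - wd (us @ [x] @ vs) - wd (us @ [y] @ vs) \<in> multilin A"
  unfolding multilin_eq by (rule lin_span.base) (unfold mrel_def, blast)

lemma mrelI2: "us \<in> W \<Longrightarrow> vs \<in> W \<Longrightarrow> x \<in> carrier A \<Longrightarrow>
    wd (us @ [c \<odot> x] @ vs) - Poly_Mapping.single (us @ [x] @ vs) c \<in> multilin A"
  unfolding multilin_eq by (rule lin_span.base) (unfold mrel_def, blast)

lemma ml_0: "0 \<in> multilin A" using lin_span.zero[of "word_alg A" mrel] by (simp add: multilin_eq)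
lemma ml_add: "p \<in> multilin A \<Longrightarrow> q \<in> multilin A \<Longrightarrow> p + q \<in> multilin A"
  using lin_span.add[of p "word_alg A" mrel q] by (simp add: multilin_eq)
lemma ml_cst: "p \<in> multilin A \<Longrightarrow> cst c * p \<in> multilin A"
  using lin_span.smult[of p "word_alg A" mrel c] by (simp add: multilin_eq)
lemma ml_uminus: "p \<in> multilin A \<Longrightarrow> - p \<in> multilin A"
  using ml_cst[of p "-1"] by (simp add: cst_minus)
lemma ml_induct [consumes 1, case_names base zero add cst]:
  assumes "p \<in> multilin A" "\<And>r. r \<in> mrel \<Longrightarrow> P r" "P 0"
    "\<And>p q. \<lbrakk>p \<in> multilin A; q \<in> multilin A; P p; P q\<rbrakk> \<Longrightarrow> P (p + q)"
    "\<And>p c. \<lbrakk>p \<in> multilin A; P p\<rbrakk> \<Longrightarrow> P (cst c * p)"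
  shows "P p"
  using assms(1) unfolding multilin_eq
  by (induction rule: lin_span.induct) (use assms in \<open>auto simp: multilin_eq\<close>)

lemma mrel_cases:
  assumes "r \<in> mrel"
  obtains us vs x y where "us \<in> W" "vs \<in> W" "x \<in> carrier A" "y \<in> carrier A"
      "r = wd (us @ [x \<oplus> y] @ vs) - wd (us @ [x] @ vs) - wd (us @ [y] @ vs)"
    | us vs x c where "us \<in> W" "vs \<in> W" "x \<in> carrier A" "r = wd (us @ [c \<odot> x] @ vs) - Poly_Mapping.single (us @ [x] @ vs) c"
  using assms unfolding mrel_def
proof (elim UnE CollectE exE conjE)
  fix us vs x y
  assume "r = wd (us @ [x \<oplus> y] @ vs) - wd (us @ [x] @ vs) - wd (us @ [y] @ vs)" "us \<in> W" "vs \<in> W" "x \<in> carrier A" "y \<in> carrier A"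
  then show thesis by (intro that(1))
next
  fix us vs c x
  assume "r = wd (us @ [c \<odot> x] @ vs) - Poly_Mapping.single (us @ [x] @ vs) c" "us \<in> W" "vs \<in> W" "x \<in> carrier A"
  then show thesis by (intro that(2))
qed

lemma ml_WA: "p \<in> multilin A \<Longrightarrow> p \<in> WA A"
proof (induction p rule: ml_induct)
  case (base r)
  then show ?case by (cases rule: mrel_cases) (auto simp: wd_def intro!: WA_diff WA_single)
qed (auto simp: WA_add WA_cst)

text \<open>Joining with a fixed word changes the distinguished letter by a linear map
  \<open>g\<close>, a multiplication or the identity, and affects nothing else that depends on it.
  Hence multilinearity relations go to multilinearity relations, and \<open>multilin\<close> absorbs
  products.\<close>

lemma slot_mult:
  assumes f: "\<And>z. z \<in> carrier A \<Longrightarrow> f (us @ [z] @ vs) = us' @ [g z] @ vs'" and cl: "us' \<in> W" "vs' \<in> W"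
    and g: "\<And>z. z \<in> carrier A \<Longrightarrow> g z \<in> carrier A" "\<And>x y. x \<in> carrier A \<Longrightarrow> y \<in> carrier A \<Longrightarrow> g (x \<oplus> y) = g x \<oplus> g y"
      "\<And>x c. x \<in> carrier A \<Longrightarrow> g (c \<odot> x) = c \<odot> g x"
  shows "x \<in> carrier A \<Longrightarrow> y \<in> carrier A \<Longrightarrow>
      Poly_Mapping.single (f (us @ [x \<oplus> y] @ vs)) a - Poly_Mapping.single (f (us @ [x] @ vs)) a - Poly_Mapping.single (f (us @ [y] @ vs)) a \<in> multilin A"
    "x \<in> carrier A \<Longrightarrow> Poly_Mapping.single (f (us @ [c \<odot> x] @ vs)) a - Poly_Mapping.single (f (us @ [x] @ vs)) (a * c) \<in> multilin A"
proof -
  assume "x \<in> carrier A" "y \<in> carrier A"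
  then show "Poly_Mapping.single (f (us @ [x \<oplus> y] @ vs)) a - Poly_Mapping.single (f (us @ [x] @ vs)) a - Poly_Mapping.single (f (us @ [y] @ vs)) a \<in> multilin A"
    using ml_cst[OF mrelI1[OF cl g(1) g(1)], of x y a] f g by (simp add: right_diff_distrib wd_def cst_single)
next
  assume "x \<in> carrier A"
  then show "Poly_Mapping.single (f (us @ [c \<odot> x] @ vs)) a - Poly_Mapping.single (f (us @ [x] @ vs)) (a * c) \<in> multilin A"
    using ml_cst[OF mrelI2[OF cl g(1)], of x a c] f g by (simp add: right_diff_distrib wd_def cst_single)
qed

lemma wj_slot_r:
  assumes "u \<in> W" "u \<noteq> []" "us \<in> W" "vs \<in> W"
  obtains us' vs' g where "us' \<in> W" "vs' \<in> W" "\<And>z. z \<in> carrier A \<Longrightarrow> wj u (us @ [z] @ vs) = us' @ [g z] @ vs'"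
    "\<And>z. z \<in> carrier A \<Longrightarrow> g z \<in> carrier A" "\<And>x y. x \<in> carrier A \<Longrightarrow> y \<in> carrier A \<Longrightarrow> g (x \<oplus> y) = g x \<oplus> g y"
      "\<And>x c. x \<in> carrier A \<Longrightarrow> g (c \<odot> x) = c \<odot> g x"
proof (cases "us = []")
  case True
  have "butlast u \<in> W" "last u \<in> carrier A" using assms by (auto dest: in_set_butlastD)
  then show thesis using True assms
    by (intro that[of "butlast u" vs "\<lambda>z. last u \<otimes> z"]) (auto simp: word_join_def alg_m_closed alg_r_distr alg_smult_r)
next
  case False
  then show thesis using wj_W[of u us] assms
    by (intro that[of "wj u us" vs "\<lambda>z. z"]) (auto simp: word_join_def)
qed

lemma wj_slot_l:
  assumes "u \<in> W" "u \<noteq> []" "us \<in> W" "vs \<in> W"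
  obtains us' vs' g where "us' \<in> W" "vs' \<in> W" "\<And>z. z \<in> carrier A \<Longrightarrow> wj (us @ [z] @ vs) u = us' @ [g z] @ vs'"
    "\<And>z. z \<in> carrier A \<Longrightarrow> g z \<in> carrier A" "\<And>x y. x \<in> carrier A \<Longrightarrow> y \<in> carrier A \<Longrightarrow> g (x \<oplus> y) = g x \<oplus> g y"
      "\<And>x c. x \<in> carrier A \<Longrightarrow> g (c \<odot> x) = c \<odot> g x"
proof (cases "vs = []")
  case True
  obtain h t where u: "u = h # t" using assms(2) by (cases u) auto
  then show thesis using True assms
    by (intro that[of us t "\<lambda>z. z \<otimes> h"]) (auto simp: word_join_def alg_m_closed alg_l_distr alg_smult_l butlast_append)
next
  case False
  then show thesis using wj_W[of vs u] assms
    by (intro that[of us "wj vs u" "\<lambda>z. z"]) (auto simp: word_join_def butlast_append)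
qed

lemma ml_wmul:
  assumes r: "r \<in> multilin A" and p: "p \<in> WA A"
  shows "wmul A p r \<in> multilin A" "wmul A r p \<in> multilin A"
proof -
  have "wmul A (Poly_Mapping.single u a) r \<in> multilin A \<and> wmul A r (Poly_Mapping.single u a) \<in> multilin A" if u: "u \<in> W" "u \<noteq> []" for u a
    using r
  proof (induction r rule: ml_induct)
    case (base r)
    then show ?case
    proof (cases rule: mrel_cases)
      case (1 us vs x y)
      obtain us1 vs1 g1 where 2: "us1 \<in> W" "vs1 \<in> W" "\<And>z. z \<in> carrier A \<Longrightarrow> wj u (us @ [z] @ vs) = us1 @ [g1 z] @ vs1"
        "\<And>z. z \<in> carrier A \<Longrightarrow> g1 z \<in> carrier A" "\<And>x y. x \<in> carrier A \<Longrightarrow> y \<in> carrier A \<Longrightarrow> g1 (x \<oplus> y) = g1 x \<oplus> g1 y"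
        "\<And>x c. x \<in> carrier A \<Longrightarrow> g1 (c \<odot> x) = c \<odot> g1 x" by (rule wj_slot_r[OF u 1(1,2)]) (rule that)
      obtain us2 vs2 g2 where 3: "us2 \<in> W" "vs2 \<in> W" "\<And>z. z \<in> carrier A \<Longrightarrow> wj (us @ [z] @ vs) u = us2 @ [g2 z] @ vs2"
        "\<And>z. z \<in> carrier A \<Longrightarrow> g2 z \<in> carrier A" "\<And>x y. x \<in> carrier A \<Longrightarrow> y \<in> carrier A \<Longrightarrow> g2 (x \<oplus> y) = g2 x \<oplus> g2 y"
        "\<And>x c. x \<in> carrier A \<Longrightarrow> g2 (c \<odot> x) = c \<odot> g2 x" by (rule wj_slot_l[OF u 1(1,2)]) (rule that)
      show ?thesis
        using slot_mult(1)[where f = "wj u", OF 2(3,1,2,4,5,6) 1(3,4), of a]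
          slot_mult(1)[where f = "\<lambda>w. wj w u", OF 3(3,1,2,4,5,6) 1(3,4), of a]
        by (simp only: 1(5) wmul_diff wd_def wmul_single mult_1 mult_1_right simp_thms)
    next
      case (2 us vs x c)
      obtain us1 vs1 g1 where 1: "us1 \<in> W" "vs1 \<in> W" "\<And>z. z \<in> carrier A \<Longrightarrow> wj u (us @ [z] @ vs) = us1 @ [g1 z] @ vs1"
        "\<And>z. z \<in> carrier A \<Longrightarrow> g1 z \<in> carrier A" "\<And>x y. x \<in> carrier A \<Longrightarrow> y \<in> carrier A \<Longrightarrow> g1 (x \<oplus> y) = g1 x \<oplus> g1 y"
        "\<And>x c. x \<in> carrier A \<Longrightarrow> g1 (c \<odot> x) = c \<odot> g1 x" by (rule wj_slot_r[OF u 2(1,2)]) (rule that)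
      obtain us2 vs2 g2 where 3: "us2 \<in> W" "vs2 \<in> W" "\<And>z. z \<in> carrier A \<Longrightarrow> wj (us @ [z] @ vs) u = us2 @ [g2 z] @ vs2"
        "\<And>z. z \<in> carrier A \<Longrightarrow> g2 z \<in> carrier A" "\<And>x y. x \<in> carrier A \<Longrightarrow> y \<in> carrier A \<Longrightarrow> g2 (x \<oplus> y) = g2 x \<oplus> g2 y"
        "\<And>x c. x \<in> carrier A \<Longrightarrow> g2 (c \<odot> x) = c \<odot> g2 x" by (rule wj_slot_l[OF u 2(1,2)]) (rule that)
      show ?thesis
        using slot_mult(2)[where f = "wj u", OF 1(3,1,2,4,5,6) 2(3), of c a]
          slot_mult(2)[where f = "\<lambda>w. wj w u", OF 3(3,1,2,4,5,6) 2(3), of c a]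
        by (simp only: 2(4) wmul_diff wd_def wmul_single mult_1 mult_1_right simp_thms mult.commute[of c a])
    qed
  qed (auto simp: wmul_0 wmul_add wmul_cst ml_0 ml_add ml_cst)
  note sw = this
  have "wmul A p r \<in> multilin A \<and> wmul A r p \<in> multilin A"
    using p by (induction p rule: WA_induct) (simp_all add: sw wmul_0 wmul_add ml_0 ml_add)
  then show "wmul A p r \<in> multilin A" "wmul A r p \<in> multilin A" by auto
qed

text \<open>Both joins meet in the same letter only if the middle word has a single letter; there
  the associativity of the algebra enters.\<close>

lemma wj_assoc: "u \<in> W \<Longrightarrow> v \<in> W \<Longrightarrow> w \<in> W \<Longrightarrow> u \<noteq> [] \<Longrightarrow> v \<noteq> [] \<Longrightarrow> w \<noteq> [] \<Longrightarrow> wj (wj u v) w = wj u (wj v w)"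
proof -
  assume a: "u \<in> W" "v \<in> W" "w \<in> W" "u \<noteq> []" "v \<noteq> []" "w \<noteq> []"
  obtain u' l where u: "u = u' @ [l]" using a(4) by (cases u rule: rev_cases) auto
  obtain h w' where w: "w = h # w'" using a(6) by (cases w) auto
  show ?thesis
  proof (cases v rule: rev_cases)
    case (snoc v' m)
    then show ?thesis using a u w
      by (cases v') (auto simp: word_join_def alg_m_assoc butlast_append)
  qed (use a in simp)
qed

lemma WA_wj: "u \<in> W \<Longrightarrow> u \<noteq> [] \<Longrightarrow> w \<in> W \<Longrightarrow> w \<noteq> [] \<Longrightarrow> Poly_Mapping.single (wj u w) a \<in> WA A"
  by (rule WA_single[OF wj_W wj_ne])

lemma wmul_WA: "p \<in> WA A \<Longrightarrow> q \<in> WA A \<Longrightarrow> wmul A p q \<in> WA A"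
proof (induction p rule: WA_induct)
  case (single u a)
  show ?case using single(3)
    by (induction q rule: WA_induct) (use single(1,2) in \<open>simp_all add: wmul_0 wmul_add wmul_single WA_add WA_wj del: in_lists_conv_set\<close>)
qed (auto simp: wmul_0 wmul_add WA_add)

lemma wmul_assoc: "p \<in> WA A \<Longrightarrow> q \<in> WA A \<Longrightarrow> r \<in> WA A \<Longrightarrow> wmul A (wmul A p q) r = wmul A p (wmul A q r)"
proof (induction p rule: WA_induct)
  case (single u a)
  show ?case using single(3,4)
  proof (induction q rule: WA_induct)
    case (single v b)
    show ?case using single(3) \<open>u \<in> W\<close> \<open>u \<noteq> []\<close> single(1,2)
      by (induction r rule: WA_induct) (simp_all add: wmul_0 wmul_add wmul_single wj_assoc mult.assoc)
  qed (simp_all add: wmul_0 wmul_add)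
qed (simp_all add: wmul_0 wmul_add)

sublocale wr: rep_sub "word_alg A" "\<lambda>p. p" "WA A" "multilin A"
  by unfold_locales (auto simp: WA_add WA_uminus ml_WA ml_0 ml_add ml_uminus)

definition Rc :: "('a list \<Rightarrow>\<^sub>0 complex) \<Rightarrow> ('a list \<Rightarrow>\<^sub>0 complex) set" where "Rc = wr.cs"

lemma Rc_eq: "p \<in> WA A \<Longrightarrow> q \<in> WA A \<Longrightarrow> Rc p = Rc q \<longleftrightarrow> p - q \<in> multilin A"
  unfolding Rc_def by (rule wr.cs_eq)

lemma Rc_coset: "p \<in> WA A \<Longrightarrow> multilin A +>\<^bsub>word_alg A\<^esub> p = Rc p"
  using wr.coset[of p] by (simp add: Rc_def)

lemma R_carrier: "carrier (R_alg A) = Rc ` WA A"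
  using wr.rcosets by (simp add: R_alg_def alg_quot_def FactRing_def Rc_def)

lemma R_add: "p \<in> WA A \<Longrightarrow> q \<in> WA A \<Longrightarrow> Rc p \<oplus>\<^bsub>R_alg A\<^esub> Rc q = Rc (p + q)"
  using wr.cs_add by (simp add: R_alg_def alg_quot_def FactRing_def Rc_def)

lemma R_zero: "\<zero>\<^bsub>R_alg A\<^esub> = Rc 0"
  using wr.cs_0 by (simp add: R_alg_def alg_quot_def FactRing_def Rc_def)

lemma R_smult: "p \<in> WA A \<Longrightarrow> c \<odot>\<^bsub>R_alg A\<^esub> Rc p = Rc (cst c * p)"
  using wr.cs_smult_union[of p c "\<lambda>q. cst c * q"]
  by (simp add: R_alg_def alg_quot_def Rc_def WA_cst distrib_left ml_cst)

lemma R_mult: "p \<in> WA A \<Longrightarrow> q \<in> WA A \<Longrightarrow> Rc p \<otimes>\<^bsub>R_alg A\<^esub> Rc q = Rc (wmul A p q)"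
proof -
  assume pq: "p \<in> WA A" "q \<in> WA A"
  have "rcoset_mult (word_alg A) ((\<lambda>p. p) ` multilin A) (Rc p) (Rc q) = wr.cs (wmul A p q)"
  proof (rule wr.cs_mult_union[where ?K1.0 = "multilin A" and ?K2.0 = "multilin A"])
    fix k l assume kl: "k \<in> multilin A" "l \<in> multilin A"
    have "wmul A (k + p) (l + q) - wmul A p q = wmul A k (l + q) + wmul A p l" by (simp add: wmul_add)
    moreover have "wmul A k (l + q) + wmul A p l \<in> multilin A" using kl pq ml_WA[of l] by (intro ml_add[OF ml_wmul(2) ml_wmul(1)]) (auto intro: WA_add)
    ultimately show "\<exists>r\<in>WA A. (k + p) \<otimes>\<^bsub>word_alg A\<^esub> (l + q) = r \<and> r - wmul A p q \<in> multilin A"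
      using pq ml_WA[OF kl(1)] ml_WA[OF kl(2)] by (intro bexI[of _ "wmul A (k + p) (l + q)"]) (auto intro!: wmul_WA WA_add)
  qed (use pq in \<open>auto simp: Rc_def wr.cs_def wmul_WA ml_0\<close>)
  then show ?thesis by (simp add: R_alg_def alg_quot_def FactRing_def Rc_def)
qed

sublocale rr: rep "R_alg A" Rc "WA A"
  by unfold_locales (auto simp: R_carrier R_zero R_add WA_add WA_uminus)

lemma R_complex_algebra: "complex_algebra (R_alg A)"
proof (intro complex_algebra.intro complex_algebra_axioms.intro)
  show "module cplx (R_alg A)"
  proof (rule moduleI)
    show "cring cplx" by (rule R.is_cring)
    show "abelian_group (R_alg A)" by (rule rr.abelian)
  qed (auto simp: R_carrier R_smult R_add WA_cst WA_add distrib_left distrib_right cst_add cst_mult mult.assoc)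
qed (auto simp: R_carrier R_smult R_add R_mult WA_cst WA_add wmul_WA wmul_add wmul_cst wmul_assoc)

section \<open>Realization of prescribed matrix entries\<close>

text \<open>The scalar counterpart of \<open>e_word\<close>: an entry of the product of the matrices
  that \<open>\<zeta>\<close> assigns to the letters. It is the symbol of a generator.\<close>

primrec word_entry :: "nat \<Rightarrow> (nat \<Rightarrow> nat \<Rightarrow> 'a \<Rightarrow> complex) \<Rightarrow> nat \<Rightarrow> nat \<Rightarrow> 'a list \<Rightarrow> complex" where
  "word_entry N \<zeta> i j [] = (if i = j then 1 else 0)"
| "word_entry N \<zeta> i j (x # xs) = (\<Sum>a=1..N. \<zeta> i a x * word_entry N \<zeta> a j xs)"

lemma word_entry_single: "j \<in> {1..N} \<Longrightarrow> word_entry N \<zeta> i j [x] = \<zeta> i j x"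
  using sum_delta_r[of "{1..N}" "\<lambda>a. \<zeta> i a x" j "\<lambda>_. 1"] by (simp add: eq_commute[of _ j])

lemma word_entry_append: "i \<in> {1..N} \<Longrightarrow> word_entry N \<zeta> i j (u @ v) = (\<Sum>a=1..N. word_entry N \<zeta> i a u * word_entry N \<zeta> a j v)"
proof (induction u arbitrary: i)
  case Nil
  then show ?case using sum_delta_l[of "{1..N}" i "\<lambda>_. 1" "\<lambda>a. word_entry N \<zeta> a j v"] by simp
next
  case (Cons x u)
  have "word_entry N \<zeta> i j ((x # u) @ v) = (\<Sum>b=1..N. \<zeta> i b x * (\<Sum>a=1..N. word_entry N \<zeta> b a u * word_entry N \<zeta> a j v))"
    using Cons by simp
  also have "\<dots> = (\<Sum>a=1..N. \<Sum>b=1..N. \<zeta> i b x * (word_entry N \<zeta> b a u * word_entry N \<zeta> a j v))"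
    unfolding sum_distrib_left by (rule sum.swap)
  finally show ?case by (simp add: sum_distrib_right mult.assoc)
qed

text \<open>
  The row vectors \<open>\<delta>(i, u)\<close>, for words \<open>u\<close> of length at most \<open>K\<close>, form a free shift module; subtracting
  \<open>\<Sum>\<^sub>j v\<^sub>i\<^sub>j(u) \<delta>\<^sub>j\<close> from \<open>\<delta>(i, u)\<close> turns the prescribed values into the coordinates at \<open>\<delta>\<^sub>j\<close>.
\<close>
theorem realization:
  assumes B: "is_basis A B" and B0: "finite B0" "B0 \<subseteq> B"
  shows "\<exists>N \<zeta>. d \<le> N \<and> (\<forall>i j. linfun A (\<zeta> i j)) \<and>
    (\<forall>i\<in>{1..d}. \<forall>j\<in>{1..d}. \<forall>w\<in>lists B0. w \<noteq> [] \<longrightarrow> length w \<le> K \<longrightarrow> word_entry N \<zeta> i j w = v i j w)"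
proof -
  define Q where "Q = {1..d} \<times> {u. u \<noteq> [] \<and> set u \<subseteq> B0 \<and> length u \<le> K}"
  have "finite {u. set u \<subseteq> B0 \<and> length u \<le> K}" using B0 by (intro finite_lists_length_le)
  then have "finite {u. u \<noteq> [] \<and> set u \<subseteq> B0 \<and> length u \<le> K}" by (rule rev_finite_subset) auto
  then have fQ: "finite Q" unfolding Q_def by blast
  define N where "N = d + card Q"
  have "card {d+1..N} = card Q" by (simp add: N_def)
  then obtain g where g: "bij_betw g {d+1..N} Q" using fQ finite_same_card_bij by blast
  \<comment> \<open>An index up to \<open>d\<close> stands for a vector \<open>\<delta>\<close> with
    that index, and an index \<open>a > d\<close> with \<open>g a = (i, u)\<close> for the corrected
    vector of \<open>(i, u)\<close>. Row \<open>a\<close> lists the coordinates of this vector after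
    a shift by \<open>b\<close>. Pairs with words longer than \<open>K\<close> are not in
    \<open>Q\<close>, so their coordinate is dropped.\<close>
  define z where "z a a' b = (if a \<le> d then (if a' \<le> d then v a a' [b] else if g a' = (a, [b]) then 1 else 0)
    else (if a' \<le> d then v (fst (g a)) a' (snd (g a) @ [b]) - (\<Sum>j=1..d. v (fst (g a)) j (snd (g a)) * v j a' [b])
      else (if g a' = (fst (g a), snd (g a) @ [b]) then 1 else 0) -
        (\<Sum>j=1..d. v (fst (g a)) j (snd (g a)) * (if g a' = (j, [b]) then 1 else 0))))" for a a' :: nat and b :: 'a
  define \<zeta> where "\<zeta> a a' = (SOME f. linfun A f \<and> (\<forall>b\<in>B. f b = z a a' b))" for a a'
  have \<zeta>: "linfun A (\<zeta> a a') \<and> (\<forall>b\<in>B. \<zeta> a a' b = z a a' b)" for a a'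
    unfolding \<zeta>_def using someI_ex[OF linfun_extend[OF B, of "z a a'"]] .
  \<comment> \<open>The induction computes the whole row: the prescribed values in the first
    \<open>d\<close> coordinates, and beyond them a single 1 that remembers
    \<open>(i, w)\<close>.\<close>
  have main: "w \<in> lists B0 \<Longrightarrow> w \<noteq> [] \<Longrightarrow> length w \<le> K \<Longrightarrow> i \<in> {1..d} \<Longrightarrow> a \<in> {1..N} \<Longrightarrow>
      word_entry N \<zeta> i a w = (if a \<le> d then v i a w else if g a = (i, w) then 1 else 0)" for w i a
  proof (induction w arbitrary: a rule: rev_induct)
    case (snoc b w)
    have b: "b \<in> B" using snoc.prems B0 by auto
    have iN: "i \<in> {1..N}" using snoc.prems N_def by auto
    show ?case
    proof (cases "w = []")
      case True
      then show ?thesis using snoc.prems \<zeta> b word_entry_single[of a N \<zeta> i b] by (simp add: z_def del: word_entry.simps)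
    next
      case False
      have "(i, w) \<in> Q" using snoc.prems False by (auto simp: Q_def)
      then obtain c0 where c0: "c0 \<in> {d+1..N}" "g c0 = (i, w)" using g by (auto simp: bij_betw_def)
      have uniq: "g c = (i, w) \<longleftrightarrow> c = c0" if "c \<in> {d+1..N}" for c
        using g c0 that by (auto simp: bij_betw_def inj_on_def)
      have un: "{1..N} = {1..d} \<union> {d+1..N}" using N_def by auto
      have "word_entry N \<zeta> i a (w @ [b]) = (\<Sum>c=1..N. word_entry N \<zeta> i c w * z c a b)"
        using snoc.prems \<zeta> b iN by (simp add: word_entry_append word_entry_single del: word_entry.simps)
      also have "\<dots> = (\<Sum>c=1..d. word_entry N \<zeta> i c w * z c a b) + (\<Sum>c=d+1..N. word_entry N \<zeta> i c w * z c a b)"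
        unfolding un by (rule sum.union_disjoint) auto
      also have "(\<Sum>c=1..d. word_entry N \<zeta> i c w * z c a b) = (\<Sum>c=1..d. v i c w * z c a b)"
        using snoc.IH snoc.prems False N_def by (intro sum.cong) auto
      also have "(\<Sum>c=d+1..N. word_entry N \<zeta> i c w * z c a b) = (\<Sum>c=d+1..N. if c0 = c then z c a b else 0)"
        using snoc.IH snoc.prems False uniq by (intro sum.cong refl) auto
      also have "\<dots> = z c0 a b" using c0 by simp
      also have "(\<Sum>c=1..d. v i c w * z c a b) + z c0 a b = (if a \<le> d then v i a (w @ [b]) else if g a = (i, w @ [b]) then 1 else 0)"
        using c0 by (auto simp: z_def)
      finally show ?thesis .
    qed
  qed simp
  show ?thesis
  proof (intro exI[of _ N] exI[of _ \<zeta>] conjI ballI allI impI)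
    show "d \<le> N" by (simp add: N_def)
    show "linfun A (\<zeta> i j)" for i j using \<zeta> by blast
    fix i j w assume "i \<in> {1..d}" "j \<in> {1..d}" "w \<in> lists B0" "w \<noteq> []" "length w \<le> K"
    then show "word_entry N \<zeta> i j w = v i j w" using main[of w i j] N_def by auto
  qed
qed

section \<open>Independence of ordered monomials\<close>

definition basis_lab :: "nat \<Rightarrow> 'a set \<Rightarrow> (nat \<times> nat \<times> 'a list) set" where
  "basis_lab d B = {1..d} \<times> {1..d} \<times> (lists B - {[]})"

lemma len_le_1 [simp]: "len_le k 1"
  using len_le_wd[of "[]" k] by (simp add: wd_Nil)

lemma top_symbol_1 [simp]: "top_symbol f 0 1 = 1"
  using top_symbol_single[of f 0 "[]" 1] by (simp add: wd_def[symmetric] wd_Nil)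

text \<open>Every factor \<open>c\<close> comes with a merging of letters and so with a shorter
  word; the symbol is that of \<open>e_word\<close>.\<close>

lemma t_word_top:
  assumes \<zeta>: "\<And>i j. linfun A (\<zeta> i j)"
  shows "x \<in> W \<Longrightarrow> i \<in> {1..N} \<Longrightarrow> j \<in> {1..N} \<Longrightarrow>
    len_le (length x) (t_word N c i j x) \<and> top_symbol (lf N \<zeta>) (length x) (t_word N c i j x) = word_entry N \<zeta> i j x"
proof (induction N c i j x rule: t_word.induct)
  case (1 N c i j)
  then show ?case by simp
next
  case (2 N c i j x)
  then show ?case by (simp add: len_le_wd wd_def top_symbol_single lf_EE[OF \<zeta>] word_entry_single del: word_entry.simps) (simp add: len_le_def)
next
  case (3 N c i j x y zs)
  let ?L = "length (y # zs)"
  have IH: "len_le ?L (t_word N c a j (y # zs))" "top_symbol (lf N \<zeta>) ?L (t_word N c a j (y # zs)) = word_entry N \<zeta> a j (y # zs)" if "a \<in> {1..N}" for a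
    using 3 that by auto
  have d1: "len_le (Suc ?L) (wd [EE i a x] * t_word N c a j (y # zs))" if "a \<in> {1..N}" for a
    using len_le_mult[OF len_le_wd[of "[EE i a x]" 1] IH(1)[OF that]] by simp
  have t1: "top_symbol (lf N \<zeta>) (Suc ?L) (wd [EE i a x] * t_word N c a j (y # zs)) = \<zeta> i a x * word_entry N \<zeta> a j (y # zs)" if "a \<in> {1..N}" for a
    using top_symbol_mult[OF len_le_wd[of "[EE i a x]" 1] IH(1)[OF that], of "lf N \<zeta>"] IH(2)[OF that] 3 that
    by (simp add: wd_def top_symbol_single lf_EE[OF \<zeta>])
  have d2: "len_le ?L (cst c * t_word N c i j ((x \<otimes> y) # zs))"
    using 3 by (intro len_le_cst_mult) (auto simp: alg_m_closed)
  have "top_symbol (lf N \<zeta>) (Suc ?L) (cst c * t_word N c i j ((x \<otimes> y) # zs)) = 0" by (rule top_symbol_low[OF d2]) simp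
  then show ?case using d1 t1 len_le_mono[OF d2, of "Suc ?L"]
    by (auto simp: top_symbol_add top_symbol_sum intro!: len_le_add len_le_sum)
qed

text \<open>The degree of a product of generators in the canonical filtration of U(gl(N)), in
  contrast to the shifted degree \<open>sdeg\<close>.\<close>

definition total_length :: "(nat \<times> nat \<times> 'a list) list \<Rightarrow> nat" where
  "total_length w = (\<Sum>(i, j, x)\<leftarrow>w. length x)"

lemma ev_top:
  assumes \<zeta>: "\<And>i j. linfun A (\<zeta> i j)" and d: "d \<le> N"
  shows "w \<in> lists (lab d) \<Longrightarrow> len_le (total_length w) (ev N c (wd w)) \<and>
    top_symbol (lf N \<zeta>) (total_length w) (ev N c (wd w)) = (\<Prod>(i, j, x)\<leftarrow>w. word_entry N \<zeta> i j x)"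
proof (induction w)
  case Nil
  then show ?case by (simp add: wd_Nil ev_simps total_length_def)
next
  case (Cons l w)
  obtain i j x where l: "l = (i, j, x)" by (cases l)
  have r: "i \<in> {1..N}" "j \<in> {1..N}" "x \<in> W" using Cons.prems d l by (auto simp: t_index_def)
  have e: "ev N c (wd (l # w)) = t_word N c i j x * ev N c (wd w)"
    using wd_mult[of "[l]" w] ev_simps(2)[of N c "wd [l]" "wd w"] by (simp add: l ev_wd1)
  have IH: "len_le (total_length w) (ev N c (wd w))" "top_symbol (lf N \<zeta>) (total_length w) (ev N c (wd w)) = (\<Prod>(i, j, x)\<leftarrow>w. word_entry N \<zeta> i j x)"
    using Cons by auto
  have T: "len_le (length x) (t_word N c i j x)" "top_symbol (lf N \<zeta>) (length x) (t_word N c i j x) = word_entry N \<zeta> i j x"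
    using t_word_top[OF \<zeta> r(3,1,2)] by auto
  show ?case unfolding e using len_le_mult[OF T(1) IH(1)] top_symbol_mult[OF T(1) IH(1), of "lf N \<zeta>"] T(2) IH(2)
    by (simp add: total_length_def l)
qed

lemma labels_finite:
  assumes "finite Ks" "Ks \<subseteq> lists (basis_lab d B)"
  obtains B0 where "finite B0" "B0 \<subseteq> B" "\<And>w i j x. w \<in> Ks \<Longrightarrow> (i, j, x) \<in> set w \<Longrightarrow> x \<in> lists B0"
proof (rule that[of "\<Union>w\<in>Ks. \<Union>(i, j, x)\<in>set w. set x"])
  show "finite (\<Union>w\<in>Ks. \<Union>(i, j, x)\<in>set w. set x)" using assms by auto
  show "(\<Union>w\<in>Ks. \<Union>(i, j, x)\<in>set w. set x) \<subseteq> B" using assms(2) by (fastforce simp: basis_lab_def)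
qed (fastforce)

lemma max_key:
  assumes "u \<noteq> (0 :: 'k \<Rightarrow>\<^sub>0 complex)"
  shows "\<exists>w\<in>Poly_Mapping.keys u. \<forall>w'\<in>Poly_Mapping.keys u. (f w' :: nat) \<le> f w"
proof -
  have "Max (f ` Poly_Mapping.keys u) \<in> f ` Poly_Mapping.keys u" using assms by (intro Max_in) auto
  then obtain w where "w \<in> Poly_Mapping.keys u" "f w = Max (f ` Poly_Mapping.keys u)" by auto
  then show ?thesis by (intro bexI[of _ w]) auto
qed

text \<open>Words of maximal \<open>total_length\<close> have products of matrix entries as symbols.
  Given arbitrary values \<open>v\<close> for the labels, \<open>realization\<close> yields a size
  \<open>N\<close> and functionals for which the entries are these values; the symbol of
  \<open>u\<close> becomes a polynomial in \<open>v\<close>, and \<open>arranged_indep\<close>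
  applies. The required \<open>N\<close> may be large, hence a hypothesis for all
  \<open>N\<close>.\<close>

theorem indep_Y:
  assumes B: "is_basis A B" and u: "Poly_Mapping.keys u \<subseteq> arranged (basis_lab d B)"
    and 0: "\<And>N. d \<le> N \<Longrightarrow> ev N (c N) u \<in> uea_ideal (gl N A)"
  shows "u = 0"
proof (rule ccontr)
  assume "u \<noteq> 0"
  then obtain w0 where w0: "w0 \<in> Poly_Mapping.keys u" "\<And>w. w \<in> Poly_Mapping.keys u \<Longrightarrow> total_length w \<le> total_length w0"
    using max_key[of u total_length] by blast
  let ?K = "total_length w0"
  let ?W = "{w \<in> Poly_Mapping.keys u. total_length w = ?K}"
  have BA: "B \<subseteq> carrier A" using B by (simp add: is_basis_def)
  have ub: "Poly_Mapping.keys u \<subseteq> lists (basis_lab d B)" using u by (auto simp: arranged_def)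
  have ul: "Poly_Mapping.keys u \<subseteq> lists (lab d)" using ub BA by (fastforce simp: basis_lab_def t_index_def)
  obtain B0 where B0: "finite B0" "B0 \<subseteq> B" "\<And>w i j x. w \<in> Poly_Mapping.keys u \<Longrightarrow> (i, j, x) \<in> set w \<Longrightarrow> x \<in> lists B0"
    using labels_finite[OF _ ub] by auto
  have "Poly_Mapping.lookup u w0 = 0"
  proof (rule arranged_indep[of ?W "basis_lab d B"])
    fix v :: "nat \<times> nat \<times> 'a list \<Rightarrow> complex"
    obtain N \<zeta> where N: "d \<le> N" "\<And>i j. linfun A (\<zeta> i j)"
      "\<And>i j w. \<lbrakk>i \<in> {1..d}; j \<in> {1..d}; w \<in> lists B0; w \<noteq> []; length w \<le> ?K\<rbrakk> \<Longrightarrow> word_entry N \<zeta> i j w = v (i, j, w)"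
      using realization[OF B B0(1,2), of d ?K "\<lambda>i j w. v (i, j, w)"] by blast
    interpret lie_action "gl N A" "gl N A" "mat_mult N A" by (rule lie_action_gl) simp
    have et: "len_le (total_length w) (ev N (c N) (wd w))" "top_symbol (lf N \<zeta>) (total_length w) (ev N (c N) (wd w)) = (\<Prod>(i, j, x)\<leftarrow>w. word_entry N \<zeta> i j x)"
      if "w \<in> Poly_Mapping.keys u" for w using ev_top[where \<zeta> = \<zeta>, OF N(2,1), of w "c N"] ul that by auto
    have eu: "ev N (c N) u = (\<Sum>w\<in>Poly_Mapping.keys u. cst (Poly_Mapping.lookup u w) * ev N (c N) (wd w))"
      by (subst pm_eq_sum) (simp add: ev_simps single_conv)
    have "len_le ?K (ev N (c N) u)" unfolding eu
      by (intro len_le_sum len_le_cst_mult) (use len_le_mono[OF et(1)] w0 in blast)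
    then have "top_symbol (lf N \<zeta>) ?K (ev N (c N) u) = 0"
      by (rule pbw_top[OF linfun_lf[OF N(2)] 0[OF N(1)]])
    then have "(\<Sum>w\<in>Poly_Mapping.keys u. Poly_Mapping.lookup u w * top_symbol (lf N \<zeta>) ?K (ev N (c N) (wd w))) = 0"
      unfolding eu top_symbol_sum top_symbol_cst .
    moreover have "top_symbol (lf N \<zeta>) ?K (ev N (c N) (wd w)) = (if total_length w = ?K then prod_list (map v w) else 0)" if w: "w \<in> Poly_Mapping.keys u" for w
    proof (cases "total_length w = ?K")
      case True
      have "(case l of (i, j, x) \<Rightarrow> word_entry N \<zeta> i j x) = v l" if l: "l \<in> set w" for l
      proof -
        obtain i j x where lx: "l = (i, j, x)" by (cases l)
        have "length x \<le> total_length w" unfolding total_length_def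
          using member_le_sum_list[of "length x" "map (\<lambda>(i, j, x). length x) w"] l lx by force
        moreover have "x \<in> lists B0" "i \<in> {1..d}" "j \<in> {1..d}" "x \<noteq> []"
          using B0(3)[OF w] l lx subsetD[OF ub w] by (auto simp: basis_lab_def)
        ultimately show ?thesis using N(3) True lx by auto
      qed
      then have m: "map (\<lambda>(i, j, x). word_entry N \<zeta> i j x) w = map v w" by auto
      show ?thesis using et(2)[OF w] by (simp only: True m if_True simp_thms)
    next
      case False
      then show ?thesis using top_symbol_low[OF et(1)[OF w], of ?K] w0(2)[OF w] by simp
    qed
    ultimately have "(\<Sum>w\<in>Poly_Mapping.keys u. if total_length w = ?K then Poly_Mapping.lookup u w * prod_list (map v w) else 0) = 0"
      by (simp add: if_distrib cong: if_cong)
    then show "(\<Sum>w\<in>?W. Poly_Mapping.lookup u w * prod_list (map v w)) = 0"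
      by (simp add: sum.inter_filter)
  qed (use u w0 in auto)
  then show False using w0 by (simp add: in_keys_iff)
qed

definition U_map :: "(nat \<times> nat \<times> 'a list) fa \<Rightarrow> (nat \<Rightarrow> nat \<Rightarrow> ('a list \<Rightarrow>\<^sub>0 complex) set) fa" where
  "U_map = subst (\<lambda>(i, j, x). wd [mat_unit (R_alg A) i j (Rc (wd x))])"

text \<open>An entry of a product of matrices is linear in each letter, so it descends to a linear
  functional on the tensor powers.\<close>

lemma word_entry_multilin:
  assumes \<zeta>: "\<And>i j. linfun A (\<zeta> i j)" and r: "r \<in> multilin A" and i: "i \<in> {1..N}"
  shows "lin_ext (\<lambda>w a. a * word_entry N \<zeta> i j w) r = 0"
proof -
  have ag: "coeff_additive (\<lambda>w a. a * word_entry N \<zeta> i j w)" by (rule coeff_additiveI) (simp add: algebra_simps)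
  have cs: "lin_ext (\<lambda>w a. a * word_entry N \<zeta> i j w) (cst c * p) = c * lin_ext (\<lambda>w a. a * word_entry N \<zeta> i j w) p" for c p
  proof -
    have "Poly_Mapping.keys p \<subseteq> UNIV" by simp
    then show ?thesis by (induction p rule: pm_induct) (simp_all add: distrib_left lin_ext_add[OF ag] lin_ext_single[OF ag] cst_single)
  qed
  show ?thesis using r
  proof (induction r rule: ml_induct)
    case (base r)
    then show ?case
    proof (cases rule: mrel_cases)
      case (1 us vs x y)
      have "word_entry N \<zeta> i j (us @ [x \<oplus> y] @ vs) = word_entry N \<zeta> i j (us @ [x] @ vs) + word_entry N \<zeta> i j (us @ [y] @ vs)"
        using 1 i by (simp add: word_entry_append linfunD(1)[OF \<zeta>] distrib_right distrib_left sum.distrib)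
      then show ?thesis by (simp add: 1(5) lin_ext_diff[OF ag] wd_def lin_ext_single[OF ag])
    next
      case (2 us vs x c)
      have "word_entry N \<zeta> i j (us @ [c \<odot> x] @ vs) = c * word_entry N \<zeta> i j (us @ [x] @ vs)"
        using 2 i by (simp add: word_entry_append linfunD(2)[OF \<zeta>] sum_distrib_left mult.assoc mult.left_commute[of _ c])
      then show ?thesis by (simp add: 2(4) lin_ext_diff[OF ag] wd_def lin_ext_single[OF ag])
    qed
  qed (simp_all add: lin_ext_add[OF ag] cs)
qed

text \<open>A label is now a single letter of the Lie algebra, so the degree is the number of
  labels. The realization of matrix entries is used a second time, to supply functionals on R with
  prescribed values on the finitely many words involved; they replace a basis of the tensor
  powers.\<close>

theorem indep_U:
  assumes B: "is_basis A B" and u: "Poly_Mapping.keys u \<subseteq> arranged (basis_lab d B)"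
    and 0: "U_map u \<in> uea_ideal (gl d (R_alg A))"
  shows "u = 0"
proof (rule ccontr)
  assume "u \<noteq> 0"
  then obtain w0 where w0: "w0 \<in> Poly_Mapping.keys u" "\<And>w. w \<in> Poly_Mapping.keys u \<Longrightarrow> length w \<le> length w0"
    using max_key[of u length] by blast
  let ?K = "length w0"
  let ?W = "{w \<in> Poly_Mapping.keys u. length w = ?K}"
  have BA: "B \<subseteq> carrier A" using B by (simp add: is_basis_def)
  have ub: "Poly_Mapping.keys u \<subseteq> lists (basis_lab d B)" using u by (auto simp: arranged_def)
  obtain B0 where B0: "finite B0" "B0 \<subseteq> B" "\<And>w i j x. w \<in> Poly_Mapping.keys u \<Longrightarrow> (i, j, x) \<in> set w \<Longrightarrow> x \<in> lists B0"
    using labels_finite[OF _ ub] by auto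
  define L where "L = Max (total_length ` Poly_Mapping.keys u)"
  interpret RA: complex_algebra "R_alg A" by (rule R_complex_algebra)
  interpret lie_action "gl d (R_alg A)" "gl d (R_alg A)" "mat_mult d (R_alg A)" by (rule RA.lie_action_gl) simp
  have "Poly_Mapping.lookup u w0 = 0"
  proof (rule arranged_indep[of ?W "basis_lab d B"])
    fix v :: "nat \<times> nat \<times> 'a list \<Rightarrow> complex"
    obtain N \<zeta> where N: "d \<le> N" "\<And>i j. linfun A (\<zeta> i j)"
      "\<And>i j w. \<lbrakk>i \<in> {1..d}; j \<in> {1..d}; w \<in> lists B0; w \<noteq> []; length w \<le> L\<rbrakk> \<Longrightarrow> word_entry N \<zeta> i j w = v (i, j, w)"
      using realization[OF B B0(1,2), of d L "\<lambda>i j w. v (i, j, w)"] by blast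
    define z where "z i j = lin_ext (\<lambda>w a. a * word_entry N \<zeta> i j w)" for i j
    have ag: "coeff_additive (\<lambda>w a. a * word_entry N \<zeta> i j w)" for i j by (rule coeff_additiveI) (simp add: algebra_simps)
    have zcst: "z i j (cst c * p) = c * z i j p" for i j c p
    proof -
      have "Poly_Mapping.keys p \<subseteq> UNIV" by simp
      then show ?thesis unfolding z_def
        by (induction p rule: pm_induct) (simp_all add: distrib_left lin_ext_add[OF ag] lin_ext_single[OF ag] cst_single)
    qed
    \<comment> \<open>By \<open>word_entry_multilin\<close> the value does not depend on the chosen
      representative as long as \<open>i\<close> is in range; the default 0 makes the functional
      linear for the other \<open>i\<close> as well.\<close>
    define \<eta> where "\<eta> i j X = (if i \<in> {1..N} then z i j (SOME p. p \<in> WA A \<and> X = Rc p) else 0)" for i j X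
    have \<eta>: "\<eta> i j (Rc p) = z i j p" if p: "p \<in> WA A" and i: "i \<in> {1..N}" for i j p
    proof -
      have q: "(SOME q. q \<in> WA A \<and> Rc p = Rc q) \<in> WA A \<and> Rc p = Rc (SOME q. q \<in> WA A \<and> Rc p = Rc q)"
        by (rule someI[of _ p]) (use p in auto)
      then have "p - (SOME q. q \<in> WA A \<and> Rc p = Rc q) \<in> multilin A" using p Rc_eq by blast
      then have "z i j (p - (SOME q. q \<in> WA A \<and> Rc p = Rc q)) = 0"
        unfolding z_def using word_entry_multilin[where \<zeta> = \<zeta>, OF N(2) _ i] by blast
      then show ?thesis using i by (simp add: \<eta>_def z_def lin_ext_diff[OF ag])
    qed
    have lin: "linfun (R_alg A) (\<eta> i j)" for i j
    proof (cases "i \<in> {1..N}")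
      case True
      then show ?thesis
        by (auto simp: linfun_def R_carrier R_add R_smult \<eta> WA_add WA_cst zcst) (simp add: z_def lin_ext_add[OF ag])
    qed (auto simp: linfun_def \<eta>_def)
    let ?f = "lf d \<eta>"
    have eu: "U_map u = (\<Sum>w\<in>Poly_Mapping.keys u. cst (Poly_Mapping.lookup u w) * wd (map (\<lambda>(i, j, x). mat_unit (R_alg A) i j (Rc (wd x))) w))"
    proof -
      have 1: "prod_list (map (\<lambda>(i, j, x). wd [mat_unit (R_alg A) i j (Rc (wd x))]) w) = wd (map (\<lambda>(i, j, x). mat_unit (R_alg A) i j (Rc (wd x))) w)" for w
        by (subst prod_list_wd[symmetric]) (simp add: o_def case_prod_unfold)
      show ?thesis by (subst pm_eq_sum) (simp add: U_map_def subst_sum subst_single 1)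
    qed
    have "len_le ?K (U_map u)" unfolding eu
      by (intro len_le_sum len_le_cst_mult len_le_wd) (use w0 in auto)
    then have "top_symbol ?f ?K (U_map u) = 0"
      by (rule pbw_top[OF RA.linfun_lf[OF lin] 0])
    then have "(\<Sum>w\<in>Poly_Mapping.keys u. Poly_Mapping.lookup u w * top_symbol ?f ?K (wd (map (\<lambda>(i, j, x). mat_unit (R_alg A) i j (Rc (wd x))) w))) = 0"
      unfolding eu top_symbol_sum top_symbol_cst .
    moreover have "top_symbol ?f ?K (wd (map (\<lambda>(i, j, x). mat_unit (R_alg A) i j (Rc (wd x))) w)) = (if length w = ?K then prod_list (map v w) else 0)" if w: "w \<in> Poly_Mapping.keys u" for w
    proof -
      have "?f (case l of (i, j, x) \<Rightarrow> mat_unit (R_alg A) i j (Rc (wd x))) = v l" if l: "l \<in> set w" for l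
      proof -
        obtain i j x where lx: "l = (i, j, x)" by (cases l)
        have "length x \<le> total_length w" unfolding total_length_def
          using member_le_sum_list[of "length x" "map (\<lambda>(i, j, x). length x) w"] l lx by force
        also have "total_length w \<le> L" unfolding L_def using w by (intro Max_ge) auto
        finally have len: "length x \<le> L" .
        have x: "x \<in> lists B0" "i \<in> {1..d}" "j \<in> {1..d}" "x \<noteq> []"
          using B0(3)[OF w] l lx subsetD[OF ub w] by (auto simp: basis_lab_def)
        have xW: "wd x \<in> WA A" using x B0(2) BA unfolding wd_def by (intro WA_single) auto
        have "?f (mat_unit (R_alg A) i j (Rc (wd x))) = \<eta> i j (Rc (wd x))"
          using RA.lf_EE[where \<zeta> = \<eta>, OF lin, of "Rc (wd x)" d i j] x xW by (simp add: R_carrier)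
        also have "\<dots> = word_entry N \<zeta> i j x" using \<eta>[OF xW] x(2) N(1) by (simp add: z_def wd_def lin_ext_single[OF ag])
        also have "\<dots> = v l" using N(3)[OF x(2,3,1,4) len] lx by simp
        finally show ?thesis using lx by simp
      qed
      then have m: "map ?f (map (\<lambda>(i, j, x). mat_unit (R_alg A) i j (Rc (wd x))) w) = map v w" by simp
      have tw: "top_symbol ?f ?K (wd ws) = (if length ws = ?K then prod_list (map ?f ws) else 0)" for ws
        by (simp add: wd_def top_symbol_single)
      show ?thesis unfolding tw m length_map ..
    qed
    ultimately have "(\<Sum>w\<in>Poly_Mapping.keys u. if length w = ?K then Poly_Mapping.lookup u w * prod_list (map v w) else 0) = 0"
      by (simp add: if_distrib cong: if_cong)
    then show "(\<Sum>w\<in>?W. Poly_Mapping.lookup u w * prod_list (map v w)) = 0"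
      by (simp add: sum.inter_filter)
  qed (use u w0 in auto)
  then show False using w0 by (simp add: in_keys_iff)
qed

end

section \<open>The shifted degree\<close>

definition sdeg :: "(nat \<times> nat \<times> 'a list) list \<Rightarrow> nat" where
  "sdeg w = (\<Sum>(i, j, x)\<leftarrow>w. length x - 1)"

lemma sdeg_simps [simp]: "sdeg [] = 0" "sdeg (u @ v) = sdeg u + sdeg v" "sdeg ((i, j, x) # w) = dg x + sdeg w"
  by (simp_all add: sdeg_def dg_def)

definition hom_part :: "nat \<Rightarrow> (nat \<times> nat \<times> 'a list) fa \<Rightarrow> (nat \<times> nat \<times> 'a list) fa" where
  "hom_part k = lin_ext (\<lambda>w a. if sdeg w = k then Poly_Mapping.single w a else 0)"

lemma coeff_additive_hom_part: "coeff_additive (\<lambda>w a. if sdeg w = k then Poly_Mapping.single w a else 0)"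
  by (rule coeff_additiveI) (simp add: Poly_Mapping.single_add)

lemma hom_part_simps: "hom_part k (p + q) = hom_part k p + hom_part k q" "hom_part k (p - q) = hom_part k p - hom_part k q" "hom_part k 0 = 0" "hom_part k (- p) = - hom_part k p"
  "hom_part k (sum f S) = (\<Sum>x\<in>S. hom_part k (f x))"
  "hom_part k (Poly_Mapping.single w a) = (if sdeg w = k then Poly_Mapping.single w a else 0)"
  by (simp_all add: hom_part_def lin_ext_add lin_ext_diff lin_ext_uminus lin_ext_sum lin_ext_single coeff_additive_hom_part)

lemma lookup_hom_part: "Poly_Mapping.lookup (hom_part k p) w = (if sdeg w = k then Poly_Mapping.lookup p w else 0)"
proof -
  have "Poly_Mapping.keys p \<subseteq> UNIV" by simp
  then show ?thesis
    by (induction p rule: pm_induct) (auto simp: hom_part_simps lookup_add lookup_single when_def)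
qed

lemma hom_part_cst: "hom_part k (cst c * p) = cst c * hom_part k p"
  by (rule poly_mapping_eqI) (simp add: lookup_hom_part map_smult[symmetric] map.rep_eq when_def)

lemma keys_hom_part: "Poly_Mapping.keys (hom_part k p) = {w \<in> Poly_Mapping.keys p. sdeg w = k}"
  by (auto simp: in_keys_iff lookup_hom_part split: if_splits)

lemma hom_part_hom_part: "hom_part k (hom_part l p) = (if k = l then hom_part k p else 0)"
  by (rule poly_mapping_eqI) (simp add: lookup_hom_part)

lemma hom_part_mult: "hom_part k (p * q) = (\<Sum>i\<le>k. hom_part i p * hom_part (k - i) q)"
proof -
  have P: "Poly_Mapping.keys p \<subseteq> UNIV" "Poly_Mapping.keys q \<subseteq> UNIV" by auto
  have 1: "hom_part k (Poly_Mapping.single u a * Poly_Mapping.single v b) = (\<Sum>i\<le>k. hom_part i (Poly_Mapping.single u a) * hom_part (k - i) (Poly_Mapping.single v b))"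
    for u v a b
  proof -
    have "(\<Sum>i\<le>k. hom_part i (Poly_Mapping.single u a) * hom_part (k - i) (Poly_Mapping.single v b))
      = (\<Sum>i\<le>k. if sdeg u = i then (if sdeg v = k - i then Poly_Mapping.single (u @ v) (a * b) else 0) else 0)"
      by (rule sum.cong[OF refl]) (auto simp: hom_part_simps single_mult_list)
    also have "\<dots> = (if sdeg u + sdeg v = k then Poly_Mapping.single (u @ v) (a * b) else 0)"
      by (auto simp: sum.delta)
    finally show ?thesis by (simp add: hom_part_simps single_mult_list)
  qed
  have 2: "hom_part k (Poly_Mapping.single u a * q) = (\<Sum>i\<le>k. hom_part i (Poly_Mapping.single u a) * hom_part (k - i) q)" for u a
    using P(2) by (induction q rule: pm_induct) (simp_all only: mult_zero_right sum.neutral_const hom_part_simps(1,3) distrib_left sum.distrib 1)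
  show ?thesis
    using P(1) by (induction p rule: pm_induct) (simp_all only: mult_zero_left sum.neutral_const hom_part_simps(1,3) distrib_right sum.distrib 2)
qed

lemma hom_part_sum: "p = (\<Sum>k\<in>sdeg ` Poly_Mapping.keys p. hom_part k p)"
proof (rule poly_mapping_eqI)
  fix w
  have "Poly_Mapping.lookup (\<Sum>k\<in>sdeg ` Poly_Mapping.keys p. hom_part k p) w =
      (\<Sum>k\<in>sdeg ` Poly_Mapping.keys p. if sdeg w = k then Poly_Mapping.lookup p w else 0)"
    by (simp add: lookup_sum lookup_hom_part)
  also have "\<dots> = Poly_Mapping.lookup p w"
    by (auto simp: in_keys_iff)
  finally show "Poly_Mapping.lookup p w = Poly_Mapping.lookup (\<Sum>k\<in>sdeg ` Poly_Mapping.keys p. hom_part k p) w" by simp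
qed

section \<open>The kernels of the maps out of T\<close>

locale yang = complex_algebra A for A :: "(complex, 'a) module" (structure) +
  fixes d :: nat and s :: complex and B :: "'a set"
  assumes B: "is_basis A B"
begin

abbreviation "T \<equiv> FA (lab d)"
abbreviation "cN N \<equiv> - of_nat N - s"
abbreviation "IN N \<equiv> uea_ideal (gl N A)"
abbreviation "IU \<equiv> uea_ideal (gl d (R_alg A))"

text \<open>The bound is strict so that \<open>T_below 0\<close> is zero, in accordance with the
  convention for the filtration term of index -1.\<close>

definition T_below :: "nat \<Rightarrow> (nat \<times> nat \<times> 'a list) fa set" where
  "T_below k = {p \<in> T. \<forall>w\<in>Poly_Mapping.keys p. sdeg w < k}"

definition T_hom :: "nat \<Rightarrow> (nat \<times> nat \<times> 'a list) fa set" where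
  "T_hom k = {p \<in> T. \<forall>w\<in>Poly_Mapping.keys p. sdeg w = k}"

definition ker_Y :: "(nat \<times> nat \<times> 'a list) fa set" where
  "ker_Y = {p \<in> T. \<forall>N\<ge>d. ev N (cN N) p \<in> IN N}"

text \<open>The kernel of the map from elements of degree at most \<open>k\<close> to the graded
  piece of Y of degree \<open>k\<close>.\<close>

definition ker_gr :: "nat \<Rightarrow> (nat \<times> nat \<times> 'a list) fa set" where
  "ker_gr k = {p \<in> T_below (Suc k). \<exists>q\<in>T_below k. p - q \<in> ker_Y}"

lemma T_below_T: "p \<in> T_below k \<Longrightarrow> p \<in> T" by (simp add: T_below_def)
lemma T_hom_T: "p \<in> T_hom k \<Longrightarrow> p \<in> T" by (simp add: T_hom_def)
lemma T_hom_T_below: "p \<in> T_hom k \<Longrightarrow> p \<in> T_below (Suc k)" by (auto simp: T_hom_def T_below_def)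
lemma T_below_mono: "p \<in> T_below k \<Longrightarrow> k \<le> l \<Longrightarrow> p \<in> T_below l" by (force simp: T_below_def)
lemma T_below_0: "T_below 0 = {0}" by (auto simp: T_below_def)
lemma T_below_zero [simp]: "0 \<in> T_below k" by (auto simp: T_below_def)
lemma T_hom_zero [simp]: "0 \<in> T_hom k" by (auto simp: T_hom_def)

lemma T_below_add: "p \<in> T_below k \<Longrightarrow> q \<in> T_below k \<Longrightarrow> p + q \<in> T_below k"
  using Poly_Mapping.keys_add[of p q] by (auto simp: T_below_def)
lemma T_below_cst: "p \<in> T_below k \<Longrightarrow> cst c * p \<in> T_below k"
  using keys_cst_mult[of c p] by (auto simp: T_below_def)
lemma T_below_uminus: "p \<in> T_below k \<Longrightarrow> - p \<in> T_below k"
  using T_below_cst[of p k "-1"] by (simp add: cst_minus)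
lemma T_below_diff: "p \<in> T_below k \<Longrightarrow> q \<in> T_below k \<Longrightarrow> p - q \<in> T_below k"
  by (metis T_below_add T_below_uminus diff_conv_add_uminus)
lemma T_hom_add: "p \<in> T_hom k \<Longrightarrow> q \<in> T_hom k \<Longrightarrow> p + q \<in> T_hom k"
  using Poly_Mapping.keys_add[of p q] by (auto simp: T_hom_def)
lemma T_hom_cst: "p \<in> T_hom k \<Longrightarrow> cst c * p \<in> T_hom k"
  using keys_cst_mult[of c p] by (auto simp: T_hom_def)
lemma T_hom_diff: "p \<in> T_hom k \<Longrightarrow> q \<in> T_hom k \<Longrightarrow> p - q \<in> T_hom k"
  using T_hom_add[of p k "cst (-1) * q"] T_hom_cst[of q k "-1"] by (simp add: cst_minus)
lemma T_hom_wd: "w \<in> lists (lab d) \<Longrightarrow> wd w \<in> T_hom (sdeg w)"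
  by (auto simp: T_hom_def wd_def intro!: FA_single)

lemma keys_multE: "w \<in> Poly_Mapping.keys (p * q) \<Longrightarrow> \<exists>u\<in>Poly_Mapping.keys p. \<exists>v\<in>Poly_Mapping.keys q. w = u @ v"
  for p q :: "'b fa"
  by (drule subsetD[OF Poly_Mapping.keys_mult]) (auto simp: plus_list_def)

lemma T_hom_mult: "p \<in> T_hom k \<Longrightarrow> q \<in> T_hom l \<Longrightarrow> p * q \<in> T_hom (k + l)"
  unfolding T_hom_def by (auto dest!: keys_multE)

lemma T_below_mult: "p \<in> T_below (Suc k) \<Longrightarrow> q \<in> T_below l \<Longrightarrow> p * q \<in> T_below (k + l)" "p \<in> T_below k \<Longrightarrow> q \<in> T_below (Suc l) \<Longrightarrow> p * q \<in> T_below (k + l)"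
  unfolding T_below_def by (auto dest!: keys_multE simp: less_Suc_eq_le) (blast intro: add_le_less_mono add_less_le_mono)+

lemma hom_part_T_hom: "p \<in> T \<Longrightarrow> hom_part k p \<in> T_hom k"
  by (auto simp: T_hom_def FA_def keys_hom_part)

lemma hom_part_T: "p \<in> T \<Longrightarrow> hom_part k p \<in> T"
  by (rule T_hom_T[OF hom_part_T_hom])

lemma T_hom_hom_part: "p \<in> T_hom k \<Longrightarrow> hom_part m p = (if m = k then p else 0)"
  by (rule poly_mapping_eqI) (auto simp: T_hom_def lookup_hom_part in_keys_iff)

lemma T_below_hom_part: "p \<in> T_below (Suc k) \<Longrightarrow> p - hom_part k p \<in> T_below k"
proof -
  assume p: "p \<in> T_below (Suc k)"
  have "p - hom_part k p \<in> T" using p by (intro FA_diff hom_part_T) (auto simp: T_below_def)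
  moreover have "sdeg w < k" if "w \<in> Poly_Mapping.keys (p - hom_part k p)" for w
  proof -
    have "Poly_Mapping.lookup p w \<noteq> 0 \<and> sdeg w \<noteq> k" using that by (auto simp: in_keys_iff lookup_minus lookup_hom_part split: if_splits)
    then show ?thesis using p by (auto simp: T_below_def in_keys_iff less_Suc_eq)
  qed
  ultimately show ?thesis by (simp add: T_below_def)
qed

lemma ker_Y_0 [simp]: "0 \<in> ker_Y" by (simp add: ker_Y_def ev_simps lie_rec.I_0[OF lie_rec_gl])
lemma ker_Y_add: "p \<in> ker_Y \<Longrightarrow> q \<in> ker_Y \<Longrightarrow> p + q \<in> ker_Y"
  by (auto simp: ker_Y_def ev_simps intro: lie_rec.I_add[OF lie_rec_gl])
lemma ker_Y_lmult: "p \<in> ker_Y \<Longrightarrow> q \<in> T \<Longrightarrow> q * p \<in> ker_Y"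
  by (auto simp: ker_Y_def ev_simps intro!: lie_rec.I_lmult[OF lie_rec_gl] ev_FA)
lemma ker_Y_rmult: "p \<in> ker_Y \<Longrightarrow> q \<in> T \<Longrightarrow> p * q \<in> ker_Y"
  by (auto simp: ker_Y_def ev_simps intro!: lie_rec.I_rmult[OF lie_rec_gl] ev_FA)
lemma ker_grD: "p \<in> ker_gr k \<Longrightarrow> p \<in> T_below (Suc k)" by (simp add: ker_gr_def)
lemma ker_grI: "p \<in> T_below (Suc k) \<Longrightarrow> q \<in> T_below k \<Longrightarrow> p - q \<in> ker_Y \<Longrightarrow> p \<in> ker_gr k" by (auto simp: ker_gr_def)
lemma ker_gr_T_below: "p \<in> T_below k \<Longrightarrow> p \<in> ker_gr k" by (rule ker_grI[of p k p]) (auto intro: T_below_mono)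
lemma ker_gr_0 [simp]: "0 \<in> ker_gr k" by (rule ker_gr_T_below) simp
lemma ker_gr_add: "p \<in> ker_gr k \<Longrightarrow> q \<in> ker_gr k \<Longrightarrow> p + q \<in> ker_gr k"
proof -
  assume "p \<in> ker_gr k" "q \<in> ker_gr k"
  then obtain p' q' where pq: "p \<in> T_below (Suc k)" "p' \<in> T_below k" "p - p' \<in> ker_Y" "q \<in> T_below (Suc k)" "q' \<in> T_below k" "q - q' \<in> ker_Y"
    by (auto simp: ker_gr_def)
  have "(p + q) - (p' + q') \<in> ker_Y" using ker_Y_add[OF pq(3,6)] by (simp add: algebra_simps)
  then show ?thesis using pq by (intro ker_grI[of "p + q" k "p' + q'"]) (auto intro: T_below_add)
qed

lemma ker_gr_lmult: "p \<in> ker_gr k \<Longrightarrow> q \<in> T_below (Suc l) \<Longrightarrow> q * p \<in> ker_gr (l + k)"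
proof -
  assume "p \<in> ker_gr k" and q: "q \<in> T_below (Suc l)"
  then obtain p' where p: "p \<in> T_below (Suc k)" "p' \<in> T_below k" "p - p' \<in> ker_Y" by (auto simp: ker_gr_def)
  have "q * p - q * p' \<in> ker_Y" using ker_Y_lmult[OF p(3) T_below_T[OF q]] by (simp add: algebra_simps)
  then show ?thesis using T_below_mult(1)[OF q p(1)] T_below_mult(1)[OF q p(2)] by (intro ker_grI[of _ _ "q * p'"]) auto
qed

lemma ker_gr_rmult: "p \<in> ker_gr k \<Longrightarrow> q \<in> T_below (Suc l) \<Longrightarrow> p * q \<in> ker_gr (k + l)"
proof -
  assume "p \<in> ker_gr k" and q: "q \<in> T_below (Suc l)"
  then obtain p' where p: "p \<in> T_below (Suc k)" "p' \<in> T_below k" "p - p' \<in> ker_Y" by (auto simp: ker_gr_def)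
  have "p * q - p' * q \<in> ker_Y" using ker_Y_rmult[OF p(3) T_below_T[OF q]] by (simp add: algebra_simps)
  then show ?thesis using T_below_mult(2)[OF p(1), of q l] T_below_mult(2)[OF p(2) q] q by (intro ker_grI[of _ _ "p' * q"]) (auto intro: T_below_mono)
qed

lemma ker_gr_cst: "p \<in> ker_gr k \<Longrightarrow> cst c * p \<in> ker_gr k"
proof -
  assume p: "p \<in> ker_gr k"
  have "cst c \<in> T_below (Suc 0)" unfolding T_below_def by (intro CollectI conjI FA_cst) (auto simp: cst_def)
  then show ?thesis using ker_gr_lmult[OF p, of "cst c" 0] by simp
qed

lemma ker_gr_uminus: "p \<in> ker_gr k \<Longrightarrow> - p \<in> ker_gr k"
  using ker_gr_cst[of p k "-1"] by (simp add: cst_minus)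

lemma ker_gr_diff: "p \<in> ker_gr k \<Longrightarrow> q \<in> ker_gr k \<Longrightarrow> p - q \<in> ker_gr k"
  by (metis ker_gr_add ker_gr_uminus diff_conv_add_uminus)

lemma ker_gr_sum: "(\<And>x. x \<in> S \<Longrightarrow> f x \<in> ker_gr k) \<Longrightarrow> sum f S \<in> ker_gr k"
  by (induction S rule: infinite_finite_induct) (auto intro: ker_gr_add)

section \<open>The enveloping algebra of gl(d, R) and the common kernel\<close>

sublocale RA: complex_algebra "R_alg A" by (rule R_complex_algebra)
sublocale GU: gl_alg "R_alg A" d ..

abbreviation "FU \<equiv> FA (carrier (gl d (R_alg A)))"

lemma U_map_simps: "U_map (p + q) = U_map p + U_map q" "U_map (p * q) = U_map p * U_map q"
  "U_map (p - q) = U_map p - U_map q" "U_map 0 = 0" "U_map 1 = 1" "U_map (cst a) = cst a" "U_map (- p) = - U_map p"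
  "U_map (sum f S) = (\<Sum>x\<in>S. U_map (f x))"
  by (simp_all add: U_map_def subst_add subst_mult subst_diff subst_cst subst_uminus subst_sum)

lemma U_map_wd1: "U_map (wd [(i, j, x)]) = wd [mat_unit (R_alg A) i j (Rc (wd x))]"
  by (simp add: U_map_def subst_wd)

lemma wd_WA: "x \<in> W \<Longrightarrow> x \<noteq> [] \<Longrightarrow> wd x \<in> WA A"
  unfolding wd_def by (rule WA_single)

lemma Rc_carrier: "p \<in> WA A \<Longrightarrow> Rc p \<in> carrier (R_alg A)"
  by (simp add: R_carrier)

lemma lab_iff: "(i, j, x) \<in> lab d \<longleftrightarrow> i \<in> {1..d} \<and> j \<in> {1..d} \<and> x \<in> W \<and> x \<noteq> []"
  by (auto simp: t_index_def)

lemma U_map_FU: "p \<in> T \<Longrightarrow> U_map p \<in> FU"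
  unfolding U_map_def by (erule subst_FA) (auto simp: t_index_def intro!: FA_wd1 RA.EE_cl Rc_carrier wd_WA)

text \<open>The condition is imposed on homogeneous parts because \<open>ker_gr\<close> makes sense
  only degree by degree. The resulting set is a two-sided ideal, so a single straightening modulo it
  serves both targets.\<close>

definition common_ker :: "(nat \<times> nat \<times> 'a list) fa set" where
  "common_ker = {p \<in> T. \<forall>k. hom_part k p \<in> ker_gr k \<and> U_map (hom_part k p) \<in> IU}"

lemma common_ker_0: "0 \<in> common_ker" by (simp add: common_ker_def hom_part_simps U_map_simps)

lemma common_ker_add: "p \<in> common_ker \<Longrightarrow> q \<in> common_ker \<Longrightarrow> p + q \<in> common_ker"
  by (auto simp: common_ker_def hom_part_simps U_map_simps ker_gr_add GU.U.I_add)

lemma common_ker_lmult: "p \<in> common_ker \<Longrightarrow> q \<in> T \<Longrightarrow> q * p \<in> common_ker"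
proof -
  assume p: "p \<in> common_ker" and q: "q \<in> T"
  have "hom_part i q * hom_part (k - i) p \<in> ker_gr k" if "i \<le> k" for i k
    using ker_gr_lmult[of "hom_part (k - i) p" "k - i" "hom_part i q" i] p that T_hom_T_below[OF hom_part_T_hom[OF q]] by (simp add: common_ker_def)
  moreover have "U_map (hom_part i q * hom_part (k - i) p) \<in> IU" for i k
    unfolding U_map_simps using p q by (intro GU.U.I_lmult U_map_FU hom_part_T) (auto simp: common_ker_def)
  ultimately show ?thesis using p q by (auto simp: common_ker_def hom_part_mult U_map_simps intro!: ker_gr_sum GU.U.I_sum)
qed

lemma common_ker_rmult: "p \<in> common_ker \<Longrightarrow> q \<in> T \<Longrightarrow> p * q \<in> common_ker"
proof -
  assume p: "p \<in> common_ker" and q: "q \<in> T"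
  have "hom_part i p * hom_part (k - i) q \<in> ker_gr k" if "i \<le> k" for i k
    using ker_gr_rmult[of "hom_part i p" i "hom_part (k - i) q" "k - i"] p that T_hom_T_below[OF hom_part_T_hom[OF q]] by (simp add: common_ker_def)
  moreover have "U_map (hom_part i p * hom_part (k - i) q) \<in> IU" for i k
    unfolding U_map_simps using p q by (intro GU.U.I_rmult U_map_FU hom_part_T) (auto simp: common_ker_def)
  ultimately show ?thesis using p q by (auto simp: common_ker_def hom_part_mult U_map_simps intro!: ker_gr_sum GU.U.I_sum)
qed

lemma common_ker_cst: "p \<in> common_ker \<Longrightarrow> cst c * p \<in> common_ker" by (rule common_ker_lmult) auto

lemma common_ker_uminus: "p \<in> common_ker \<Longrightarrow> - p \<in> common_ker"
  using common_ker_cst[of p "-1"] by (simp add: cst_minus)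

lemma common_ker_diff: "p \<in> common_ker \<Longrightarrow> q \<in> common_ker \<Longrightarrow> p - q \<in> common_ker"
  by (metis common_ker_add common_ker_uminus diff_conv_add_uminus)

lemma common_ker_hom: "p \<in> T_hom k \<Longrightarrow> p \<in> ker_gr k \<Longrightarrow> U_map p \<in> IU \<Longrightarrow> p \<in> common_ker"
  by (auto simp: common_ker_def T_hom_hom_part U_map_simps T_hom_T)

text \<open>The combination of \<open>y\<close> and \<open>z\<close> treats sums and multiples at
  once. The recursion of \<open>t_word\<close> touches the first two letters, hence the distinction
  whether the varying letter is the first, the second or a later one; merging it with a neighbour is
  again linear.\<close>

lemma t_word_lin:
  assumes a: "y \<in> carrier A" "z \<in> carrier A"
  shows "us \<in> W \<Longrightarrow> vs \<in> W \<Longrightarrow> i \<in> {1..N} \<Longrightarrow> j \<in> {1..N} \<Longrightarrow>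
    eqN N (t_word N c i j (us @ [a \<odot> y \<oplus> z] @ vs)) (cst a * t_word N c i j (us @ [y] @ vs) + t_word N c i j (us @ [z] @ vs))"
  using a
proof (induction "length us + length vs" arbitrary: us vs y z i rule: less_induct)
  case less
  interpret gl_alg A N ..
  have split: "(\<Sum>b=1..N. w1 i b x * (cst a * f b + g b)) + cst c * (cst a * h + k)
    = cst a * ((\<Sum>b=1..N. w1 i b x * f b) + cst c * h) + ((\<Sum>b=1..N. w1 i b x * g b) + cst c * k)" for x f g h k
  proof -
    have "w1 i b x * (cst a * f b + g b) = cst a * (w1 i b x * f b) + w1 i b x * g b" for b
      by (simp add: distrib_left cst_left_comm)
    then show ?thesis by (simp add: sum.distrib sum_distrib_left distrib_left cst_left_comm[of "cst c" a] add_ac)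
  qed
  show ?case
  proof (cases us)
    case Nil
    show ?thesis
    proof (cases vs)
      case Nil
      have "w1 i j (a \<odot> y \<oplus> z) \<approx> w1 i j (a \<odot> y) + w1 i j z" using less by (intro w1_add) auto
      also have "\<dots> \<approx> cst a * w1 i j y + w1 i j z" using less by (intro U.eqv_add w1_smult U.eqv_refl) auto
      finally show ?thesis using Nil \<open>us = []\<close> by simp
    next
      case (Cons v vs')
      have cl: "v \<in> carrier A" "vs' \<in> W" using less.prems Cons by auto
      have e: "(a \<odot> y \<oplus> z) \<otimes> v = a \<odot> (y \<otimes> v) \<oplus> z \<otimes> v" using less.prems cl by (simp add: alg_l_distr alg_smult_l alg_m_closed)
      have w: "w1 i b (a \<odot> y \<oplus> z) \<approx> cst a * w1 i b y + w1 i b z" if "b \<in> {1..N}" for b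
      proof -
        have "w1 i b (a \<odot> y \<oplus> z) \<approx> w1 i b (a \<odot> y) + w1 i b z" using less that by (intro w1_add) auto
        also have "\<dots> \<approx> cst a * w1 i b y + w1 i b z" using less that by (intro U.eqv_add w1_smult U.eqv_refl) auto
        finally show ?thesis .
      qed
      have IH: "t_word N c i j ((a \<odot> (y \<otimes> v) \<oplus> z \<otimes> v) # vs') \<approx> cst a * t_word N c i j ((y \<otimes> v) # vs') + t_word N c i j ((z \<otimes> v) # vs')"
        using less.hyps[of "[]" vs' i "y \<otimes> v" "z \<otimes> v"] less.prems Cons \<open>us = []\<close> cl by (simp add: alg_m_closed)
      have "t_word N c i j ((a \<odot> y \<oplus> z) # v # vs') \<approx> (\<Sum>b=1..N. (cst a * w1 i b y + w1 i b z) * t_word N c b j (v # vs')) +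
         cst c * (cst a * t_word N c i j ((y \<otimes> v) # vs') + t_word N c i j ((z \<otimes> v) # vs'))"
        unfolding t_word.simps e using w less.prems Cons
        by (intro U.eqv_add U.eqv_sum U.eqv_rmult U.eqv_cst IH t_word_FA) auto
      also have "\<dots> = cst a * t_word N c i j (y # v # vs') + t_word N c i j (z # v # vs')"
        by (simp add: distrib_right distrib_left sum.distrib sum_distrib_left mult.assoc cst_left_comm[of "cst c" a] add_ac)
      finally show ?thesis using Cons \<open>us = []\<close> by simp
    qed
  next
    case (Cons u us')
    have cl: "u \<in> carrier A" "us' \<in> W" using less.prems Cons by auto
    show ?thesis
    proof (cases us')
      case Nil
      have e: "u \<otimes> (a \<odot> y \<oplus> z) = a \<odot> (u \<otimes> y) \<oplus> u \<otimes> z" using less.prems cl by (simp add: alg_r_distr alg_smult_r alg_m_closed)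
      have IH1: "t_word N c b j ((a \<odot> y \<oplus> z) # vs) \<approx> cst a * t_word N c b j (y # vs) + t_word N c b j (z # vs)" if "b \<in> {1..N}" for b
        using less.hyps[of "[]" vs b y z] less.prems Cons Nil that by simp
      have IH2: "t_word N c i j ((a \<odot> (u \<otimes> y) \<oplus> u \<otimes> z) # vs) \<approx> cst a * t_word N c i j ((u \<otimes> y) # vs) + t_word N c i j ((u \<otimes> z) # vs)"
        using less.hyps[of "[]" vs i "u \<otimes> y" "u \<otimes> z"] less.prems Cons Nil cl by (simp add: alg_m_closed)
      have "t_word N c i j (u # (a \<odot> y \<oplus> z) # vs) \<approx> (\<Sum>b=1..N. w1 i b u * (cst a * t_word N c b j (y # vs) + t_word N c b j (z # vs))) +
         cst c * (cst a * t_word N c i j ((u \<otimes> y) # vs) + t_word N c i j ((u \<otimes> z) # vs))"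
        unfolding t_word.simps e using less.prems cl
        by (intro U.eqv_add U.eqv_sum U.eqv_lmult U.eqv_cst IH1 IH2 w1_F) auto
      then show ?thesis unfolding split using Cons Nil by simp
    next
      case (Cons u' us'')
      have cl': "u' \<in> carrier A" "us'' \<in> W" using cl Cons by auto
      have IH1: "t_word N c b j (u' # us'' @ [a \<odot> y \<oplus> z] @ vs) \<approx> cst a * t_word N c b j (u' # us'' @ [y] @ vs) + t_word N c b j (u' # us'' @ [z] @ vs)"
        if "b \<in> {1..N}" for b
        using less.hyps[of "u' # us''" vs b y z] less.prems \<open>us = u # us'\<close> Cons that by simp
      have IH2: "t_word N c i j ((u \<otimes> u') # us'' @ [a \<odot> y \<oplus> z] @ vs) \<approx> cst a * t_word N c i j ((u \<otimes> u') # us'' @ [y] @ vs) + t_word N c i j ((u \<otimes> u') # us'' @ [z] @ vs)"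
        using less.hyps[of "(u \<otimes> u') # us''" vs i y z] less.prems \<open>us = u # us'\<close> Cons cl cl' by (simp add: alg_m_closed)
      have "t_word N c i j (u # u' # us'' @ [a \<odot> y \<oplus> z] @ vs) \<approx>
         (\<Sum>b=1..N. w1 i b u * (cst a * t_word N c b j (u' # us'' @ [y] @ vs) + t_word N c b j (u' # us'' @ [z] @ vs))) +
         cst c * (cst a * t_word N c i j ((u \<otimes> u') # us'' @ [y] @ vs) + t_word N c i j ((u \<otimes> u') # us'' @ [z] @ vs))"
        unfolding t_word.simps using less.prems cl
        by (intro U.eqv_add U.eqv_sum U.eqv_lmult U.eqv_cst IH1 IH2 w1_F) auto
      then show ?thesis unfolding split using \<open>us = u # us'\<close> Cons by simp
    qed
  qed
qed

lemma Rc_lin: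
  assumes "us \<in> W" "vs \<in> W" "y \<in> carrier A" "z \<in> carrier A"
  shows "Rc (wd (us @ [a \<odot> y \<oplus> z] @ vs)) = a \<odot>\<^bsub>R_alg A\<^esub> Rc (wd (us @ [y] @ vs)) \<oplus>\<^bsub>R_alg A\<^esub> Rc (wd (us @ [z] @ vs))"
proof -
  have wa: "wd (us @ [x] @ vs) \<in> WA A" if "x \<in> carrier A" for x using assms that by (intro wd_WA) auto
  have "wd (us @ [a \<odot> y \<oplus> z] @ vs) - (cst a * wd (us @ [y] @ vs) + wd (us @ [z] @ vs)) =
    (wd (us @ [a \<odot> y \<oplus> z] @ vs) - wd (us @ [a \<odot> y] @ vs) - wd (us @ [z] @ vs)) + (wd (us @ [a \<odot> y] @ vs) - cst a * wd (us @ [y] @ vs))"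
    by (simp add: algebra_simps)
  also have "\<dots> \<in> multilin A"
    using assms mrelI2[of us vs y a] by (intro ml_add mrelI1) (auto simp: single_conv)
  finally have "Rc (wd (us @ [a \<odot> y \<oplus> z] @ vs)) = Rc (cst a * wd (us @ [y] @ vs) + wd (us @ [z] @ vs))"
    using assms by (subst Rc_eq) (use wa[of y] wa[of z] wa[of "a \<odot> y \<oplus> z"] in \<open>auto intro: WA_add WA_cst\<close>)
  then show ?thesis using wa[OF assms(3)] wa[OF assms(4)] by (simp add: R_smult R_add WA_cst)
qed

text \<open>In Y this relation holds exactly, without lower terms, since each generator is linear in
  every letter for every \<open>N\<close>.\<close>

lemma common_ker_lin:
  assumes "us \<in> W" "vs \<in> W" "y \<in> carrier A" "z \<in> carrier A" "i \<in> {1..d}" "j \<in> {1..d}"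
  shows "wd [(i, j, us @ [a \<odot> y \<oplus> z] @ vs)] - (cst a * wd [(i, j, us @ [y] @ vs)] + wd [(i, j, us @ [z] @ vs)]) \<in> common_ker"
proof -
  let ?w = "\<lambda>x. wd [(i, j, us @ [x] @ vs)]"
  let ?r = "?w (a \<odot> y \<oplus> z) - (cst a * ?w y + ?w z)"
  let ?k = "length us + length vs"
  have l: "[(i, j, us @ [x] @ vs)] \<in> lists (lab d)" if "x \<in> carrier A" for x using assms that by (auto simp: lab_iff)
  have tk: "?w x \<in> T_hom ?k" if "x \<in> carrier A" for x using T_hom_wd[OF l[OF that]] by (simp add: dg_def)
  have r: "?r \<in> T_hom ?k" using assms by (intro T_hom_diff T_hom_add T_hom_cst tk) auto
  have "?r \<in> ker_Y"
    unfolding ker_Y_def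
  proof (intro CollectI conjI allI impI)
    show "?r \<in> T" by (rule T_hom_T[OF r])
    fix N assume N: "d \<le> N"
    then have ij: "i \<in> {1..N}" "j \<in> {1..N}" using assms by auto
    show "ev N (cN N) ?r \<in> IN N"
      using t_word_lin[OF assms(3,4,1,2) ij] by (simp add: ev_simps ev_wd1 lie_rec.eqv_def[OF lie_rec_gl])
  qed
  then have "?r \<in> ker_gr ?k" using T_hom_T_below[OF r] by (intro ker_grI[of _ _ 0]) auto
  moreover have "U_map ?r \<in> IU"
  proof -
    have wa: "Rc (wd (us @ [x] @ vs)) \<in> carrier (R_alg A)" if "x \<in> carrier A" for x using assms that by (intro Rc_carrier wd_WA) auto
    have "GU.U.eqv (GU.w1 i j (a \<odot>\<^bsub>R_alg A\<^esub> Rc (wd (us @ [y] @ vs)) \<oplus>\<^bsub>R_alg A\<^esub> Rc (wd (us @ [z] @ vs))))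
       (GU.w1 i j (a \<odot>\<^bsub>R_alg A\<^esub> Rc (wd (us @ [y] @ vs))) + GU.w1 i j (Rc (wd (us @ [z] @ vs))))"
      using assms wa by (intro GU.w1_add) auto
    also have "GU.U.eqv \<dots> (cst a * GU.w1 i j (Rc (wd (us @ [y] @ vs))) + GU.w1 i j (Rc (wd (us @ [z] @ vs))))"
      using assms wa by (intro GU.U.eqv_add GU.w1_smult GU.U.eqv_refl) auto
    finally show ?thesis unfolding U_map_simps U_map_wd1 Rc_lin[OF assms(1,2,3,4)] by (simp add: GU.U.eqv_def)
  qed
  ultimately show ?thesis using r common_ker_hom by blast
qed

lemma BA: "B \<subseteq> carrier A" "lin_span A B = carrier A"
  using B by (auto simp: is_basis_def)

abbreviation "SB \<equiv> basis_lab d B"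

lemma SB_lab: "SB \<subseteq> lab d"
  using BA(1) by (fastforce simp: basis_lab_def t_index_def)

text \<open>The letters are expanded in the basis from left to right; \<open>us\<close> is the part
  already expanded.\<close>

lemma letter_red:
  assumes ij: "i \<in> {1..d}" "j \<in> {1..d}"
  shows "vs \<in> W \<Longrightarrow> us \<in> lists B \<Longrightarrow> us @ vs \<noteq> [] \<Longrightarrow> \<exists>q\<in>letter_combs SB. wd [(i, j, us @ vs)] - q \<in> common_ker"
proof (induction vs arbitrary: us)
  case Nil
  then show ?case using ij by (intro bexI[of _ "wd [(i, j, us)]"]) (auto simp: common_ker_0 basis_lab_def intro!: letter_combs_wd)
next
  case (Cons v vs)
  have us: "us \<in> W" using Cons.prems BA by auto
  have vs: "vs \<in> W" using Cons.prems by auto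
  let ?w = "\<lambda>x. wd [(i, j, us @ [x] @ vs)]"
  note lin = common_ker_lin[OF us vs _ _ ij]
  have z0: "?w \<zero> \<in> common_ker" using common_ker_uminus[OF lin[of \<zero> \<zero> 1]] by (simp add: sm_one)
  have "v \<in> lin_span A B" using Cons.prems BA(2) by auto
  then have "\<exists>q\<in>letter_combs SB. ?w v - q \<in> common_ker"
  proof induction
    case (base x)
    then show ?case using Cons.IH[of "us @ [x]"] Cons.prems by auto
  next
    case zero
    show ?case by (rule bexI[of _ 0]) (use z0 in auto)
  next
    case (add x y)
    then obtain p q where pq: "p \<in> letter_combs SB" "?w x - p \<in> common_ker" "q \<in> letter_combs SB" "?w y - q \<in> common_ker" by blast
    have xy: "x \<in> carrier A" "y \<in> carrier A" using add BA(2) by auto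
    have "?w (x \<oplus> y) - (p + q) = (?w (1 \<odot> x \<oplus> y) - (cst 1 * ?w x + ?w y)) + ((?w x - p) + (?w y - q))"
      using xy by (simp add: sm_one algebra_simps)
    also have "\<dots> \<in> common_ker" using pq by (intro common_ker_add lin xy)
    finally show ?case using pq letter_combs_add by blast
  next
    case (smult x c)
    then obtain p where p: "p \<in> letter_combs SB" "?w x - p \<in> common_ker" by blast
    have x: "x \<in> carrier A" using smult BA(2) by auto
    have "?w (c \<odot> x) - cst c * p = (?w (c \<odot> x \<oplus> \<zero>) - (cst c * ?w x + ?w \<zero>)) + (cst c * (?w x - p) + ?w \<zero>)"
      using x by (simp add: algebra_simps)
    also have "\<dots> \<in> common_ker" using p by (intro common_ker_add common_ker_cst z0 lin x) auto
    finally show ?case using p letter_combs_cst by blast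
  qed
  then show ?case by simp
qed

text \<open>The counterpart of \<open>e_word\<close> in \<open>T\<close>, with the Kronecker delta
  for the empty word, so that all members of \<open>all_prods\<close> translate uniformly.\<close>

definition t_gen :: "nat \<Rightarrow> nat \<Rightarrow> 'a list \<Rightarrow> (nat \<times> nat \<times> 'a list) fa" where
  "t_gen i j u = (if u = [] then (if i = j then 1 else 0) else wd [(i, j, u)])"

lemma t_gen_ev: "j \<in> {1..N} \<Longrightarrow> ev N 0 (t_gen i j u) = e_word N i j u"
  using t_word_0[of j N i u] by (auto simp: t_gen_def ev_simps ev_wd1)

lemma t_gen_T_hom: "u \<in> W \<Longrightarrow> i \<in> {1..d} \<Longrightarrow> j \<in> {1..d} \<Longrightarrow> t_gen i j u \<in> T_hom (dg u)"
proof (cases "u = []")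
  case True
  have "(1 :: (nat \<times> nat \<times> 'a list) fa) \<in> T_hom 0" using T_hom_wd[of "[]"] by (simp add: wd_Nil)
  then show ?thesis using True by (simp add: t_gen_def dg_def)
next
  case False
  assume "u \<in> W" "i \<in> {1..d}" "j \<in> {1..d}"
  then show ?thesis using False T_hom_wd[of "[(i, j, u)]"] by (simp add: t_gen_def lab_iff)
qed

text \<open>The derivation of \<open>Good\<close> is followed rule by rule with the indices fixed in
  \<open>{1..d}\<close>; since no rule involves \<open>N\<close>, the same \<open>q\<close> serves
  every \<open>N\<close>.\<close>

lemma Good_translate:
  assumes r: "i \<in> {1..d}" "j \<in> {1..d}" "k \<in> {1..d}" "l \<in> {1..d}" and G: "Good D G"
  shows "\<exists>q\<in>T_below D. \<forall>N\<ge>d. eqN N (G N i j k l) (ev N 0 q)"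
  using G
proof induction
  case (base G)
  then obtain u v where uv: "u \<in> W" "v \<in> W" "dg u + dg v < D" and G: "G = prod_kj_il u v \<or> G = prod_il_kj u v \<or> G = prod_ij_kl u v \<or> G = prod_kl_ij u v"
    by (elim all_prods_cases)
  have tl: "p * q \<in> T_below D" if "p \<in> T_hom m" "q \<in> T_hom n" "m + n < D" for p q m n
    using T_hom_T_below[OF T_hom_mult[OF that(1,2)]] that(3) by (auto elim: T_below_mono)
  have rN: "j \<in> {1..N}" "l \<in> {1..N}" if "d \<le> N" for N using r that by auto
  show ?case using G
  proof (elim disjE)
    assume "G = prod_kj_il u v"
    then show ?thesis using uv r rN
      by (intro bexI[of _ "t_gen k j u * t_gen i l v"] tl[OF t_gen_T_hom t_gen_T_hom]) (auto simp: prod_kj_il_def ev_simps t_gen_ev)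
  next
    assume "G = prod_il_kj u v"
    then show ?thesis using uv r rN
      by (intro bexI[of _ "t_gen i l v * t_gen k j u"] tl[OF t_gen_T_hom t_gen_T_hom]) (auto simp: prod_il_kj_def ev_simps t_gen_ev)
  next
    assume "G = prod_ij_kl u v"
    then show ?thesis using uv r rN
      by (intro bexI[of _ "t_gen i j u * t_gen k l v"] tl[OF t_gen_T_hom t_gen_T_hom]) (auto simp: prod_ij_kl_def ev_simps t_gen_ev)
  next
    assume "G = prod_kl_ij u v"
    then show ?thesis using uv r rN
      by (intro bexI[of _ "t_gen k l v * t_gen i j u"] tl[OF t_gen_T_hom t_gen_T_hom]) (auto simp: prod_kl_ij_def ev_simps t_gen_ev)
  qed
next
  case zero
  show ?case by (rule bexI[of _ 0]) (auto simp: ev_simps)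
next
  case (add G G')
  then obtain q q' where "q \<in> T_below D" "q' \<in> T_below D" "\<And>N. N \<ge> d \<Longrightarrow> eqN N (G N i j k l) (ev N 0 q)" "\<And>N. N \<ge> d \<Longrightarrow> eqN N (G' N i j k l) (ev N 0 q')"
    by blast
  then show ?case by (intro bexI[of _ "q + q'"]) (auto simp: ev_simps intro: T_below_add lie_rec.eqv_add[OF lie_rec_gl])
next
  case (neg G)
  then obtain q where "q \<in> T_below D" "\<And>N. N \<ge> d \<Longrightarrow> eqN N (G N i j k l) (ev N 0 q)" by blast
  then show ?case by (intro bexI[of _ "- q"]) (auto simp: ev_simps intro: T_below_uminus lie_rec.eqv_uminus[OF lie_rec_gl])
next
  case (eqv G G')
  then obtain q where q: "q \<in> T_below D" "\<And>N. N \<ge> d \<Longrightarrow> eqN N (G N i j k l) (ev N 0 q)" by blast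
  have "eqN N (G' N i j k l) (ev N 0 q)" if "N \<ge> d" for N
  proof -
    have "eqN N (G N i j k l) (G' N i j k l)" using r that by (intro eqv.hyps) auto
    then show ?thesis using q(2)[OF that] lie_rec.eqv_trans[OF lie_rec_gl lie_rec.eqv_sym[OF lie_rec_gl]] by blast
  qed
  then show ?case using q by blast
qed

text \<open>In U(gl(d, R)) this is the bracket of matrix units. In Y it is checked at
  \<open>c = 0\<close>, where the generators become \<open>e_word\<close> and the defect is the
  evaluation of some \<open>q\<close> of lower degree; \<open>stability\<close> carries the
  vanishing of the difference over to \<open>c = - N - s\<close>.\<close>

lemma common_ker_comm:
  assumes r: "i \<in> {1..d}" "j \<in> {1..d}" "k \<in> {1..d}" "l \<in> {1..d}" and xy: "x \<in> W" "y \<in> W" "x \<noteq> []" "y \<noteq> []"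
  shows "wd [(i, j, x), (k, l, y)] - wd [(k, l, y), (i, j, x)] -
    ((if k = j then wd [(i, l, wj x y)] else 0) - (if i = l then wd [(k, j, wj y x)] else 0)) \<in> common_ker" (is "?r \<in> common_ker")
proof (rule common_ker_hom)
  let ?D = "dg x + dg y"
  have l: "(i, j, x) \<in> lab d" "(k, l, y) \<in> lab d" "(i, l, wj x y) \<in> lab d" "(k, j, wj y x) \<in> lab d"
    using r xy wj_W[of x y] wj_W[of y x] wj_ne by (simp_all add: lab_iff)
  have t: "wd [(i, j, x), (k, l, y)] \<in> T_hom ?D" "wd [(k, l, y), (i, j, x)] \<in> T_hom ?D" "wd [(i, l, wj x y)] \<in> T_hom ?D" "wd [(k, j, wj y x)] \<in> T_hom ?D"
    using T_hom_wd[of "[(i, j, x), (k, l, y)]"] T_hom_wd[of "[(k, l, y), (i, j, x)]"] T_hom_wd[of "[(i, l, wj x y)]"] T_hom_wd[of "[(k, j, wj y x)]"]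
      l xy by (simp_all add: wj_dg add.commute)
  show r': "?r \<in> T_hom ?D" by (intro T_hom_diff t) (auto simp: t)
  have w2: "wd [a, b] = wd [a] * wd [b]" for a b :: "nat \<times> nat \<times> 'a list" by (simp add: wd_mult)
  show "U_map ?r \<in> IU"
  proof -
    have wa: "wd x \<in> WA A" "wd y \<in> WA A" using xy by (auto intro: wd_WA)
    have m: "Rc (wd x) \<otimes>\<^bsub>R_alg A\<^esub> Rc (wd y) = Rc (wd (wj x y))" "Rc (wd y) \<otimes>\<^bsub>R_alg A\<^esub> Rc (wd x) = Rc (wd (wj y x))"
      using wa by (simp_all add: R_mult) (simp_all add: wd_def wmul_single)
    show ?thesis
      using GU.w1_comm[OF Rc_carrier[OF wa(1)] Rc_carrier[OF wa(2)] r]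
      by (simp add: U_map_simps U_map_wd1 w2 m GU.U.eqv_def if_distrib[of U_map] cong: if_cong)
  qed
  obtain q where q: "q \<in> T_below ?D" "\<And>N. N \<ge> d \<Longrightarrow> eqN N (bracket_defect x y N i j k l) (ev N 0 q)"
    using Good_translate[OF r bracket_defect_Good[OF xy]] by blast
  have T: "?r - q \<in> T" using T_hom_T[OF r'] T_below_T[OF q(1)] by (rule FA_diff)
  have e0: "ev N 0 (?r - q) \<in> IN N" if N: "N \<ge> d" for N
  proof -
    have rN: "j \<in> {1..N}" "l \<in> {1..N}" using r N by auto
    have "ev N 0 ?r = bracket_defect x y N i j k l"
      using rN by (simp add: ev_simps ev_wd1 w2 bracket_defect_def t_word_0 if_distrib[of "ev N 0"] cong: if_cong)
    then show ?thesis using q(2)[OF N] by (simp add: ev_simps(3) lie_rec.eqv_def[OF lie_rec_gl])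
  qed
  have "?r - q \<in> ker_Y" unfolding ker_Y_def using T stability[OF B T e0] by blast
  then show "?r \<in> ker_gr ?D" using q(1) T_hom_T_below[OF r'] by (intro ker_grI[of _ _ q]) auto
qed

sublocale st: straight common_ker "lab d" SB
proof
  show "SB \<subseteq> lab d" by (rule SB_lab)
  fix a assume "a \<in> lab d"
  then show "\<exists>q\<in>letter_combs SB. wd [a] - q \<in> common_ker"
    using letter_red[of "fst a" "fst (snd a)" "snd (snd a)" "[]"] by (cases a) (auto simp: lab_iff)
next
  fix a b assume ab: "a \<in> SB" "b \<in> SB"
  obtain i j x k l y where e: "a = (i, j, x)" "b = (k, l, y)" by (cases a, cases b) auto
  have r: "i \<in> {1..d}" "j \<in> {1..d}" "k \<in> {1..d}" "l \<in> {1..d}" and xy: "x \<in> W" "y \<in> W" "x \<noteq> []" "y \<noteq> []"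
    using subsetD[OF SB_lab ab(1)] subsetD[OF SB_lab ab(2)] by (simp_all add: e lab_iff)
  obtain p where p: "p \<in> letter_combs SB" "wd [(i, l, wj x y)] - p \<in> common_ker"
    using letter_red[OF r(1,4), of "wj x y" "[]"] wj_W[of x y] xy wj_ne by auto
  obtain q where q: "q \<in> letter_combs SB" "wd [(k, j, wj y x)] - q \<in> common_ker"
    using letter_red[OF r(3,2), of "wj y x" "[]"] wj_W[of y x] xy wj_ne by auto
  let ?p = "if k = j then p else 0" and ?q = "if i = l then q else 0"
  have "((if k = j then wd [(i, l, wj x y)] else 0) - ?p) \<in> common_ker" "((if i = l then wd [(k, j, wj y x)] else 0) - ?q) \<in> common_ker"
    using p q common_ker_0 by auto
  from common_ker_add[OF common_ker_comm[OF r xy] common_ker_diff[OF this]]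
  have "wd [a, b] - wd [b, a] - (?p - ?q) \<in> common_ker" by (simp add: e algebra_simps)
  moreover have "?p - ?q \<in> letter_combs SB" using p q by (auto intro: letter_combs_diff letter_combs_uminus)
  ultimately show "\<exists>q\<in>letter_combs SB. wd [a, b] - wd [b, a] - q \<in> common_ker" by blast
qed (auto intro: common_ker_0 common_ker_add common_ker_lmult common_ker_rmult)

section \<open>Comparison of the two kernels\<close>

lemma arranged_T: "Poly_Mapping.keys u \<subseteq> arranged SB \<Longrightarrow> u \<in> T"
  using SB_lab by (auto simp: FA_def arranged_def)

text \<open>Straightening modulo \<open>common_ker\<close> is correct in Y only up to terms of lower
  degree. These are straightened in turn, down to degree 0, and the result is a congruence in Y
  itself.\<close>

lemma arranged_low:
  "q \<in> T_below k \<Longrightarrow> \<exists>u. Poly_Mapping.keys u \<subseteq> arranged SB \<and> u \<in> T_below k \<and> q - u \<in> ker_Y"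
proof (induction k arbitrary: q)
  case 0
  then show ?case by (intro exI[of _ 0]) (simp add: T_below_0)
next
  case (Suc k)
  obtain u where u: "Poly_Mapping.keys u \<subseteq> arranged SB" "q - u \<in> common_ker" using st.straighten[OF T_below_T[OF Suc.prems]] by blast
  have uT: "u \<in> T" by (rule arranged_T[OF u(1)])
  have "hom_part k (q - u) \<in> ker_gr k" using u(2) by (simp add: common_ker_def)
  then obtain r where r: "r \<in> T_below k" "hom_part k q - hom_part k u - r \<in> ker_Y" by (auto simp: ker_gr_def hom_part_simps)
  \<comment> \<open>What remains of \<open>q\<close> when its top part is replaced by the arranged
    part \<open>hom_part k u\<close>; its degree is lower.\<close>
  have "r + (q - hom_part k q) \<in> T_below k" using r T_below_hom_part[OF Suc.prems] by (intro T_below_add)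
  from Suc.IH[OF this] obtain v where v: "Poly_Mapping.keys v \<subseteq> arranged SB" "v \<in> T_below k" "r + (q - hom_part k q) - v \<in> ker_Y" by blast
  have "Poly_Mapping.keys (hom_part k u + v) \<subseteq> arranged SB"
    using Poly_Mapping.keys_add[of "hom_part k u" v] u(1) v(1) by (auto simp: keys_hom_part)
  moreover have "hom_part k u + v \<in> T_below (Suc k)" using T_hom_T_below[OF hom_part_T_hom[OF uT]] v(2) by (intro T_below_add) (auto intro: T_below_mono)
  moreover have "q - (hom_part k u + v) \<in> ker_Y" using ker_Y_add[OF r(2) v(3)] by (simp add: algebra_simps)
  ultimately show ?case by blast
qed

text \<open>Straighten \<open>p\<close> to \<open>u\<close> modulo the common kernel. If
  \<open>p\<close> vanishes in one target, so does \<open>u\<close>, and independence there gives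
  \<open>u = 0\<close>. Then \<open>p\<close> lies in the common kernel and vanishes in the other
  target.\<close>

theorem kernel:
  assumes p: "p \<in> T"
  shows "(\<forall>k. hom_part k p \<in> ker_gr k) \<longleftrightarrow> U_map p \<in> IU"
proof -
  obtain u where u: "Poly_Mapping.keys u \<subseteq> arranged SB" "p - u \<in> common_ker" using st.straighten[OF p] by blast
  have uT: "u \<in> T" by (rule arranged_T[OF u(1)])
  have CU: "U_map q \<in> IU" if "q \<in> common_ker" for q
  proof -
    have "U_map q = (\<Sum>k\<in>sdeg ` Poly_Mapping.keys q. U_map (hom_part k q))"
      by (subst hom_part_sum) (simp add: U_map_simps)
    then show ?thesis using that by (auto simp: common_ker_def intro!: GU.U.I_sum)
  qed
  show ?thesis
  proof
    assume k: "\<forall>k. hom_part k p \<in> ker_gr k"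
    have "hom_part k u = 0" for k
    proof -
      have "hom_part k (p - u) \<in> ker_gr k" using u(2) by (simp add: common_ker_def)
      then have "hom_part k p - hom_part k (p - u) \<in> ker_gr k" using k ker_gr_diff by blast
      then have "hom_part k u \<in> ker_gr k" by (simp add: hom_part_simps)
      then obtain q where q: "q \<in> T_below k" "hom_part k u - q \<in> ker_Y" by (auto simp: ker_gr_def)
      \<comment> \<open>\<open>indep_Y\<close> is about Y and not about its graded algebra, so the
        lower term \<open>q\<close> has to be made arranged as well. The degrees then keep it apart
        from \<open>hom_part k u\<close>.\<close>
      obtain v where v: "Poly_Mapping.keys v \<subseteq> arranged SB" "v \<in> T_below k" "q - v \<in> ker_Y" using arranged_low[OF q(1)] by blast
      have "hom_part k u - v \<in> ker_Y" using ker_Y_add[OF q(2) v(3)] by simp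
      moreover have "Poly_Mapping.keys (hom_part k u - v) \<subseteq> arranged SB"
        using Poly_Mapping.keys_add[of "hom_part k u" "cst (-1) * v"] keys_cst_mult[of "-1" v] u(1) v(1) by (auto simp: keys_hom_part cst_minus)
      ultimately have "hom_part k u - v = 0" by (intro indep_Y[OF B, of _ d "\<lambda>N. cN N"]) (auto simp: ker_Y_def)
      then have e: "hom_part k u = v" by simp
      show ?thesis
      proof (rule ccontr)
        assume "hom_part k u \<noteq> 0"
        then obtain w where "w \<in> Poly_Mapping.keys (hom_part k u)" by (metis keys_eq_empty ex_in_conv)
        then show False using e v(2) keys_hom_part[of k u] by (auto simp: T_below_def)
      qed
    qed
    then have "u = 0" by (subst hom_part_sum) simp
    then show "U_map p \<in> IU" using CU u(2) by simp
  next
    assume "U_map p \<in> IU"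
    then have "U_map p - U_map (p - u) \<in> IU" by (rule GU.U.I_diff[OF _ CU[OF u(2)]])
    then have "U_map u \<in> IU" by (simp add: U_map_simps)
    then have "u = 0" by (rule indep_U[OF B u(1)])
    then show "\<forall>k. hom_part k p \<in> ker_gr k" using u(2) by (simp add: common_ker_def)
  qed
qed

end

section \<open>The generators \<open>t\<^sub>i\<^sub>j(x; s)\<close>\<close>

lemma lists_Suc: "{a. set a \<subseteq> S \<and> length a = Suc n} = (\<lambda>(b, a). b # a) ` (S \<times> {a. set a \<subseteq> S \<and> length a = n})"
  by (auto simp: length_Suc_conv image_iff)

lemma sum_lists_Suc:
  "(\<Sum>a\<in>{a. set a \<subseteq> S \<and> length a = Suc n}. f a) = (\<Sum>b\<in>S. \<Sum>a\<in>{a. set a \<subseteq> S \<and> length a = n}. f (b # a))"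
  unfolding lists_Suc by (subst sum.reindex) (auto simp: inj_on_def sum.cartesian_product case_prod_unfold)

lemma comps_1: "comps (Suc 0) = {[Suc 0]}"
proof -
  have "\<nu> = [Suc 0]" if "0 \<notin> set \<nu>" "sum_list \<nu> = Suc 0" for \<nu>
    using that by (cases \<nu>) (auto, metis add_is_1 list.set_intros(1) neq0_conv sum_list_eq_0_iff[THEN iffD1] set_empty all_not_in_conv)
  then show ?thesis by (auto simp: comps_def)
qed

definition bump :: "nat list \<Rightarrow> nat list" where "bump \<nu> = Suc (hd \<nu>) # tl \<nu>"

text \<open>A composition of \<open>m + 1\<close> begins with 1 or has a first part that can be
  lowered by one. These are the two terms in the recursion of \<open>t_word\<close>.\<close>

lemma comps_Suc:
  assumes "m > 0"
  shows "comps (Suc m) = (#) 1 ` comps m \<union> bump ` comps m" "(#) 1 ` comps m \<inter> bump ` comps m = {}"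
    "inj_on ((#) 1) (comps m)" "inj_on bump (comps m)"
proof -
  have ne: "\<nu> \<noteq> []" "hd \<nu> \<noteq> 0" if "\<nu> \<in> comps m" for \<nu>
    using that assms by (cases \<nu>; auto simp: comps_def)+
  show "inj_on ((#) 1) (comps m)" by auto
  show "inj_on bump (comps m)"
  proof (rule inj_onI)
    fix \<nu> \<mu> assume "\<nu> \<in> comps m" "\<mu> \<in> comps m" "bump \<nu> = bump \<mu>"
    then show "\<nu> = \<mu>" using ne[of \<nu>] ne[of \<mu>] by (cases \<nu>; cases \<mu>) (auto simp: bump_def)
  qed
  show "(#) 1 ` comps m \<inter> bump ` comps m = {}" by (auto simp: bump_def dest: ne(2))
  show "comps (Suc m) = (#) 1 ` comps m \<union> bump ` comps m"
  proof (intro equalityI subsetI)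
    fix \<nu> assume n: "\<nu> \<in> comps (Suc m)"
    then obtain k \<mu> where \<nu>: "\<nu> = k # \<mu>" by (cases \<nu>) (auto simp: comps_def)
    show "\<nu> \<in> (#) 1 ` comps m \<union> bump ` comps m"
    proof (cases "k = 1")
      case True
      then show ?thesis using n \<nu> by (auto simp: comps_def)
    next
      case False
      then obtain k' where "k = Suc (Suc k')" using n \<nu> by (cases k; cases "k - 1") (auto simp: comps_def)
      then have "(Suc k' # \<mu>) \<in> comps m" "\<nu> = bump (Suc k' # \<mu>)" using n \<nu> by (auto simp: comps_def bump_def)
      then show ?thesis by blast
    qed
  next
    fix \<nu> assume "\<nu> \<in> (#) 1 ` comps m \<union> bump ` comps m"
    then show "\<nu> \<in> comps (Suc m)"
    proof
      assume "\<nu> \<in> bump ` comps m"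
      then obtain \<mu> where m: "\<mu> \<in> comps m" "\<nu> = bump \<mu>" by blast
      then show ?thesis using ne[OF m(1)] by (cases \<mu>) (auto simp: comps_def bump_def)
    qed (auto simp: comps_def)
  qed
qed

lemma finite_comps: "m > 0 \<Longrightarrow> finite (comps m)"
proof (induction m)
  case (Suc m)
  then show ?case by (cases "m = 0") (auto simp: comps_1 comps_Suc(1))
qed simp

lemma length_merge: "length (merge_word \<Omega> x \<nu>) = length \<nu>"
  by (induction \<Omega> x \<nu> rule: merge_word.induct) auto

lemma comps_length: "\<nu> \<in> comps m \<Longrightarrow> length \<nu> \<le> m"
proof (induction \<nu> arbitrary: m)
  case (Cons k \<nu>)
  then have "\<nu> \<in> comps (m - k)" "k \<ge> 1" "k \<le> m" by (auto simp: comps_def)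
  then show ?case using Cons.IH by fastforce
qed simp

context complex_algebra
begin

lemma mprod1_closed: "x \<in> W \<Longrightarrow> x \<noteq> [] \<Longrightarrow> mprod1 A x \<in> carrier A"
proof -
  have "foldl (\<otimes>) a x \<in> carrier A" if "x \<in> W" "a \<in> carrier A" for a x
    using that by (induction x arbitrary: a) (auto simp: alg_m_closed)
  then show "x \<in> W \<Longrightarrow> x \<noteq> [] \<Longrightarrow> mprod1 A x \<in> carrier A" by (cases x) (auto simp: mprod1_def)
qed

lemma merge_W: "x \<in> W \<Longrightarrow> \<nu> \<in> comps (length x) \<Longrightarrow> merge_word A x \<nu> \<in> W"
proof (induction \<nu> arbitrary: x)
  case (Cons k \<nu>)
  have k: "k > 0" "k \<le> length x" and \<nu>: "\<nu> \<in> comps (length (drop k x))" using Cons.prems by (auto simp: comps_def)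
  have "mprod1 A (take k x) \<in> carrier A" using Cons.prems k by (intro mprod1_closed) (auto dest: in_set_takeD)
  moreover have "merge_word A (drop k x) \<nu> \<in> W" using Cons.prems \<nu> by (intro Cons.IH) (auto dest: in_set_dropD)
  ultimately show ?case by simp
qed simp

text \<open>The first step of the index path is split off; what remains is a path for the tail,
  starting at the second vertex.\<close>

lemma path_sum:
  "x \<noteq> [] \<Longrightarrow> j \<in> {1..N} \<Longrightarrow> (\<Sum>a\<in>{a. set a \<subseteq> {1..N} \<and> length a = length x - 1}.
     prod_list (map (\<lambda>q. wd [EE ((i # a @ [j]) ! q) ((i # a @ [j]) ! Suc q) (x ! q)]) [0..<length x])) = e_word N i j x"
proof (induction x arbitrary: i)
  case (Cons x xs)
  show ?case
  proof (cases "xs = []")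
    case True
    have e0: "{a :: nat list. set a \<subseteq> {1..N} \<and> length a = length [x] - 1} = {[]}" by auto
    show ?thesis unfolding True e0 e_word_single[OF Cons.prems(2)] by simp
  next
    case False
    then obtain n where n: "length xs = Suc n" by (cases xs) auto
    have e: "prod_list (map (\<lambda>q. wd [EE ((i # (b # a) @ [j]) ! q) ((i # (b # a) @ [j]) ! Suc q) ((x # xs) ! q)]) [0..<length (x # xs)])
      = wd [EE i b x] * prod_list (map (\<lambda>q. wd [EE ((b # a @ [j]) ! q) ((b # a @ [j]) ! Suc q) (xs ! q)]) [0..<length xs])" for a b
    proof -
      have "[0..<length (x # xs)] = 0 # map Suc [0..<length xs]" by (simp add: map_Suc_upt upt_conv_Cons del: upt_Suc)
      then show ?thesis by (simp only: list.map map_map o_def nth_Cons_0 nth_Cons_Suc prod_list.Cons append_Cons)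
    qed
    have "length (x # xs) - 1 = Suc n" using n by simp
    let ?P = "\<lambda>b a. prod_list (map (\<lambda>q. wd [EE ((b # a @ [j]) ! q) ((b # a @ [j]) ! Suc q) (xs ! q)]) [0..<length xs])"
    have IH: "(\<Sum>a\<in>{a. set a \<subseteq> {1..N} \<and> length a = n}. ?P b a) = e_word N b j xs" for b
      using Cons.IH[OF False Cons.prems(2), of b] n by (simp only: diff_Suc_1)
    have "(\<Sum>b=1..N. \<Sum>a\<in>{a. set a \<subseteq> {1..N} \<and> length a = n}. wd [EE i b x] * ?P b a) = e_word N i j (x # xs)"
      unfolding e_word.simps IH[symmetric] sum_distrib_left ..
    then show ?thesis unfolding \<open>length (x # xs) - 1 = Suc n\<close> sum_lists_Suc e .
  qed
qed simp

lemma e_elt_cls: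
  assumes x: "x \<in> W" "x \<noteq> []" and ij: "i \<in> {1..N}" "j \<in> {1..N}"
  shows "e_elt A N i j x = lie_rec.cls (gl N A) (e_word N i j x)"
proof -
  interpret gl_alg A N ..
  let ?S = "{a. set a \<subseteq> {1..N} \<and> length a = length x - 1}"
  let ?g = "\<lambda>a q. wd [EE ((i # a @ [j]) ! q) ((i # a @ [j]) ! Suc q) (x ! q)]"
  have fin: "finite ?S" by (rule finite_lists_length_eq) simp
  have F: "?g a q \<in> U.F" if "a \<in> ?S" "q < length x" for a q
  proof (rule w1_F)
    have "set (i # a @ [j]) \<subseteq> {1..N}" "length (i # a @ [j]) = Suc (length x)" using that ij x by auto
    then show "(i # a @ [j]) ! q \<in> {1..N}" "(i # a @ [j]) ! Suc q \<in> {1..N}"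
      using that(2) nth_mem[of q "i # a @ [j]"] nth_mem[of "Suc q" "i # a @ [j]"] by (metis less_SucI Suc_less_eq subsetD)+
    show "x ! q \<in> carrier A" using x that by auto
  qed
  have "e_elt A N i j x = finsum (uea (gl N A)) (\<lambda>a. U.cls (prod_list (map (?g a) [0..<length x]))) ?S"
    unfolding e_elt_def Let_def
  proof (rule abelian_monoid.finsum_cong')
    show "abelian_monoid (uea (gl N A))" using U.ue.abelian by (rule abelian_group.axioms(1))
    show "(\<lambda>a. U.cls (prod_list (map (?g a) [0..<length x]))) \<in> ?S \<rightarrow> carrier (uea (gl N A))"
    proof
      fix a assume a: "a \<in> ?S"
      have "prod_list (map (?g a) [0..<length x]) \<in> U.F"
        by (rule FA_prod_list) (use F[OF a] in auto)
      then show "U.cls (prod_list (map (?g a) [0..<length x])) \<in> carrier (uea (gl N A))"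
        unfolding U.uea_carrier by (rule imageI)
    qed
    fix a assume a: "a \<in> ?S"
    have mm: "map (\<lambda>q. uea_of (gl N A) (EE ((i # a @ [j]) ! q) ((i # a @ [j]) ! Suc q) (x ! q))) [0..<length x]
      = map U.cls (map (?g a) [0..<length x])" by (simp add: U.uea_of_cls)
    show "mprod (uea (gl N A)) (map (\<lambda>q. uea_of (gl N A) (EE ((i # a @ [j]) ! q) ((i # a @ [j]) ! Suc q) (x ! q))) [0..<length x])
      = U.cls (prod_list (map (?g a) [0..<length x]))"
      unfolding mm by (rule U.uea_mprod) (use F[OF a] in auto)
  qed simp
  also have "\<dots> = U.cls (\<Sum>a\<in>?S. prod_list (map (?g a) [0..<length x]))"
  proof -
    have "prod_list (map (?g a) [0..<length x]) \<in> U.F" if a: "a \<in> ?S" for a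
      by (rule FA_prod_list) (use F[OF a] in auto)
    then show ?thesis using U.ue.rp_finsum[OF fin, of "\<lambda>a. prod_list (map (?g a) [0..<length x])"] by blast
  qed
  finally show ?thesis using path_sum[OF x(2) ij(2), of i] by simp
qed

text \<open>A first part 1 keeps the first letter and leaves the exponent of \<open>c\<close>
  unchanged; enlarging the first part merges the first two letters and costs one factor
  \<open>c\<close>.\<close>

lemma comp_sum:
  "x \<noteq> [] \<Longrightarrow> j \<in> {1..N} \<Longrightarrow> (\<Sum>\<nu>\<in>comps (length x). cst (c ^ (length x - length \<nu>)) * e_word N i j (merge_word A x \<nu>)) = t_word N c i j x"
proof (induction N c i j x rule: t_word.induct)
  case (2 N c i j x)
  then show ?case using e_word_single[of j N i x] by (simp add: comps_1 mprod1_def del: e_word.simps)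
next
  case (3 N c i j x y zs)
  let ?m = "length (y # zs)"
  have m: "?m > 0" by simp
  have fin: "finite (comps ?m)" using finite_comps[OF m] .
  have c1: "cst (c ^ (Suc ?m - length (1 # \<nu>))) * e_word N i j (merge_word A (x # y # zs) (1 # \<nu>)) =
      (\<Sum>a=1..N. wd [EE i a x] * (cst (c ^ (?m - length \<nu>)) * e_word N a j (merge_word A (y # zs) \<nu>)))" for \<nu>
    by (simp add: mprod1_def sum_distrib_left cst_left_comm)
  have c2: "cst (c ^ (Suc ?m - length (bump \<nu>))) * e_word N i j (merge_word A (x # y # zs) (bump \<nu>)) =
      cst c * (cst (c ^ (?m - length \<nu>)) * e_word N i j (merge_word A ((x \<otimes> y) # zs) \<nu>))" if n: "\<nu> \<in> comps ?m" for \<nu>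
  proof -
    obtain k \<mu> where \<nu>: "\<nu> = k # \<mu>" using n by (cases \<nu>) (auto simp: comps_def)
    then obtain k' where k: "k = Suc k'" using n by (cases k) (auto simp: comps_def)
    have "Suc ?m - length (bump \<nu>) = Suc (?m - length \<nu>)" using comps_length[OF n] by (simp add: bump_def \<nu>)
    \<comment> \<open>Since \<open>mprod1\<close> folds from the left, the block that begins with
      \<open>x\<close> and \<open>y\<close> and the block that begins with the merged letter have
      the same product by definition.\<close>
    then show ?thesis by (simp add: \<nu> k bump_def mprod1_def cst_mult mult.assoc)
  qed
  let ?f = "\<lambda>\<nu>. cst (c ^ (Suc ?m - length \<nu>)) * e_word N i j (merge_word A (x # y # zs) \<nu>)"
  have "sum ?f (comps (Suc ?m)) = sum ?f ((#) 1 ` comps ?m) + sum ?f (bump ` comps ?m)"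
    unfolding comps_Suc(1)[OF m] by (rule sum.union_disjoint) (use fin comps_Suc(2)[OF m] in auto)
  also have "sum ?f ((#) 1 ` comps ?m) = (\<Sum>\<nu>\<in>comps ?m. ?f (1 # \<nu>))"
    by (simp only: sum.reindex[OF comps_Suc(3)[OF m]] o_def)
  also have "sum ?f (bump ` comps ?m) = (\<Sum>\<nu>\<in>comps ?m. ?f (bump \<nu>))"
    by (simp only: sum.reindex[OF comps_Suc(4)[OF m]] o_def)
  also have "(\<Sum>\<nu>\<in>comps ?m. cst (c ^ (Suc ?m - length (1 # \<nu>))) * e_word N i j (merge_word A (x # y # zs) (1 # \<nu>)))
    = (\<Sum>a=1..N. wd [EE i a x] * (\<Sum>\<nu>\<in>comps ?m. cst (c ^ (?m - length \<nu>)) * e_word N a j (merge_word A (y # zs) \<nu>)))"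
    unfolding c1 sum_distrib_left by (rule sum.swap)
  also have "(\<Sum>\<nu>\<in>comps ?m. cst (c ^ (Suc ?m - length (bump \<nu>))) * e_word N i j (merge_word A (x # y # zs) (bump \<nu>)))
    = cst c * (\<Sum>\<nu>\<in>comps ?m. cst (c ^ (?m - length \<nu>)) * e_word N i j (merge_word A ((x \<otimes> y) # zs) \<nu>))"
    unfolding sum_distrib_left by (rule sum.cong[OF refl c2])
  also have "(\<Sum>\<nu>\<in>comps ?m. cst (c ^ (?m - length \<nu>)) * e_word N i j (merge_word A ((x \<otimes> y) # zs) \<nu>)) = t_word N c i j ((x \<otimes> y) # zs)"
    using 3(2) 3(4) by simp
  also have "(\<Sum>a=1..N. wd [EE i a x] * (\<Sum>\<nu>\<in>comps ?m. cst (c ^ (?m - length \<nu>)) * e_word N a j (merge_word A (y # zs) \<nu>)))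
    = (\<Sum>a=1..N. wd [EE i a x] * t_word N c a j (y # zs))"
    using 3(1) 3(4) by (intro sum.cong refl) simp
  finally show ?case by simp
qed simp

lemma t_term_cls:
  assumes x: "x \<in> W" "x \<noteq> []" and ij: "i \<in> {1..N}" "j \<in> {1..N}"
  shows "t_term A s N i j x = lie_rec.cls (gl N A) (t_word N (- of_nat N - s) i j x)"
proof -
  interpret gl_alg A N ..
  let ?c = "- of_nat N - s"
  let ?C = "comps (length x)"
  let ?g = "\<lambda>\<nu>. cst (?c ^ (length x - length \<nu>)) * e_word N i j (merge_word A x \<nu>)"
  have fin: "finite ?C" using finite_comps x by simp
  have mW: "merge_word A x \<nu> \<in> W" "merge_word A x \<nu> \<noteq> []" if "\<nu> \<in> ?C" for \<nu>
  proof -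
    show "merge_word A x \<nu> \<in> W" by (rule merge_W[OF x(1) that])
    have "\<nu> \<noteq> []" using that x(2) by (auto simp: comps_def)
    then show "merge_word A x \<nu> \<noteq> []" by (cases \<nu>) auto
  qed
  have F: "?g \<nu> \<in> U.F" "e_word N i j (merge_word A x \<nu>) \<in> U.F" if "\<nu> \<in> ?C" for \<nu>
    using mW[OF that] ij by (auto intro!: FA_mult e_word_FA)
  have "t_term A s N i j x = finsum (uea (gl N A)) (\<lambda>\<nu>. U.cls (?g \<nu>)) ?C"
    unfolding t_term_def
  proof (rule abelian_monoid.finsum_cong')
    show "abelian_monoid (uea (gl N A))" using U.ue.abelian by (rule abelian_group.axioms(1))
    show "(\<lambda>\<nu>. U.cls (?g \<nu>)) \<in> ?C \<rightarrow> carrier (uea (gl N A))" using F by (auto simp: U.uea_carrier)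
    fix \<nu> assume n: "\<nu> \<in> ?C"
    show "?c ^ (length x - length (merge_word A x \<nu>)) \<odot>\<^bsub>uea (gl N A)\<^esub> e_elt A N i j (merge_word A x \<nu>) = U.cls (?g \<nu>)"
      unfolding e_elt_cls[OF mW[OF n] ij] length_merge using F(2)[OF n] by (rule U.uea_smult)
  qed simp
  also have "\<dots> = U.cls (\<Sum>\<nu>\<in>?C. ?g \<nu>)" using U.ue.rp_finsum[OF fin, of ?g] F by auto
  also have "(\<Sum>\<nu>\<in>?C. ?g \<nu>) = t_word N ?c i j x" by (rule comp_sum[OF x(2) ij(2)])
  finally show ?thesis .
qed

end

section \<open>The associated graded algebra\<close>

text \<open>Two images of one free algebra with the same fibres are isomorphic. The compatibility
  with \<open>G\<close> and \<open>H\<close> is kept in the conclusion, since it determines where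
  graded pieces go.\<close>

lemma ex_alg_iso:
  fixes A1 :: "(complex, 'a) module" and A2 :: "(complex, 'b) module"
    and G :: "'t fa \<Rightarrow> 'a" and H :: "'t fa \<Rightarrow> 'b"
  assumes cG: "carrier A1 = G ` FA S" and cH: "carrier A2 = H ` FA S"
    and ker: "\<And>p q. p \<in> FA S \<Longrightarrow> q \<in> FA S \<Longrightarrow> G p = G q \<longleftrightarrow> H p = H q"
    and addG: "\<And>p q. p \<in> FA S \<Longrightarrow> q \<in> FA S \<Longrightarrow> G p \<oplus>\<^bsub>A1\<^esub> G q = G (p + q)"
    and addH: "\<And>p q. p \<in> FA S \<Longrightarrow> q \<in> FA S \<Longrightarrow> H p \<oplus>\<^bsub>A2\<^esub> H q = H (p + q)"
    and multG: "\<And>p q. p \<in> FA S \<Longrightarrow> q \<in> FA S \<Longrightarrow> G p \<otimes>\<^bsub>A1\<^esub> G q = G (p * q)"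
    and multH: "\<And>p q. p \<in> FA S \<Longrightarrow> q \<in> FA S \<Longrightarrow> H p \<otimes>\<^bsub>A2\<^esub> H q = H (p * q)"
    and oneG: "\<one>\<^bsub>A1\<^esub> = G 1" and oneH: "\<one>\<^bsub>A2\<^esub> = H 1"
    and smG: "\<And>p c. p \<in> FA S \<Longrightarrow> c \<odot>\<^bsub>A1\<^esub> G p = G (cst c * p)"
    and smH: "\<And>p c. p \<in> FA S \<Longrightarrow> c \<odot>\<^bsub>A2\<^esub> H p = H (cst c * p)"
  shows "\<exists>\<phi>\<in>alg_iso A1 A2. \<forall>p\<in>FA S. \<phi> (G p) = H p"
proof -
  define \<phi> where "\<phi> f = H (SOME p. p \<in> FA S \<and> G p = f)" for f
  have \<phi>: "\<phi> (G p) = H p" if p: "p \<in> FA S" for p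
  proof -
    have "(SOME q. q \<in> FA S \<and> G q = G p) \<in> FA S \<and> G (SOME q. q \<in> FA S \<and> G q = G p) = G p"
      by (rule someI[of _ p]) (use p in auto)
    then show ?thesis unfolding \<phi>_def using ker p by blast
  qed
  have "\<phi> \<in> ring_hom A1 A2"
    by (rule ring_hom_memI) (auto simp: cG cH \<phi> addG addH multG multH oneG oneH FA_add FA_mult)
  moreover have "bij_betw \<phi> (carrier A1) (carrier A2)"
    unfolding bij_betw_def
  proof
    show "inj_on \<phi> (carrier A1)" by (auto simp: inj_on_def cG \<phi> ker)
    show "\<phi> ` carrier A1 = carrier A2" unfolding cG cH image_image by (rule image_cong) (auto simp: \<phi>)
  qed
  moreover have "\<forall>c. \<forall>x\<in>carrier A1. \<phi> (c \<odot>\<^bsub>A1\<^esub> x) = c \<odot>\<^bsub>A2\<^esub> \<phi> x"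
    by (auto simp: cG \<phi> smG smH FA_mult)
  ultimately have "\<phi> \<in> alg_iso A1 A2" by (simp add: alg_iso_def ring_iso_def)
  then show ?thesis using \<phi> by blast
qed

lemma a_r_coset_update: "a_r_coset (M\<lparr>carrier := C\<rparr>) X x = a_r_coset M X x"
  by (simp add: a_r_coset_def')

lemma rcoset_mult_update: "rcoset_mult (M\<lparr>carrier := C\<rparr>) X Y Z = rcoset_mult M X Y Z"
  by (simp add: rcoset_mult_def a_r_coset_update)

section \<open>Y and its filtration as images of T\<close>

context yang
begin

abbreviation "YA \<equiv> Y_alg d A s"
abbreviation "clN N \<equiv> lie_rec.cls (gl N A)"

definition Y_map :: "(nat \<times> nat \<times> 'a list) fa \<Rightarrow> nat \<Rightarrow> 'a ugl" where
  "Y_map p = (\<lambda>N\<in>{d..}. clN N (ev N (cN N) p))"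

lemma Y_simps: "a \<oplus>\<^bsub>YA\<^esub> b = (\<lambda>N\<in>{d..}. a N \<oplus>\<^bsub>Ugl A N\<^esub> b N)" "a \<otimes>\<^bsub>YA\<^esub> b = (\<lambda>N\<in>{d..}. a N \<otimes>\<^bsub>Ugl A N\<^esub> b N)"
  "c \<odot>\<^bsub>YA\<^esub> a = (\<lambda>N\<in>{d..}. c \<odot>\<^bsub>Ugl A N\<^esub> a N)" "\<one>\<^bsub>YA\<^esub> = (\<lambda>N\<in>{d..}. \<one>\<^bsub>Ugl A N\<^esub>)" "\<zero>\<^bsub>YA\<^esub> = (\<lambda>N\<in>{d..}. \<zero>\<^bsub>Ugl A N\<^esub>)"
  "a \<oplus>\<^bsub>A_alg d A\<^esub> b = a \<oplus>\<^bsub>YA\<^esub> b" "a \<otimes>\<^bsub>A_alg d A\<^esub> b = a \<otimes>\<^bsub>YA\<^esub> b" "c \<odot>\<^bsub>A_alg d A\<^esub> a = c \<odot>\<^bsub>YA\<^esub> a"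
  "\<one>\<^bsub>A_alg d A\<^esub> = \<one>\<^bsub>YA\<^esub>" "\<zero>\<^bsub>A_alg d A\<^esub> = \<zero>\<^bsub>YA\<^esub>"
  by (simp_all add: Y_alg_def A_alg_def)

lemma Y_map_add: "p \<in> T \<Longrightarrow> q \<in> T \<Longrightarrow> Y_map p \<oplus>\<^bsub>YA\<^esub> Y_map q = Y_map (p + q)"
  by (auto simp: Y_simps Y_map_def ev_simps fun_eq_iff lie_rec.uea_add[OF lie_rec_gl] ev_FA)

lemma Y_map_mult: "p \<in> T \<Longrightarrow> q \<in> T \<Longrightarrow> Y_map p \<otimes>\<^bsub>YA\<^esub> Y_map q = Y_map (p * q)"
  by (auto simp: Y_simps Y_map_def ev_simps fun_eq_iff lie_rec.uea_mult[OF lie_rec_gl] ev_FA)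

lemma Y_map_smult: "p \<in> T \<Longrightarrow> c \<odot>\<^bsub>YA\<^esub> Y_map p = Y_map (cst c * p)"
  by (auto simp: Y_simps Y_map_def ev_simps fun_eq_iff lie_rec.uea_smult[OF lie_rec_gl] ev_FA)

lemma Y_map_one: "\<one>\<^bsub>YA\<^esub> = Y_map 1" and Y_map_zero: "\<zero>\<^bsub>YA\<^esub> = Y_map 0"
  by (auto simp: Y_simps Y_map_def ev_simps fun_eq_iff lie_rec.uea_one[OF lie_rec_gl] lie_rec.uea_zero[OF lie_rec_gl])

lemma Y_map_eq: "p \<in> T \<Longrightarrow> q \<in> T \<Longrightarrow> Y_map p = Y_map q \<longleftrightarrow> p - q \<in> ker_Y"
proof -
  assume pq: "p \<in> T" "q \<in> T"
  have 1: "clN N (ev N (cN N) p) = clN N (ev N (cN N) q) \<longleftrightarrow> ev N (cN N) (p - q) \<in> IN N" if "d \<le> N" for N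
    using lie_rec.cls_eq[OF lie_rec_gl ev_FA[OF pq(1) that] ev_FA[OF pq(2) that]]
    by (simp add: lie_rec.eqv_def[OF lie_rec_gl] ev_simps)
  have "Y_map p = Y_map q \<longleftrightarrow> (\<forall>N\<ge>d. clN N (ev N (cN N) p) = clN N (ev N (cN N) q))"
    unfolding Y_map_def by (auto simp: fun_eq_iff restrict_def)
  then show ?thesis using pq 1 by (auto simp: ker_Y_def FA_diff)
qed

lemma wd_T: "w \<in> lists (lab d) \<Longrightarrow> wd w \<in> T"
  by (rule FA_wd) auto

lemma t_elt_Y_map:
  assumes "l \<in> lab d"
  shows "t_elt d A s l = Y_map (wd [l])"
proof -
  obtain i j x where l: "l = (i, j, x)" by (cases l)
  have x: "x \<in> W" "x \<noteq> []" "i \<in> {1..d}" "j \<in> {1..d}" using assms by (simp_all add: lab_iff l)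
  have "t_term A s N i j x = clN N (t_word N (cN N) i j x)" if "d \<le> N" for N
    by (rule t_term_cls[OF x(1,2)]) (use x(3,4) that in auto)
  then show ?thesis unfolding t_elt_def Y_map_def l prod.case ev_wd1 by (intro restrict_ext) simp
qed

lemma Y_map_word: "ts \<in> lists (lab d) \<Longrightarrow> mprod YA (map (t_elt d A s) ts) = Y_map (wd ts)"
proof (induction ts)
  case Nil
  then show ?case by (simp add: mprod_def Y_map_one wd_Nil)
next
  case (Cons l ts)
  have "mprod YA (map (t_elt d A s) (l # ts)) = Y_map (wd [l]) \<otimes>\<^bsub>YA\<^esub> Y_map (wd ts)"
    using Cons by (simp add: mprod_def t_elt_Y_map)
  moreover have "wd [l] \<in> T" "wd ts \<in> T" using Cons.prems by (auto intro: wd_T)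
  ultimately show ?case by (simp add: Y_map_mult wd_mult)
qed

abbreviation "Fk \<equiv> Y_shifted_filt d A s"

text \<open>The index \<open>Suc k\<close> reflects the strict bound in
  \<open>T_below\<close>.\<close>

lemma filt_Y_map: "Fk k = Y_map ` T_below (Suc k)"
proof (intro equalityI subsetI)
  fix a assume "a \<in> Fk k"
  then show "a \<in> Y_map ` T_below (Suc k)"
    unfolding Y_shifted_filt_def
  proof induction
    case (base x)
    then obtain ts where ts: "x = mprod YA (map (t_elt d A s) ts)" "ts \<in> lists (lab d)" "sdeg ts \<le> k"
      by (auto simp: sdeg_def)
    then show ?case using T_hom_T_below[OF T_hom_wd[OF ts(2)]] by (auto simp: Y_map_word intro: T_below_mono)
  next
    case zero
    show ?case unfolding Y_map_zero by (rule imageI) simp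
  next
    case (add x y)
    then show ?case by (auto simp: Y_map_add T_below_T intro!: imageI T_below_add)
  next
    case (smult x c)
    then show ?case by (auto simp: Y_map_smult T_below_T intro!: imageI T_below_cst)
  qed
next
  fix a assume "a \<in> Y_map ` T_below (Suc k)"
  then obtain p where p: "p \<in> T_below (Suc k)" "a = Y_map p" by blast
  have "Poly_Mapping.keys p \<subseteq> {w \<in> lists (lab d). sdeg w \<le> k}" using p by (auto simp: T_below_def FA_def)
  then have "Y_map p \<in> Fk k"
  proof (induction p rule: pm_induct)
    case zero
    show ?case unfolding Y_shifted_filt_def Y_map_zero[symmetric] by (rule lin_span.zero)
  next
    case (single w c)
    then have w: "w \<in> lists (lab d)" "sdeg w \<le> k" by auto
    have "Y_map (wd w) \<in> Fk k" unfolding Y_shifted_filt_def Y_map_word[OF w(1), symmetric]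
      by (rule lin_span.base) (use w in \<open>auto simp: sdeg_def\<close>)
    then have "c \<odot>\<^bsub>YA\<^esub> Y_map (wd w) \<in> Fk k" unfolding Y_shifted_filt_def by (rule lin_span.smult)
    then show ?case using w by (simp add: Y_map_smult wd_T single_conv)
  next
    case (add p q)
    then have "Y_map p \<oplus>\<^bsub>YA\<^esub> Y_map q \<in> Fk k" unfolding Y_shifted_filt_def by (intro lin_span.add)
    moreover have "p \<in> T" "q \<in> T" using add by (auto simp: FA_def)
    ultimately show ?case by (simp add: Y_map_add)
  qed
  then show "a \<in> Fk k" using p by simp
qed

lemma filt_prev_Y_map: "filt_prev YA Fk k = Y_map ` T_below k"
  by (cases k) (simp_all add: filt_prev_def Y_map_zero T_below_0 filt_Y_map)

text \<open>The previous filtration term is the image of \<open>T_below k\<close>, but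
  \<open>rep_sub\<close> needs a subgroup that contains the kernel of \<open>Y_map\<close> within
  the degrees considered. This is \<open>ker_gr k\<close>, which has the same image.\<close>

lemma ker_gr_image: "Y_map ` ker_gr k = Y_map ` T_below k"
proof (intro equalityI subsetI)
  fix a assume "a \<in> Y_map ` ker_gr k"
  then obtain p q where "a = Y_map p" "p \<in> T_below (Suc k)" "q \<in> T_below k" "p - q \<in> ker_Y" by (auto simp: ker_gr_def)
  then show "a \<in> Y_map ` T_below k" using Y_map_eq[of p q] T_below_T by blast
qed (use ker_gr_T_below in blast)

lemma gr_rep: "rep_sub (YA\<lparr>carrier := Fk k\<rparr>) Y_map (T_below (Suc k)) (ker_gr k)"
proof
  fix p q assume "p \<in> T_below (Suc k)" "q \<in> T_below (Suc k)" "Y_map p = Y_map q"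
  then show "p - q \<in> ker_gr k" using Y_map_eq[of p q] T_below_T by (intro ker_grI[of _ _ 0]) (auto intro: T_below_diff)
qed (auto simp: T_below_add T_below_uminus filt_Y_map Y_map_zero Y_map_add T_below_T ker_grD ker_gr_add ker_gr_uminus)

definition cs :: "nat \<Rightarrow> (nat \<times> nat \<times> 'a list) fa \<Rightarrow> (nat \<Rightarrow> 'a ugl) set" where
  "cs k p = Y_map ` {q + p | q. q \<in> ker_gr k}"

lemma cs_eq': "cs k = rep_sub.cs Y_map (ker_gr k)"
  using rep_sub.cs_def[OF gr_rep[of k]] by (simp add: fun_eq_iff cs_def)

abbreviation "gk \<equiv> gr_comp YA Fk"

lemma gr_carrier: "carrier (gk k) = cs k ` T_below (Suc k)"
  using rep_sub.rcosets[OF gr_rep[of k]]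
  by (simp add: gr_comp_def alg_quot_def FactRing_def filt_prev_Y_map ker_gr_image cs_eq')

lemma gr_add: "p \<in> T_below (Suc k) \<Longrightarrow> q \<in> T_below (Suc k) \<Longrightarrow> cs k p \<oplus>\<^bsub>gk k\<^esub> cs k q = cs k (p + q)"
  using rep_sub.cs_add[OF gr_rep[of k]] by (simp add: gr_comp_def alg_quot_def FactRing_def cs_eq')

lemma gr_zero: "\<zero>\<^bsub>gk k\<^esub> = cs k 0"
  using rep_sub.cs_0[OF gr_rep[of k]] by (simp add: gr_comp_def alg_quot_def FactRing_def filt_prev_Y_map ker_gr_image cs_eq')

lemma gr_smult: "p \<in> T_below (Suc k) \<Longrightarrow> c \<odot>\<^bsub>gk k\<^esub> cs k p = cs k (cst c * p)"
proof -
  assume p: "p \<in> T_below (Suc k)"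
  have "(\<Union>x\<in>rep_sub.cs Y_map (ker_gr k) p. Y_map ` ker_gr k +>\<^bsub>YA\<lparr>carrier := Fk k\<rparr>\<^esub> (c \<odot>\<^bsub>YA\<lparr>carrier := Fk k\<rparr>\<^esub> x)) = rep_sub.cs Y_map (ker_gr k) (cst c * p)"
    by (rule rep_sub.cs_smult_union[OF gr_rep p]) (auto simp: Y_map_smult T_below_T T_below_cst distrib_left ker_gr_cst)
  then show ?thesis by (simp add: gr_comp_def alg_quot_def filt_prev_Y_map ker_gr_image cs_eq')
qed

lemma gr_eq: "p \<in> T_below (Suc k) \<Longrightarrow> q \<in> T_below (Suc k) \<Longrightarrow> cs k p = cs k q \<longleftrightarrow> p - q \<in> ker_gr k"
  unfolding cs_eq' by (rule rep_sub.cs_eq[OF gr_rep])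

lemma gr_mult:
  assumes p: "p \<in> T_below (Suc i)" and q: "q \<in> T_below (Suc j)"
  shows "rcoset_mult YA (filt_prev YA Fk (i + j)) (cs i p) (cs j q) = cs (i + j) (p * q)"
proof -
  have m: "a * b \<in> T_below (Suc (i + j))" if "a \<in> T_below (Suc i)" "b \<in> T_below (Suc j)" for a b
    using T_below_mult(1)[OF that] by simp
  have "rcoset_mult (YA\<lparr>carrier := Fk (i + j)\<rparr>) (Y_map ` ker_gr (i + j)) (cs i p) (cs j q) = rep_sub.cs Y_map (ker_gr (i + j)) (p * q)"
  proof (rule rep_sub.cs_mult_union[OF gr_rep, where ?K1.0 = "ker_gr i" and ?K2.0 = "ker_gr j"])
    fix k l assume k: "k \<in> ker_gr i" and l: "l \<in> ker_gr j"
    have kl: "k + p \<in> T_below (Suc i)" "l + q \<in> T_below (Suc j)" using k l p q by (auto intro: T_below_add ker_grD)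
    have "(k + p) * (l + q) - p * q = k * (l + q) + p * l" by (simp add: algebra_simps)
    also have "\<dots> \<in> ker_gr (i + j)" by (intro ker_gr_add ker_gr_rmult ker_gr_lmult k l p kl)
    finally show "\<exists>r\<in>T_below (Suc (i + j)). Y_map (k + p) \<otimes>\<^bsub>YA\<lparr>carrier := Fk (i + j)\<rparr>\<^esub> Y_map (l + q) = Y_map r \<and> r - p * q \<in> ker_gr (i + j)"
      using kl m by (intro bexI[of _ "(k + p) * (l + q)"]) (auto simp: Y_map_mult T_below_T)
  next
    show "p * q \<in> T_below (Suc (i + j))" by (rule m[OF p q])
  qed (simp_all add: cs_def)
  then show ?thesis by (simp add: rcoset_mult_update filt_prev_Y_map ker_gr_image cs_eq')
qed

section \<open>The map from T onto the graded algebra\<close>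

abbreviation "GR \<equiv> gr_alg YA Fk"

definition gr_map :: "(nat \<times> nat \<times> 'a list) fa \<Rightarrow> nat \<Rightarrow> (nat \<Rightarrow> 'a ugl) set" where
  "gr_map p = (\<lambda>k. cs k (hom_part k p))"

lemma hom_part_T_below: "p \<in> T \<Longrightarrow> hom_part k p \<in> T_below (Suc k)"
  by (rule T_hom_T_below[OF hom_part_T_hom])

lemma gr_map_carrier: "carrier GR = gr_map ` T"
proof (intro equalityI subsetI)
  fix f assume "f \<in> gr_map ` T"
  then obtain p where p: "p \<in> T" "f = gr_map p" by blast
  have "{k. f k \<noteq> \<zero>\<^bsub>gk k\<^esub>} \<subseteq> sdeg ` Poly_Mapping.keys p"
  proof
    fix k assume "k \<in> {k. f k \<noteq> \<zero>\<^bsub>gk k\<^esub>}"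
    then have "hom_part k p \<noteq> 0" using p by (auto simp: gr_zero gr_map_def)
    then have "Poly_Mapping.keys (hom_part k p) \<noteq> {}" by simp
    then show "k \<in> sdeg ` Poly_Mapping.keys p" unfolding keys_hom_part by blast
  qed
  then have "finite {k. f k \<noteq> \<zero>\<^bsub>gk k\<^esub>}" by (rule finite_subset) simp
  then show "f \<in> carrier GR" using p by (auto simp: gr_alg_def gr_carrier gr_map_def hom_part_T_below)
next
  fix f assume "f \<in> carrier GR"
  then have f: "\<And>k. f k \<in> cs k ` T_below (Suc k)" and fin: "finite {k. f k \<noteq> \<zero>\<^bsub>gk k\<^esub>}"
    by (auto simp: gr_alg_def gr_carrier)
  have "\<forall>k. \<exists>q. q \<in> T_below (Suc k) \<and> f k = cs k q" using f by blast
  then obtain q where q: "\<And>k. q k \<in> T_below (Suc k)" "\<And>k. f k = cs k (q k)" by metis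
  let ?S = "{k. f k \<noteq> \<zero>\<^bsub>gk k\<^esub>}"
  \<comment> \<open>Each class is represented by the top homogeneous part of a representative, as
    the rest lies in \<open>ker_gr k\<close>. Parts of different degrees do not interfere in the
    sum.\<close>
  define p where "p = (\<Sum>k\<in>?S. hom_part k (q k))"
  have qT: "q k \<in> T" for k by (rule T_below_T[OF q(1)])
  have pT: "p \<in> T" unfolding p_def by (intro FA_sum hom_part_T qT)
  have "gr_map p k = f k" for k
  proof -
    have hp: "hom_part k p = (if k \<in> ?S then hom_part k (q k) else 0)"
      unfolding p_def hom_part_simps hom_part_hom_part using fin by (simp add: sum.delta)
    show ?thesis
    proof (cases "k \<in> ?S")
      case True
      have "q k - hom_part k (q k) \<in> ker_gr k" by (rule ker_gr_T_below[OF T_below_hom_part[OF q(1)]])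
      then have "cs k (q k) = cs k (hom_part k (q k))" using gr_eq[OF q(1) hom_part_T_below[OF qT]] by blast
      then show ?thesis using True hp q(2) by (simp add: gr_map_def)
    next
      case False
      then show ?thesis using hp by (simp add: gr_map_def gr_zero)
    qed
  qed
  then show "f \<in> gr_map ` T" using pT by (intro image_eqI[of _ _ p]) auto
qed

lemma gr_map_add: "p \<in> T \<Longrightarrow> q \<in> T \<Longrightarrow> gr_map p \<oplus>\<^bsub>GR\<^esub> gr_map q = gr_map (p + q)"
  by (simp add: gr_alg_def gr_map_def gr_add hom_part_T_below hom_part_simps)

lemma gr_map_smult: "p \<in> T \<Longrightarrow> c \<odot>\<^bsub>GR\<^esub> gr_map p = gr_map (cst c * p)"
  by (simp add: gr_alg_def gr_map_def gr_smult hom_part_T_below hom_part_cst)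

lemma gr_finsum_rep: "rep (gk k) (cs k) (T_below (Suc k))"
  by unfold_locales (auto simp: T_below_add T_below_uminus gr_carrier gr_zero gr_add)

lemma gr_map_mult: "p \<in> T \<Longrightarrow> q \<in> T \<Longrightarrow> gr_map p \<otimes>\<^bsub>GR\<^esub> gr_map q = gr_map (p * q)"
proof (rule ext)
  fix k assume p: "p \<in> T" and q: "q \<in> T"
  have m: "hom_part i p * hom_part (k - i) q \<in> T_below (Suc k)" if "i \<le> k" for i
    using T_hom_T_below[OF T_hom_mult[OF hom_part_T_hom[OF p, of i] hom_part_T_hom[OF q, of "k - i"]]] that by simp
  have e: "rcoset_mult YA (filt_prev YA Fk k) (gr_map p i) (gr_map q (k - i)) = cs k (hom_part i p * hom_part (k - i) q)" if "i \<le> k" for i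
    using gr_mult[OF hom_part_T_below[OF p, of i] hom_part_T_below[OF q, of "k - i"]] that by (simp add: gr_map_def)
  have "(gr_map p \<otimes>\<^bsub>GR\<^esub> gr_map q) k = finsum (gk k) (\<lambda>i. rcoset_mult YA (filt_prev YA Fk k) (gr_map p i) (gr_map q (k - i))) {..k}"
    by (simp add: gr_alg_def)
  also have "\<dots> = finsum (gk k) (\<lambda>i. cs k (hom_part i p * hom_part (k - i) q)) {..k}"
    by (rule abelian_monoid.finsum_cong'[OF abelian_group.axioms(1)[OF rep.abelian[OF gr_finsum_rep]]])
      (use e m in \<open>auto simp: gr_carrier\<close>)
  also have "\<dots> = cs k (\<Sum>i\<le>k. hom_part i p * hom_part (k - i) q)"
    using rep.rp_finsum[OF gr_finsum_rep, of "{..k}" "\<lambda>i. hom_part i p * hom_part (k - i) q" k] m by auto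
  finally show "(gr_map p \<otimes>\<^bsub>GR\<^esub> gr_map q) k = gr_map (p * q) k" by (simp add: gr_map_def hom_part_mult)
qed

lemma gr_map_one: "\<one>\<^bsub>GR\<^esub> = gr_map 1"
proof -
  have h: "hom_part k 1 = (if k = 0 then 1 else 0)" for k :: nat
    using hom_part_simps(6)[of k "[]" 1] by (auto simp: wd_def[symmetric] wd_Nil)
  have 1: "(1 :: (nat \<times> nat \<times> 'a list) fa) \<in> T_below (Suc 0)" using T_hom_T_below[OF T_hom_wd[of "[]"]] by (simp add: wd_Nil)
  have "filt_prev YA Fk 0 +>\<^bsub>YA\<^esub> \<one>\<^bsub>YA\<^esub> = cs 0 1"
    using rep_sub.coset[OF gr_rep 1] by (simp add: a_r_coset_update filt_prev_Y_map ker_gr_image cs_eq' Y_map_one)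
  then show ?thesis by (auto simp: gr_alg_def gr_map_def h gr_zero fun_eq_iff)
qed

section \<open>The map from T onto the enveloping algebra\<close>

abbreviation "UU \<equiv> uea (gl d (R_alg A))"

definition uea_map :: "(nat \<times> nat \<times> 'a list) fa \<Rightarrow> ((nat \<Rightarrow> nat \<Rightarrow> ('a list \<Rightarrow>\<^sub>0 complex) set) list \<Rightarrow>\<^sub>0 complex) set" where
  "uea_map p = GU.U.cls (U_map p)"

lemma uea_map_eq: "p \<in> T \<Longrightarrow> q \<in> T \<Longrightarrow> uea_map p = uea_map q \<longleftrightarrow> U_map (p - q) \<in> IU"
  by (simp add: uea_map_def GU.U.cls_eq U_map_FU GU.U.eqv_def U_map_simps)

lemma gr_map_uea_map: "p \<in> T \<Longrightarrow> q \<in> T \<Longrightarrow> gr_map p = gr_map q \<longleftrightarrow> uea_map p = uea_map q"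
proof -
  assume pq: "p \<in> T" "q \<in> T"
  have "gr_map p = gr_map q \<longleftrightarrow> (\<forall>k. hom_part k (p - q) \<in> ker_gr k)"
    using pq by (simp add: gr_map_def fun_eq_iff gr_eq hom_part_T_below hom_part_simps)
  also have "\<dots> \<longleftrightarrow> U_map (p - q) \<in> IU" using pq by (intro kernel FA_diff)
  finally show ?thesis using uea_map_eq[OF pq] by simp
qed

text \<open>The set \<open>D\<close> of admissible degrees serves two purposes: \<open>UNIV\<close>
  yields surjectivity onto the enveloping algebra, a singleton yields surjectivity onto a graded
  piece.\<close>

lemma letter_lift:
  assumes ij: "i \<in> {1..d}" "j \<in> {1..d}" and p: "Poly_Mapping.keys p \<subseteq> {w \<in> W. w \<noteq> [] \<and> dg w \<in> D}"
  shows "\<exists>q\<in>T. (\<forall>w\<in>Poly_Mapping.keys q. sdeg w \<in> D) \<and> GU.U.eqv (GU.w1 i j (Rc p)) (U_map q)"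
  using p
proof (induction p rule: pm_induct)
  case zero
  have "GU.U.eqv (GU.w1 i j (Rc 0)) 0" using GU.wd_zero by (simp add: R_zero[symmetric] RA.EE_zero)
  then show ?case by (intro bexI[of _ 0]) (auto simp: U_map_simps)
next
  case (single w c)
  then have w: "w \<in> W" "w \<noteq> []" "dg w \<in> D" by auto
  have wa: "wd w \<in> WA A" using w by (intro wd_WA)
  have "GU.w1 i j (Rc (Poly_Mapping.single w c)) = GU.w1 i j (c \<odot>\<^bsub>R_alg A\<^esub> Rc (wd w))"
    using wa by (simp add: R_smult single_conv)
  also have "GU.U.eqv \<dots> (cst c * GU.w1 i j (Rc (wd w)))" using wa ij by (intro GU.w1_smult Rc_carrier)
  also have "\<dots> = U_map (cst c * wd [(i, j, w)])" by (simp add: U_map_simps U_map_wd1)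
  finally have "GU.U.eqv (GU.w1 i j (Rc (Poly_Mapping.single w c))) (U_map (cst c * wd [(i, j, w)]))" .
  moreover have "cst c * wd [(i, j, w)] \<in> T_hom (dg w)"
    using T_hom_cst[OF T_hom_wd[of "[(i, j, w)]"]] w ij by (simp add: lab_iff)
  ultimately show ?case using w(3) by (intro bexI[of _ "cst c * wd [(i, j, w)]"]) (auto simp: T_hom_def)
next
  case (add p q)
  then obtain p' q' where "p' \<in> T" "\<forall>w\<in>Poly_Mapping.keys p'. sdeg w \<in> D" "GU.U.eqv (GU.w1 i j (Rc p)) (U_map p')"
    "q' \<in> T" "\<forall>w\<in>Poly_Mapping.keys q'. sdeg w \<in> D" "GU.U.eqv (GU.w1 i j (Rc q)) (U_map q')" by blast
  note pq' = this
  have wa: "p \<in> WA A" "q \<in> WA A" using add by (auto simp: WA_def)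
  have "GU.w1 i j (Rc (p + q)) = GU.w1 i j (Rc p \<oplus>\<^bsub>R_alg A\<^esub> Rc q)" using wa by (simp add: R_add)
  also have "GU.U.eqv \<dots> (GU.w1 i j (Rc p) + GU.w1 i j (Rc q))" using wa ij by (intro GU.w1_add Rc_carrier)
  also have "GU.U.eqv \<dots> (U_map p' + U_map q')" using pq' by (intro GU.U.eqv_add)
  also have "\<dots> = U_map (p' + q')" by (simp add: U_map_simps)
  finally have "GU.U.eqv (GU.w1 i j (Rc (p + q))) (U_map (p' + q'))" .
  then show ?case using pq' Poly_Mapping.keys_add[of p' q'] by (intro bexI[of _ "p' + q'"]) auto
qed

lemma matrix_lift:
  assumes X: "X \<in> carrier (gl d (R_alg A))"
    and D: "\<And>i j. i \<in> {1..d} \<Longrightarrow> j \<in> {1..d} \<Longrightarrow> \<exists>p. Poly_Mapping.keys p \<subseteq> {w \<in> W. w \<noteq> [] \<and> dg w \<in> D} \<and> X i j = Rc p"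
  shows "\<exists>q\<in>T. (\<forall>w\<in>Poly_Mapping.keys q. sdeg w \<in> D) \<and> GU.U.eqv (wd [X]) (U_map q)"
proof -
  let ?P = "\<lambda>i j q. q \<in> T \<and> (\<forall>w\<in>Poly_Mapping.keys q. sdeg w \<in> D) \<and> GU.U.eqv (GU.w1 i j (X i j)) (U_map q)"
  define q where "q i j = (SOME q. ?P i j q)" for i j
  have q: "?P i j (q i j)" if ij: "i \<in> {1..d}" "j \<in> {1..d}" for i j
    unfolding q_def
  proof (rule someI_ex[of "?P i j"])
    obtain p where "Poly_Mapping.keys p \<subseteq> {w \<in> W. w \<noteq> [] \<and> dg w \<in> D}" "X i j = Rc p" using D[OF ij] by blast
    then show "\<exists>q. ?P i j q" using letter_lift[OF ij, of p D] by auto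
  qed
  let ?q = "\<Sum>i=1..d. \<Sum>j=1..d. q i j"
  have "?q \<in> T \<and> (\<forall>w\<in>Poly_Mapping.keys ?q. sdeg w \<in> D)"
  proof -
    have sum: "sum f S \<in> T \<and> (\<forall>w\<in>Poly_Mapping.keys (sum f S). sdeg w \<in> D)"
      if "\<And>x. x \<in> S \<Longrightarrow> f x \<in> T \<and> (\<forall>w\<in>Poly_Mapping.keys (f x). sdeg w \<in> D)" for S :: "nat set" and f
      using that
    proof (induction S rule: infinite_finite_induct)
      case (insert x F)
      then show ?case using Poly_Mapping.keys_add[of "f x" "sum f F"] by auto
    qed auto
    show ?thesis using q by (intro sum) auto
  qed
  moreover have "GU.U.eqv (wd [X]) (U_map ?q)"
  proof -
    have "GU.U.eqv (wd [X]) (\<Sum>i=1..d. \<Sum>j=1..d. GU.w1 i j (X i j))" by (rule GU.wd_decomp[OF X])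
    also have "GU.U.eqv \<dots> (\<Sum>i=1..d. \<Sum>j=1..d. U_map (q i j))" using q by (intro GU.U.eqv_sum) auto
    also have "\<dots> = U_map ?q" by (simp add: U_map_simps)
    finally show ?thesis .
  qed
  ultimately show ?thesis by blast
qed

lemma uea_map_carrier: "carrier UU = uea_map ` T"
proof (intro equalityI subsetI)
  fix x assume "x \<in> uea_map ` T"
  then show "x \<in> carrier UU" by (auto simp: uea_map_def GU.U.uea_carrier U_map_FU)
next
  fix x assume "x \<in> carrier UU"
  then obtain p where p: "p \<in> FU" "x = GU.U.cls p" by (auto simp: GU.U.uea_carrier)
  have letter: "\<exists>q\<in>T. GU.U.eqv (wd [X]) (U_map q)" if X: "X \<in> carrier (gl d (R_alg A))" for X
  proof -
    have "\<exists>p. Poly_Mapping.keys p \<subseteq> {w \<in> W. w \<noteq> [] \<and> dg w \<in> UNIV} \<and> X i j = Rc p" for i j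
    proof -
      obtain p where "p \<in> WA A" "X i j = Rc p" using RA.gl_cl[OF X, of i j] by (auto simp: R_carrier)
      then show ?thesis by (intro exI[of _ p]) (auto simp: WA_def)
    qed
    then show ?thesis using matrix_lift[OF X, of UNIV] by blast
  qed
  have word: "\<exists>q\<in>T. GU.U.eqv (wd w) (U_map q)" if "w \<in> lists (carrier (gl d (R_alg A)))" for w
    using that
  proof (induction w)
    case Nil
    show ?case by (rule bexI[of _ 1]) (auto simp: wd_Nil U_map_simps)
  next
    case (Cons X w)
    obtain q r where q: "q \<in> T" "GU.U.eqv (wd [X]) (U_map q)" and r: "r \<in> T" "GU.U.eqv (wd w) (U_map r)"
      using Cons letter by blast
    have "wd (X # w) = wd [X] * wd w" by (simp add: wd_mult)
    also have "GU.U.eqv \<dots> (U_map q * U_map r)"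
      using Cons q r by (intro GU.U.eqv_mult) (auto simp: U_map_FU)
    also have "\<dots> = U_map (q * r)" by (simp add: U_map_simps)
    finally show ?case using q r by (intro bexI[of _ "q * r"]) auto
  qed
  have "\<exists>q\<in>T. GU.U.eqv p (U_map q)" using p(1)
  proof (induction p rule: FA_induct)
    case zero
    show ?case by (rule bexI[of _ 0]) (auto simp: U_map_simps)
  next
    case (single w c)
    then obtain q where q: "q \<in> T" "GU.U.eqv (wd w) (U_map q)" using word by blast
    then show ?case by (intro bexI[of _ "cst c * q"]) (auto simp: single_conv U_map_simps GU.U.eqv_cst)
  next
    case (add p r)
    then obtain p' r' where "p' \<in> T" "GU.U.eqv p (U_map p')" "r' \<in> T" "GU.U.eqv r (U_map r')" by blast
    then show ?case by (intro bexI[of _ "p' + r'"]) (auto simp: U_map_simps GU.U.eqv_add)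
  qed
  then obtain q where "q \<in> T" "GU.U.eqv p (U_map q)" by blast
  then show "x \<in> uea_map ` T" using p GU.U.cls_eq[OF p(1) U_map_FU] by (auto simp: uea_map_def)
qed

lemma gr_hom_gr_map: "gr_hom YA Fk k = gr_map ` T_hom k"
proof (intro equalityI subsetI)
  fix f assume "f \<in> gr_hom YA Fk k"
  then obtain p where p: "p \<in> T" "f = gr_map p" and z: "\<And>m. m \<noteq> k \<Longrightarrow> f m = \<zero>\<^bsub>gk m\<^esub>"
    by (auto simp: gr_hom_def gr_map_carrier)
  have "gr_map (hom_part k p) m = f m" for m
    using z[of m] p by (auto simp: gr_map_def hom_part_hom_part gr_zero)
  then show "f \<in> gr_map ` T_hom k" using hom_part_T_hom[OF p(1)] by (intro image_eqI[of _ _ "hom_part k p"]) auto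
next
  fix f assume "f \<in> gr_map ` T_hom k"
  then obtain p where p: "p \<in> T_hom k" "f = gr_map p" by blast
  have "gr_map p \<in> carrier GR" unfolding gr_map_carrier by (rule imageI[OF T_hom_T[OF p(1)]])
  moreover have "gr_map p m = \<zero>\<^bsub>gk m\<^esub>" if "m \<noteq> k" for m
    using that p by (simp add: gr_map_def T_hom_hom_part gr_zero)
  ultimately show "f \<in> gr_hom YA Fk k" using p by (simp add: gr_hom_def)
qed

lemma uea_map_word:
  assumes "w \<in> lists (lab d)"
  shows "uea_map (wd w) = mprod UU (map (uea_of (gl d (R_alg A))) (map (\<lambda>(i, j, x). mat_unit (R_alg A) i j (Rc (wd x))) w))"
proof -
  have m: "mat_unit (R_alg A) i j (Rc (wd x)) \<in> carrier (gl d (R_alg A))" if "(i, j, x) \<in> set w" for i j x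
  proof -
    have "(i, j, x) \<in> lab d" using assms that by blast
    then have "x \<in> W" "x \<noteq> []" "i \<in> {1..d}" "j \<in> {1..d}" by (auto simp: lab_iff)
    then show ?thesis by (intro RA.EE_cl Rc_carrier wd_WA)
  qed
  have "mprod UU (map GU.U.cls (map (\<lambda>(i, j, x). wd [mat_unit (R_alg A) i j (Rc (wd x))]) w)) = GU.U.cls (prod_list (map (\<lambda>(i, j, x). wd [mat_unit (R_alg A) i j (Rc (wd x))]) w))"
    by (rule GU.U.uea_mprod) (use m in \<open>auto intro!: FA_wd1\<close>)
  also have "\<dots> = uea_map (wd w)" by (simp add: uea_map_def U_map_def subst_wd)
  finally show ?thesis by (simp add: o_def case_prod_unfold GU.U.uea_of_cls)
qed

lemma uea_map_lin: "p \<in> T \<Longrightarrow> q \<in> T \<Longrightarrow> uea_map p \<oplus>\<^bsub>UU\<^esub> uea_map q = uea_map (p + q)"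
  "p \<in> T \<Longrightarrow> q \<in> T \<Longrightarrow> uea_map p \<otimes>\<^bsub>UU\<^esub> uea_map q = uea_map (p * q)"
  "p \<in> T \<Longrightarrow> c \<odot>\<^bsub>UU\<^esub> uea_map p = uea_map (cst c * p)" "\<one>\<^bsub>UU\<^esub> = uea_map 1" "\<zero>\<^bsub>UU\<^esub> = uea_map 0"
  by (simp_all add: uea_map_def GU.U.uea_add GU.U.uea_mult GU.U.uea_smult GU.U.uea_one GU.U.uea_zero U_map_simps U_map_FU)

abbreviation "gG \<equiv> gl_R_grade d A"

lemma unit_grade: "(i, j, x) \<in> lab d \<Longrightarrow> mat_unit (R_alg A) i j (Rc (wd x)) \<in> gG (length x - 1)"
proof -
  assume l: "(i, j, x) \<in> lab d"
  then have x: "x \<in> W" "x \<noteq> []" "i \<in> {1..d}" "j \<in> {1..d}" by (auto simp: lab_iff)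
  have "Rc (wd x) \<in> R_grade A (length x - 1)"
    unfolding R_grade_def using wd_WA[OF x(1,2)] x(2)
    by (intro CollectI exI[of _ "wd x"]) (auto simp: Rc_coset wd_def)
  moreover have "Rc 0 \<in> R_grade A (length x - 1)"
    unfolding R_grade_def by (intro CollectI exI[of _ 0]) (auto simp: Rc_coset)
  ultimately show ?thesis
    using RA.EE_cl[OF Rc_carrier[OF wd_WA[OF x(1,2)]] x(3,4)]
    by (auto simp: gl_R_grade_def) (auto simp: mat_unit_def R_zero)
qed

text \<open>A product of homogeneous letters lifts factor by factor to a product of homogeneous
  elements of \<open>T\<close>. Conversely, a word of labels becomes a product of matrix units whose
  degrees add up to its \<open>sdeg\<close>.\<close>

lemma uea_grade_uea_map: "uea_grade (gl d (R_alg A)) gG k = uea_map ` T_hom k"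
proof (intro equalityI subsetI)
  fix x assume "x \<in> uea_map ` T_hom k"
  then obtain p where p: "p \<in> T_hom k" "x = uea_map p" by blast
  have "Poly_Mapping.keys p \<subseteq> {w \<in> lists (lab d). sdeg w = k}" using p by (auto simp: T_hom_def FA_def)
  then have "uea_map p \<in> uea_grade (gl d (R_alg A)) gG k"
  proof (induction p rule: pm_induct)
    case zero
    show ?case unfolding uea_grade_def uea_map_lin(5)[symmetric] by (rule lin_span.zero)
  next
    case (single w c)
    then have w: "w \<in> lists (lab d)" "sdeg w = k" by auto
    have la: "list_all2 (\<lambda>x n. x \<in> gG n) (map (\<lambda>(i, j, x). mat_unit (R_alg A) i j (Rc (wd x))) w) (map (\<lambda>(i, j, x). length x - 1) w)"
      using w(1) unit_grade by (auto simp: list_all2_map1 list_all2_map2 list_all2_same)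
    have "uea_map (wd w) \<in> uea_grade (gl d (R_alg A)) gG k"
      unfolding uea_grade_def uea_map_word[OF w(1)]
      by (rule lin_span.base, intro CollectI exI conjI, rule refl, rule la) (use w(2) in \<open>simp add: sdeg_def\<close>)
    then have "c \<odot>\<^bsub>UU\<^esub> uea_map (wd w) \<in> uea_grade (gl d (R_alg A)) gG k" unfolding uea_grade_def by (rule lin_span.smult)
    then show ?case using w by (simp add: uea_map_lin wd_T single_conv)
  next
    case (add p q)
    then have "uea_map p \<oplus>\<^bsub>UU\<^esub> uea_map q \<in> uea_grade (gl d (R_alg A)) gG k" unfolding uea_grade_def by (intro lin_span.add)
    moreover have "p \<in> T" "q \<in> T" using add by (auto simp: FA_def)
    ultimately show ?case by (simp add: uea_map_lin)
  qed
  then show "x \<in> uea_grade (gl d (R_alg A)) gG k" using p by simp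
next
  have letter: "\<exists>q\<in>T_hom n. uea_of (gl d (R_alg A)) X = uea_map q" if X: "X \<in> gG n" for X n
  proof -
    have Xc: "X \<in> carrier (gl d (R_alg A))" and Xg: "\<And>i j. X i j \<in> R_grade A n" using X by (auto simp: gl_R_grade_def)
    have "\<exists>p. Poly_Mapping.keys p \<subseteq> {w \<in> W. w \<noteq> [] \<and> dg w \<in> {n}} \<and> X i j = Rc p" for i j
    proof -
      obtain p where "p \<in> WA A" "\<forall>w\<in>Poly_Mapping.keys p. length w = n + 1" "X i j = multilin A +>\<^bsub>word_alg A\<^esub> p"
        using Xg[of i j] by (auto simp: R_grade_def)
      then show ?thesis by (intro exI[of _ p]) (auto simp: WA_def dg_def Rc_coset)
    qed
    then obtain q where q: "q \<in> T" "\<forall>w\<in>Poly_Mapping.keys q. sdeg w \<in> {n}" "GU.U.eqv (wd [X]) (U_map q)"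
      using matrix_lift[OF Xc, of "{n}"] by blast
    then have "uea_of (gl d (R_alg A)) X = uea_map q"
      using GU.U.cls_eq[OF FA_wd1[OF Xc] U_map_FU[OF q(1)]] by (simp add: GU.U.uea_of_cls uea_map_def)
    then show ?thesis using q by (intro bexI[of _ q]) (auto simp: T_hom_def)
  qed
  have word: "\<exists>q\<in>T_hom (sum_list ns). mprod UU (map (uea_of (gl d (R_alg A))) xs) = uea_map q" if "list_all2 (\<lambda>x n. x \<in> gG n) xs ns" for xs ns
    using that
  proof (induction xs ns rule: list_all2_induct)
    case Nil
    show ?case using T_hom_wd[of "[]"] by (intro bexI[of _ 1]) (auto simp: mprod_def uea_map_lin wd_Nil)
  next
    case (Cons x xs n ns)
    obtain q r where q: "q \<in> T_hom n" "uea_of (gl d (R_alg A)) x = uea_map q" and r: "r \<in> T_hom (sum_list ns)" "mprod UU (map (uea_of (gl d (R_alg A))) xs) = uea_map r"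
      using Cons letter by blast
    then show ?case using T_hom_mult[OF q(1) r(1)] by (intro bexI[of _ "q * r"]) (auto simp: mprod_def uea_map_lin T_hom_T)
  qed
  fix x assume "x \<in> uea_grade (gl d (R_alg A)) gG k"
  then show "x \<in> uea_map ` T_hom k"
    unfolding uea_grade_def
  proof induction
    case (base x)
    then show ?case using word by blast
  next
    case zero
    show ?case unfolding uea_map_lin by (rule imageI) simp
  next
    case (add x y)
    then show ?case by (auto simp: uea_map_lin T_hom_T intro!: imageI T_hom_add)
  next
    case (smult x c)
    then show ?case by (auto simp: uea_map_lin T_hom_T intro!: imageI T_hom_cst)
  qed
qed

text \<open>By \<open>kernel\<close> the maps from \<open>T\<close> to the two algebras have the
  same fibres, and on either side the image of \<open>T_hom k\<close> is the homogeneous component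
  of degree \<open>k\<close>.\<close>

theorem graded_iso:
  "\<exists>\<phi> \<in> alg_iso GR UU. \<forall>k. \<phi> ` gr_hom YA Fk k = uea_grade (gl d (R_alg A)) gG k"
proof -
  obtain \<phi> where \<phi>: "\<phi> \<in> alg_iso GR UU" "\<And>p. p \<in> T \<Longrightarrow> \<phi> (gr_map p) = uea_map p"
    using ex_alg_iso[of GR gr_map "lab d" UU uea_map, OF gr_map_carrier uea_map_carrier gr_map_uea_map gr_map_add uea_map_lin(1) gr_map_mult uea_map_lin(2)
        gr_map_one uea_map_lin(4) gr_map_smult uea_map_lin(3)] by blast
  have "\<phi> ` gr_hom YA Fk k = uea_grade (gl d (R_alg A)) gG k" for k
    unfolding gr_hom_gr_map uea_grade_uea_map image_image by (rule image_cong) (auto simp: \<phi>(2) T_hom_T)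
  then show ?thesis using \<phi>(1) by blast
qed

end

theorem proposition6p3:
  fixes \<Omega> :: "(complex, 'w) module" and d :: nat and s :: complex
  assumes "complex_algebra \<Omega>" and "countable_dim \<Omega>" and "d \<ge> 1"
  shows "\<exists>\<phi> \<in> alg_iso (gr_alg (Y_alg d \<Omega> s) (Y_shifted_filt d \<Omega> s)) (uea (gl d (R_alg \<Omega>))).
    \<forall>k. \<phi> ` gr_hom (Y_alg d \<Omega> s) (Y_shifted_filt d \<Omega> s) k =
        uea_grade (gl d (R_alg \<Omega>)) (gl_R_grade d \<Omega>) k"
proof -
  obtain B where "is_basis \<Omega> B" using assms(2) by (auto simp: countable_dim_def)
  then interpret yang \<Omega> d s B using assms(1) by (intro yang.intro yang_axioms.intro)
  show ?thesis by (rule graded_iso)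
qed

end
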